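(* Let $N\geqslant 3$, $s\in(0,1)$ and $p\in(2^*_s,2^* )$, where $2^*=\frac{2N}{N-2}$ and $2^*_s=\frac{2N}{N-2s}$. Then: (1) There is a constant $C_{N,p,s}>0$, independent of $u$, which is the best (smallest) constant such that for all $u\in E$, $$\int_{\mathbb{R}^N}|u|^p\,\mathrm{d}x\leqslant C_{N,p,s}\,\|u\|_{D^{s,2}(\mathbb{R}^N)}^{\frac{2N-p(N-2)}{2(1-s)}}\,\|u\|_{D^{1,2}(\mathbb{R}^N)}^{\frac{p(N-2s)-2N}{2(1-s)}}.\qquad(\ast)$$ (2) There exists a radial non-negative optimizer $u\in E$ for $(\ast)$ (i.e. $u\neq 0$ attains equality in $(\ast)$) such that the following (3) holds. (3) Set $Q(x)=\lambda_1 u(\lambda_2 x)$, where $$\lambda_1=\left[\frac{p(N-2s)-2N}{2N-p(N-2)}\right]^{\frac{1}{(1-s)(p-2)}}\left[\frac{2p(1-s)}{p(N-2s)-2N}\cdot\frac{1}{\|u\|_{L^p(\mathbb{R}^N)}^p}\right]^{\frac{1}{p-2}},\qquad \lambda_2=\left[\frac{p(N-2s)-2N}{2N-p(N-2)}\right]^{\frac{1}{2-2s}}.$$ Then $Q$ is a radial non-negative weak solution of $-\Delta Q+(-\Delta)^sQ=|Q|^{p-2}Q$ in $\mathbb{R}^N$, $Q$ is also an optimizer for $(\ast)$, and $$\|Q\|_{D^{1,2}(\mathbb{R}^N)}^2=\frac{p(N-2s)-2N}{2N-p(N-2)}\|Q\|_{D^{s,2}(\mathbb{R}^N)}^2=\frac{p(N-2s)-2N}{2p(1-s)}\|Q\|_{L^p(\mathbb{R}^N)}^p,$$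 $$\frac{N-2}{2}\|Q\|_{D^{1,2}(\mathbb{R}^N)}^2+\frac{N-2s}{2}\|Q\|_{D^{s,2}(\mathbb{R}^N)}^2=\frac{N}{p}\|Q\|_{L^p(\mathbb{R}^N)}^p,$$ $$C_{N,p,s}^{-1}=\left(\frac{2N-p(N-2)}{2p(1-s)}\right)^{\frac{2N-p(N-2)}{4(1-s)}}\left(\frac{p(N-2s)-2N}{2p(1-s)}\right)^{\frac{p(N-2s)-2N}{4(1-s)}}\|Q\|_{L^p(\mathbb{R}^N)}^{\frac{p(p-2)}{2}}.$$
   Context: For $u$ on $\mathbb{R}^N$ write $\|u\|_{D^{1,2}(\mathbb{R}^N)}^2=\int_{\mathbb{R}^N}|\nabla u|^2\,\mathrm{d}x$ and $\|u\|_{D^{s,2}(\mathbb{R}^N)}^2=\int_{\mathbb{R}^N}\int_{\mathbb{R}^N}\frac{|u(x)-u(y)|^2}{|x-y|^{N+2s}}\,\mathrm{d}x\,\mathrm{d}y$ (no normalizing constant). The space $E$ is the completion of $C_0^\infty(\mathbb{R}^N)$ with respect to $\|u\|_E^2=\|u\|_{D^{1,2}(\mathbb{R}^N)}^2+\|u\|_{D^{s,2}(\mathbb{R}^N)}^2$. A function $Q\in E$ is a weak solution of $-\Delta Q+(-\Delta)^sQ=|Q|^{p-2}Q$ in $\mathbb{R}^N$ if for all $\varphi\in E$, $\int_{\mathbb{R}^N}\nabla Q\cdot\nabla\varphi\,\mathrm{d}x+\int_{\mathbb{R}^N}\int_{\mathbb{R}^N}\frac{(Q(x)-Q(y))(\varphi(x)-\varphi(y))}{|x-y|^{N+2s}}\,\mathrm{d}x\,\mathrm{d}y=\int_{\mathbb{R}^N}|Q|^{p-2}Q\varphi\,\mathrm{d}x.$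 *)

theory Defs
  imports "HOL-Analysis.Analysis"
begin

definition partial_d :: "'n::finite \<Rightarrow> (real^'n \<Rightarrow> real) \<Rightarrow> real^'n \<Rightarrow> real" where
  "partial_d i f x = frechet_derivative f (at x) (axis i 1)"

fun C_k :: "nat \<Rightarrow> (real^'n::finite \<Rightarrow> real) \<Rightarrow> bool" where
  "C_k 0 f = continuous_on UNIV f"
| "C_k (Suc k) f = (f differentiable_on UNIV \<and> (\<forall>i. C_k k (partial_d i f)))"

definition test_fun :: "(real^'n::finite \<Rightarrow> real) \<Rightarrow> bool" where
  "test_fun \<phi> \<longleftrightarrow> (\<forall>k. C_k k \<phi>) \<and> bounded {x. \<phi> x \<noteq> 0}"

definition weak_grad :: "(real^'n::finite \<Rightarrow> real) \<Rightarrow> (real^'n \<Rightarrow> real^'n) \<Rightarrow> bool" where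
  "weak_grad u g \<longleftrightarrow> g \<in> borel_measurable lebesgue \<and>
     (\<forall>\<phi> i. test_fun \<phi> \<longrightarrow>
        integrable lebesgue (\<lambda>x. u x * partial_d i \<phi> x) \<and>
        integrable lebesgue (\<lambda>x. g x $ i * \<phi> x) \<and>
        (\<integral>x. u x * partial_d i \<phi> x \<partial>lebesgue) = - (\<integral>x. g x $ i * \<phi> x \<partial>lebesgue))"

definition wgrad :: "(real^'n::finite \<Rightarrow> real) \<Rightarrow> real^'n \<Rightarrow> real^'n" where
  "wgrad u = (SOME g. weak_grad u g)"

definition D12_enn :: "(real^'n::finite \<Rightarrow> real) \<Rightarrow> ennreal" where
  "D12_enn u = (\<integral>\<^sup>+ x. ennreal ((norm (wgrad u x))\<^sup>2) \<partial>lebesgue)"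

definition Ds2_enn :: "real \<Rightarrow> (real^'n::finite \<Rightarrow> real) \<Rightarrow> ennreal" where
  "Ds2_enn s u = (\<integral>\<^sup>+ z. ennreal ((u (fst z) - u (snd z))\<^sup>2
        / dist (fst z) (snd z) powr (real CARD('n) + 2 * s)) \<partial>(lebesgue \<Otimes>\<^sub>M lebesgue))"

definition Lp_enn :: "real \<Rightarrow> (real^'n::finite \<Rightarrow> real) \<Rightarrow> ennreal" where
  "Lp_enn p u = (\<integral>\<^sup>+ x. ennreal (\<bar>u x\<bar> powr p) \<partial>lebesgue)"

definition D12_sq :: "(real^'n::finite \<Rightarrow> real) \<Rightarrow> real" where
  "D12_sq u = enn2real (D12_enn u)"
definition Ds2_sq :: "real \<Rightarrow> (real^'n::finite \<Rightarrow> real) \<Rightarrow> real" where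
  "Ds2_sq s u = enn2real (Ds2_enn s u)"
definition Lp_pow :: "real \<Rightarrow> (real^'n::finite \<Rightarrow> real) \<Rightarrow> real" where
  "Lp_pow p u = enn2real (Lp_enn p u)"

definition D12_norm :: "(real^'n::finite \<Rightarrow> real) \<Rightarrow> real" where "D12_norm u = sqrt (D12_sq u)"
definition Ds2_norm :: "real \<Rightarrow> (real^'n::finite \<Rightarrow> real) \<Rightarrow> real" where "Ds2_norm s u = sqrt (Ds2_sq s u)"
definition Lp_norm :: "real \<Rightarrow> (real^'n::finite \<Rightarrow> real) \<Rightarrow> real" where "Lp_norm p u = Lp_pow p u powr (1 / p)"

text \<open>The space E: concrete realisation of the completion of C_c^infty w.r.t. the E-norm:
  functions with weak gradient and finite E-norm that are E-norm limits of test functions,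
  the convergence also holding in L^1_loc (this pins down the representative).\<close>
definition E_space :: "real \<Rightarrow> (real^'n::finite \<Rightarrow> real) set" where
  "E_space s = {u. u \<in> borel_measurable lebesgue \<and> (\<exists>g. weak_grad u g) \<and>
      D12_enn u < \<infinity> \<and> Ds2_enn s u < \<infinity> \<and>
      (\<exists>\<phi>. (\<forall>k. test_fun (\<phi> k)) \<and>
         (\<lambda>k. D12_sq (\<lambda>x. \<phi> k x - u x) + Ds2_sq s (\<lambda>x. \<phi> k x - u x)) \<longlonglongrightarrow> 0 \<and>
         (\<forall>k. (\<exists>g. weak_grad (\<lambda>x. \<phi> k x - u x) g) \<and>
              D12_enn (\<lambda>x. \<phi> k x - u x) < \<infinity> \<and> Ds2_enn s (\<lambda>x. \<phi> k x - u x) < \<infinity>) \<and>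
         (\<forall>K. compact K \<longrightarrow>
            (\<lambda>k. \<integral>\<^sup>+ x\<in>K. ennreal \<bar>\<phi> k x - u x\<bar> \<partial>lebesgue) \<longlonglongrightarrow> 0))}"

definition radial :: "(real^'n::finite \<Rightarrow> real) \<Rightarrow> bool" where
  "radial u \<longleftrightarrow> (\<forall>x y. norm x = norm y \<longrightarrow> u x = u y)"

definition nonneg :: "(real^'n::finite \<Rightarrow> real) \<Rightarrow> bool" where
  "nonneg u \<longleftrightarrow> (\<forall>x. 0 \<le> u x)"

definition GN_ineq :: "real \<Rightarrow> real \<Rightarrow> real \<Rightarrow> (real^'n::finite \<Rightarrow> real) \<Rightarrow> bool" where
  "GN_ineq s p C u \<longleftrightarrow>
     (let N = real CARD('n) in
      Lp_enn p u \<le> ennreal (C * Ds2_norm s u powr ((2*N - p*(N-2)) / (2*(1-s)))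
                            * D12_norm u powr ((p*(N-2 * s) - 2*N) / (2*(1-s)))))"

definition GN_optimizer :: "real \<Rightarrow> real \<Rightarrow> real \<Rightarrow> (real^'n::finite \<Rightarrow> real) \<Rightarrow> bool" where
  "GN_optimizer s p C u \<longleftrightarrow> u \<in> E_space s \<and> \<not> (AE x in lebesgue. u x = 0) \<and>
     (let N = real CARD('n) in
      Lp_enn p u = ennreal (C * Ds2_norm s u powr ((2*N - p*(N-2)) / (2*(1-s)))
                            * D12_norm u powr ((p*(N-2 * s) - 2*N) / (2*(1-s)))))"

definition weak_solution :: "real \<Rightarrow> real \<Rightarrow> (real^'n::finite \<Rightarrow> real) \<Rightarrow> bool" where
  "weak_solution s p Q \<longleftrightarrow> Q \<in> E_space s \<and>
     (\<forall>\<phi>\<in>E_space s.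
        integrable lebesgue (\<lambda>x. wgrad Q x \<bullet> wgrad \<phi> x) \<and>
        integrable (lebesgue \<Otimes>\<^sub>M lebesgue) (\<lambda>z. (Q (fst z) - Q (snd z)) * (\<phi> (fst z) - \<phi> (snd z))
             / dist (fst z) (snd z) powr (real CARD('n) + 2 * s)) \<and>
        integrable lebesgue (\<lambda>x. \<bar>Q x\<bar> powr (p - 2) * Q x * \<phi> x) \<and>
        (\<integral>x. wgrad Q x \<bullet> wgrad \<phi> x \<partial>lebesgue)
        + (\<integral>z. (Q (fst z) - Q (snd z)) * (\<phi> (fst z) - \<phi> (snd z))
             / dist (fst z) (snd z) powr (real CARD('n) + 2 * s) \<partial>(lebesgue \<Otimes>\<^sub>M lebesgue))
        = (\<integral>x. \<bar>Q x\<bar> powr (p - 2) * Q x * \<phi> x \<partial>lebesgue))"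

end

(* The inequality for test functions comes from weak-type bounds for the level sets, obtained by
averaging increments over small balls. A normalised maximizing sequence is translated so that it
does not vanish locally; convergence in local L^1 along dyadic cells, a Brezis-Lieb splitting and
the strict superadditivity 1 < al + be give a maximizer. Polarization does not increase the
Dirichlet energy or the fractional seminorm, and equality for the latter forces a maximizer to be
comparable with its reflection on each half space. Reflecting in hyperplanes that halve the L^p
mass first centres the maximizer and then makes it invariant under all reflections through the
origin; limits of ball averages provide an everywhere radial representative. The Euler-Lagrange
equation follows from the convexity of the p-th power, and scaling normalises its constants. *)

theory Submission
  imports Defs "HOL-Library.Diagonal_Subsequence"
begin

text \<open>Membership in \<open>E_space\<close> is tied to approximation by test functions, in
  energy and locally in L^1. Estimates are therefore made for test functions and carried to limits
  by Fatou or by one closure principle: bounded energies together with local L^1 convergence keep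
  the limit in the space. The strict position of p between the two critical exponents enters through
  a weak-type bound at each end. The sums over very large and very small dyadic values converge
  geometrically, uniformly in u; only a middle range of values remains, which makes the constant
  finite and excludes vanishing. The exponents \<open>al\<close> and \<open>be\<close> act on
  squared seminorms, hence \<open>al + be = p / 2 > 1\<close>, the source of the superadditivity
  that excludes splitting. The modulus is not smooth, so polarization is done with a smoothed
  modulus that is zero near 0, which removes the kink along the mirror. Averages over balls are
  taken because \<open>radial\<close> is a condition at every point, whereas the reflection
  arguments give symmetry almost everywhere.\<close>

abbreviation \<L> :: "'a::euclidean_space measure" where "\<L> \<equiv> lebesgue"
abbreviation \<L>\<^sub>2 :: "('a::euclidean_space \<times> 'b::euclidean_space) measure" where "\<L>\<^sub>2 \<equiv> \<L> \<Otimes>\<^sub>M \<L>"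
abbreviation \<M> :: "('a::euclidean_space => 'b::topological_space) set" where "\<M> \<equiv> borel_measurable \<L>"

section \<open>Smooth functions\<close>

definition smooth :: "(real^'n::finite => real) => bool" where
 "smooth f \<longleftrightarrow> (\<forall>k. C_k k f)"

lemma partial_d_eqI: "(f has_derivative f') (at x) ==> partial_d i f x = f' (axis i 1)"
 unfolding partial_d_def by (metis frechet_derivative_at)

lemma partial_d_works:
 assumes "f differentiable (at x)"
 shows "(f has_derivative (\<lambda>h. \<Sum>i\<in>UNIV. h $ i * partial_d i f x)) (at x)"
proof -
 let ?D = "frechet_derivative f (at x)"
 have D: "(f has_derivative ?D) (at x)" using assms by (simp add: frechet_derivative_works)
 then interpret linear ?D using has_derivative_linear by blast
 have "?D h = (\<Sum>i\<in>UNIV. h $ i * partial_d i f x)" for h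
 proof -
  have "?D h = ?D (\<Sum>i\<in>UNIV. (h $ i) *\<^sub>R axis i 1)"
   by (simp add: basis_expansion flip: scalar_mult_eq_scaleR)
  then show ?thesis by (simp add: sum scaleR partial_d_def)
 qed
 then have "?D = (\<lambda>h. \<Sum>i\<in>UNIV. h $ i * partial_d i f x)" by auto
 with D show ?thesis by simp
qed

lemma C_k_Suc_imp: "C_k (Suc k) f ==> C_k k f"
 by (induction k arbitrary: f) (auto intro: differentiable_imp_continuous_on)

lemma C_k_differentiable: "C_k (Suc k) f ==> f differentiable (at x)"
 by (simp add: differentiable_on_def)

lemma C_k_const: "C_k k (\<lambda>x::real^'n::finite. c)"
proof (induction k arbitrary: c)
 case (Suc k)
 have "partial_d i (\<lambda>x::real^'n. c) = (\<lambda>x. 0)" for i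
  by (rule ext, subst partial_d_eqI[OF has_derivative_const]) simp
 then show ?case using Suc by simp
qed simp

lemma partial_d_add:
 "f differentiable (at x) ==> g differentiable (at x) ==>
  partial_d i (\<lambda>x. f x + g x) x = partial_d i f x + partial_d i g x"
 by (subst partial_d_eqI[OF has_derivative_add[OF partial_d_works partial_d_works]])
  (auto simp: axis_def if_distrib[of "\<lambda>x. x * _"] cong: if_cong)

lemma partial_d_mult:
 "f differentiable (at x) ==> g differentiable (at x) ==>
  partial_d i (\<lambda>x. f x * g x) x = f x * partial_d i g x + partial_d i f x * g x"
 by (subst partial_d_eqI[OF has_derivative_mult[OF partial_d_works partial_d_works]])
  (auto simp: axis_def if_distrib[of "\<lambda>x. x * _"] cong: if_cong)

lemma partial_d_chain:
 assumes "f differentiable (at x)" "(h has_real_derivative h') (at (f x))"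
 shows "partial_d i (\<lambda>x. h (f x)) x = h' * partial_d i f x"
 by (subst partial_d_eqI[OF has_derivative_compose[OF partial_d_works[OF assms(1)] assms(2)[unfolded has_field_derivative_def]]])
  (auto simp: axis_def if_distrib[of "\<lambda>x. x * _"] cong: if_cong)

lemma C_k_add: "C_k k f ==> C_k k g ==> C_k k (\<lambda>x. f x + g x)"
proof (induction k arbitrary: f g)
 case (Suc k)
 note d = Suc.prems[THEN C_k_differentiable]
 have "partial_d i (\<lambda>x. f x + g x) = (\<lambda>x. partial_d i f x + partial_d i g x)" for i
  using partial_d_add[OF d] by auto
 then show ?case using Suc by (auto simp: differentiable_on_def intro!: differentiable_add)
qed (auto intro: continuous_intros)

lemma C_k_mult: "C_k k f ==> C_k k g ==> C_k k (\<lambda>x. f x * g x)"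
proof (induction k arbitrary: f g)
 case (Suc k)
 note d = Suc.prems[THEN C_k_differentiable]
 have "partial_d i (\<lambda>x. f x * g x) = (\<lambda>x. f x * partial_d i g x + partial_d i f x * g x)" for i
  using partial_d_mult[OF d] by auto
 moreover have "C_k k f" "C_k k g" using Suc.prems C_k_Suc_imp by blast+
 ultimately show ?case using Suc
  by (auto simp: differentiable_on_def intro!: differentiable_mult C_k_add)
qed (auto intro: continuous_intros)

text \<open>Scalar counterpart of \<open>C_k\<close>. The derivative is quantified existentially, so
  a closed formula can be offered as witness at every order; the induction for \<open>flat\<close>
  exploits this.\<close>

fun Ck1 :: "nat => (real => real) => bool" where
 "Ck1 0 h = continuous_on UNIV h"
| "Ck1 (Suc k) h = (\<exists>h'. (\<forall>x. (h has_real_derivative h' x) (at x)) \<and> Ck1 k h')"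

lemma Ck1_Suc_imp: "Ck1 (Suc k) h ==> Ck1 k h"
proof (induction k arbitrary: h)
 case 0
 then show ?case by (auto intro!: continuous_at_imp_continuous_on intro: DERIV_isCont)
qed auto

lemma Ck1_const: "Ck1 k (\<lambda>x. c)"
proof (induction k arbitrary: c)
 case (Suc k)
 then show ?case by (auto intro!: exI[of _ "\<lambda>x. 0"] derivative_eq_intros)
qed auto

lemma Ck1_ident: "Ck1 k (\<lambda>x. x)"
 by (cases k) (auto intro!: exI[of _ "\<lambda>x. 1"] derivative_eq_intros Ck1_const)

lemma Ck1_add: "Ck1 k f ==> Ck1 k g ==> Ck1 k (\<lambda>x. f x + g x)"
proof (induction k arbitrary: f g)
 case (Suc k)
 then obtain f' g' where "\<And>x. (f has_real_derivative f' x) (at x)" "Ck1 k f'"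
  "\<And>x. (g has_real_derivative g' x) (at x)" "Ck1 k g'" by auto
 then show ?case using Suc.IH by (auto intro!: exI[of _ "\<lambda>x. f' x + g' x"] derivative_eq_intros)
qed (auto intro: continuous_intros)

lemma Ck1_mult: "Ck1 k f ==> Ck1 k g ==> Ck1 k (\<lambda>x. f x * g x)"
proof (induction k arbitrary: f g)
 case (Suc k)
 have k: "Ck1 k f" "Ck1 k g" using Suc.prems Ck1_Suc_imp by blast+
 obtain f' g' where "\<And>x. (f has_real_derivative f' x) (at x)" "Ck1 k f'"
  "\<And>x. (g has_real_derivative g' x) (at x)" "Ck1 k g'" using Suc.prems by auto
 then show ?case using Suc.IH k
  by (auto intro!: exI[of _ "\<lambda>x. f' x * g x + f x * g' x"] derivative_eq_intros Ck1_add)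
qed (auto intro: continuous_intros)

lemma Ck1_compose: "Ck1 k f ==> Ck1 k g ==> Ck1 k (\<lambda>x. f (g x))"
proof (induction k arbitrary: f g)
 case 0
 then show ?case by (auto intro: continuous_on_compose2)
next
 case (Suc k)
 have k: "Ck1 k g" using Suc.prems Ck1_Suc_imp by blast
 obtain f' g' where "\<And>x. (f has_real_derivative f' x) (at x)" "Ck1 k f'"
  "\<And>x. (g has_real_derivative g' x) (at x)" "Ck1 k g'" using Suc.prems by auto
 then show ?case using Suc.IH k
  by (auto intro!: exI[of _ "\<lambda>x. f' (g x) * g' x"] Ck1_mult intro: DERIV_chain2)
qed

lemma C_k_compose: "Ck1 k h ==> C_k k f ==> C_k k (\<lambda>x. h (f x))"
proof (induction k arbitrary: f h)
 case 0
 then show ?case by (auto intro: continuous_on_compose2)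
next
 case (Suc k)
 obtain h' where h': "\<And>x. (h has_real_derivative h' x) (at x)" "Ck1 k h'" using Suc.prems by auto
 note d = Suc.prems(2)[THEN C_k_differentiable]
 have "partial_d i (\<lambda>x. h (f x)) = (\<lambda>x. h' (f x) * partial_d i f x)" for i
  using partial_d_chain[OF d h'(1)] by auto
 moreover have "(\<lambda>x. h (f x)) differentiable (at x)" for x
  using has_derivative_compose[OF partial_d_works[OF d] h'(1)[unfolded has_field_derivative_def]]
  by (auto simp: differentiable_def)
 moreover have "C_k k f" using Suc.prems C_k_Suc_imp by blast
 ultimately show ?case using Suc h'(2) by (auto simp: differentiable_on_def intro!: C_k_mult)
qed

lemma C_k_sum: "finite I ==> (\<And>j. j \<in> I ==> C_k k (f j)) ==> C_k k (\<lambda>x. \<Sum>j\<in>I. f j x)"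
 by (induction I rule: finite_induct) (auto intro!: C_k_add C_k_const)

lemma C_k_prod: "finite I ==> (\<And>j. j \<in> I ==> C_k k (f j)) ==> C_k k (\<lambda>x. \<Prod>j\<in>I. f j x)"
 by (induction I rule: finite_induct) (auto intro!: C_k_mult C_k_const)

lemma C_k_affine_map:
 fixes L :: "real^'m::finite => real^'n::finite"
 assumes L: "bounded_linear L" shows "C_k k f ==> C_k k (\<lambda>x. f (L x + a))"
proof (induction k arbitrary: f)
 case 0
 have "continuous_on UNIV (\<lambda>x. L x + a)"
  by (intro continuous_intros linear_continuous_on L)
 then show ?case using 0 by (auto intro: continuous_on_compose2)
next
 case (Suc k)
 note d = Suc.prems[THEN C_k_differentiable]
 have D: "((\<lambda>x. f (L x + a)) has_derivative (\<lambda>h. \<Sum>j\<in>UNIV. L h $ j * partial_d j f (L x + a))) (at x)" for x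
  by (rule has_derivative_compose[OF _ partial_d_works[OF d], of "\<lambda>x. L x + a" L])
   (auto intro!: derivative_eq_intros bounded_linear_imp_has_derivative L)
 then have "partial_d i (\<lambda>x. f (L x + a)) = (\<lambda>x. \<Sum>j\<in>UNIV. L (axis i 1) $ j * partial_d j f (L x + a))" for i
  using partial_d_eqI by blast
 moreover have "(\<lambda>x. f (L x + a)) differentiable (at x)" for x
  using D by (auto simp: differentiable_def)
 ultimately show ?case using Suc by (auto simp: differentiable_on_def intro!: C_k_sum C_k_mult C_k_const)
qed

lemma C_k_inner: "C_k k (\<lambda>x::real^'n::finite. x \<bullet> e)"
proof (cases k)
 case 0
 then show ?thesis by (auto intro!: continuous_intros)
next
 case (Suc m)
 have D: "((\<lambda>x::real^'n. x \<bullet> e) has_derivative (\<lambda>h. h \<bullet> e)) (at x)" for x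
  by (auto intro!: derivative_eq_intros)
 then have "partial_d i (\<lambda>x. x \<bullet> e) = (\<lambda>x. axis i 1 \<bullet> e)" for i
  using partial_d_eqI by blast
 moreover have "(\<lambda>x. x \<bullet> e) differentiable (at x)" for x
  using D by (auto simp: differentiable_def)
 ultimately show ?thesis using Suc by (auto simp: differentiable_on_def intro!: C_k_const)
qed

text \<open>No differentiability enters: near \<open>x\<close> both functions have exactly the same
  derivatives, so the choice inside \<open>frechet_derivative\<close> receives the same predicate
  and returns the same map.\<close>

lemma partial_d_cong_open:
 assumes "open U" "x \<in> U" "\<And>y. y \<in> U ==> f y = g y"
 shows "partial_d i f x = partial_d i g x"
proof -
 have "(f has_derivative D) (at x) = (g has_derivative D) (at x)" for D
  using has_derivative_transform_within_open[OF _ assms(1,2), of f D UNIV g]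
   has_derivative_transform_within_open[OF _ assms(1,2), of g D UNIV f] assms(3) by auto
 then show ?thesis by (simp add: partial_d_def frechet_derivative_def)
qed

text \<open>For functions given by different smooth formulas in different regions, as smoothed
  polarizations are on the two sides of the mirror and near it. The induction works because
  agreement on an open set passes to the partial derivatives.\<close>

lemma C_k_local:
 assumes "\<And>x. \<exists>g U. open U \<and> x \<in> U \<and> (\<forall>y\<in>U. f y = g y) \<and> C_k k g"
 shows "C_k k f"
 using assms
proof (induction k arbitrary: f)
 case 0
 have "isCont f x" for x
 proof -
  obtain g U where *: "open U" "x \<in> U" "\<forall>y\<in>U. f y = g y" "C_k 0 g" using 0 by blast
  then have "isCont g x" by (simp add: continuous_on_eq_continuous_at)
  then show ?thesis using * isCont_cong[of f g x] by (auto simp: eventually_nhds)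
 qed
 then show ?case by (simp add: continuous_at_imp_continuous_on)
next
 case (Suc k)
 have "f differentiable (at x)" for x
 proof -
  obtain g U where *: "open U" "x \<in> U" "\<forall>y\<in>U. f y = g y" "C_k (Suc k) g" using Suc.prems by blast
  then have "(g has_derivative (\<lambda>h. \<Sum>i\<in>UNIV. h $ i * partial_d i g x)) (at x)"
   by (intro partial_d_works C_k_differentiable)
  then show ?thesis using has_derivative_transform_within_open[OF _ *(1,2), of g _ UNIV f] *(3)
   by (auto simp: differentiable_def)
 qed
 moreover have "C_k k (partial_d i f)" for i
 proof (rule Suc.IH)
  fix x
  obtain g U where *: "open U" "x \<in> U" "\<forall>y\<in>U. f y = g y" "C_k (Suc k) g" using Suc.prems by blast
  have "\<forall>y\<in>U. partial_d i f y = partial_d i g y"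
   by (intro ballI partial_d_cong_open[OF *(1)]) (use *(3) in blast)+
  moreover have "C_k k (partial_d i g)" using *(4) by simp
  ultimately show "\<exists>g U. open U \<and> x \<in> U \<and> (\<forall>y\<in>U. partial_d i f y = g y) \<and> C_k k g"
   using *(1,2) by blast
 qed
 ultimately show ?case by (simp add: differentiable_on_def)
qed

lemma smooth_partial: "smooth f ==> smooth (partial_d i f)"
 unfolding smooth_def by (metis C_k.simps(2))

lemma smooth_differentiable: "smooth f ==> f differentiable (at x)"
 unfolding smooth_def using C_k_differentiable by blast

lemma smooth_continuous: "smooth f ==> continuous_on UNIV f"
 unfolding smooth_def by (metis C_k.simps(1))

subsection \<open>Flat functions of one variable\<close>

text \<open>The powers of 1/t make the family closed under differentiation up to linear
  combinations, so smoothness follows by one induction for all \<open>m\<close>.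
  \<open>flat 0\<close> is the classical cut-off profile exp(-1/t).\<close>

definition flat :: "nat => real => real" where
 "flat m t = (if t <= 0 then 0 else exp (- (1 / t)) / t ^ m)"

text \<open>Only the term of order m + 2 of the exponential series at 1/t is kept. Two powers more
  than in the denominator leave t^2, so the difference quotient at 0 tends to 0.\<close>

lemma flat_le: "t > 0 ==> flat m t <= fact (m + 2) * t\<^sup>2"
proof -
 assume t: "t > 0"
 have "(1/t) ^ (m+2) / fact (m+2) <= exp (1/t)"
 proof -
  have "(\<Sum>n\<in>{m+2}. (1/t)^n / fact n) <= (\<Sum>n. (1/t)^n / fact n)"
   using t summable_exp[of "1/t"] by (intro sum_le_suminf) (auto simp: divide_inverse mult.commute)
  also have "\<dots> = exp (1/t)" by (simp add: exp_def scaleR_conv_of_real divide_inverse mult.commute)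
  finally show ?thesis by simp
 qed
 then have "1 / (fact (m+2) * t ^ (m+2)) <= exp (1/t)"
  by (simp add: power_inverse[symmetric] divide_inverse mult.commute del: power_add power_Suc fact_Suc add_2_eq_Suc')
 moreover have "0 < fact (m+2) * t ^ (m+2)" using t by (intro mult_pos_pos fact_gt_zero zero_less_power)
 ultimately have "1 <= exp (1/t) * (fact (m+2) * t ^ (m+2))"
  by (simp only: pos_divide_le_eq)
 then have "1 <= exp (1/t) * fact (m+2) * t ^ (m+2)" by (simp only: mult.assoc)
 then have "exp (-(1/t)) * 1 <= exp (-(1/t)) * (exp (1/t) * fact (m+2) * t ^ (m+2))"
  by (intro mult_left_mono) auto
 then have "exp (-(1/t)) <= fact (m+2) * t ^ (m+2)"
  by (simp only: mult.assoc[symmetric] exp_add[symmetric]) (simp only: mult_1_right exp_zero add.left_inverse mult_1_left)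
 then show ?thesis using t by (simp add: flat_def field_simps power_add power2_eq_square)
qed

lemma flat_nonneg: "0 <= flat m t"
 by (simp add: flat_def)

lemma flat_has_derivative:
 "(flat m has_real_derivative (flat (m+2) t - m * flat (m+1) t)) (at t)"
proof (cases t "0::real" rule: linorder_cases)
 case less
 have "((\<lambda>t. 0) has_real_derivative 0) (at t)" by simp
 then have "(flat m has_real_derivative 0) (at t)"
  by (rule DERIV_cong_ev[THEN iffD1, rotated 3])
   (use less in \<open>auto simp: flat_def eventually_nhds intro!: exI[of _ "{..<0}"]\<close>)
 then show ?thesis using less by (simp add: flat_def)
next
 case greater
 \<comment> \<open>In the variable y = 1/t the function is exp(-y) y^m; the inner derivative -y^2 is
   what raises the indices by one and two.\<close>
 have 1: "((\<lambda>t. 1 / t) has_real_derivative - (1/t)\<^sup>2) (at t)"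
  using greater by (auto intro!: derivative_eq_intros simp: power2_eq_square)
 have 2: "((\<lambda>y. exp (-y) * y ^ m) has_real_derivative (exp (-y) * (m * y^(m-1)) - exp (-y) * y ^ m)) (at y)" for y :: real
  by (auto intro!: derivative_eq_intros)
 have 3: "((\<lambda>t. exp (-(1/t)) * (1/t)^m) has_real_derivative
   (exp (-(1/t)) * (m * (1/t)^(m-1)) - exp (-(1/t)) * (1/t) ^ m) * (- (1/t)\<^sup>2)) (at t)"
  by (rule DERIV_chain2[OF 2 1])
 have 4: "(exp (-y) * (m * y^(m-1)) - exp (-y) * y ^ m) * (- y\<^sup>2) = exp (-y) * y^(m+2) - m * (exp (-y) * y^(m+1))" for y :: real
  by (cases m) (simp_all add: power2_eq_square algebra_simps)
 have "((\<lambda>t. exp (-(1/t)) / t^m) has_real_derivative (flat (m+2) t - m * flat (m+1) t)) (at t)"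
  using 3 greater unfolding 4 by (simp add: flat_def power_inverse[symmetric] divide_inverse)
 then show ?thesis
  by (rule DERIV_cong_ev[THEN iffD1, rotated 3])
   (use greater in \<open>auto simp: flat_def eventually_nhds intro!: exI[of _ "{0<..}"]\<close>)
next
 case equal
 have "((\<lambda>h. flat m h / h) \<longlongrightarrow> 0) (at 0)"
 proof (rule Lim_null_comparison)
  show "\<forall>\<^sub>F h in at 0. norm (flat m h / h) <= fact (m+2) * \<bar>h\<bar>"
  proof (rule always_eventually, rule allI)
   fix h :: real
   show "norm (flat m h / h) <= fact (m+2) * \<bar>h\<bar>"
   proof (cases "h <= 0")
    case True
    then show ?thesis unfolding flat_def by (simp add: mult_nonneg_nonpos del: fact_Suc add_2_eq_Suc')
   next
    case False
    then have "flat m h / h <= fact (m+2) * h\<^sup>2 / h"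
     using flat_le[of h m] by (intro divide_right_mono) auto
    then show ?thesis using False flat_nonneg[of m h] by (simp add: power2_eq_square del: fact_Suc add_2_eq_Suc')
   qed
  qed
  show "((\<lambda>h. fact (m+2) * \<bar>h\<bar>) \<longlongrightarrow> 0) (at (0::real))"
   by (intro tendsto_eq_intros) auto
 qed
 then show ?thesis using equal by (simp add: DERIV_def flat_def)
qed

lemma Ck1_flat: "Ck1 k (flat m)"
proof (induction k arbitrary: m)
 case 0
 show ?case by (auto intro!: continuous_at_imp_continuous_on DERIV_isCont flat_has_derivative)
next
 case (Suc k)
 have "Ck1 k (\<lambda>t. flat (m+2) t + (- real m) * flat (m+1) t)"
  by (intro Ck1_add Ck1_mult Ck1_const Suc)
 then show ?case using flat_has_derivative by (auto intro!: exI[of _ "\<lambda>t. flat (m+2) t - m * flat (m+1) t"])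
qed

section \<open>Operations on test functions and bump functions\<close>

lemma test_fun_smooth: "test_fun f ==> smooth f" by (simp add: test_fun_def smooth_def)

lemma smooth_add: "smooth f ==> smooth g ==> smooth (\<lambda>x. f x + g x)"
 and smooth_mult: "smooth f ==> smooth g ==> smooth (\<lambda>x. f x * g x)"
 and smooth_const: "smooth (\<lambda>x. c)"
 and smooth_inner: "smooth (\<lambda>x. x \<bullet> e)"
 and smooth_compose: "(\<And>k. Ck1 k h) ==> smooth f ==> smooth (\<lambda>x. h (f x))"
 and smooth_affine_map: "bounded_linear L ==> smooth f ==> smooth (\<lambda>x. f (L x + a))"
 and smooth_sum: "finite I ==> (\<And>j. j \<in> I ==> smooth (F j)) ==> smooth (\<lambda>x. \<Sum>j\<in>I. F j x)"
 and smooth_prod: "finite I ==> (\<And>j. j \<in> I ==> smooth (F j)) ==> smooth (\<lambda>x. \<Prod>j\<in>I. F j x)"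
 by (auto simp: smooth_def intro: C_k_add C_k_mult C_k_const C_k_inner C_k_compose C_k_affine_map C_k_sum C_k_prod)

lemma smooth_local:
 assumes "\<And>x. \<exists>g U. open U \<and> x \<in> U \<and> (\<forall>y\<in>U. f y = g y) \<and> smooth g"
 shows "smooth f"
 using assms unfolding smooth_def by (metis C_k_local)

text \<open>Off the closure of the support the function is locally 0, so the derivative vanishes
  there, and the closure of a bounded set is bounded.\<close>

lemma test_fun_partial: "test_fun f ==> test_fun (partial_d i f)"
proof -
 assume f: "test_fun f"
 have "{x. partial_d i f x \<noteq> 0} \<subseteq> closure {x. f x \<noteq> 0}"
 proof (rule ccontr)
  assume "\<not> ?thesis"
  then obtain x where x: "partial_d i f x \<noteq> 0" "x \<in> - closure {x. f x \<noteq> 0}" by auto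
  have "partial_d i f x = partial_d i (\<lambda>x. 0) x"
   using x(2) closure_subset[of "{x. f x \<noteq> 0}"] by (intro partial_d_cong_open[OF _ x(2)]) auto
  also have "\<dots> = 0" by (subst partial_d_eqI[OF has_derivative_const]) simp
  finally show False using x by simp
 qed
 then show ?thesis using f smooth_partial[of f i] bounded_subset[OF bounded_closure]
  unfolding test_fun_def smooth_def by blast
qed

lemma test_funI:
 assumes "smooth f" "test_fun g" "\<And>x. g x = 0 ==> f x = 0" shows "test_fun f"
proof -
 have "{x. f x \<noteq> 0} \<subseteq> {x. g x \<noteq> 0}" using assms by auto
 then show ?thesis using assms bounded_subset by (auto simp: test_fun_def smooth_def)
qed

lemma test_fun_add: "test_fun f ==> test_fun g ==> test_fun (\<lambda>x. f x + g x)"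
proof -
 assume *: "test_fun f" "test_fun g"
 have "{x. f x + g x \<noteq> 0} \<subseteq> {x. f x \<noteq> 0} \<union> {x. g x \<noteq> 0}" by auto
 then have "bounded {x. f x + g x \<noteq> 0}"
  using * by (intro bounded_subset[OF _ \<open>_ \<subseteq> _\<close>]) (auto simp: test_fun_def)
 then show ?thesis using * smooth_add[of f g] by (auto simp: test_fun_def smooth_def)
qed

lemma test_fun_mult: "smooth f ==> test_fun g ==> test_fun (\<lambda>x. f x * g x)"
 by (rule test_funI[of _ g]) (auto intro: smooth_mult test_fun_smooth)

lemma test_fun_scale: "test_fun g ==> test_fun (\<lambda>x. c * g x)"
 using test_fun_mult[OF smooth_const] .

lemma test_fun_zero: "test_fun (\<lambda>x. 0)"
 using smooth_const[of 0] by (auto simp: test_fun_def smooth_def)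

lemma test_fun_diff: "test_fun f ==> test_fun g ==> test_fun (\<lambda>x. f x - g x)"
 using test_fun_add[of f "\<lambda>x. (-1) * g x"] test_fun_scale[of g "-1"] by simp

lemma test_fun_compose: "(\<And>k. Ck1 k h) ==> h 0 = 0 ==> test_fun g ==> test_fun (\<lambda>x. h (g x))"
 by (rule test_funI[of _ g]) (auto intro: smooth_compose test_fun_smooth)

lemma flat_pos_iff: "0 < flat m t \<longleftrightarrow> 0 < t" "flat m t = 0 \<longleftrightarrow> t <= 0"
 by (auto simp: flat_def)

lemma flat0_le1: "flat 0 t <= 1" by (simp add: flat_def)

definition bump :: "real^'n::finite => real => real^'n => real" where
 "bump c r x = flat 0 (r\<^sup>2 - (norm (x - c))\<^sup>2)"

lemma test_fun_bump: "test_fun (bump c r)"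
proof -
 have "(norm (x - c))\<^sup>2 = (\<Sum>i\<in>UNIV. (x \<bullet> axis i 1 + (- (c $ i))) * (x \<bullet> axis i 1 + (- (c $ i))))" for x
  unfolding power2_norm_eq_inner inner_vec_def[of "x - c"] by (simp add: inner_axis)
 then have *: "bump c r = (\<lambda>x. flat 0 (r\<^sup>2 + (-1) * (\<Sum>i\<in>UNIV. (x \<bullet> axis i 1 + (- (c $ i))) * (x \<bullet> axis i 1 + (- (c $ i))))))"
  unfolding bump_def by simp
 have "smooth (bump c r)"
  unfolding * by (intro smooth_compose[of "flat 0"] Ck1_flat smooth_add smooth_const smooth_sum smooth_mult smooth_inner finite)
 moreover have "{x. bump c r x \<noteq> 0} \<subseteq> cball c \<bar>r\<bar>"
 proof
  fix x assume "x \<in> {x. bump c r x \<noteq> 0}"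
  then have "(norm (x - c))\<^sup>2 < r\<^sup>2" by (simp add: bump_def flat_pos_iff)
  then have "\<bar>norm (x - c)\<bar> < \<bar>r\<bar>" using abs_le_square_iff[of r "norm (x - c)"] by linarith
  then show "x \<in> cball c \<bar>r\<bar>" by (simp add: dist_norm norm_minus_commute)
 qed
 ultimately show ?thesis using bounded_subset[OF bounded_cball] by (auto simp: test_fun_def smooth_def)
qed

lemma bump_pos: "dist x c < r ==> 0 < bump c r x"
 by (auto simp: bump_def flat_pos_iff dist_norm intro!: power_strict_mono)

section \<open>Similarities and Lebesgue measure\<close>

lemma sigma_finite_lebesgue: "sigma_finite_measure (\<L> :: 'a::euclidean_space measure)"
proof
 show "\<exists>A::'a set set. countable A \<and> A \<subseteq> sets \<L> \<and> \<Union>A = space \<L> \<and> (\<forall>a\<in>A. emeasure \<L> a \<noteq> \<infinity>)"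
 proof (intro exI[of _ "range (\<lambda>n::nat. cball 0 n)"] conjI ballI)
  show "\<Union> (range (\<lambda>n::nat. cball 0 n)) = space (\<L> :: 'a measure)"
   using real_arch_simple by auto
  fix a assume "a \<in> range (\<lambda>n::nat. cball (0::'a) n)"
  then show "emeasure \<L> a \<noteq> \<infinity>"
   using emeasure_lborel_cball_finite[of "0::'a"] by (auto simp: less_top)
 qed auto
qed

interpretation leb: sigma_finite_measure "\<L> :: (real^'n::finite) measure"
 by (rule sigma_finite_lebesgue)

interpretation leb2: pair_sigma_finite "\<L> :: (real^'n::finite) measure" "\<L> :: (real^'n) measure"
 by (intro pair_sigma_finite.intro sigma_finite_lebesgue)

text \<open>One class for the translations, dilations and hyperplane reflections used below, so that
  measure, energies and membership in \<open>E_space\<close> are transformed only once.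
  \<open>l\<close> is the dilation factor.\<close>

definition simil :: "real => (real^'n::finite => real^'n) => bool" where
 "simil l T \<longleftrightarrow> l > 0 \<and> (\<exists>R a. orthogonal_transformation R \<and> T = (\<lambda>x. l *\<^sub>R R x + a))"

lemma similI: "l > 0 ==> orthogonal_transformation R ==> simil l (\<lambda>x. l *\<^sub>R R x + a)"
 by (auto simp: simil_def)

lemma simil_pos: "simil l T ==> l > 0" by (simp add: simil_def)

lemma simil_dist: "simil l T ==> dist (T x) (T y) = l * dist x y"
 by (auto simp: simil_def dist_norm scaleR_diff_right[symmetric] linear_diff[symmetric]
   orthogonal_transformation_linear orthogonal_transformation_norm)

lemma simil_scale: "l > 0 ==> simil l (\<lambda>x. l *\<^sub>R x)"
 using similI[of l "\<lambda>x. x" 0] by (simp add: orthogonal_transformation_id)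

lemma simil_translate: "simil 1 (\<lambda>x. x + a)"
 using similI[of 1 "\<lambda>x. x" a] by (simp add: orthogonal_transformation_id)

lemma simil_id: "simil 1 (\<lambda>x. x)"
 using simil_translate[of 0] by simp

lemma simil_inverse:
 assumes "simil l T"
 obtains T' where "simil (1/l) T'" "\<And>x. T (T' x) = x" "\<And>x. T' (T x) = x"
proof -
 obtain R a where l: "l > 0" and R: "orthogonal_transformation R" and T: "T = (\<lambda>x. l *\<^sub>R R x + a)"
  using assms by (auto simp: simil_def)
 let ?S = "inv R"
 have S: "orthogonal_transformation ?S" using R by (rule orthogonal_transformation_inv)
 have RS: "R (?S x) = x" "?S (R x) = x" for x
  using orthogonal_transformation_bij[OF R] by (simp_all add: bij_is_surj surj_f_inv_f bij_is_inj)
 interpret S: linear ?S using S by (rule orthogonal_transformation_linear)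
 show thesis
 proof (rule that[of "\<lambda>x. (1/l) *\<^sub>R ?S x + - ((1/l) *\<^sub>R ?S a)"])
  show "simil (1/l) (\<lambda>x. (1/l) *\<^sub>R ?S x + - ((1/l) *\<^sub>R ?S a))" using l S by (intro similI) auto
  interpret R: linear R using R by (rule orthogonal_transformation_linear)
  show "T ((1/l) *\<^sub>R ?S x + - ((1/l) *\<^sub>R ?S a)) = x" for x
   using l by (simp add: T R.diff R.scale RS scaleR_diff_right)
  show "(1/l) *\<^sub>R ?S (T x) + - ((1/l) *\<^sub>R ?S a) = x" for x
   using l by (simp add: T S.add S.scale RS scaleR_add_right)
 qed
qed

lemma simil_continuous: "simil l T ==> continuous_on UNIV T"
proof -
 assume "simil l T"
 then obtain R a where R: "bounded_linear R" and T: "T = (\<lambda>x. l *\<^sub>R R x + a)"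
  by (auto simp: simil_def linear_conv_bounded_linear dest!: orthogonal_transformation_linear)
 then show ?thesis unfolding T by (intro continuous_intros linear_continuous_on R)
qed

lemma nn_integral_lborel_plus:
 fixes f :: "'a::euclidean_space => ennreal"
 assumes [measurable]: "f \<in> borel_measurable borel"
 shows "(\<integral>\<^sup>+x. f (x + c) \<partial>lborel) = (\<integral>\<^sup>+x. f x \<partial>lborel)"
proof -
 have "(\<integral>\<^sup>+x. f x \<partial>lborel) = (\<integral>\<^sup>+x. f x \<partial>distr lborel borel ((+) c))" by (simp add: lborel_distr_plus)
 also have "\<dots> = (\<integral>\<^sup>+x. f (c + x) \<partial>lborel)" by (subst nn_integral_distr) auto
 finally show ?thesis by (simp add: add.commute)
qed

text \<open>Uniqueness of translation-invariant measures by Tonelli: integrating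
 \<open>indicator B y * indicator A (T x + y)\<close> in both orders identifies the image measure under \<open>T\<close>
 with a multiple of Lebesgue measure; the multiple is read off the unit ball.\<close>

lemma simil_emeasure_uminus:
 fixes T :: "real^'n::finite => real^'n"
 assumes T: "simil l T" and A [measurable]: "A \<in> sets borel" and B [measurable]: "B \<in> sets borel"
 shows "emeasure lborel B * emeasure lborel (T -` A) = emeasure lborel A * emeasure lborel (T -` (uminus ` B))"
proof -
 obtain R a where l: "l > 0" and R: "orthogonal_transformation R" and Teq: "T = (\<lambda>x. l *\<^sub>R R x + a)"
  using T by (auto simp: simil_def)
 have [measurable]: "T \<in> borel_measurable borel"
  using simil_continuous[OF T] by (rule borel_measurable_continuous_onI)
 have inv: "(\<integral>\<^sup>+x. h (T x + y) \<partial>lborel) = (\<integral>\<^sup>+x. h (T x) \<partial>lborel)"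
  if [measurable]: "h \<in> borel_measurable borel" for h :: "real^'n => ennreal" and y
 proof -
  interpret R: linear R using R by (rule orthogonal_transformation_linear)
  have "R (inv R y) = y" using orthogonal_transformation_surj[OF R] by (simp add: surj_f_inv_f)
  then have "T x + y = T (x + (1/l) *\<^sub>R inv R y)" for x
   using l by (simp add: Teq R.add R.scale scaleR_add_right)
  then show ?thesis using nn_integral_lborel_plus[of "\<lambda>x. h (T x)" "(1/l) *\<^sub>R inv R y"] by simp
 qed
 have [measurable]: "uminus ` B \<in> sets borel"
 proof -
  have "uminus ` B = uminus -` B" by (auto simp: image_iff) (metis minus_minus)
  then show ?thesis using measurable_sets[OF borel_measurable_uminus[OF measurable_ident], of B] by simp
 qed
 have "emeasure lborel B * emeasure lborel (T -` A)
  = (\<integral>\<^sup>+y. indicator B y * (\<integral>\<^sup>+x. indicator A (T x) \<partial>lborel) \<partial>lborel)"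
  using measurable_sets[of T borel borel A]
  by (subst nn_integral_multc) (auto simp: nn_integral_indicator[symmetric] indicator_def simp del: nn_integral_indicator intro!: arg_cong2[of _ _ _ _ "(*)"] nn_integral_cong)
 also have "\<dots> = (\<integral>\<^sup>+y. \<integral>\<^sup>+x. indicator B y * indicator A (T x + y) \<partial>lborel \<partial>lborel)"
  by (subst nn_integral_cmult) (auto simp: inv)
 also have "\<dots> = (\<integral>\<^sup>+x. \<integral>\<^sup>+y. indicator B y * indicator A (T x + y) \<partial>lborel \<partial>lborel)"
  by (rule lborel_pair.Fubini') measurable
 also have "\<dots> = (\<integral>\<^sup>+x. \<integral>\<^sup>+y. indicator B (y - T x) * indicator A y \<partial>lborel \<partial>lborel)"
 proof (rule nn_integral_cong)
  fix x
  show "(\<integral>\<^sup>+y. indicator B y * indicator A (T x + y) \<partial>lborel) = (\<integral>\<^sup>+y. indicator B (y - T x) * indicator A y \<partial>lborel)"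
   by (subst nn_integral_lborel_plus[where c="T x", symmetric]) (auto simp: add.commute)
 qed
 also have "\<dots> = (\<integral>\<^sup>+y. \<integral>\<^sup>+x. indicator B (y - T x) * indicator A y \<partial>lborel \<partial>lborel)"
  by (rule lborel_pair.Fubini') measurable
 also have "\<dots> = (\<integral>\<^sup>+y. \<integral>\<^sup>+x. indicator A y * indicator (uminus ` B) (T x + - y) \<partial>lborel \<partial>lborel)"
 proof (intro nn_integral_cong)
  fix x y
  have "y - T x \<in> B \<longleftrightarrow> T x + - y \<in> uminus ` B" by (metis (no_types, lifting) diff_conv_add_uminus image_iff minus_diff_eq minus_minus)
  then show "(indicator B (y - T x) * indicator A y :: ennreal) = indicator A y * indicator (uminus ` B) (T x + - y)"
   by (simp add: indicator_def)
 qed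
 also have "\<dots> = (\<integral>\<^sup>+y. indicator A y * (\<integral>\<^sup>+x. indicator (uminus ` B) (T x) \<partial>lborel) \<partial>lborel)"
 proof (rule nn_integral_cong)
  fix y
  show "(\<integral>\<^sup>+x. indicator A y * indicator (uminus ` B) (T x + - y) \<partial>lborel) = indicator A y * (\<integral>\<^sup>+x. indicator (uminus ` B) (T x) \<partial>lborel)"
   by (subst nn_integral_cmult) (use inv[of "indicator (uminus ` B)" "- y"] in simp_all)
 qed
 also have "\<dots> = emeasure lborel A * emeasure lborel (T -` (uminus ` B))"
  using measurable_sets[of T borel borel "uminus ` B"]
  by (subst nn_integral_multc) (auto simp: nn_integral_indicator[symmetric] indicator_def simp del: nn_integral_indicator intro!: arg_cong2[of _ _ _ _ "(*)"] nn_integral_cong)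
 finally show ?thesis .
qed

lemma simil_emeasure_lborel:
 fixes T :: "real^'n::finite => real^'n"
 assumes T: "simil l T" and B: "B \<in> sets borel"
 shows "emeasure lborel (T -` B) = ennreal (1 / l ^ CARD('n)) * emeasure lborel B"
proof -
 let ?b = "ball 0 1 :: (real^'n) set" and ?v = "unit_ball_vol (real CARD('n))"
 have l: "l > 0" using T by (rule simil_pos)
 have uB: "uminus ` B \<in> sets borel"
 proof -
  have "uminus ` B = uminus -` B" by (auto simp: image_iff) (metis minus_minus)
  then show ?thesis using measurable_sets[OF borel_measurable_uminus[OF measurable_ident] B] by simp
 qed
 have v: "emeasure lborel ?b = ennreal ?v" using emeasure_ball[of 1 "0::real^'n"] by simp
 have v0: "0 < ?v" by simp
 obtain T' where T': "simil (1/l) T'" "\<And>x. T (T' x) = x" "\<And>x. T' (T x) = x"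
  using simil_inverse[OF T] by metis
 have "T -` ?b = ball (T' 0) (1/l)"
 proof -
  have "x \<in> T -` ?b \<longleftrightarrow> x \<in> ball (T' 0) (1/l)" for x
   using simil_dist[OF T, of "T' 0" x] l T'(2)[of 0] by (simp add: dist_commute field_simps)
  then show ?thesis by blast
 qed
 then have b: "emeasure lborel (T -` ?b) = ennreal (1 / l ^ CARD('n)) * ennreal ?v"
  using emeasure_ball[of "1/l" "T' 0"] l by (simp add: ennreal_mult[symmetric] power_one_over mult.commute)
 have uu: "uminus ` uminus ` B = B" by (simp add: image_image)
 \<comment> \<open>With the identity map the exchange formula says that reflection in the origin
   preserves volume; this disposes of \<open>uminus\<close> in the general case.\<close>
 have "ennreal ?v * emeasure lborel (uminus ` B) = ennreal ?v * emeasure lborel B"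
  using simil_emeasure_uminus[OF simil_id, of ?b B] B by (simp add: v vimage_def mult.commute)
 then have sym: "emeasure lborel (uminus ` B) = emeasure lborel B"
  using v0 by (simp add: ennreal_mult_cancel_left)
 have "ennreal ?v * (ennreal (1 / l ^ CARD('n)) * emeasure lborel B) = ennreal ?v * emeasure lborel (T -` B)"
  using simil_emeasure_uminus[OF T, of ?b "uminus ` B"] uB by (simp add: v b uu sym mult_ac)
 then show ?thesis using v0 by (simp add: ennreal_mult_cancel_left)
qed

text \<open>For the completed measure continuity is not sufficient: preimages of null sets must be
  null as well, which the volume formula provides.\<close>

lemma simil_measurable:
 fixes T :: "real^'n::finite => real^'n"
 assumes T: "simil l T" shows "T \<in> \<L> \<rightarrow>\<^sub>M \<L>"
proof -
 have [measurable]: "T \<in> borel_measurable borel"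
  using simil_continuous[OF T] by (rule borel_measurable_continuous_onI)
 have l: "l > 0" using T by (rule simil_pos)
 have "emeasure (distr \<L> lborel T) A = 0" if "A \<in> null_sets lborel" for A
 proof -
  have "T -` A \<in> sets borel" using that measurable_sets[OF \<open>T \<in> borel_measurable borel\<close>, of A] by auto
  then show ?thesis using that simil_emeasure_lborel[OF T, of A]
   by (subst emeasure_distr) (auto simp: measurable_completion null_sets_def)
 qed
 then have "null_sets lborel \<subseteq> null_sets (distr \<L> lborel T)"
  by (auto simp: null_sets_def)
 then show ?thesis
  by (intro completion.measurable_completion2) (auto simp: measurable_completion)
qed

text \<open>The integrand is only Lebesgue measurable, so it is replaced by a Borel version. The
  exceptional set stays null after composition, because the image measure of \<open>T\<close> is a
  constant multiple of Lebesgue measure.\<close>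

lemma simil_nn_integral:
 fixes T :: "real^'n::finite => real^'n"
 assumes T: "simil l T" and f: "f \<in> \<M>"
 shows "(\<integral>\<^sup>+x. f (T x) \<partial>\<L>) = ennreal (1 / l ^ CARD('n)) * (\<integral>\<^sup>+x. f x \<partial>\<L>)"
proof -
 have [measurable]: "T \<in> borel_measurable borel"
  using simil_continuous[OF T] by (rule borel_measurable_continuous_onI)
 have l: "l > 0" using T by (rule simil_pos)
 obtain g where g[measurable]: "g \<in> borel_measurable lborel" and ae: "AE x in lborel. f x = g x"
  using completion_ex_borel_measurable[OF f] by auto
 have d: "distr lborel borel T = density lborel (\<lambda>_. ennreal (1 / l ^ CARD('n)))"
  by (rule measure_eqI) (auto simp: emeasure_distr emeasure_density simil_emeasure_lborel[OF T] nn_integral_cmult)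
 have aeT: "AE x in lborel. f (T x) = g (T x)"
 proof -
  have "AE x in distr lborel borel T. f x = g x"
   unfolding d using ae by (subst AE_density) auto
  then obtain N where N: "N \<in> null_sets (distr lborel borel T)" "{x. f x \<noteq> g x} \<subseteq> N"
   by (auto simp: eventually_ae_filter)
  then have "T -` N \<in> null_sets lborel"
   by (auto simp: null_sets_def emeasure_distr) (metis \<open>T \<in> borel_measurable borel\<close> measurable_sets_borel)
  then show ?thesis using N(2) by (auto simp: eventually_ae_filter intro!: bexI[of _ "T -` N"])
 qed
 have "(\<integral>\<^sup>+x. f (T x) \<partial>\<L>) = (\<integral>\<^sup>+x. g (T x) \<partial>lborel)"
  unfolding nn_integral_completion using aeT by (rule nn_integral_cong_AE)
 also have "\<dots> = (\<integral>\<^sup>+x. g x \<partial>distr lborel borel T)"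
  by (subst nn_integral_distr) auto
 also have "\<dots> = ennreal (1 / l ^ CARD('n)) * (\<integral>\<^sup>+x. g x \<partial>lborel)"
  unfolding d by (subst nn_integral_density) (auto simp: nn_integral_cmult)
 also have "(\<integral>\<^sup>+x. g x \<partial>lborel) = (\<integral>\<^sup>+x. f x \<partial>\<L>)"
  unfolding nn_integral_completion using ae by (intro nn_integral_cong_AE) auto
 finally show ?thesis .
qed

lemma simil_measurable_comp:
 "simil l T ==> f \<in> \<L> \<rightarrow>\<^sub>M N ==> (\<lambda>x. f (T x)) \<in> \<L> \<rightarrow>\<^sub>M N"
 using measurable_compose[OF simil_measurable] .

text \<open>The two variables move independently: equal maps describe the fractional seminorm under
  similarities, and polarization reflects one variable while fixing the other.\<close>

definition pmap :: "('a => 'a) => ('a => 'a) => 'a \<times> 'a => 'a \<times> 'a" where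
 "pmap T T' z = (T (fst z), T' (snd z))"

lemma simil_pmap_measurable:
 assumes [measurable]: "T \<in> \<L> \<rightarrow>\<^sub>M \<L>" "T' \<in> \<L> \<rightarrow>\<^sub>M \<L>"
 shows "pmap T T' \<in> \<L> \<Otimes>\<^sub>M \<L> \<rightarrow>\<^sub>M \<L> \<Otimes>\<^sub>M \<L>"
 unfolding pmap_def by measurable

lemma simil_nn_integral_pair:
 fixes T T' :: "real^'n::finite => real^'n"
 assumes T: "simil l T" and T': "simil l' T'" and F[measurable]: "F \<in> borel_measurable \<L>\<^sub>2"
 shows "(\<integral>\<^sup>+z. F (pmap T T' z) \<partial>\<L>\<^sub>2) =
  ennreal (1 / l ^ CARD('n) * (1 / l' ^ CARD('n))) * (\<integral>\<^sup>+z. F z \<partial>\<L>\<^sub>2)"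
proof -
 note [measurable] = simil_measurable[OF T] simil_measurable[OF T']
 have l: "0 < l" "0 < l'" using T T' by (auto dest: simil_pos)
 have "(\<integral>\<^sup>+z. F (pmap T T' z) \<partial>\<L>\<^sub>2) = (\<integral>\<^sup>+x. \<integral>\<^sup>+y. F (T x, T' y) \<partial>\<L> \<partial>\<L>)"
  by (subst leb.nn_integral_fst[symmetric]) (simp_all add: pmap_def)
 also have "\<dots> = (\<integral>\<^sup>+x. ennreal (1 / l' ^ CARD('n)) * \<integral>\<^sup>+y. F (T x, y) \<partial>\<L> \<partial>\<L>)"
 proof (rule nn_integral_cong)
  fix x show "(\<integral>\<^sup>+y. F (T x, T' y) \<partial>\<L>) = ennreal (1 / l' ^ CARD('n)) * \<integral>\<^sup>+y. F (T x, y) \<partial>\<L>"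
   by (rule simil_nn_integral[OF T', of "\<lambda>y. F (T x, y)"]) (simp add: measurable_Pair2[OF F])
 qed
 also have "\<dots> = ennreal (1 / l' ^ CARD('n)) * (\<integral>\<^sup>+x. \<integral>\<^sup>+y. F (T x, y) \<partial>\<L> \<partial>\<L>)"
  by (rule nn_integral_cmult) measurable
 also have "(\<integral>\<^sup>+x. \<integral>\<^sup>+y. F (T x, y) \<partial>\<L> \<partial>\<L>) = ennreal (1 / l ^ CARD('n)) * (\<integral>\<^sup>+x. \<integral>\<^sup>+y. F (x, y) \<partial>\<L> \<partial>\<L>)"
  by (rule simil_nn_integral[OF T]) measurable
 also have "(\<integral>\<^sup>+x. \<integral>\<^sup>+y. F (x, y) \<partial>\<L> \<partial>\<L>) = (\<integral>\<^sup>+z. F z \<partial>\<L>\<^sub>2)"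
  by (rule leb.nn_integral_fst) measurable
 finally show ?thesis using l by (simp add: ennreal_mult[symmetric] mult.assoc[symmetric] mult.commute)
qed

text \<open>Kept abstract to serve both points and pairs. The formula for nonnegative functions
  identifies the image measure as \<open>M\<close> with constant density \<open>c\<close>, which
  settles signed and vector-valued functions.\<close>

lemma bochner_change_of_variables:
 fixes f :: "'a => 'b::{banach, second_countable_topology}"
 assumes \<Phi>[measurable]: "\<Phi> \<in> M \<rightarrow>\<^sub>M M" and c: "c > 0"
  and nn: "\<And>F. F \<in> borel_measurable M ==> (\<integral>\<^sup>+z. F (\<Phi> z) \<partial>M) = ennreal c * (\<integral>\<^sup>+z. F z \<partial>M)"
  and [measurable]: "f \<in> borel_measurable M"
 shows "integrable M (\<lambda>z. f (\<Phi> z)) \<longleftrightarrow> integrable M f" "(\<integral>z. f (\<Phi> z) \<partial>M) = c *\<^sub>R (\<integral>z. f z \<partial>M)"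
proof -
 have d: "distr M M \<Phi> = density M (\<lambda>_. ennreal c)"
 proof (rule measure_eqI)
  fix A assume "A \<in> sets (distr M M \<Phi>)"
  then have A[measurable]: "A \<in> sets M" by simp
  have "emeasure (distr M M \<Phi>) A = (\<integral>\<^sup>+z. indicator A (\<Phi> z) \<partial>M)"
   using nn_integral_distr[of \<Phi> M M "indicator A"] nn_integral_indicator[of A "distr M M \<Phi>"] A by simp
  also have "\<dots> = emeasure (density M (\<lambda>_. ennreal c)) A"
   using A by (subst nn) (auto simp: emeasure_density nn_integral_cmult)
  finally show "emeasure (distr M M \<Phi>) A = emeasure (density M (\<lambda>_. ennreal c)) A" .
 qed simp
 have "integrable M (\<lambda>z. f (\<Phi> z)) \<longleftrightarrow> integrable (distr M M \<Phi>) f"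
  by (rule integrable_distr_eq[symmetric]) measurable
 also have "\<dots> \<longleftrightarrow> integrable M (\<lambda>x. c *\<^sub>R f x)"
  unfolding d using c by (subst integrable_density) auto
 also have "\<dots> \<longleftrightarrow> integrable M f" using c integrable_scaleR_right[of c M f] integrable_scaleR_right[of "1/c" M "\<lambda>x. c *\<^sub>R f x"] by auto
 finally show "integrable M (\<lambda>z. f (\<Phi> z)) \<longleftrightarrow> integrable M f" .
 have "(\<integral>z. f (\<Phi> z) \<partial>M) = (\<integral>z. f z \<partial>distr M M \<Phi>)"
  by (rule integral_distr[symmetric]) measurable
 also have "\<dots> = (\<integral>z. c *\<^sub>R f z \<partial>M)"
  unfolding d using c by (subst integral_density) auto
 finally show "(\<integral>z. f (\<Phi> z) \<partial>M) = c *\<^sub>R (\<integral>z. f z \<partial>M)" using c by simp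
qed

lemma simil_integral:
 fixes T :: "real^'n::finite => real^'n" and f :: "real^'n => 'b::{banach, second_countable_topology}"
 assumes T: "simil l T" and f: "f \<in> \<M>"
 shows "integrable \<L> (\<lambda>x. f (T x)) \<longleftrightarrow> integrable \<L> f"
  "(\<integral>x. f (T x) \<partial>\<L>) = (1 / l ^ CARD('n)) *\<^sub>R (\<integral>x. f x \<partial>\<L>)"
 using simil_pos[OF T]
  bochner_change_of_variables[OF simil_measurable[OF T] _ simil_nn_integral[OF T] f]
 by auto

lemma simil_integral_pair:
 fixes T T' :: "real^'n::finite => real^'n" and F :: "(real^'n) \<times> (real^'n) => real"
 assumes T: "simil l T" and T': "simil l' T'" and F: "F \<in> borel_measurable \<L>\<^sub>2"
 shows "integrable \<L>\<^sub>2 (\<lambda>z. F (pmap T T' z)) \<longleftrightarrow> integrable \<L>\<^sub>2 F"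
  "(\<integral>z. F (pmap T T' z) \<partial>\<L>\<^sub>2) = (1 / l ^ CARD('n) * (1 / l' ^ CARD('n))) * (\<integral>z. F z \<partial>\<L>\<^sub>2)"
 using simil_pos[OF T] simil_pos[OF T']
  bochner_change_of_variables[OF simil_pmap_measurable[OF simil_measurable[OF T] simil_measurable[OF T']] _ simil_nn_integral_pair[OF T T'] F]
 by auto

lemma AE_simil:
 assumes T: "simil l T" and ae: "AE x in \<L>. P x"
 shows "AE x in \<L>. P (T x)"
proof -
 obtain N where N: "N \<in> null_sets \<L>" "{x. \<not> P x} \<subseteq> N"
  using ae by (auto simp: eventually_ae_filter)
 have [measurable]: "N \<in> sets \<L>" using N by auto
 have "T -` N \<in> sets \<L>"
  using measurable_sets[OF simil_measurable[OF T], of N] by auto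
 then have "emeasure \<L> (T -` N) = (\<integral>\<^sup>+x. indicator (T -` N) x \<partial>\<L>)"
  by (rule nn_integral_indicator[symmetric])
 also have "\<dots> = (\<integral>\<^sup>+x. indicator N (T x) \<partial>\<L>)"
  by (auto simp: indicator_def intro!: nn_integral_cong)
 also have "\<dots> = 0" using N(1) by (subst simil_nn_integral[OF T]) auto
 finally have "T -` N \<in> null_sets \<L>"
  using measurable_sets[OF simil_measurable[OF T], of N] by auto
 then show ?thesis using N(2) by (auto simp: eventually_ae_filter intro!: bexI[of _ "T -` N"])
qed

section \<open>Test functions and weak gradients\<close>

lemma borel_measurable_nth [measurable (raw)]:
 "f \<in> borel_measurable M ==> (\<lambda>x. f x $ i :: real) \<in> borel_measurable M"
 using borel_measurable_inner[of f M "\<lambda>_. axis i 1"] by (simp add: inner_axis)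

lemma borel_ident_lebesgue: "(\<lambda>x. x) \<in> \<M>"
 by (intro measurable_completion) simp

lemma pred_ball_lebesgue [measurable]: "Measurable.pred \<L> (\<lambda>x::real^'n::finite. x \<in> ball c r)"
 by (simp add: pred_def)

lemma pred_box_lebesgue [measurable]: "Measurable.pred \<L> (\<lambda>x::real^'n::finite. x \<in> box a b)"
 by (simp add: pred_def)

lemma continuous_lebesgue_measurable:
 fixes f :: "real^'n::finite => 'b::{second_countable_topology, topological_space}"
 shows "continuous_on UNIV f ==> f \<in> \<M>"
 by (intro measurable_completion) (simp add: borel_measurable_continuous_onI)

lemma test_fun_continuous: "test_fun f ==> continuous_on UNIV f"
 by (intro smooth_continuous test_fun_smooth)

lemma test_fun_measurable [measurable_dest]: "test_fun f ==> f \<in> \<M>"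
 by (intro continuous_lebesgue_measurable test_fun_continuous)

lemma test_fun_support:
 assumes "test_fun f" obtains R where "R > 0" "\<And>x. norm x \<ge> R ==> f x = 0"
proof -
 obtain B where B: "B > 0" "\<And>x. f x \<noteq> 0 ==> norm x <= B"
  using assms unfolding test_fun_def by (metis (mono_tags) bounded_pos mem_Collect_eq)
 show thesis by (rule that[of "B + 1"]) (use B in force)+
qed

lemma test_fun_bounded:
 assumes f: "test_fun f" obtains M where "M > 0" "\<And>x. \<bar>f x\<bar> <= M"
proof -
 obtain R where R: "R > 0" "\<And>x. norm x \<ge> R ==> f x = 0" using test_fun_support[OF f] by metis
 have "compact (f ` cball 0 R)"
  by (intro compact_continuous_image continuous_on_subset[OF test_fun_continuous[OF f]]) auto
 then obtain M where M: "M > 0" "\<And>x. x \<in> cball 0 R ==> \<bar>f x\<bar> <= M"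
  using compact_imp_bounded bounded_pos by (metis imageI real_norm_def)
 have "\<bar>f x\<bar> <= M" for x
 proof (cases "norm x <= R")
  case True then show ?thesis using M by simp
 next
  case False then show ?thesis using M R(2)[of x] by simp
 qed
 then show thesis using M that by blast
qed

lemma finite_ball: "emeasure \<L> (ball (c::real^'n::finite) r) < \<infinity>"
 using emeasure_lborel_ball_finite[of c r] by simp

lemma integrable_indicator_ball [simp]: "integrable \<L> (indicat_real (ball (c::real^'n::finite) r))"
 using finite_ball by (auto intro!: integrable_real_indicator)

lemma integrable_bounded_support:
 fixes f :: "real^'n::finite => 'b::{banach, second_countable_topology}"
 assumes [measurable]: "f \<in> \<M>"
  and M: "\<And>x. norm (f x) <= M" and R: "\<And>x. norm x \<ge> R ==> f x = 0"
 shows "integrable \<L> f"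
proof (rule Bochner_Integration.integrable_bound)
 show "integrable \<L> (\<lambda>x. indicator (ball (0::real^'n) R) x * M)"
  using finite_ball by (intro integrable_mult_left) (auto intro!: integrable_real_indicator)
 show "AE x in \<L>. norm (f x) <= norm (indicator (ball (0::real^'n) R) x * M)"
  by (rule AE_I2) (use M R order_trans[OF norm_ge_zero M] in \<open>auto simp: indicator_def\<close>)
qed simp

lemma test_fun_integrable: "test_fun f ==> integrable \<L> f"
 by (metis test_fun_bounded test_fun_support integrable_bounded_support test_fun_measurable real_norm_def)

definition grad :: "(real^'n::finite => real) => real^'n => real^'n" where
 "grad f x = (\<chi> i. partial_d i f x)"

lemma grad_nth [simp]: "grad f x $ i = partial_d i f x" by (simp add: grad_def)

lemma smooth_has_derivative: "smooth f ==> (f has_derivative (\<lambda>h. grad f x \<bullet> h)) (at x)"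
 using partial_d_works[OF smooth_differentiable, of f x] by (simp add: inner_vec_def mult.commute)

lemma smooth_directional:
 assumes "smooth f" shows "((\<lambda>t. f (x + t *\<^sub>R h)) has_real_derivative (grad f (x + t *\<^sub>R h) \<bullet> h)) (at t)"
proof -
 have "((\<lambda>t. x + t *\<^sub>R h) has_derivative (\<lambda>t. t *\<^sub>R h)) (at t)"
  by (auto intro!: derivative_eq_intros)
 from has_derivative_compose[OF this smooth_has_derivative[OF assms]] show ?thesis
  by (simp add: has_field_derivative_def mult.commute[of _ "_ \<bullet> _"] cong: if_cong)
qed

lemma test_fun_grad_bounded:
 assumes f: "test_fun f" obtains M where "M > 0" "\<And>x. norm (grad f x) <= M"
proof -
 have "\<forall>i. \<exists>M. \<forall>x. \<bar>partial_d i f x\<bar> <= M"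
  using test_fun_bounded[OF test_fun_partial[OF f]] by metis
 then obtain M where M: "\<And>i x. \<bar>partial_d i f x\<bar> <= M i" by metis
 have "norm (grad f x) <= (\<Sum>i\<in>UNIV. M i)" for x
  by (rule order_trans[OF norm_le_l1_cart]) (simp add: sum_mono M)
 then show thesis by (intro that[of "1 + \<bar>\<Sum>i\<in>UNIV. M i\<bar>"]) (auto intro: order_trans[OF _ add_increasing[OF _ abs_ge_self]])
qed

lemma test_fun_grad_support:
 fixes f :: "real^'n::finite => real"
 assumes f: "test_fun f" obtains R where "R > 0" "\<And>x. norm x \<ge> R ==> f x = 0" "\<And>x. norm x \<ge> R ==> grad f x = 0"
proof -
 obtain R where R: "R > 0" "\<And>x. norm x \<ge> R ==> f x = 0" using test_fun_support[OF f] by blast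
 have "\<forall>i. \<exists>R. \<forall>x. norm x \<ge> R \<longrightarrow> partial_d i f x = 0"
  using test_fun_support[OF test_fun_partial[OF f]] by metis
 then obtain R' where R': "\<And>i x. norm x \<ge> R' i ==> partial_d i f x = 0" by metis
 have le: "R' i <= (\<Sum>i\<in>UNIV. \<bar>R' i\<bar>)" for i
  using member_le_sum[of i UNIV "\<lambda>i. \<bar>R' i\<bar>"] by simp
 show thesis
 proof (rule that[of "R + (\<Sum>i\<in>UNIV. \<bar>R' i\<bar>)"])
  show "0 < R + (\<Sum>i\<in>UNIV. \<bar>R' i\<bar>)" using R by (intro add_pos_nonneg sum_nonneg) auto
  have nn: "0 <= (\<Sum>i\<in>UNIV. \<bar>R' i\<bar>)" by (intro sum_nonneg) auto
  fix x :: "real^'n" assume x: "R + (\<Sum>i\<in>UNIV. \<bar>R' i\<bar>) <= norm x"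
  show "f x = 0" by (rule R) (use x nn in linarith)
  have "partial_d i f x = 0" for i by (rule R'[of i]) (use x le[of i] R(1) in linarith)
  then show "grad f x = 0" by (simp add: vec_eq_iff)
 qed
qed

lemma test_fun_lipschitz:
 assumes f: "test_fun f" and M: "\<And>x. norm (grad f x) <= M"
 shows "\<bar>f (x + h) - f x\<bar> <= M * norm h"
proof -
 obtain t where "f (x + 1 *\<^sub>R h) - f (x + 0 *\<^sub>R h) = (1 - 0) * (grad f (x + t *\<^sub>R h) \<bullet> h)"
  using MVT2[of 0 1 "\<lambda>t. f (x + t *\<^sub>R h)" "\<lambda>t. grad f (x + t *\<^sub>R h) \<bullet> h"]
   smooth_directional[OF test_fun_smooth[OF f]] by (metis zero_less_one)
 then have "\<bar>f (x + h) - f x\<bar> <= norm (grad f (x + t *\<^sub>R h)) * norm h"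
  using Cauchy_Schwarz_ineq2[of "grad f (x + t *\<^sub>R h)" h] by simp
 also have "\<dots> <= M * norm h" by (intro mult_right_mono M) simp
 finally show ?thesis .
qed

lemma grad_measurable: "smooth f ==> grad f \<in> \<M>"
proof -
 assume f: "smooth f"
 have "continuous_on UNIV (grad f)"
  unfolding grad_def by (intro continuous_on_vec_lambda smooth_continuous smooth_partial f)
 then show ?thesis by (rule continuous_lebesgue_measurable)
qed

text \<open>The bound is one constant on one ball for all \<open>n\<close>: the mean value theorem
  gives the constant, and the shifts are never longer than \<open>h\<close>. It is the majorant for
  dominated convergence.\<close>

lemma difference_quotient:
 assumes f: "test_fun f"
 shows "\<And>x. (\<lambda>n. real (Suc n) * (f (x + (1 / Suc n) *\<^sub>R h) - f x)) \<longlonglongrightarrow> grad f x \<bullet> h"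
  and "\<exists>M R. 0 <= M \<and> (\<forall>n x. \<bar>real (Suc n) * (f (x + (1 / Suc n) *\<^sub>R h) - f x)\<bar> <= M * indicator (ball 0 R) x)"
proof -
 fix x
 have "((\<lambda>t. (f (x + t *\<^sub>R h) - f x) / t) \<longlongrightarrow> grad f x \<bullet> h) (at 0)"
  using smooth_directional[OF test_fun_smooth[OF f], of x h 0] by (simp add: DERIV_def)
 moreover have "filterlim (\<lambda>n. 1 / real (Suc n)) (at 0) sequentially"
  using LIMSEQ_Suc[OF lim_1_over_n[where 'a=real]] by (auto simp: filterlim_at simp del: of_nat_Suc)
 ultimately have "(\<lambda>n. (f (x + (1 / real (Suc n)) *\<^sub>R h) - f x) / (1 / real (Suc n))) \<longlonglongrightarrow> grad f x \<bullet> h"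
  by (rule filterlim_compose)
 then show "(\<lambda>n. real (Suc n) * (f (x + (1 / Suc n) *\<^sub>R h) - f x)) \<longlonglongrightarrow> grad f x \<bullet> h"
  by (simp add: mult.commute)
next
 obtain M where M: "M > 0" "\<And>x. norm (grad f x) <= M" using test_fun_grad_bounded[OF f] by blast
 obtain R where R: "R > 0" "\<And>x. norm x \<ge> R ==> f x = 0" using test_fun_support[OF f] by blast
 have "\<bar>real (Suc n) * (f (x + (1 / Suc n) *\<^sub>R h) - f x)\<bar> <= (M * norm h) * indicator (ball 0 (R + norm h)) x" for n x
 proof (cases "norm x < R + norm h")
  case True
  have "real (Suc n) * \<bar>f (x + (1 / Suc n) *\<^sub>R h) - f x\<bar> <= real (Suc n) * (M * norm ((1 / Suc n) *\<^sub>R h))"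
   by (intro mult_left_mono test_fun_lipschitz[OF f] M) auto
  also have "\<dots> = M * norm h" by simp
  finally show ?thesis using True by (simp add: abs_mult indicator_def)
 next
  case False
  have "norm ((1 / Suc n) *\<^sub>R h) <= norm h" by (simp add: divide_le_eq mult_le_cancel_left1)
  then have "norm (x + (1 / Suc n) *\<^sub>R h) \<ge> R" "norm x \<ge> R"
   using False norm_diff_ineq[of x "(1 / Suc n) *\<^sub>R h"] norm_ge_zero[of h] by linarith+
  then show ?thesis using R False by (simp add: indicator_def)
 qed
 then show "\<exists>M R. 0 <= M \<and> (\<forall>n x. \<bar>real (Suc n) * (f (x + (1 / Suc n) *\<^sub>R h) - f x)\<bar> <= M * indicator (ball 0 R) x)"
  using M by (intro exI[of _ "M * norm h"] exI[of _ "R + norm h"]) auto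
qed

lemma integrable_ball: "integrable \<L> (\<lambda>x. M * indicator (ball (0::real^'n::finite) R) x :: real)"
 using finite_ball by (intro integrable_mult_right) (auto intro!: integrable_real_indicator)

text \<open>Every difference quotient has integral 0 by translation invariance, and dominated
  convergence passes to the derivative. Applied to products this is integration by parts.\<close>

lemma integral_partial_zero:
 assumes f: "test_fun f" shows "(\<integral>x. partial_d i f x \<partial>\<L>) = 0"
proof -
 let ?h = "axis i 1"
 let ?q = "\<lambda>n x. real (Suc n) * (f (x + (1 / Suc n) *\<^sub>R ?h) - f x)"
 obtain M R where MR: "\<And>n x. \<bar>?q n x\<bar> <= M * indicator (ball 0 R) x"
  using difference_quotient(2)[OF f, of ?h] by blast
 note [measurable] = test_fun_measurable[OF f]
 have fT: "(\<lambda>x. f (x + a)) \<in> \<M>" for a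
  by (rule simil_measurable_comp[OF simil_translate]) simp
 have "(\<lambda>n. \<integral>x. ?q n x \<partial>\<L>) \<longlonglongrightarrow> (\<integral>x. grad f x \<bullet> ?h \<partial>\<L>)"
  by (rule integral_dominated_convergence[where w="\<lambda>x. M * indicator (ball 0 R) x"])
   (use MR difference_quotient(1)[OF f] fT in \<open>auto simp: integrable_ball grad_measurable[OF test_fun_smooth[OF f]] simp del: of_nat_Suc intro!: AE_I2 borel_measurable_inner\<close>)
 moreover have "(\<integral>x. ?q n x \<partial>\<L>) = 0" for n
  using simil_integral[OF simil_translate test_fun_measurable[OF f], of "(1 / Suc n) *\<^sub>R ?h"] test_fun_integrable[OF f]
  by (subst integral_mult_right_zero, subst Bochner_Integration.integral_diff) auto
 ultimately show ?thesis by (simp add: inner_axis LIMSEQ_const_iff)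
qed

lemma weak_grad_test:
 fixes f :: "real^'n::finite => real"
 assumes f: "test_fun f" shows "weak_grad f (grad f)"
 unfolding weak_grad_def
proof (intro conjI allI impI)
 show "grad f \<in> \<M>" by (rule grad_measurable[OF test_fun_smooth[OF f]])
 fix \<phi> :: "real^'n => real" and i assume \<phi>: "test_fun \<phi>"
 have 1: "test_fun (\<lambda>x. f x * partial_d i \<phi> x)" "test_fun (\<lambda>x. partial_d i f x * \<phi> x)"
  using f \<phi> by (auto intro!: test_fun_mult test_fun_smooth test_fun_partial)
 show i1: "integrable \<L> (\<lambda>x. f x * partial_d i \<phi> x)" using test_fun_integrable[OF 1(1)] .
 show i2: "integrable \<L> (\<lambda>x. grad f x $ i * \<phi> x)" using test_fun_integrable[OF 1(2)] by simp
 have "partial_d i (\<lambda>x. f x * \<phi> x) = (\<lambda>x. f x * partial_d i \<phi> x + partial_d i f x * \<phi> x)"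
  using f \<phi> by (intro ext partial_d_mult smooth_differentiable test_fun_smooth)
 then have "(\<integral>x. f x * partial_d i \<phi> x + partial_d i f x * \<phi> x \<partial>\<L>) = 0"
  using integral_partial_zero[OF test_fun_mult[OF test_fun_smooth[OF f] \<phi>], of i] by simp
 then show "(\<integral>x. f x * partial_d i \<phi> x \<partial>\<L>) = - (\<integral>x. grad f x $ i * \<phi> x \<partial>\<L>)"
  using i1 i2 by (subst (asm) Bochner_Integration.integral_add) auto
qed

subsection \<open>Uniqueness of weak gradients\<close>

lemma flat0_mono: "s <= t ==> flat 0 s <= flat 0 t"
 by (auto simp: flat_def frac_le)

lemma flat0_tendsto: "(\<lambda>n. flat 0 (real n * t)) \<longlonglongrightarrow> (if t > 0 then 1 else 0)"
proof (cases "t > 0")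
 case True
 have "(\<lambda>n. exp (- (inverse (real n) * (1 / t)))) \<longlonglongrightarrow> exp (- (0 * (1/t)))"
  by (intro tendsto_intros lim_inverse_n)
 moreover have "\<forall>\<^sub>F n in sequentially. exp (- (inverse (real n) * (1 / t))) = flat 0 (real n * t)"
  using eventually_gt_at_top[of 0] by eventually_elim (use True in \<open>simp add: flat_def field_simps mult_le_0_iff\<close>)
 ultimately show ?thesis using True by (auto dest: tendsto_cong)
next
 case False
 then have "flat 0 (real n * t) = 0" for n by (simp add: flat_pos_iff mult_nonneg_nonpos)
 then show ?thesis using False by simp
qed

text \<open>Smooth approximation of the indicator of an open box from inside: values in [0,1], zero
  off the box, pointwise convergence as \<open>n\<close> grows.\<close>

definition box_bump :: "nat => real^'n::finite => real^'n => real^'n => real" where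
 "box_bump n a b x = (\<Prod>i\<in>UNIV. flat 0 (real n * (x $ i - a $ i)) * flat 0 (real n * (b $ i - x $ i)))"

lemma box_bump_tendsto: "(\<lambda>n. box_bump n a b x) \<longlonglongrightarrow> indicator (box a b) x"
proof -
 have "(\<lambda>n. box_bump n a b x) \<longlonglongrightarrow> (\<Prod>i\<in>UNIV. (if x$i - a$i > 0 then 1 else 0) * (if b$i - x$i > 0 then 1 else 0))"
  unfolding box_bump_def by (intro tendsto_prod tendsto_mult flat0_tendsto)
 also have "(\<Prod>i\<in>UNIV. (if x$i - a$i > 0 then 1 else 0) * (if b$i - x$i > 0 then 1 else 0)) = (indicator (box a b) x :: real)"
  by (auto simp: indicator_def mem_box_cart prod_zero_iff)
 finally show ?thesis .
qed

lemma box_bump_le: "0 <= box_bump n a b x" "box_bump n a b x <= 1"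
 unfolding box_bump_def by (auto intro!: prod_nonneg prod_le_1 mult_le_one simp: flat_nonneg flat0_le1)

lemma box_bump_zero: "x \<notin> box a b ==> box_bump n a b x = 0"
proof -
 assume "x \<notin> box a b"
 then obtain i where "x $ i <= a $ i \<or> b $ i <= x $ i" by (auto simp: mem_box_cart not_less)
 then show ?thesis unfolding box_bump_def
  by (intro prod_zero[OF finite] bexI[of _ i]) (auto simp: flat_pos_iff mult_nonneg_nonpos)
qed

lemma test_fun_box_bump: "test_fun (box_bump n a b)"
proof -
 have *: "box_bump n a b = (\<lambda>x. \<Prod>i\<in>UNIV. flat 0 (real n * (x \<bullet> axis i 1 + - (a $ i))) * flat 0 (real n * ((-1) * (x \<bullet> axis i 1) + b $ i)))"
  by (simp add: box_bump_def[abs_def] inner_axis)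
 have "smooth (box_bump n a b)" unfolding *
  by (intro smooth_prod finite smooth_mult smooth_compose[of "flat 0"] Ck1_flat smooth_add smooth_const smooth_inner)
 moreover have "{x. box_bump n a b x \<noteq> 0} \<subseteq> box a b" using box_bump_zero by blast
 ultimately show ?thesis using bounded_subset[OF bounded_box] by (auto simp: test_fun_def smooth_def)
qed

text \<open>A bump on a slightly larger ball is bounded below by a positive constant on the given
  one, so integrability against that single test function yields local integrability.\<close>

lemma integrable_on_ball_of_test:
 assumes h: "\<And>\<phi>. test_fun \<phi> ==> integrable \<L> (\<lambda>x. h x * \<phi> x)" and [measurable]: "h \<in> \<M>"
 shows "integrable \<L> (\<lambda>x. indicator (ball (0::real^'n::finite) R) x * h x)"
proof (rule Bochner_Integration.integrable_bound)
 let ?c = "flat 0 ((\<bar>R\<bar>+1)\<^sup>2 - \<bar>R\<bar>\<^sup>2)"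
 have c: "?c > 0" by (simp add: flat_pos_iff power2_eq_square algebra_simps)
 show "integrable \<L> (\<lambda>x. (1 / ?c) * (h x * bump 0 (\<bar>R\<bar>+1) x))"
  by (intro integrable_mult_right h test_fun_bump)
 show "AE x in \<L>. norm (indicator (ball (0::real^'n) R) x * h x) <= norm ((1 / ?c) * (h x * bump 0 (\<bar>R\<bar>+1) x))"
 proof (rule AE_I2)
  fix x :: "real^'n"
  show "norm (indicator (ball (0::real^'n) R) x * h x) <= norm ((1 / ?c) * (h x * bump 0 (\<bar>R\<bar>+1) x))"
  proof (cases "norm x < R")
   case True
   then have "?c <= bump 0 (\<bar>R\<bar>+1) x" unfolding bump_def
    by (intro flat0_mono) (auto intro!: power_mono)
   then have "1 <= (1 / ?c) * bump 0 (\<bar>R\<bar>+1) x" using c by (simp add: field_simps)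
   then have "\<bar>h x\<bar> * 1 <= \<bar>h x\<bar> * ((1 / ?c) * bump 0 (\<bar>R\<bar>+1) x)" by (intro mult_left_mono) auto
   then show ?thesis using True c \<open>?c <= bump 0 (\<bar>R\<bar>+1) x\<close> by (simp add: abs_mult mult_ac)
  qed (simp add: indicator_def)
 qed
qed measurable

text \<open>The positive and negative parts of \<open>h\<close> are densities of two finite measures
  that agree on boxes, an intersection-stable generator of the Borel sets. Equal measures have
  densities equal almost everywhere.\<close>

lemma AE_zero_if_box_integrals_zero:
 fixes h :: "real^'n::finite => real"
 assumes h: "integrable \<L> h" and z: "\<And>a b. (\<integral>x. indicator (box a b) x * h x \<partial>\<L>) = 0"
 shows "AE x in \<L>. h x = 0"
proof -
 obtain g where g[measurable]: "g \<in> borel_measurable lborel" and ae: "AE x in lborel. h x = g x"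
  using completion_ex_borel_measurable_real[OF borel_measurable_integrable[OF h]] by auto
 have gi: "integrable lborel g"
  using h ae integrable_cong_AE[of h \<L> g] by (auto simp: measurable_completion integrable_completion AE_completion)
 have gb: "(\<integral>x. indicator (box a b) x * g x \<partial>lborel) = 0" for a b
 proof -
  have "(\<integral>x. indicator (box a b) x * g x \<partial>lborel) = (\<integral>x. indicator (box a b) x * g x \<partial>\<L>)"
   by (rule integral_completion[symmetric]) measurable
  also have "\<dots> = (\<integral>x. indicator (box a b) x * h x \<partial>\<L>)"
   using ae h by (intro integral_cong_AE) (auto simp: measurable_completion intro!: AE_completion borel_measurable_times)
  finally show ?thesis using z by simp
 qed
 let ?p = "\<lambda>x. ennreal (g x)" and ?m = "\<lambda>x. ennreal (- g x)"
 have fin: "(\<integral>\<^sup>+x. ?p x \<partial>lborel) < \<infinity>" "(\<integral>\<^sup>+x. ?m x \<partial>lborel) < \<infinity>"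
  using gi by (auto simp: real_integrable_def less_top)
 have eq: "emeasure (density lborel ?p) (box a b) = emeasure (density lborel ?m) (box a b)" for a b
 proof -
  have i: "integrable lborel (\<lambda>x. indicator (box a b) x * g x)"
   using integrable_mult_indicator[OF _ gi, of "box a b"] by simp
  have 1: "enn2real (\<integral>\<^sup>+x. ennreal (indicator (box a b) x * g x) \<partial>lborel) = enn2real (\<integral>\<^sup>+x. ennreal (- (indicator (box a b) x * g x)) \<partial>lborel)"
   using gb[of a b] i by (simp add: real_lebesgue_integral_def)
  have 2: "(\<integral>\<^sup>+x. ennreal (indicator (box a b) x * g x) \<partial>lborel) = (\<integral>\<^sup>+x. ennreal (- (indicator (box a b) x * g x)) \<partial>lborel)"
   (is "?I = ?J")
  proof -
   have "?I < top" "?J < top" using i by (auto simp: real_integrable_def less_top)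
   then have "?I = ennreal (enn2real ?I)" "?J = ennreal (enn2real ?J)" by (simp_all only: ennreal_enn2real)
   then show ?thesis by (simp only: 1)
  qed
  have 3: "ennreal (indicator (box a b) x * g x) = ?p x * indicator (box a b) x" "ennreal (- (indicator (box a b) x * g x)) = ?m x * indicator (box a b) x" for x
   by (auto simp: indicator_def)
  show ?thesis using 2 unfolding 3 by (simp add: emeasure_density)
 qed
 have "density lborel ?p = density lborel ?m"
 proof (rule measure_eqI_generator_eq[where E="range (\<lambda>(a, b). box a b)" and A="\<lambda>n. box (- (\<chi> i. real n)) (\<chi> i. real n)" and \<Omega>=UNIV])
  show "Int_stable (range (\<lambda>(a, b). box a b :: (real^'n) set))"
  proof (unfold Int_stable_def, intro ballI)
   fix S T :: "(real^'n) set" assume "S \<in> range (\<lambda>(a, b). box a b)" "T \<in> range (\<lambda>(a, b). box a b)"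
   then obtain a b c d where "S = box a b" "T = box c d" by auto
   then obtain e f where "S \<inter> T = box e f" using box_Int_box[of a b c d] by blast
   then show "S \<inter> T \<in> range (\<lambda>(a, b). box a b)" by (auto intro: range_eqI[of _ _ "(e, f)"])
  qed
  show "(\<Union>n. box (- (\<chi> i. real n)) (\<chi> i. real n)) = (UNIV :: (real^'n) set)"
  proof -
   have "\<exists>n. x \<in> box (- (\<chi> i. real n)) (\<chi> i. real n)" for x :: "real^'n"
   proof -
    obtain n where n: "norm x < real n" using reals_Archimedean2 by blast
    have "\<bar>x $ i\<bar> < real n" for i using component_le_norm_cart[of x i] n by simp
    then show ?thesis by (auto simp: mem_box_cart abs_less_iff intro!: exI[of _ n]) (metis minus_less_iff)
   qed
   then show ?thesis by auto
  qed
  show "emeasure (density lborel ?p) (box (- (\<chi> i. real n)) (\<chi> i. real n)) \<noteq> \<infinity>" for n :: nat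
  proof -
   have "emeasure (density lborel ?p) (box (- (\<chi> i. real n)) (\<chi> i. real n)) <= (\<integral>\<^sup>+x. ?p x \<partial>lborel)"
    by (auto simp: emeasure_density intro!: nn_integral_mono mult_left_le split: split_indicator)
   then show ?thesis using fin by (auto simp: top_unique)
  qed
 qed (auto simp: eq borel_eq_box)
 then have "AE x in lborel. ?p x = ?m x"
  using fin by (subst (asm) finite_density_unique) auto
 then have "AE x in lborel. h x = 0" using ae
  by eventually_elim (metis ennreal_inj ennreal_neg linorder_le_cases neg_0_le_iff_le ennreal_eq_0_iff antisym neg_le_0_iff_le)
 then show ?thesis by (rule AE_completion)
qed

text \<open>Box indicators are limits of test functions dominated on a fixed ball, so the hypothesis
  passes to boxes. Cutting \<open>h\<close> off by boxes makes it globally integrable, and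
  intersections of boxes are boxes, so the cut-off functions satisfy the criterion just
  proved.\<close>

lemma fundamental_lemma:
 fixes h :: "real^'n::finite => real"
 assumes h: "\<And>\<phi>. test_fun \<phi> ==> integrable \<L> (\<lambda>x. h x * \<phi> x)" and m[measurable]: "h \<in> \<M>"
  and z: "\<And>\<phi>. test_fun \<phi> ==> (\<integral>x. h x * \<phi> x \<partial>\<L>) = 0"
 shows "AE x in \<L>. h x = 0"
proof -
 have bx: "(\<integral>x. indicator (box a b) x * h x \<partial>\<L>) = 0" for a b
 proof -
  obtain R where R: "box a b \<subseteq> ball 0 R" using bounded_subset_ballD[OF bounded_box] by metis
  have "(\<lambda>n. \<integral>x. h x * box_bump n a b x \<partial>\<L>) \<longlonglongrightarrow> (\<integral>x. h x * indicator (box a b) x \<partial>\<L>)"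
  proof (rule integral_dominated_convergence[where w="\<lambda>x. norm (indicator (ball (0::real^'n) R) x * h x)"])
   show "integrable \<L> (\<lambda>x. norm (indicator (ball (0::real^'n) R) x * h x))"
    by (intro integrable_norm integrable_on_ball_of_test h m)
   show "AE x in \<L>. (\<lambda>n. h x * box_bump n a b x) \<longlonglongrightarrow> h x * indicator (box a b) x"
    by (intro AE_I2 tendsto_intros box_bump_tendsto)
   show "AE x in \<L>. norm (h x * box_bump n a b x) <= norm (indicator (ball (0::real^'n) R) x * h x)" for n
   proof (rule AE_I2)
    fix x show "norm (h x * box_bump n a b x) <= norm (indicator (ball (0::real^'n) R) x * h x)"
     using box_bump_le[of n a b x] box_bump_zero[of x a b n] R
     by (cases "x \<in> box a b") (auto simp: abs_mult indicator_def intro!: mult_left_le)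
   qed
   show "(\<lambda>x. h x * box_bump n a b x) \<in> \<M>" for n
    using test_fun_measurable[OF test_fun_box_bump[of n a b]] by measurable
  qed measurable
  then show ?thesis using z[OF test_fun_box_bump] by (simp add: LIMSEQ_const_iff mult.commute)
 qed
 have "AE x in \<L>. indicator (box (- (\<chi> i. real n)) (\<chi> i. real n)) x * h x = 0" for n
 proof (rule AE_zero_if_box_integrals_zero)
  let ?B = "box (- (\<chi> i. real n)) (\<chi> i. real n) :: (real^'n) set"
  obtain R where R: "?B \<subseteq> ball 0 R" using bounded_subset_ballD[OF bounded_box] by metis
  have "integrable \<L> (\<lambda>x. indicator ?B x *\<^sub>R (indicator (ball 0 R) x * h x))"
   by (intro integrable_mult_indicator integrable_on_ball_of_test h m) auto
  moreover have "(\<lambda>x. indicator ?B x *\<^sub>R (indicator (ball 0 R) x * h x)) = (\<lambda>x. indicator ?B x * h x)"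
   using R by (auto simp: indicator_def intro!: ext dest!: subsetD)
  ultimately show "integrable \<L> (\<lambda>x. indicator ?B x * h x)" by simp
  show "(\<integral>x. indicator (box a b) x * (indicator ?B x * h x) \<partial>\<L>) = 0" for a b
  proof -
   obtain c d where "box a b \<inter> ?B = box c d" unfolding box_Int_box by blast
   then show ?thesis using bx[of c d] by (simp add: mult.assoc[symmetric] indicator_inter_arith[symmetric])
  qed
 qed
 then have "AE x in \<L>. \<forall>n::nat. indicator (box (- (\<chi> i. real n)) (\<chi> i. real n)) x * h x = 0"
  by (simp only: AE_all_countable simp_thms)
 then show ?thesis
 proof eventually_elim
  case (elim x)
  obtain n where n: "norm x < real n" using reals_Archimedean2 by blast
  have "\<bar>x $ i\<bar> < real n" for i using component_le_norm_cart[of x i] n by simp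
  then have "x \<in> box (- (\<chi> i. real n)) (\<chi> i. real n)" by (auto simp: mem_box_cart abs_less_iff) (metis minus_less_iff)
  then show ?case using elim[THEN spec, of n] by (simp only: indicator_simps mult_1_left)
 qed
qed

text \<open>\<open>wgrad\<close> is an arbitrary choice among weak gradients; uniqueness allows
  energies and forms to be computed from any of them.\<close>

lemma weak_grad_unique:
 fixes u :: "real^'n::finite => real"
 assumes g: "weak_grad u g" and h: "weak_grad u h"
 shows "AE x in \<L>. g x = h x"
proof -
 have [measurable]: "g \<in> \<M>" "h \<in> \<M>"
  using g h by (auto simp: weak_grad_def)
 have "AE x in \<L>. g x $ i - h x $ i = 0" for i
 proof (rule fundamental_lemma)
  fix \<phi> :: "real^'n => real" assume \<phi>: "test_fun \<phi>"
  have i: "integrable \<L> (\<lambda>x. g x $ i * \<phi> x)" "integrable \<L> (\<lambda>x. h x $ i * \<phi> x)"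
   and e1: "(\<integral>x. u x * partial_d i \<phi> x \<partial>\<L>) = - (\<integral>x. g x $ i * \<phi> x \<partial>\<L>)"
    "(\<integral>x. u x * partial_d i \<phi> x \<partial>\<L>) = - (\<integral>x. h x $ i * \<phi> x \<partial>\<L>)"
   using g h \<phi> unfolding weak_grad_def by blast+
  have e: "(\<integral>x. g x $ i * \<phi> x \<partial>\<L>) = (\<integral>x. h x $ i * \<phi> x \<partial>\<L>)"
   using e1 by simp
  show "integrable \<L> (\<lambda>x. (g x $ i - h x $ i) * \<phi> x)" "(\<integral>x. (g x $ i - h x $ i) * \<phi> x \<partial>\<L>) = 0"
   using i e by (auto simp: left_diff_distrib)
 qed measurable
 then have "AE x in \<L>. \<forall>i. g x $ i - h x $ i = 0" by (simp add: AE_all_countable)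
 then show ?thesis by eventually_elim (simp add: vec_eq_iff)
qed

section \<open>The two quadratic forms\<close>

text \<open>Vector-valued and over any measure, so that gradients over points and the differences
  \<open>fdiff\<close> over pairs share one Hilbert space calculus.\<close>

definition L2 :: "'a measure => ('a => 'b::euclidean_space) => bool" where
 "L2 M f \<longleftrightarrow> f \<in> borel_measurable M \<and> integrable M (\<lambda>x. (norm (f x))\<^sup>2)"

lemma L2_iff: "L2 M f \<longleftrightarrow> f \<in> borel_measurable M \<and> (\<integral>\<^sup>+x. ennreal ((norm (f x))\<^sup>2) \<partial>M) < \<infinity>"
 unfolding L2_def by (auto simp: integrable_iff_bounded)

lemma L2_measurable [measurable_dest]: "L2 M f ==> f \<in> borel_measurable M"
 by (simp add: L2_def)

lemma L2_inner: "L2 M f ==> L2 M g ==> integrable M (\<lambda>x. f x \<bullet> g x)"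
proof (rule Bochner_Integration.integrable_bound)
 assume f: "L2 M f" and g: "L2 M g"
 then show "integrable M (\<lambda>x. (norm (f x))\<^sup>2 + (norm (g x))\<^sup>2)" by (auto simp: L2_def)
 have "\<bar>a \<bullet> b\<bar> <= (norm a)\<^sup>2 + (norm b)\<^sup>2" for a b :: 'b
 proof -
  have "2 * (norm a * norm b) <= (norm a)\<^sup>2 + (norm b)\<^sup>2"
   using zero_le_power2[of "norm a - norm b"] by (simp add: power2_diff algebra_simps)
  then show ?thesis using Cauchy_Schwarz_ineq2[of a b] mult_nonneg_nonneg[of "norm a" "norm b"] by linarith
 qed
 then show "AE x in M. norm (f x \<bullet> g x) <= norm ((norm (f x))\<^sup>2 + (norm (g x))\<^sup>2)"
  by simp
 show "(\<lambda>x. f x \<bullet> g x) \<in> borel_measurable M" using f g by measurable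
qed

lemma norm_add_scale: "(norm (a + c *\<^sub>R b))\<^sup>2 = (norm a)\<^sup>2 + 2 * c * (a \<bullet> b) + c\<^sup>2 * (norm b)\<^sup>2"
 for a b :: "'b::euclidean_space"
 unfolding power2_norm_eq_inner by (simp add: inner_add inner_commute power2_eq_square algebra_simps)

lemma L2_lincomb: "L2 M f ==> L2 M g ==> L2 M (\<lambda>x. f x + c *\<^sub>R g x)"
 using L2_inner[of M f g] by (auto simp: L2_def norm_add_scale intro!: borel_measurable_add borel_measurable_scaleR)

lemma L2_expand:
 assumes "L2 M f" "L2 M g"
 shows "(\<integral>x. (norm (f x + c *\<^sub>R g x))\<^sup>2 \<partial>M) =
  (\<integral>x. (norm (f x))\<^sup>2 \<partial>M) + 2 * c * (\<integral>x. f x \<bullet> g x \<partial>M) + c\<^sup>2 * (\<integral>x. (norm (g x))\<^sup>2 \<partial>M)"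
 unfolding norm_add_scale using assms L2_inner[OF assms] by (subst Bochner_Integration.integral_add | simp add: L2_def)+

lemma L2_nonneg: "0 <= (\<integral>x. (norm (f x))\<^sup>2 \<partial>M)" by simp

lemma L2_Cauchy_Schwarz:
 assumes "L2 M f" "L2 M g"
 shows "\<bar>\<integral>x. f x \<bullet> g x \<partial>M\<bar> <= sqrt (\<integral>x. (norm (f x))\<^sup>2 \<partial>M) * sqrt (\<integral>x. (norm (g x))\<^sup>2 \<partial>M)"
proof -
 let ?a = "\<integral>x. (norm (g x))\<^sup>2 \<partial>M" and ?b = "\<integral>x. f x \<bullet> g x \<partial>M" and ?c = "\<integral>x. (norm (f x))\<^sup>2 \<partial>M"
 have q: "0 <= ?c + 2 * t * ?b + t\<^sup>2 * ?a" for t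
  using L2_expand[OF assms, of t] L2_nonneg[of M "\<lambda>x. f x + t *\<^sub>R g x"] by simp
 have "?b\<^sup>2 <= ?a * ?c"
 proof (cases "?a = 0")
  case True
  have "?b = 0"
  proof (rule ccontr)
   assume b: "?b \<noteq> 0"
   \<comment> \<open>Without quadratic term an affine function of t would be nonnegative everywhere;
     at this t its value is -1.\<close>
   show False using q[of "- (?c + 1) / (2 * ?b)"] b True by (simp add: field_simps)
  qed
  then show ?thesis using True by simp
 next
  case False
  then have a: "?a > 0" using L2_nonneg[of M g] by linarith
  \<comment> \<open>Evaluation at the minimizer t = -b/a of the quadratic.\<close>
  have "0 <= ?a * (?c + 2 * (- ?b / ?a) * ?b + (- ?b / ?a)\<^sup>2 * ?a)"
   by (rule mult_nonneg_nonneg[OF less_imp_le[OF a] q])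
  also have "\<dots> = ?a * ?c - ?b\<^sup>2" using a by (simp add: field_simps power2_eq_square)
  finally show ?thesis by simp
 qed
 then have "sqrt (?b\<^sup>2) <= sqrt (?a * ?c)" by (rule real_sqrt_le_mono)
 then show ?thesis by (simp add: real_sqrt_mult mult.commute)
qed

subsection \<open>Weak gradients\<close>

lemma weak_grad_measurable [measurable_dest]: "weak_grad u g ==> g \<in> \<M>"
 by (simp add: weak_grad_def)

lemma weak_grad_wgrad: "weak_grad u g ==> weak_grad u (wgrad u)"
 unfolding wgrad_def by (rule someI[of "weak_grad u"])

lemma wgrad_AE: "weak_grad u g ==> AE x in \<L>. wgrad u x = g x"
 using weak_grad_unique weak_grad_wgrad by blast

lemma D12_enn_eq:
 assumes "weak_grad u g"
 shows "D12_enn u = (\<integral>\<^sup>+x. ennreal ((norm (g x))\<^sup>2) \<partial>\<L>)"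
 unfolding D12_enn_def using wgrad_AE[OF assms] by (intro nn_integral_cong_AE) auto

lemma weak_grad_lincomb:
 assumes u: "weak_grad u g" and v: "weak_grad v h"
 shows "weak_grad (\<lambda>x. u x + c * v x) (\<lambda>x. g x + c *\<^sub>R h x)"
 unfolding weak_grad_def
proof (intro conjI allI impI)
 show "(\<lambda>x. g x + c *\<^sub>R h x) \<in> \<M>" using u v by measurable
 fix \<phi> :: "real^'a => real" and i assume \<phi>: "test_fun \<phi>"
 note * = u[unfolded weak_grad_def, THEN conjunct2, rule_format, OF \<phi>, of i]
  v[unfolded weak_grad_def, THEN conjunct2, rule_format, OF \<phi>, of i]
 have 1: "(u x + c * v x) * partial_d i \<phi> x = u x * partial_d i \<phi> x + c * (v x * partial_d i \<phi> x)"
  "(g x + c *\<^sub>R h x) $ i * \<phi> x = g x $ i * \<phi> x + c * (h x $ i * \<phi> x)" for x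
  by (auto simp: algebra_simps)
 show "integrable \<L> (\<lambda>x. (u x + c * v x) * partial_d i \<phi> x)"
  "integrable \<L> (\<lambda>x. (g x + c *\<^sub>R h x) $ i * \<phi> x)"
  "(\<integral>x. (u x + c * v x) * partial_d i \<phi> x \<partial>\<L>) = - (\<integral>x. (g x + c *\<^sub>R h x) $ i * \<phi> x \<partial>\<L>)"
  unfolding 1 using * by simp_all
qed

lemma weak_grad_cong_AE:
 assumes [measurable]: "u \<in> \<M>" "v \<in> \<M>" and ae: "AE x in \<L>. u x = v x"
 shows "weak_grad u = weak_grad v"
proof -
 have "integrable \<L> (\<lambda>x. u x * partial_d i \<phi> x) = integrable \<L> (\<lambda>x. v x * partial_d i \<phi> x)"
  "(\<integral>x. u x * partial_d i \<phi> x \<partial>\<L>) = (\<integral>x. v x * partial_d i \<phi> x \<partial>\<L>)" if "test_fun \<phi>" for \<phi> i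
  using test_fun_measurable[OF test_fun_partial[OF that, of i]] ae
  by (intro integrable_cong_AE integral_cong_AE; auto)+
 then show ?thesis unfolding weak_grad_def by (intro ext) (metis (no_types, lifting))
qed

subsection \<open>Finite energy functions\<close>

text \<open>The square root of the kernel is attached to the difference, so the fractional seminorm
  becomes an L^2 norm over pairs. On the diagonal the value is 0.\<close>

definition fdiff :: "real => (real^'n::finite => real) => (real^'n) \<times> (real^'n) => real" where
 "fdiff s u z = (u (fst z) - u (snd z)) / dist (fst z) (snd z) powr ((real CARD('n) + 2 * s) / 2)"

lemma fdiff_mult:
 "fdiff s u z * fdiff s v z = (u (fst z) - u (snd z)) * (v (fst z) - v (snd z))
  / dist (fst z) (snd z) powr (real CARD('n) + 2 * s)"
 for z :: "(real^'n::finite) \<times> (real^'n)"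
 by (simp add: fdiff_def powr_add[symmetric])

lemma fdiff_sq: "(fdiff s u z)\<^sup>2 = (u (fst z) - u (snd z))\<^sup>2 / dist (fst z) (snd z) powr (real CARD('n) + 2 * s)"
 for z :: "(real^'n::finite) \<times> (real^'n)"
 using fdiff_mult[of s u z u] by (simp add: power2_eq_square)

lemma Ds2_enn_fdiff: "Ds2_enn s u = (\<integral>\<^sup>+z. ennreal ((norm (fdiff s u z))\<^sup>2) \<partial>\<L>\<^sub>2)"
 unfolding Ds2_enn_def by (simp add: fdiff_sq)

lemma measurable_fst_leb [measurable]: "(\<lambda>z::(real^'n::finite)\<times>(real^'n). fst z) \<in> borel_measurable \<L>\<^sub>2"
 and measurable_snd_leb [measurable]: "(\<lambda>z::(real^'n::finite)\<times>(real^'n). snd z) \<in> borel_measurable \<L>\<^sub>2"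
 using measurable_compose[OF measurable_fst borel_ident_lebesgue] measurable_compose[OF measurable_snd borel_ident_lebesgue]
 by auto

lemma measurable_dist_leb [measurable]: "(\<lambda>z::(real^'n::finite)\<times>(real^'n). dist (fst z) (snd z)) \<in> borel_measurable \<L>\<^sub>2"
 by (intro borel_measurable_dist measurable_fst_leb measurable_snd_leb)

lemma fdiff_measurable [measurable]:
 fixes u :: "real^'n::finite => real"
 assumes u: "u \<in> \<M>"
 shows "fdiff s u \<in> borel_measurable \<L>\<^sub>2"
proof -
 have "(\<lambda>z::(real^'n)\<times>(real^'n). u (fst z)) \<in> borel_measurable \<L>\<^sub>2"
  "(\<lambda>z::(real^'n)\<times>(real^'n). u (snd z)) \<in> borel_measurable \<L>\<^sub>2"
  using measurable_compose[OF measurable_fst u] measurable_compose[OF measurable_snd u] by auto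
 then show ?thesis unfolding fdiff_def[abs_def] by measurable
qed

text \<open>Finite energy without approximability by test functions. The calculus of the forms lives
  on this larger class; \<open>E_space\<close> adds the approximating sequence.\<close>

definition fin_E :: "real => (real^'n::finite => real) => bool" where
 "fin_E s u \<longleftrightarrow> u \<in> \<M> \<and> (\<exists>g. weak_grad u g) \<and> D12_enn u < \<infinity> \<and> Ds2_enn s u < \<infinity>"

lemma fin_E_measurable [measurable_dest]: "fin_E s u ==> u \<in> \<M>"
 by (simp add: fin_E_def)

lemma fin_E_weak_grad: "fin_E s u ==> weak_grad u (wgrad u)"
 using weak_grad_wgrad by (auto simp: fin_E_def)

lemma fin_E_L2:
 assumes "fin_E s u"
 shows "L2 \<L> (wgrad u)" "L2 \<L>\<^sub>2 (fdiff s u)"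
 using assms weak_grad_measurable[OF fin_E_weak_grad[OF assms]]
 unfolding L2_iff by (auto simp: fin_E_def D12_enn_def Ds2_enn_fdiff)

lemma D12_sq_eq: "fin_E s u ==> D12_sq u = (\<integral>x. (norm (wgrad u x))\<^sup>2 \<partial>\<L>)"
 using fin_E_L2(1)[of s u] unfolding D12_sq_def D12_enn_def L2_def
 by (subst nn_integral_eq_integral) auto

lemma Ds2_sq_eq: "fin_E s u ==> Ds2_sq s u = (\<integral>z. (norm (fdiff s u z))\<^sup>2 \<partial>\<L>\<^sub>2)"
 using fin_E_L2(2)[of s u] unfolding Ds2_sq_def Ds2_enn_fdiff L2_def
 by (subst nn_integral_eq_integral) auto

lemma D12_sq_nonneg [simp]: "0 <= D12_sq u" and Ds2_sq_nonneg [simp]: "0 <= Ds2_sq s u"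
 by (simp_all add: D12_sq_def Ds2_sq_def)

lemma D12_enn_ennreal: "fin_E s u ==> D12_enn u = ennreal (D12_sq u)"
 and Ds2_enn_ennreal: "fin_E s u ==> Ds2_enn s u = ennreal (Ds2_sq s u)"
 by (simp_all add: fin_E_def D12_sq_def Ds2_sq_def less_top)

definition D12_form :: "(real^'n::finite => real) => (real^'n => real) => real" where
 "D12_form u v = (\<integral>x. wgrad u x \<bullet> wgrad v x \<partial>\<L>)"

definition Ds2_form :: "real => (real^'n::finite => real) => (real^'n => real) => real" where
 "Ds2_form s u v = (\<integral>z. fdiff s u z * fdiff s v z \<partial>\<L>\<^sub>2)"

lemma fdiff_lincomb: "fdiff s (\<lambda>x. u x + c * v x) z = fdiff s u z + c *\<^sub>R fdiff s v z"
 by (simp add: fdiff_def add_divide_distrib[symmetric] algebra_simps)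

text \<open>The expansion in \<open>c\<close> is the source of the triangle inequality, the
  parallelogram law and the first variation.\<close>

lemma fin_E_lincomb:
 assumes u: "fin_E s u" and v: "fin_E s v"
 shows "fin_E s (\<lambda>x. u x + c * v x)"
  and "D12_sq (\<lambda>x. u x + c * v x) = D12_sq u + 2 * c * D12_form u v + c\<^sup>2 * D12_sq v"
  and "Ds2_sq s (\<lambda>x. u x + c * v x) = Ds2_sq s u + 2 * c * Ds2_form s u v + c\<^sup>2 * Ds2_sq s v"
proof -
 let ?w = "\<lambda>x. u x + c * v x"
 have w: "weak_grad ?w (\<lambda>x. wgrad u x + c *\<^sub>R wgrad v x)"
  by (intro weak_grad_lincomb fin_E_weak_grad[OF u] fin_E_weak_grad[OF v])
 have L1: "L2 \<L> (\<lambda>x. wgrad u x + c *\<^sub>R wgrad v x)"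
  by (intro L2_lincomb fin_E_L2[OF u] fin_E_L2[OF v])
 have L2: "L2 \<L>\<^sub>2 (\<lambda>z. fdiff s u z + c *\<^sub>R fdiff s v z)"
  by (intro L2_lincomb fin_E_L2[OF u] fin_E_L2[OF v])
 have "?w \<in> \<M>" using u v by measurable
 then show fw: "fin_E s ?w" using w L1 L2
  unfolding fin_E_def D12_enn_eq[OF w] Ds2_enn_fdiff fdiff_lincomb L2_iff by blast
 have "D12_sq ?w = (\<integral>x. (norm (wgrad u x + c *\<^sub>R wgrad v x))\<^sup>2 \<partial>\<L>)"
  unfolding D12_sq_def D12_enn_eq[OF w] using L1 by (subst nn_integral_eq_integral) (auto simp: L2_def)
 then show "D12_sq ?w = D12_sq u + 2 * c * D12_form u v + c\<^sup>2 * D12_sq v"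
  by (simp add: L2_expand fin_E_L2[OF u] fin_E_L2[OF v] D12_sq_eq[OF u] D12_sq_eq[OF v] D12_form_def)
 show "Ds2_sq s ?w = Ds2_sq s u + 2 * c * Ds2_form s u v + c\<^sup>2 * Ds2_sq s v"
  using L2_expand[OF fin_E_L2(2)[OF u] fin_E_L2(2)[OF v], of c]
  unfolding Ds2_sq_eq[OF fw] fdiff_lincomb Ds2_sq_eq[OF u] Ds2_sq_eq[OF v] Ds2_form_def by simp
qed

lemma forms_Cauchy_Schwarz:
 assumes u: "fin_E s u" and v: "fin_E s v"
 shows "\<bar>D12_form u v\<bar> <= sqrt (D12_sq u) * sqrt (D12_sq v)"
  "\<bar>Ds2_form s u v\<bar> <= sqrt (Ds2_sq s u) * sqrt (Ds2_sq s v)"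
 using L2_Cauchy_Schwarz[OF fin_E_L2(1)[OF u] fin_E_L2(1)[OF v]] L2_Cauchy_Schwarz[OF fin_E_L2(2)[OF u] fin_E_L2(2)[OF v]]
 by (simp_all add: D12_form_def Ds2_form_def D12_sq_eq[OF u] D12_sq_eq[OF v] Ds2_sq_eq[OF u] Ds2_sq_eq[OF v])

lemma wgrad_cong_AE:
 assumes [measurable]: "u \<in> \<M>" "v \<in> \<M>" and ae: "AE x in \<L>. u x = v x"
 shows "wgrad u = wgrad v"
 unfolding wgrad_def weak_grad_cong_AE[OF assms] ..

lemma AE_pair_leb:
 assumes "AE x in \<L>. P (x::real^'n::finite)"
 shows "AE z in \<L> \<Otimes>\<^sub>M \<L>. P (fst z) \<and> P (snd z :: real^'n)"
proof -
 obtain N where N: "N \<in> null_sets \<L>" "{x. \<not> P x} \<subseteq> N"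
  using assms by (auto simp: eventually_ae_filter)
 then have [measurable]: "N \<in> sets \<L>" by auto
 have "AE z in \<L> \<Otimes>\<^sub>M \<L>. fst z \<notin> N \<and> snd z \<notin> N"
 proof (rule leb2.AE_pair_measure)
  show "{z \<in> space \<L>\<^sub>2. fst z \<notin> N \<and> snd z \<notin> N} \<in> sets \<L>\<^sub>2"
  proof -
   have "{z \<in> space \<L>\<^sub>2. fst z \<notin> N \<and> snd z \<notin> N} = (- N) \<times> (- N)"
    by (auto simp: space_pair_measure)
   then show ?thesis using \<open>N \<in> sets \<L>\<close> by (simp add: Compl_in_sets_lebesgue)
  qed
  show "AE x in \<L>. AE y in \<L>. fst (x, y) \<notin> N \<and> snd (x, y) \<notin> N"
   using AE_not_in[OF N(1)] by (auto elim!: eventually_mono)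
 qed
 then show ?thesis by eventually_elim (use N(2) in auto)
qed

lemma Ds2_enn_cong_AE:
 assumes ae: "AE x in \<L>. u x = v x" shows "Ds2_enn s u = Ds2_enn s v"
 unfolding Ds2_enn_def using AE_pair_leb[OF ae] by (intro nn_integral_cong_AE) auto

lemma fin_E_cong_AE:
 assumes u: "fin_E s u" and v[measurable]: "v \<in> \<M>" and ae: "AE x in \<L>. u x = v x"
 shows "fin_E s v" "D12_enn v = D12_enn u" "Ds2_enn s v = Ds2_enn s u" "wgrad v = wgrad u"
proof -
 have [measurable]: "u \<in> \<M>" using u by measurable
 show w: "wgrad v = wgrad u" using wgrad_cong_AE[OF _ _ ae] by simp
 show 1: "D12_enn v = D12_enn u" by (simp add: D12_enn_def w)
 show 2: "Ds2_enn s v = Ds2_enn s u" using Ds2_enn_cong_AE[OF ae] by simp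
 show "fin_E s v" using u weak_grad_cong_AE[OF _ _ ae] by (simp add: fin_E_def 1 2)
qed

subsection \<open>Behaviour under similarities\<close>

lemma partial_d_affine:
 fixes L :: "real^'n::finite => real^'n"
 assumes "bounded_linear L" "smooth f"
 shows "partial_d i (\<lambda>x. f (L x + a)) x = (\<Sum>j\<in>UNIV. L (axis i 1) $ j * partial_d j f (L x + a))"
proof -
 have "((\<lambda>x. f (L x + a)) has_derivative (\<lambda>h. \<Sum>j\<in>UNIV. L h $ j * partial_d j f (L x + a))) (at x)"
  by (rule has_derivative_compose[OF _ partial_d_works[OF smooth_differentiable], of "\<lambda>x. L x + a" L])
   (auto intro!: derivative_eq_intros bounded_linear_imp_has_derivative assms)
 then show ?thesis by (rule partial_d_eqI)
qed

lemma simil_affine: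
 fixes T :: "real^'n::finite => real^'n"
 assumes "simil l T" obtains L a where "bounded_linear L" "T = (\<lambda>x. L x + a)"
proof -
 obtain R a where R: "orthogonal_transformation R" and T: "T = (\<lambda>x. l *\<^sub>R R x + a)"
  using assms by (auto simp: simil_def)
 have "bounded_linear (\<lambda>x. l *\<^sub>R R x)"
  using R by (intro bounded_linear_scaleR_right[THEN bounded_linear_compose])
   (auto dest!: orthogonal_transformation_linear simp: linear_conv_bounded_linear)
 then show thesis using that T by blast
qed

lemma test_fun_simil:
 fixes f :: "real^'n::finite => real"
 assumes f: "test_fun f" and T: "simil l T" shows "test_fun (\<lambda>x. f (T x))"
proof -
 obtain L a where L: "bounded_linear L" "T = (\<lambda>x. L x + a)" using simil_affine[OF T] .
 have "smooth (\<lambda>x. f (T x))" unfolding L(2) by (intro smooth_affine_map L test_fun_smooth f)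
 moreover obtain R where R: "\<And>x. f x \<noteq> 0 ==> norm x < R" using test_fun_support[OF f] by (metis not_less)
 have "bounded {x. f (T x) \<noteq> 0}"
 proof -
  obtain T' where T': "simil (1/l) T'" "\<And>x. T (T' x) = x" "\<And>x. T' (T x) = x" using simil_inverse[OF T] by metis
  have "f (T x) \<noteq> 0 ==> dist (T' 0) x <= (1/l) * R" for x
   using simil_dist[OF T'(1), of 0 "T x"] R[of "T x"] simil_pos[OF T] T'(3)[of x]
   by (simp add: divide_right_mono)
  then show ?thesis unfolding bounded_def by blast
 qed
 ultimately show ?thesis by (auto simp: test_fun_def smooth_def)
qed

text \<open>Testing u(T x) against \<phi> is testing \<open>u\<close> against \<phi> composed with
  the inverse of \<open>T\<close>. The chain rule distributes the derivative over the coordinates,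
  and orthogonality turns the transposed matrix into \<open>inv R\<close>.\<close>

lemma weak_grad_simil:
 fixes u :: "real^'n::finite => real" and T R :: "real^'n => real^'n"
 assumes u: "weak_grad u g" and R: "orthogonal_transformation R" and l: "l > 0" and T: "T = (\<lambda>x. l *\<^sub>R R x + a)"
 shows "weak_grad (\<lambda>x. u (T x)) (\<lambda>x. l *\<^sub>R inv R (g (T x)))"
 unfolding weak_grad_def
proof (intro conjI allI impI)
 have S: "simil l T" unfolding T by (intro similI l R)
 have Ri: "orthogonal_transformation (inv R)" using R by (rule orthogonal_transformation_inv)
 have c: "continuous_on UNIV (inv R)"
  using orthogonal_transformation_linear[OF Ri] by (auto intro!: linear_continuous_on simp: linear_conv_bounded_linear)
 have gm: "g \<in> \<M>" using u by (simp add: weak_grad_def)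
 show "(\<lambda>x. l *\<^sub>R inv R (g (T x))) \<in> \<M>"
  using simil_measurable_comp[OF S gm] borel_measurable_continuous_onI[OF c]
  by (intro borel_measurable_scaleR borel_measurable_const) (rule measurable_compose)
 fix \<phi> :: "real^'n => real" and i assume \<phi>: "test_fun \<phi>"
 obtain T' where T': "simil (1/l) T'" "\<And>x. T (T' x) = x" "\<And>x. T' (T x) = x" using simil_inverse[OF S] by metis
 let ?\<psi> = "\<lambda>y. \<phi> (T' y)" and ?c = "\<lambda>j. l * R (axis i 1) $ j"
 have \<psi>: "test_fun ?\<psi>" using test_fun_simil[OF \<phi> T'(1)] .
 note W = u[unfolded weak_grad_def, THEN conjunct2, rule_format, OF \<psi>]
 have bl: "bounded_linear (\<lambda>x. l *\<^sub>R R x)"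
  using R by (intro bounded_linear_scaleR_right[THEN bounded_linear_compose])
   (auto dest!: orthogonal_transformation_linear simp: linear_conv_bounded_linear)
 have 1: "u (T x) * partial_d i \<phi> x = (\<Sum>j\<in>UNIV. ?c j * (u (T x) * partial_d j ?\<psi> (T x)))" for x
 proof -
  have "partial_d i \<phi> x = partial_d i (\<lambda>x. ?\<psi> (l *\<^sub>R R x + a)) x" using T'(3) by (simp add: T)
  also have "\<dots> = (\<Sum>j\<in>UNIV. ?c j * partial_d j ?\<psi> (T x))"
   by (subst partial_d_affine[OF bl test_fun_smooth[OF \<psi>]]) (simp add: T)
  finally show ?thesis by (simp add: sum_distrib_left mult_ac)
 qed
 have 2: "(l *\<^sub>R inv R (g (T x))) $ i * \<phi> x = (\<Sum>j\<in>UNIV. ?c j * (g (T x) $ j * ?\<psi> (T x)))" for x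
 proof -
  have "inv R y $ i = y \<bullet> R (axis i 1)" for y
  proof -
   have "inv R y $ i = inv R y \<bullet> axis i 1" by (simp add: inner_axis)
   also have "\<dots> = R (inv R y) \<bullet> R (axis i 1)" using R by (simp add: orthogonal_transformation_def)
   also have "R (inv R y) = y" using orthogonal_transformation_surj[OF R] by (simp add: surj_f_inv_f)
   finally show ?thesis .
  qed
  then show ?thesis by (simp add: inner_vec_def sum_distrib_left sum_distrib_right T'(3) mult_ac)
 qed
 let ?F = "\<lambda>y. \<Sum>j\<in>UNIV. ?c j * (u y * partial_d j ?\<psi> y)" and ?G = "\<lambda>y. \<Sum>j\<in>UNIV. ?c j * (g y $ j * ?\<psi> y)"
 have F: "integrable \<L> ?F" and G: "integrable \<L> ?G"
  using W by auto
 have FG: "(\<integral>y. ?F y \<partial>\<L>) = - (\<integral>y. ?G y \<partial>\<L>)"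
  using W by (simp add: Bochner_Integration.integral_sum sum_negf)
 show "integrable \<L> (\<lambda>x. u (T x) * partial_d i \<phi> x)"
  unfolding 1 using simil_integral(1)[OF S, of ?F] F by auto
 show "integrable \<L> (\<lambda>x. (l *\<^sub>R inv R (g (T x))) $ i * \<phi> x)"
  unfolding 2 using simil_integral(1)[OF S, of ?G] G by auto
 show "(\<integral>x. u (T x) * partial_d i \<phi> x \<partial>\<L>) = - (\<integral>x. (l *\<^sub>R inv R (g (T x))) $ i * \<phi> x \<partial>\<L>)"
  unfolding 1 2 using simil_integral(2)[OF S, of ?F] simil_integral(2)[OF S, of ?G] F G FG by auto
qed

lemma fdiff_simil:
 fixes u :: "real^'n::finite => real"
 assumes T: "simil l T"
 shows "fdiff s (\<lambda>x. u (T x)) z = l powr ((real CARD('n) + 2 * s) / 2) * fdiff s u (pmap T T z)"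
 using simil_pos[OF T] by (simp add: fdiff_def pmap_def simil_dist[OF T] powr_mult)

lemma fin_E_simil:
 fixes u v :: "real^'n::finite => real"
 assumes T: "simil l T" and u: "fin_E s u"
 shows "fin_E s (\<lambda>x. u (T x))"
  and "D12_sq (\<lambda>x. u (T x)) = l\<^sup>2 / l ^ CARD('n) * D12_sq u"
  and "Ds2_sq s (\<lambda>x. u (T x)) = l powr (real CARD('n) + 2 * s) / (l ^ CARD('n) * l ^ CARD('n)) * Ds2_sq s u"
  and "fin_E s v ==> D12_form (\<lambda>x. u (T x)) (\<lambda>x. v (T x)) = l\<^sup>2 / l ^ CARD('n) * D12_form u v"
  and "fin_E s v ==> Ds2_form s (\<lambda>x. u (T x)) (\<lambda>x. v (T x)) = l powr (real CARD('n) + 2 * s) / (l ^ CARD('n) * l ^ CARD('n)) * Ds2_form s u v"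
proof -
 obtain R a where R: "orthogonal_transformation R" and l: "l > 0" and Teq: "T = (\<lambda>x. l *\<^sub>R R x + a)"
  using T by (auto simp: simil_def)
 have Ri: "orthogonal_transformation (inv R)" using R by (rule orthogonal_transformation_inv)
 let ?gr = "\<lambda>u x. l *\<^sub>R inv R (wgrad u (T x))"
 have wg: "weak_grad (\<lambda>x. u (T x)) (?gr u)" if "fin_E s u" for u
  by (rule weak_grad_simil[OF fin_E_weak_grad[OF that] R l Teq])
 have ip: "?gr u x \<bullet> ?gr v x = l\<^sup>2 * (wgrad u (T x) \<bullet> wgrad v (T x))" for u v x
  using Ri by (simp add: orthogonal_transformation_def power2_eq_square)
 have nm: "(norm (?gr u x))\<^sup>2 = l\<^sup>2 * (norm (wgrad u (T x)))\<^sup>2" for u x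
  unfolding power2_norm_eq_inner ip ..
 have pw: "l powr ((real CARD('n) + 2 * s) / 2) * l powr ((real CARD('n) + 2 * s) / 2) = l powr (real CARD('n) + 2 * s)"
  by (simp add: powr_add[symmetric])
 have fi: "fdiff s (\<lambda>x. u (T x)) z * fdiff s (\<lambda>x. v (T x)) z = l powr (real CARD('n) + 2 * s) * (fdiff s u (pmap T T z) * fdiff s v (pmap T T z))" for u v z
  unfolding fdiff_simil[OF T] pw[symmetric] by (simp add: mult_ac)
 have fn: "(norm (fdiff s (\<lambda>x. u (T x)) z))\<^sup>2 = l powr (real CARD('n) + 2 * s) * (norm (fdiff s u (pmap T T z)))\<^sup>2" for u z
  using fi[of u z u] by (simp add: power2_eq_square)
 note [measurable] = fin_E_measurable[OF u] weak_grad_measurable[OF fin_E_weak_grad[OF u]]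
 have A: "D12_enn (\<lambda>x. u (T x)) = ennreal (l\<^sup>2 / l ^ CARD('n)) * D12_enn u"
 proof -
  have "D12_enn (\<lambda>x. u (T x)) = (\<integral>\<^sup>+x. ennreal (l\<^sup>2) * ennreal ((norm (wgrad u (T x)))\<^sup>2) \<partial>\<L>)"
   unfolding D12_enn_eq[OF wg[OF u]] nm by (simp add: ennreal_mult)
  also have "\<dots> = ennreal (1 / l ^ CARD('n)) * (\<integral>\<^sup>+x. ennreal (l\<^sup>2) * ennreal ((norm (wgrad u x))\<^sup>2) \<partial>\<L>)"
   by (rule simil_nn_integral[OF T]) measurable
  also have "\<dots> = ennreal (1 / l ^ CARD('n)) * ennreal (l\<^sup>2) * D12_enn u"
   by (subst nn_integral_cmult) (auto simp: D12_enn_def mult.assoc)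
  finally show ?thesis using l by (simp add: ennreal_mult[symmetric])
 qed
 have B: "Ds2_enn s (\<lambda>x. u (T x)) = ennreal (l powr (real CARD('n) + 2 * s) / (l ^ CARD('n) * l ^ CARD('n))) * Ds2_enn s u"
 proof -
  have "Ds2_enn s (\<lambda>x. u (T x)) = (\<integral>\<^sup>+z. ennreal (l powr (real CARD('n) + 2 * s)) * ennreal ((norm (fdiff s u (pmap T T z)))\<^sup>2) \<partial>\<L>\<^sub>2)"
   unfolding Ds2_enn_fdiff fn by (simp add: ennreal_mult)
  also have "\<dots> = ennreal (1 / l ^ CARD('n) * (1 / l ^ CARD('n))) * (\<integral>\<^sup>+z. ennreal (l powr (real CARD('n) + 2 * s)) * ennreal ((norm (fdiff s u z))\<^sup>2) \<partial>\<L>\<^sub>2)"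
   by (rule simil_nn_integral_pair[OF T T]) measurable
  also have "\<dots> = ennreal (1 / l ^ CARD('n) * (1 / l ^ CARD('n))) * ennreal (l powr (real CARD('n) + 2 * s)) * Ds2_enn s u"
   by (subst nn_integral_cmult) (auto simp: Ds2_enn_fdiff mult.assoc)
  finally show ?thesis using l by (simp add: ennreal_mult[symmetric])
 qed
 show "fin_E s (\<lambda>x. u (T x))"
  unfolding fin_E_def A B using u wg[OF u] simil_measurable_comp[OF T fin_E_measurable[OF u]]
  by (auto simp: fin_E_def ennreal_mult_less_top)
 show "D12_sq (\<lambda>x. u (T x)) = l\<^sup>2 / l ^ CARD('n) * D12_sq u"
  "Ds2_sq s (\<lambda>x. u (T x)) = l powr (real CARD('n) + 2 * s) / (l ^ CARD('n) * l ^ CARD('n)) * Ds2_sq s u"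
  unfolding D12_sq_def Ds2_sq_def A B using l by (simp_all add: enn2real_mult)
 assume v: "fin_E s v"
 note [measurable] = fin_E_measurable[OF v] weak_grad_measurable[OF fin_E_weak_grad[OF v]]
 have "D12_form (\<lambda>x. u (T x)) (\<lambda>x. v (T x)) = (\<integral>x. ?gr u x \<bullet> ?gr v x \<partial>\<L>)"
  unfolding D12_form_def using wgrad_AE[OF wg[OF u]] wgrad_AE[OF wg[OF v]]
   weak_grad_measurable[OF wg[OF u]] weak_grad_measurable[OF wg[OF v]]
   weak_grad_measurable[OF weak_grad_wgrad[OF wg[OF u]]] weak_grad_measurable[OF weak_grad_wgrad[OF wg[OF v]]]
  by (intro integral_cong_AE borel_measurable_inner) auto
 also have "\<dots> = l\<^sup>2 * (\<integral>x. wgrad u (T x) \<bullet> wgrad v (T x) \<partial>\<L>)" unfolding ip by simp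
 also have "(\<integral>x. wgrad u (T x) \<bullet> wgrad v (T x) \<partial>\<L>) = (1 / l ^ CARD('n)) * D12_form u v"
  unfolding D12_form_def by (subst simil_integral(2)[OF T, of "\<lambda>x. wgrad u x \<bullet> wgrad v x"]) (auto intro!: borel_measurable_inner)
 finally show "D12_form (\<lambda>x. u (T x)) (\<lambda>x. v (T x)) = l\<^sup>2 / l ^ CARD('n) * D12_form u v" by simp
 have "Ds2_form s (\<lambda>x. u (T x)) (\<lambda>x. v (T x)) = l powr (real CARD('n) + 2 * s) * (\<integral>z. fdiff s u (pmap T T z) * fdiff s v (pmap T T z) \<partial>\<L>\<^sub>2)"
  unfolding Ds2_form_def fi by simp
 also have "(\<integral>z. fdiff s u (pmap T T z) * fdiff s v (pmap T T z) \<partial>\<L>\<^sub>2) = (1 / l ^ CARD('n) * (1 / l ^ CARD('n))) * Ds2_form s u v"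
  unfolding Ds2_form_def by (subst simil_integral_pair(2)[OF T T, of "\<lambda>z. fdiff s u z * fdiff s v z"]) auto
 finally show "Ds2_form s (\<lambda>x. u (T x)) (\<lambda>x. v (T x)) = l powr (real CARD('n) + 2 * s) / (l ^ CARD('n) * l ^ CARD('n)) * Ds2_form s u v" by simp
qed

lemma Lp_enn_simil:
 fixes u :: "real^'n::finite => real"
 assumes T: "simil l T" and [measurable]: "u \<in> \<M>"
 shows "Lp_enn p (\<lambda>x. c * u (T x)) = ennreal (\<bar>c\<bar> powr p / l ^ CARD('n)) * Lp_enn p u"
proof -
 have l: "l > 0" using simil_pos[OF T] .
 have "Lp_enn p (\<lambda>x. c * u (T x)) = (\<integral>\<^sup>+x. ennreal (\<bar>c\<bar> powr p) * ennreal (\<bar>u (T x)\<bar> powr p) \<partial>\<L>)"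
  unfolding Lp_enn_def by (simp add: abs_mult powr_mult ennreal_mult)
 also have "\<dots> = ennreal (1 / l ^ CARD('n)) * (\<integral>\<^sup>+x. ennreal (\<bar>c\<bar> powr p) * ennreal (\<bar>u x\<bar> powr p) \<partial>\<L>)"
  by (rule simil_nn_integral[OF T]) measurable
 also have "\<dots> = ennreal (1 / l ^ CARD('n)) * ennreal (\<bar>c\<bar> powr p) * Lp_enn p u"
  by (subst nn_integral_cmult) (auto simp: Lp_enn_def mult.assoc)
 finally show ?thesis using l by (simp add: ennreal_mult[symmetric])
qed

section \<open>Increments and weak-type estimates\<close>

lemma emeasure_ball_leb:
 "r \<ge> 0 ==> emeasure \<L> (ball (c::real^'n::finite) r) = ennreal (unit_ball_vol (real CARD('n)) * r ^ CARD('n))"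
 using emeasure_ball[of r c] by simp

text \<open>Energy of the increments at distance below \<open>r\<close>. The two seminorms bound it
  by the powers r^(N+2s) and r^(N+2); the level-set estimate and local compactness use nothing about
  the function beyond such a bound and its L^p control.\<close>

definition incr :: "(real^'n::finite => real) => real => ennreal" where
 "incr u r = (\<integral>\<^sup>+z. ennreal ((u (fst z) - u (snd z))\<^sup>2) * indicator {z. dist (fst z) (snd z) < r} z \<partial>\<L>\<^sub>2)"

lemma incr_measurable [measurable]:
 fixes u :: "real^'n::finite => real"
 assumes u: "u \<in> \<M>"
 shows "(\<lambda>z. ennreal ((u (fst z) - u (snd z))\<^sup>2)) \<in> borel_measurable \<L>\<^sub>2"
proof -
 have "(\<lambda>z::(real^'n)\<times>(real^'n). u (fst z)) \<in> borel_measurable \<L>\<^sub>2"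
  "(\<lambda>z::(real^'n)\<times>(real^'n). u (snd z)) \<in> borel_measurable \<L>\<^sub>2"
  using measurable_compose[OF measurable_fst u] measurable_compose[OF measurable_snd u] by auto
 then show ?thesis by measurable
qed

lemma dist_set_measurable [measurable]:
 "Measurable.pred \<L>\<^sub>2 (\<lambda>z::(real^'n::finite)\<times>(real^'n). dist (fst z) (snd z) < r)"
 by measurable

lemma dist_set_measurable' [measurable]:
 "{z::(real^'n::finite)\<times>(real^'n). dist (fst z) (snd z) < r} \<in> sets \<L>\<^sub>2"
 using dist_set_measurable[of r, where 'n='n] by (simp add: pred_def space_pair_measure)

text \<open>Pairs at distance below \<open>r\<close> carry a kernel of at least r^-(N+2s), so
  inserting the kernel costs just this factor.\<close>

lemma incr_le_Ds2:
 fixes u :: "real^'n::finite => real"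
 assumes s: "0 < s" and [measurable]: "u \<in> \<M>"
 shows "incr u r <= ennreal (r powr (real CARD('n) + 2 * s)) * Ds2_enn s u"
proof -
 let ?g = "real CARD('n) + 2 * s"
 have "incr u r <= (\<integral>\<^sup>+z. ennreal (r powr ?g) * ennreal ((norm (fdiff s u z))\<^sup>2) \<partial>\<L>\<^sub>2)"
  unfolding incr_def
 proof (rule nn_integral_mono)
  fix z :: "(real^'n) \<times> (real^'n)"
  show "ennreal ((u (fst z) - u (snd z))\<^sup>2) * indicator {z. dist (fst z) (snd z) < r} z
    <= ennreal (r powr ?g) * ennreal ((norm (fdiff s u z))\<^sup>2)"
  proof (cases "dist (fst z) (snd z) < r \<and> fst z \<noteq> snd z")
   case True
   then have d: "0 < dist (fst z) (snd z) powr ?g" "dist (fst z) (snd z) powr ?g <= r powr ?g"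
    using s by (auto intro!: powr_mono2)
   then have "(u (fst z) - u (snd z))\<^sup>2 * 1 <= (u (fst z) - u (snd z))\<^sup>2 * (r powr ?g / dist (fst z) (snd z) powr ?g)"
    by (intro mult_left_mono) auto
   then show ?thesis using True by (simp add: ennreal_mult[symmetric] fdiff_sq mult.commute)
  qed auto
 qed
 also have "\<dots> = ennreal (r powr ?g) * Ds2_enn s u"
  unfolding Ds2_enn_fdiff by (rule nn_integral_cmult) measurable
 finally show ?thesis .
qed

text \<open>The substitution y = x + h and an exchange of integrals reduce increments to differences
  of translates, which the Dirichlet energy controls for each fixed \<open>h\<close>.\<close>

lemma incr_eq_translates:
 fixes u :: "real^'n::finite => real"
 assumes u: "test_fun u"
 shows "incr u r = (\<integral>\<^sup>+h. indicator (ball 0 r) h * (\<integral>\<^sup>+x. ennreal ((u (x + h) - u x)\<^sup>2) \<partial>\<L>) \<partial>\<L>)"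
proof -
 note [measurable] = test_fun_measurable[OF u]
 have ub: "u \<in> borel_measurable borel" using test_fun_continuous[OF u] by (rule borel_measurable_continuous_onI)
 have "(\<lambda>z::(real^'n)\<times>(real^'n). u (fst z + snd z)) \<in> borel_measurable \<L>\<^sub>2"
  by (rule measurable_compose[OF _ ub]) measurable
 then have [measurable]: "(\<lambda>z::(real^'n)\<times>(real^'n). u (snd z + fst z)) \<in> borel_measurable \<L>\<^sub>2"
  "(\<lambda>z::(real^'n)\<times>(real^'n). u (fst z + snd z)) \<in> borel_measurable \<L>\<^sub>2"
  by (simp_all add: add.commute)
 have [measurable]: "(\<lambda>z::(real^'n)\<times>(real^'n). u (fst z)) \<in> borel_measurable \<L>\<^sub>2"
  "(\<lambda>z::(real^'n)\<times>(real^'n). u (snd z)) \<in> borel_measurable \<L>\<^sub>2"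
  using measurable_compose[OF measurable_fst test_fun_measurable[OF u]] measurable_compose[OF measurable_snd test_fun_measurable[OF u]]
  by auto
 let ?F = "\<lambda>z. ennreal ((u (fst z) - u (snd z))\<^sup>2) * indicator {z. dist (fst z) (snd z) < r} z"
 have Fm[measurable]: "?F \<in> borel_measurable \<L>\<^sub>2" by measurable
 let ?G = "\<lambda>z. ennreal ((u (fst z + snd z) - u (fst z))\<^sup>2) * indicator (ball 0 r) (snd z)"
 have Gm[measurable]: "?G \<in> borel_measurable \<L>\<^sub>2" by measurable
 have "incr u r = (\<integral>\<^sup>+x. \<integral>\<^sup>+y. ?F (x, y) \<partial>\<L> \<partial>\<L>)"
  unfolding incr_def by (rule leb.nn_integral_fst[OF Fm, symmetric])
 also have "\<dots> = (\<integral>\<^sup>+x. \<integral>\<^sup>+h. ?G (x, h) \<partial>\<L> \<partial>\<L>)"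
 proof (rule nn_integral_cong)
  fix x :: "real^'n"
  have "(\<lambda>y. ?F (x, y)) \<in> \<M>" by (rule measurable_Pair2[OF Fm]) simp
  from simil_nn_integral[OF simil_translate[of x] this]
  have "(\<integral>\<^sup>+y. ?F (x, y) \<partial>\<L>) = (\<integral>\<^sup>+h. ?F (x, h + x) \<partial>\<L>)" by simp
  also have "\<dots> = (\<integral>\<^sup>+h. ?G (x, h) \<partial>\<L>)"
   by (intro nn_integral_cong) (auto simp: dist_norm indicator_def power2_commute add.commute)
  finally show "(\<integral>\<^sup>+y. ?F (x, y) \<partial>\<L>) = (\<integral>\<^sup>+h. ?G (x, h) \<partial>\<L>)" .
 qed
 also have "\<dots> = (\<integral>\<^sup>+h. \<integral>\<^sup>+x. ?G (x, h) \<partial>\<L> \<partial>\<L>)"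
  by (rule leb2.Fubini'[symmetric]) (simp add: split_beta' Gm[simplified])
 also have "\<dots> = (\<integral>\<^sup>+h. indicator (ball 0 r) h * (\<integral>\<^sup>+x. ennreal ((u (x + h) - u x)\<^sup>2) \<partial>\<L>) \<partial>\<L>)"
 proof (intro nn_integral_cong)
  fix h :: "real^'n"
  have "(\<lambda>x. ennreal ((u (x + h) - u x)\<^sup>2)) \<in> \<M>"
   using simil_measurable_comp[OF simil_translate test_fun_measurable[OF u], of h] by measurable
  from nn_integral_multc[OF this, of "indicator (ball 0 r) h"]
  show "(\<integral>\<^sup>+x. ?G (x, h) \<partial>\<L>) = indicator (ball 0 r) h * (\<integral>\<^sup>+x. ennreal ((u (x + h) - u x)\<^sup>2) \<partial>\<L>)"
   by (simp only: fst_conv snd_conv mult.commute)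
 qed
 finally show ?thesis .
qed

lemma D12_sq_test:
 assumes u: "test_fun u"
 shows "D12_enn u = ennreal (\<integral>x. (norm (grad u x))\<^sup>2 \<partial>\<L>)" "integrable \<L> (\<lambda>x. (norm (grad u x))\<^sup>2)"
  "D12_sq u = (\<integral>x. (norm (grad u x))\<^sup>2 \<partial>\<L>)"
proof -
 obtain M where M: "M > 0" "\<And>x. norm (grad u x) <= M" using test_fun_grad_bounded[OF u] by blast
 obtain R where R: "\<And>x. norm x \<ge> R ==> grad u x = 0" using test_fun_grad_support[OF u] by metis
 note [measurable] = grad_measurable[OF test_fun_smooth[OF u]]
 show i: "integrable \<L> (\<lambda>x. (norm (grad u x))\<^sup>2)"
  by (rule integrable_bounded_support[of _ "M\<^sup>2" R]) (use M R in \<open>auto intro!: power_mono\<close>)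
 show e: "D12_enn u = ennreal (\<integral>x. (norm (grad u x))\<^sup>2 \<partial>\<L>)"
  unfolding D12_enn_eq[OF weak_grad_test[OF u]] using i by (subst nn_integral_eq_integral) auto
 show "D12_sq u = (\<integral>x. (norm (grad u x))\<^sup>2 \<partial>\<L>)" unfolding D12_sq_def e by simp
qed

lemma test_fun_translate: "test_fun u ==> test_fun (\<lambda>x. u (x + h))"
 using test_fun_simil[OF _ simil_translate] .

lemma test_fun_power2: "test_fun u ==> test_fun (\<lambda>x. (u x)\<^sup>2)"
 unfolding power2_eq_square by (intro test_fun_mult test_fun_smooth)

text \<open>The shift is cut into n equal steps. Cauchy-Schwarz on the telescoping sum and
  translation invariance bound the left side by n^2 times the same integral with shift h/n, that is
  by a squared difference quotient, whose integral converges to that of (grad u . h)^2.\<close>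

lemma translate_diff_le:
 fixes u :: "real^'n::finite => real"
 assumes u: "test_fun u"
 shows "(\<integral>\<^sup>+x. ennreal ((u (x + h) - u x)\<^sup>2) \<partial>\<L>) <= ennreal ((norm h)\<^sup>2 * D12_sq u)"
proof -
 let ?I = "\<lambda>h. \<integral>x. (u (x + h) - u x)\<^sup>2 \<partial>\<L>"
 have tf: "test_fun (\<lambda>x. (u (x + a) - u (x + b))\<^sup>2)" for a b
  by (intro test_fun_power2 test_fun_diff test_fun_translate u)
 have int: "integrable \<L> (\<lambda>x. (u (x + a) - u (x + b))\<^sup>2)" for a b
  by (rule test_fun_integrable[OF tf])
 have step: "?I h <= (\<integral>x. (real (Suc m) * (u (x + (1 / Suc m) *\<^sub>R h) - u x))\<^sup>2 \<partial>\<L>)" for m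
 proof -
  let ?n = "Suc m" and ?k = "(1 / Suc m) *\<^sub>R h"
  let ?d = "\<lambda>j x. u (x + real (Suc j) *\<^sub>R ?k) - u (x + real j *\<^sub>R ?k)"
  have pt: "(u (x + h) - u x)\<^sup>2 <= ?n * (\<Sum>j<?n. (?d j x)\<^sup>2)" for x
  proof -
   have "u (x + h) - u x = (\<Sum>j<?n. ?d j x)"
    by (subst sum_lessThan_telescope) (simp del: of_nat_Suc)
   also have "(\<Sum>j<?n. ?d j x)\<^sup>2 <= (\<Sum>j<?n. (?d j x)\<^sup>2) * card {..<?n}"
    by (rule sum_squared_le_sum_of_squares) 
   finally show ?thesis by (simp add: mult.commute)
  qed
  have "?I h <= (\<integral>x. ?n * (\<Sum>j<?n. (?d j x)\<^sup>2) \<partial>\<L>)"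
   by (intro integral_mono pt integrable_mult_right Bochner_Integration.integrable_sum int) (use int[of h 0] in simp)
  also have "\<dots> = ?n * (\<Sum>j<?n. \<integral>x. (?d j x)\<^sup>2 \<partial>\<L>)"
   by (subst integral_mult_right_zero, subst Bochner_Integration.integral_sum) (auto simp del: of_nat_Suc sum.lessThan_Suc intro!: int)
  also have "\<dots> = ?n * (\<Sum>j<?n. ?I ?k)"
  proof -
   have "(\<integral>x. (?d j x)\<^sup>2 \<partial>\<L>) = ?I ?k" for j
    using simil_integral(2)[OF simil_translate[of "real j *\<^sub>R ?k"], of "\<lambda>x. (u (x + ?k) - u x)\<^sup>2"]
     borel_measurable_integrable[OF int[of ?k 0]]
    by (simp only: of_nat_Suc scaleR_add_left scaleR_one add.assoc add.commute[of 1] add_0_right scaleR_one power_one div_by_1)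
   then show ?thesis by simp
  qed
  also have "\<dots> = (real ?n)\<^sup>2 * ?I ?k" by (simp add: power2_eq_square del: of_nat_Suc)
  also have "\<dots> = (\<integral>x. (real (Suc m) * (u (x + ?k) - u x))\<^sup>2 \<partial>\<L>)"
   unfolding power_mult_distrib by simp
  finally show ?thesis .
 qed
 obtain M R where MR: "M \<ge> 0" "\<And>n x. \<bar>real (Suc n) * (u (x + (1 / Suc n) *\<^sub>R h) - u x)\<bar> <= M * indicator (ball 0 R) x"
  using difference_quotient(2)[OF u, of h] by blast
 note [measurable] = test_fun_measurable[OF u] grad_measurable[OF test_fun_smooth[OF u]]
 have fT[measurable]: "(\<lambda>x. u (x + a)) \<in> \<M>" for a
  by (rule simil_measurable_comp[OF simil_translate]) simp
 have lim: "(\<lambda>m. \<integral>x. (real (Suc m) * (u (x + (1 / Suc m) *\<^sub>R h) - u x))\<^sup>2 \<partial>\<L>) \<longlonglongrightarrow> (\<integral>x. (grad u x \<bullet> h)\<^sup>2 \<partial>\<L>)"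
 proof (rule integral_dominated_convergence[where w="\<lambda>x. M\<^sup>2 * indicator (ball 0 R) x"])
  show "AE x in \<L>. norm ((real (Suc m) * (u (x + (1 / Suc m) *\<^sub>R h) - u x))\<^sup>2) <= M\<^sup>2 * indicator (ball 0 R) x" for m
  proof (rule AE_I2)
   fix x
   have "\<bar>real (Suc m) * (u (x + (1 / Suc m) *\<^sub>R h) - u x)\<bar>\<^sup>2 <= (M * indicator (ball 0 R) x)\<^sup>2"
    using MR(2)[of m x] by (intro power_mono) auto
   then show "norm ((real (Suc m) * (u (x + (1 / Suc m) *\<^sub>R h) - u x))\<^sup>2) <= M\<^sup>2 * indicator (ball 0 R) x"
    by (cases "x \<in> ball 0 R") (simp_all add: power_mult_distrib del: of_nat_Suc)
  qed
  show "AE x in \<L>. (\<lambda>m. (real (Suc m) * (u (x + (1 / Suc m) *\<^sub>R h) - u x))\<^sup>2) \<longlonglongrightarrow> (grad u x \<bullet> h)\<^sup>2"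
   by (intro AE_I2 tendsto_power difference_quotient(1) u)
 qed (auto simp del: of_nat_Suc intro!: borel_measurable_inner borel_measurable_power)
 have "?I h <= (\<integral>x. (grad u x \<bullet> h)\<^sup>2 \<partial>\<L>)"
  by (rule LIMSEQ_le_const[OF lim]) (use step in blast)
 also have "\<dots> <= (\<integral>x. (norm h)\<^sup>2 * (norm (grad u x))\<^sup>2 \<partial>\<L>)"
 proof (rule integral_mono')
  show "integrable \<L> (\<lambda>x. (norm h)\<^sup>2 * (norm (grad u x))\<^sup>2)" using D12_sq_test(2)[OF u] by simp
  fix x
  have "\<bar>grad u x \<bullet> h\<bar>\<^sup>2 <= (norm (grad u x) * norm h)\<^sup>2" by (intro power_mono Cauchy_Schwarz_ineq2) auto
  then show "(grad u x \<bullet> h)\<^sup>2 <= (norm h)\<^sup>2 * (norm (grad u x))\<^sup>2" by (simp add: power_mult_distrib mult.commute)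
 qed simp
 also have "\<dots> = (norm h)\<^sup>2 * D12_sq u" by (simp add: D12_sq_test(3)[OF u])
 finally have "?I h <= (norm h)\<^sup>2 * D12_sq u" .
 moreover have "(\<integral>\<^sup>+x. ennreal ((u (x + h) - u x)\<^sup>2) \<partial>\<L>) = ennreal (?I h)"
  using int[of h 0] by (subst nn_integral_eq_integral) auto
 ultimately show ?thesis by (simp add: ennreal_leI)
qed

lemma incr_le_const:
 fixes u :: "real^'n::finite => real"
 assumes u: "test_fun u" and r: "r \<ge> 0"
  and C: "\<And>h. norm h < r ==> (\<integral>\<^sup>+x. ennreal ((u (x + h) - u x)\<^sup>2) \<partial>\<L>) <= ennreal C"
 shows "incr u r <= ennreal (unit_ball_vol (real CARD('n)) * r ^ CARD('n)) * ennreal C"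
proof -
 have "incr u r <= (\<integral>\<^sup>+h. indicator (ball (0::real^'n) r) h * ennreal C \<partial>\<L>)"
  unfolding incr_eq_translates[OF u] by (intro nn_integral_mono) (auto simp: indicator_def intro!: C)
 also have "\<dots> = emeasure \<L> (ball (0::real^'n) r) * ennreal C"
  by (subst nn_integral_multc) auto
 finally show ?thesis unfolding emeasure_ball_leb[OF r] .
qed

lemma incr_le_D12:
 fixes u :: "real^'n::finite => real"
 assumes u: "test_fun u" and r: "r \<ge> 0"
 shows "incr u r <= ennreal (unit_ball_vol (real CARD('n)) * r ^ (CARD('n) + 2) * D12_sq u)"
proof -
 have "incr u r <= ennreal (unit_ball_vol (real CARD('n)) * r ^ CARD('n)) * ennreal (r\<^sup>2 * D12_sq u)"
  by (rule incr_le_const[OF u r], rule order_trans[OF translate_diff_le[OF u]])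
   (auto intro!: ennreal_leI mult_right_mono power_mono)
 also have "\<dots> = ennreal (unit_ball_vol (real CARD('n)) * r ^ (CARD('n) + 2) * D12_sq u)"
  using r by (simp add: ennreal_mult[symmetric] power_add mult_ac power2_eq_square)
 finally show ?thesis .
qed

text \<open>At large radii the Dirichlet bound grows too fast. The L^2 norm, finite for a test
  function, gives growth r^N only.\<close>

lemma incr_le_L2:
 fixes u :: "real^'n::finite => real"
 assumes u: "test_fun u"
 obtains K where "K \<ge> 0" "\<And>r. r \<ge> 0 ==> incr u r <= ennreal (K * r ^ CARD('n))"
proof -
 let ?K = "4 * (\<integral>x. (u x)\<^sup>2 \<partial>\<L>)"
 have K: "(\<integral>\<^sup>+x. ennreal ((u (x + h) - u x)\<^sup>2) \<partial>\<L>) <= ennreal ?K" for h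
 proof -
  have i: "integrable \<L> (\<lambda>x. (u (x + h))\<^sup>2)" "integrable \<L> (\<lambda>x. (u x)\<^sup>2)" "integrable \<L> (\<lambda>x. (u (x + h) - u x)\<^sup>2)"
   by (intro test_fun_integrable test_fun_power2 test_fun_translate test_fun_diff u)+
  have "(u (x + h) - u x)\<^sup>2 <= 2 * (u (x + h))\<^sup>2 + 2 * (u x)\<^sup>2" for x
   using zero_le_power2[of "u (x + h) + u x"] by (simp add: power2_sum power2_diff)
  then have "(\<integral>x. (u (x + h) - u x)\<^sup>2 \<partial>\<L>) <= (\<integral>x. 2 * (u (x + h))\<^sup>2 + 2 * (u x)\<^sup>2 \<partial>\<L>)"
   using i by (intro integral_mono) auto
  also have "\<dots> = ?K"
   using i simil_integral(2)[OF simil_translate[of h], of "\<lambda>x. (u x)\<^sup>2"] by simp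
  finally show ?thesis using i(3) by (subst nn_integral_eq_integral) (auto intro: ennreal_leI)
 qed
 show thesis
 proof (rule that[of "unit_ball_vol (real CARD('n)) * ?K"])
  fix r :: real assume r: "r \<ge> 0"
  have "incr u r <= ennreal (unit_ball_vol (real CARD('n)) * r ^ CARD('n)) * ennreal ?K"
   by (rule incr_le_const[OF u r]) (rule K)
  also have "\<dots> = ennreal (unit_ball_vol (real CARD('n)) * ?K * r ^ CARD('n))"
   using r by (simp add: ennreal_mult[symmetric] mult_ac)
  finally show "incr u r <= ennreal (unit_ball_vol (real CARD('n)) * ?K * r ^ CARD('n))" .
 qed simp
qed

section \<open>Dyadic shells and finite energy of test functions\<close>

lemma dyadic_small:
 assumes "0 < d" "d < (1::real)" obtains n where "(1/2)^(Suc n) <= d" "d < (1/2)^n"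
proof -
 obtain m where m: "(1/2)^m < d" using real_arch_pow_inv[of d "1/2"] assms by auto
 define k where "k = (LEAST k. (1/2)^k <= d)"
 have k: "(1/2)^k <= d" unfolding k_def by (rule LeastI[of _ m]) (use m in simp)
 have "k \<noteq> 0" using k assms by (cases k) auto
 then obtain n where n: "k = Suc n" by (cases k) auto
 have "\<not> (1/2)^n <= d" using not_less_Least[of n "\<lambda>k. (1/2)^k <= d"] n by (simp add: k_def)
 then show thesis using that[of n] k n by auto
qed

lemma dyadic_large:
 assumes "1 <= (d::real)" obtains n where "2^n <= d" "d < 2^(Suc n)"
proof -
 obtain m where m: "d < 2^m" using real_arch_pow[of 2 d] by auto
 define k where "k = (LEAST k. d < 2^k)"
 have k: "d < 2^k" unfolding k_def by (rule LeastI[of _ m]) (use m in simp)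
 have "k \<noteq> 0" using k assms by (cases k) auto
 then obtain n where n: "k = Suc n" by (cases k) auto
 have "\<not> d < 2^n" using not_less_Least[of n "\<lambda>k. d < 2^k"] n by (simp add: k_def)
 then show thesis using that[of n] k n by auto
qed

lemma ennreal_term_le_suminf: "f n <= (\<Sum>n. f n :: ennreal)"
 using sum_le_suminf[of f "{n}"] by simp

lemma suminf_geometric_finite:
 assumes "0 <= C" "0 <= q" "q < 1" shows "(\<Sum>n. ennreal (C * q ^ n)) = ennreal (C / (1 - q))"
proof -
 have "(\<lambda>n. C * q ^ n) sums (C * (1 / (1 - q)))" using assms by (intro sums_mult geometric_sums) auto
 then show ?thesis using assms by (subst suminf_ennreal_eq) auto
qed

text \<open>\<open>g\<close> is the factor gained by the kernel when the distance is halved. In each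
  shell the kernel is estimated at the inner radius and the increments at the outer one, which
  explains the two offsets \<open>Suc n\<close>.\<close>

lemma Ds2_enn_dyadic:
 fixes u :: "real^'n::finite => real"
 assumes s: "0 < s" and [measurable]: "u \<in> \<M>"
 defines "g \<equiv> 2 powr (real CARD('n) + 2 * s)"
 shows "Ds2_enn s u <= (\<Sum>n. ennreal (g ^ Suc n) * incr u ((1/2) ^ n)) + (\<Sum>n. ennreal ((1/g) ^ n) * incr u (2 ^ Suc n))"
proof -
 let ?g = "real CARD('n) + 2 * s"
 let ?t = "\<lambda>r z. ennreal ((u (fst z) - u (snd z))\<^sup>2) * indicator {z. dist (fst z) (snd z) < r} z"
 have pw: "(2 ^ n) powr ?g = g ^ n" for n :: nat
  by (simp add: g_def powr_realpow[symmetric] powr_powr mult.commute)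
 have pw2: "((1/2) ^ n) powr ?g = (1/g) ^ n" for n :: nat
  using pw[of n] by (simp add: power_one_over powr_divide)
 have g0: "g > 0" by (simp add: g_def)
 have pt: "ennreal ((norm (fdiff s u z))\<^sup>2) <= (\<Sum>n. ennreal (g ^ Suc n) * ?t ((1/2) ^ n) z) + (\<Sum>n. ennreal ((1/g) ^ n) * ?t (2 ^ Suc n) z)" for z
 proof -
  let ?d = "dist (fst z) (snd z)"
  consider "?d = 0" | "0 < ?d" "?d < 1" | "1 <= ?d" by (metis dist_pos_lt dist_self linorder_not_less)
  then show ?thesis
  proof cases
   case 1 then show ?thesis by (simp add: fdiff_def)
  next
   case 2
   then obtain n where n: "(1/2)^(Suc n) <= ?d" "?d < (1/2)^n" using dyadic_small by blast
   have "(1/g) ^ Suc n <= ?d powr ?g" unfolding pw2[symmetric] using n s by (intro powr_mono2) auto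
   then have "(u (fst z) - u (snd z))\<^sup>2 / ?d powr ?g <= (u (fst z) - u (snd z))\<^sup>2 / (1/g) ^ Suc n"
    using g0 2 by (intro divide_left_mono mult_pos_pos) auto
   also have "\<dots> = g ^ Suc n * (u (fst z) - u (snd z))\<^sup>2" using g0 by (simp add: power_one_over field_simps)
   finally have "ennreal ((norm (fdiff s u z))\<^sup>2) <= ennreal (g ^ Suc n) * ?t ((1/2) ^ n) z"
    using n g0 by (simp add: fdiff_sq ennreal_mult[symmetric] del: power_Suc)
   also have "\<dots> <= (\<Sum>n. ennreal (g ^ Suc n) * ?t ((1/2) ^ n) z)" by (rule ennreal_term_le_suminf)
   finally show ?thesis by (rule order_trans) simp
  next
   case 3
   then obtain n where n: "2^n <= ?d" "?d < 2^(Suc n)" using dyadic_large by blast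
   have "g ^ n <= ?d powr ?g" unfolding pw[symmetric] using n s by (intro powr_mono2) auto
   then have "(u (fst z) - u (snd z))\<^sup>2 / ?d powr ?g <= (u (fst z) - u (snd z))\<^sup>2 / g ^ n"
    using zero_less_power[OF g0, of n] 3 by (intro divide_left_mono mult_pos_pos) auto
   also have "\<dots> = (1/g) ^ n * (u (fst z) - u (snd z))\<^sup>2" using g0 by (simp add: power_one_over field_simps)
   finally have "ennreal ((norm (fdiff s u z))\<^sup>2) <= ennreal ((1/g) ^ n) * ?t (2 ^ Suc n) z"
    using n g0 by (simp add: fdiff_sq ennreal_mult[symmetric] del: power_Suc)
   also have "\<dots> <= (\<Sum>n. ennreal ((1/g) ^ n) * ?t (2 ^ Suc n) z)" by (rule ennreal_term_le_suminf)
   finally show ?thesis by (rule order_trans) simp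
  qed
 qed
 have tm: "?t r \<in> borel_measurable \<L>\<^sub>2" for r
  by (intro borel_measurable_times_ennreal incr_measurable borel_measurable_indicator dist_set_measurable') measurable
 have S: "(\<integral>\<^sup>+z. (\<Sum>n. ennreal (c n) * ?t (r n) z) \<partial>\<L>\<^sub>2) = (\<Sum>n. ennreal (c n) * incr u (r n))" for c r :: "nat => real"
 proof -
  have "(\<integral>\<^sup>+z. (\<Sum>n. ennreal (c n) * ?t (r n) z) \<partial>\<L>\<^sub>2) = (\<Sum>n. (\<integral>\<^sup>+z. ennreal (c n) * ?t (r n) z \<partial>\<L>\<^sub>2))"
   by (rule nn_integral_suminf) (intro borel_measurable_times_ennreal borel_measurable_const tm)
  also have "\<dots> = (\<Sum>n. ennreal (c n) * incr u (r n))"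
   unfolding incr_def by (intro suminf_cong nn_integral_cmult tm)
  finally show ?thesis .
 qed
 have "Ds2_enn s u <= (\<integral>\<^sup>+z. (\<Sum>n. ennreal (g ^ Suc n) * ?t ((1/2) ^ n) z) + (\<Sum>n. ennreal ((1/g) ^ n) * ?t (2 ^ Suc n) z) \<partial>\<L>\<^sub>2)"
  unfolding Ds2_enn_fdiff by (intro nn_integral_mono pt)
 also have "\<dots> = (\<integral>\<^sup>+z. (\<Sum>n. ennreal (g ^ Suc n) * ?t ((1/2) ^ n) z) \<partial>\<L>\<^sub>2) + (\<integral>\<^sup>+z. (\<Sum>n. ennreal ((1/g) ^ n) * ?t (2 ^ Suc n) z) \<partial>\<L>\<^sub>2)"
  by (rule nn_integral_add) (intro borel_measurable_suminf_order borel_measurable_times_ennreal borel_measurable_const tm)+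
 also have "\<dots> = (\<Sum>n. ennreal (g ^ Suc n) * incr u ((1/2) ^ n)) + (\<Sum>n. ennreal ((1/g) ^ n) * incr u (2 ^ Suc n))"
  by (simp only: S)
 finally show ?thesis .
qed

lemma power_commute_exp: "(a ^ n) ^ k = (a ^ k) ^ n" for a :: real
 by (metis mult.commute power_mult)

text \<open>Small shells use the Dirichlet bound and give a geometric series of ratio 2^(2s-2);
  large shells use the L^2 bound and give ratio 2^(-2s). The two conditions on \<open>s\<close> are
  exactly what makes these smaller than 1.\<close>

lemma fin_E_test:
 fixes u :: "real^'n::finite => real"
 assumes s: "0 < s" "s < 1" and u: "test_fun u" shows "fin_E s u"
proof -
 note [measurable] = test_fun_measurable[OF u]
 define g where "g = 2 powr (real CARD('n) + 2 * s)"
 let ?N = "CARD('n)" and ?v = "unit_ball_vol (real CARD('n))"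
 have g0: "g > 0" by (simp add: g_def)
 obtain K where K: "K \<ge> 0" "\<And>r. r \<ge> 0 ==> incr u r <= ennreal (K * r ^ ?N)" using incr_le_L2[OF u] by metis
 have q1: "g * (1/2) ^ (?N + 2) < 1"
 proof -
  have "(1/2::real) ^ k = 2 powr (- real k)" for k
   by (simp add: powr_minus_divide powr_realpow power_one_over)
  then have "g * (1/2) ^ (?N + 2) = 2 powr (real ?N + 2 * s) * 2 powr (- real (?N + 2))"
   by (simp only: g_def)
  also have "\<dots> = 2 powr (2 * s - 2)" unfolding powr_add[symmetric] by simp
  also have "\<dots> < 2 powr 0" using s by (intro powr_less_mono) auto
  finally show ?thesis by simp
 qed
 have q2: "(1/g) * 2 ^ ?N < 1"
 proof -
  have "(1/g) * 2 ^ ?N = 2 powr (- (real ?N + 2 * s)) * 2 powr (real ?N)"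
   by (simp only: g_def powr_minus powr_realpow zero_less_numeral divide_inverse mult_1_left)
  also have "\<dots> = 2 powr (- 2 * s)" unfolding powr_add[symmetric] by simp
  also have "\<dots> < 2 powr 0" using s by (intro powr_less_mono) auto
  finally show ?thesis by simp
 qed
 have "Ds2_enn s u <= (\<Sum>n. ennreal (g ^ Suc n) * incr u ((1/2) ^ n)) + (\<Sum>n. ennreal ((1/g) ^ n) * incr u (2 ^ Suc n))"
  using Ds2_enn_dyadic[OF s(1), of u] by (simp add: g_def)
 also have "\<dots> <= (\<Sum>n. ennreal (g * ?v * D12_sq u * (g * (1/2) ^ (?N + 2)) ^ n)) + (\<Sum>n. ennreal (K * 2 ^ ?N * ((1/g) * 2 ^ ?N) ^ n))"
 proof (intro add_mono suminf_le summableI)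
  fix n
  have "ennreal (g ^ Suc n) * incr u ((1/2) ^ n) <= ennreal (g ^ Suc n) * ennreal (?v * ((1/2)^n) ^ (?N + 2) * D12_sq u)"
   by (intro mult_left_mono incr_le_D12 u) auto
  also have "\<dots> = ennreal (g * ?v * D12_sq u * (g * (1/2) ^ (?N + 2)) ^ n)"
  proof -
   have "g ^ Suc n * (?v * ((1/2)^n) ^ (?N + 2) * D12_sq u) = g * ?v * D12_sq u * (g * (1/2) ^ (?N + 2)) ^ n"
    by (simp only: power_commute_exp[of "1/2" n] power_mult_distrib power_Suc mult_ac)
   then show ?thesis using g0 by (subst ennreal_mult[symmetric]) auto
  qed
  finally show "ennreal (g ^ Suc n) * incr u ((1/2) ^ n) <= ennreal (g * ?v * D12_sq u * (g * (1/2) ^ (?N + 2)) ^ n)" .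
  have "ennreal ((1/g) ^ n) * incr u (2 ^ Suc n) <= ennreal ((1/g) ^ n) * ennreal (K * (2 ^ Suc n) ^ ?N)"
   by (intro mult_left_mono K) auto
  also have "\<dots> = ennreal (K * 2 ^ ?N * ((1/g) * 2 ^ ?N) ^ n)"
  proof -
   have "(1/g) ^ n * (K * (2 ^ Suc n) ^ ?N) = K * 2 ^ ?N * ((1/g) * 2 ^ ?N) ^ n"
    by (simp only: power_commute_exp[of 2 n] power_mult_distrib power_Suc mult_ac)
   then show ?thesis using g0 K by (subst ennreal_mult[symmetric]) auto
  qed
  finally show "ennreal ((1/g) ^ n) * incr u (2 ^ Suc n) <= ennreal (K * 2 ^ ?N * ((1/g) * 2 ^ ?N) ^ n)" .
 qed
 also have "\<dots> < \<infinity>"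
  using g0 K q1 q2 by (subst (1 2) suminf_geometric_finite) (auto simp: less_top)
 finally show ?thesis
  unfolding fin_E_def using weak_grad_test[OF u] D12_sq_test(1)[OF u] by auto
qed

section \<open>Level sets of test functions and weak-type bounds\<close>

lemma level_set_measurable [measurable]:
 "u \<in> \<M> ==> {x. t < \<bar>u x :: real\<bar>} \<in> sets (\<L> :: (real^'n::finite) measure)"
proof -
 assume [measurable]: "u \<in> \<M>"
 have "{x \<in> space \<L>. t < \<bar>u x\<bar>} \<in> sets \<L>" by measurable
 then show ?thesis by simp
qed

lemma level_set_finite:
 fixes u :: "real^'n::finite => real"
 assumes u: "test_fun u" and t: "t \<ge> 0"
 shows "emeasure \<L> {x. t < \<bar>u x\<bar>} = ennreal (measure \<L> {x. t < \<bar>u x\<bar>})"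
proof -
 obtain R where R: "\<And>x. norm x \<ge> R ==> u x = 0" using test_fun_support[OF u] by metis
 have "{x. t < \<bar>u x\<bar>} \<subseteq> ball 0 R" using R t by (force simp: not_le[symmetric])
 then have "emeasure \<L> {x. t < \<bar>u x\<bar>} <= emeasure \<L> (ball (0::real^'n) R)"
  by (intro emeasure_mono) auto
 then have "emeasure \<L> {x. t < \<bar>u x\<bar>} < \<infinity>" using finite_ball order_le_less_trans by blast
 then show ?thesis by (simp add: emeasure_eq_ennreal_measure)
qed

text \<open>A point where \<open>\<bar>u\<bar> > 2 t\<close> sees, in a ball of volume \<open>2 |{\<bar>u\<bar> > t}|\<close>, a set of measure at
 least \<open>|{\<bar>u\<bar> > t}|\<close> on which \<open>u\<close> differs by at least \<open>t\<close>.\<close>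

lemma weak_type_step:
 fixes u :: "real^'n::finite => real"
 assumes u: "test_fun u" and t: "t > 0" and S: "S \<ge> 0" and \<tau>: "\<tau> > 0"
  and W: "\<And>r. r > 0 ==> incr u r <= ennreal (S * r powr (real CARD('n) + 2 * \<tau>))"
 shows "measure \<L> {x. 2 * t < \<bar>u x\<bar>} * t\<^sup>2 \<le>
  S * (2 / unit_ball_vol (real CARD('n))) powr (1 + 2 * \<tau> / real CARD('n)) * measure \<L> {x. t < \<bar>u x\<bar>} powr (2 * \<tau> / real CARD('n))"
proof -
 let ?N = "real CARD('n)" and ?v = "unit_ball_vol (real CARD('n))"
 let ?A = "{x. t < \<bar>u x\<bar>}" and ?B = "{x. 2 * t < \<bar>u x\<bar>}"
 let ?a = "measure \<L> ?A" and ?b = "measure \<L> ?B"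
 note [measurable] = test_fun_measurable[OF u]
 have eA: "emeasure \<L> ?A = ennreal ?a" using level_set_finite[OF u] t by simp
 have eB: "emeasure \<L> ?B = ennreal ?b" using level_set_finite[OF u, of "2 * t"] t by simp
 have "emeasure \<L> ?B <= emeasure \<L> ?A" using t by (intro emeasure_mono) auto
 then have ba: "?b <= ?a" unfolding eA eB by simp
 have v: "?v > 0" by simp
 have vn: "?v \<noteq> 0" using v by (rule less_imp_neq[symmetric])
 have N: "?N > 0" by simp
 show ?thesis
 proof (cases "?a = 0")
  case True
  then have "?b = 0" using ba measure_nonneg[of \<L> ?B] by linarith
  then show ?thesis using S by simp
 next
  case False
  then have a: "?a > 0" using measure_nonneg[of \<L> ?A] by linarith
  define r where "r = (2 * ?a / ?v) powr (1 / ?N)"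
  have r: "r > 0" using a vn by (simp add: r_def)
  have rN: "?v * r ^ CARD('n) = 2 * ?a"
  proof -
   have "r ^ CARD('n) = r powr ?N" using r by (simp add: powr_realpow)
   also have "\<dots> = 2 * ?a / ?v" using a v by (simp add: r_def powr_powr)
   finally have e: "r ^ CARD('n) = 2 * ?a / ?v" .
   show ?thesis unfolding e using nonzero_mult_div_cancel_left[OF vn, of "2 * ?a"] by (simp only: times_divide_eq_right)
  qed
  let ?F = "\<lambda>z. ennreal ((u (fst z) - u (snd z))\<^sup>2) * indicator {z. dist (fst z) (snd z) < r} z"
  have Fm: "?F \<in> borel_measurable \<L>\<^sub>2"
   by (intro borel_measurable_times_ennreal incr_measurable borel_measurable_indicator dist_set_measurable') measurable
  have "ennreal (t\<^sup>2 * ?a) * ennreal ?b = (\<integral>\<^sup>+x. ennreal (t\<^sup>2 * ?a) * indicator ?B x \<partial>\<L>)"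
   by (subst nn_integral_cmult_indicator) (auto simp: eB)
  also have "\<dots> <= (\<integral>\<^sup>+x. \<integral>\<^sup>+y. ?F (x, y) \<partial>\<L> \<partial>\<L>)"
  proof (rule nn_integral_mono)
   fix x
   show "ennreal (t\<^sup>2 * ?a) * indicator ?B x <= (\<integral>\<^sup>+y. ?F (x, y) \<partial>\<L>)"
   proof (cases "x \<in> ?B")
    case True
    have "ennreal (2 * ?a) = emeasure \<L> (ball x r)"
     using emeasure_ball_leb[of r x] r by (simp add: rN)
    also have "\<dots> <= emeasure \<L> ((ball x r - ?A) \<union> ?A)" by (intro emeasure_mono) auto
    also have "\<dots> <= emeasure \<L> (ball x r - ?A) + ennreal ?a"
     unfolding eA[symmetric] by (intro emeasure_subadditive) auto
    finally have "ennreal (2 * ?a) - ennreal ?a <= emeasure \<L> (ball x r - ?A)"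
     by (simp add: ennreal_minus_le_iff add.commute)
    then have "ennreal ?a <= emeasure \<L> (ball x r - ?A)"
     by (simp add: ennreal_minus)
    then have "ennreal (t\<^sup>2) * ennreal ?a <= ennreal (t\<^sup>2) * emeasure \<L> (ball x r - ?A)"
     by (rule mult_left_mono) simp
    also have "\<dots> = (\<integral>\<^sup>+y. ennreal (t\<^sup>2) * indicator (ball x r - ?A) y \<partial>\<L>)"
     by (subst nn_integral_cmult_indicator) auto
    also have "\<dots> <= (\<integral>\<^sup>+y. ?F (x, y) \<partial>\<L>)"
    proof (rule nn_integral_mono)
     fix y
     have "t\<^sup>2 <= (u x - u y)\<^sup>2" if "y \<notin> ?A"
     proof -
      have "t <= \<bar>u x - u y\<bar>" using that True by auto
      then have "t\<^sup>2 <= \<bar>u x - u y\<bar>\<^sup>2" using t by (intro power_mono) auto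
      then show ?thesis by simp
     qed
     then show "ennreal (t\<^sup>2) * indicator (ball x r - ?A) y <= ?F (x, y)"
      by (auto simp: indicator_def intro!: ennreal_leI)
    qed
    finally show ?thesis using True by (simp add: ennreal_mult)
   qed simp
  qed
  also have "\<dots> = incr u r" unfolding incr_def by (rule leb.nn_integral_fst[OF Fm])
  also have "\<dots> <= ennreal (S * r powr (?N + 2 * \<tau>))" using W[OF r] .
  finally have "t\<^sup>2 * ?a * ?b <= S * r powr (?N + 2 * \<tau>)"
   using S by (simp add: ennreal_mult[symmetric])
  also have "r powr (?N + 2 * \<tau>) = (2 / ?v) powr (1 + 2 * \<tau> / ?N) * (?a * ?a powr (2 * \<tau> / ?N))"
  proof -
   have "r powr (?N + 2 * \<tau>) = ((2 / ?v) * ?a) powr (1 + 2 * \<tau> / ?N)"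
    using N by (simp add: r_def powr_powr add_divide_distrib)
   also have "\<dots> = (2 / ?v) powr (1 + 2 * \<tau> / ?N) * ?a powr (1 + 2 * \<tau> / ?N)"
    using a v by (intro powr_mult)
   finally show ?thesis using a by (simp add: powr_add)
  qed
  finally have "?a * (?b * t\<^sup>2) <= ?a * (S * (2 / ?v) powr (1 + 2 * \<tau> / ?N) * ?a powr (2 * \<tau> / ?N))"
   by (simp add: mult_ac)
  then show ?thesis using a by (simp only: mult_le_cancel_left_pos)
 qed
qed

text \<open>Multiplied by t^q, the estimate of one level by half that level reads M <= K M^\<theta>
  for the supremum M of t^q |{|u| > t}|, because q \<theta> = q - 2; since \<theta> < 1 this bounds
  M. \<open>q\<close> is the critical exponent of order \<tau>.\<close>

lemma weak_type:
 fixes u :: "real^'n::finite => real"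
 assumes u: "test_fun u" and t: "t > 0" and S: "S \<ge> 0" and \<tau>: "\<tau> > 0" "2 * \<tau> < real CARD('n)"
  and W: "\<And>r. r > 0 ==> incr u r <= ennreal (S * r powr (real CARD('n) + 2 * \<tau>))"
 defines "q \<equiv> 2 * real CARD('n) / (real CARD('n) - 2 * \<tau>)" and "\<theta> \<equiv> 2 * \<tau> / real CARD('n)"
 shows "measure \<L> {x. t < \<bar>u x\<bar>} \<le>
  (2 powr q * (S * (2 / unit_ball_vol (real CARD('n))) powr (1 + \<theta>))) powr (1 / (1 - \<theta>)) * t powr (- q)"
proof -
 let ?a = "\<lambda>t. measure \<L> {x. t < \<bar>u x\<bar>}"
 let ?f = "\<lambda>t. t powr q * ?a t"
 define K where "K = 2 powr q * (S * (2 / unit_ball_vol (real CARD('n))) powr (1 + \<theta>))"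
 have K: "K \<ge> 0" using S by (simp add: K_def)
 have \<theta>: "0 < \<theta>" "\<theta> < 1" using \<tau> by (simp_all add: \<theta>_def)
 have q: "q > 0" using \<tau> by (simp add: q_def)
 have q\<theta>: "q * \<theta> = q - 2" using \<tau> by (simp add: q_def \<theta>_def field_simps)
 obtain U where U: "U > 0" "\<And>x. \<bar>u x\<bar> <= U" using test_fun_bounded[OF u] by metis
 note [measurable] = test_fun_measurable[OF u]
 have am: "?a t <= ?a 0" if "t \<ge> 0" for t
 proof -
  have "emeasure \<L> {x. t < \<bar>u x\<bar>} <= emeasure \<L> {x. 0 < \<bar>u x\<bar>}"
   using that by (intro emeasure_mono level_set_measurable test_fun_measurable[OF u]) auto
  then show ?thesis using level_set_finite[OF u, of t] level_set_finite[OF u, of 0] that by simp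
 qed
 \<comment> \<open>The inequality M <= K M^\<theta> is informative only for finite M; finiteness
   comes from bounded values and bounded support.\<close>
 have fb: "?f t <= U powr q * ?a 0" if t: "t > 0" for t
 proof (cases "t <= U")
  case True
  then show ?thesis using t q am[of t] by (intro mult_mono powr_mono2) auto
 next
  case False
  then have "{x. t < \<bar>u x\<bar>} = {}" using U(2) by (force simp: not_less intro: order_trans)
  then show ?thesis by simp
 qed
 define M where "M = (SUP t\<in>{0<..}. ?f t)"
 have bdd: "bdd_above (?f ` {0<..})" using fb by (auto intro!: bdd_aboveI2)
 have fM: "?f t <= M" if "t > 0" for t unfolding M_def using that by (intro cSUP_upper bdd) auto
 have M0: "M \<ge> 0" using order_trans[OF _ fM[of 1]] by simp
 have step: "?f (2 * t) <= K * M powr \<theta>" if t: "t > 0" for t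
 proof -
  have "?a (2 * t) * t\<^sup>2 <= S * (2 / unit_ball_vol (real CARD('n))) powr (1 + \<theta>) * ?a t powr \<theta>"
   using weak_type_step[OF u t S \<tau>(1) W] by (simp add: \<theta>_def)
  then have "2 powr q * (t powr (q - 2) * (?a (2 * t) * t\<^sup>2)) <= 2 powr q * (t powr (q - 2) * (S * (2 / unit_ball_vol (real CARD('n))) powr (1 + \<theta>) * ?a t powr \<theta>))"
   by (intro mult_left_mono) auto
  also have "\<dots> = K * (t powr (q - 2) * ?a t powr \<theta>)" by (simp add: K_def mult_ac)
  also have "t powr (q - 2) * ?a t powr \<theta> = ?f t powr \<theta>"
   using t by (simp add: powr_mult powr_powr q\<theta>)
  also have "K * ?f t powr \<theta> <= K * M powr \<theta>"
   using K \<theta> fM[OF t] by (intro mult_left_mono powr_mono2) auto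
  also have "2 powr q * (t powr (q - 2) * (?a (2 * t) * t\<^sup>2)) = ?f (2 * t)"
  proof -
   have "t powr (q - 2) * t\<^sup>2 = t powr q" using t by (simp add: powr_diff powr_numeral)
   then show ?thesis using t by (simp add: powr_mult mult_ac)
  qed
  finally show ?thesis .
 qed
 have MK: "M <= K * M powr \<theta>" unfolding M_def[of]
 proof (rule cSUP_least)
  fix t :: real assume "t \<in> {0<..}"
  then show "?f t <= K * (SUP t\<in>{0<..}. ?f t) powr \<theta>" using step[of "t/2"] by (simp add: M_def)
 qed simp
 have "M <= K powr (1 / (1 - \<theta>))"
 proof (cases "M = 0")
  case False
  then have M: "M > 0" using M0 by simp
  have "M powr (1 - \<theta>) <= K" using MK M by (simp add: powr_diff pos_divide_le_eq)
  then have "(M powr (1 - \<theta>)) powr (1 / (1 - \<theta>)) <= K powr (1 / (1 - \<theta>))"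
   using \<theta> by (intro powr_mono2) auto
  then show ?thesis using M \<theta> by (simp add: powr_powr)
 qed simp
 then have "t powr q * ?a t <= K powr (1 / (1 - \<theta>))" using fM[OF t] by simp
 then have "t powr (- q) * (t powr q * ?a t) <= t powr (- q) * K powr (1 / (1 - \<theta>))" by (intro mult_left_mono) auto
 moreover have "t powr (- q) * (t powr q * ?a t) = ?a t" using t by (simp add: mult.assoc[symmetric] powr_add[symmetric])
 ultimately show ?thesis unfolding K_def by (simp add: mult.commute)
qed

section \<open>Exponents and uniform tail estimates between the critical exponents\<close>

locale GN_setting =
 fixes s p N :: real and ty :: "'n::finite itself"
 assumes N_def: "N = real CARD('n)" and N3: "3 <= N" and s0: "0 < s" and s1: "s < 1"
  and p_lo: "2 * N / (N - 2 * s) < p" and p_hi: "p < 2 * N / (N - 2)"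
begin

text \<open>Half the exponents of the inequality, because the seminorms will enter squared:
  \<open>al\<close> for the fractional seminorm, \<open>be\<close> for the Dirichlet
  seminorm.\<close>

definition "al = (2*N - p*(N-2)) / (4*(1-s))"
definition "be = (p*(N-2 * s) - 2*N) / (4*(1-s))"

text \<open>Positivity expresses that p lies strictly between the critical exponents, the sum is
  homogeneity under multiples, and the last identity is invariance under dilations; it returns later
  as the Pohozaev identity.\<close>

lemma exponents: "0 < al" "0 < be" "al + be = p / 2" "2 < p" "(N - 2) * be + (N - 2 * s) * al = N"
proof -
 have d: "N - 2 * s > 0" "N - 2 > 0" "1 - s > 0" using N3 s0 s1 by linarith+
 have h: "2 * N < p * (N - 2 * s)" "p * (N - 2) < 2 * N"
  using p_lo p_hi d by (simp_all add: pos_divide_less_eq pos_less_divide_eq)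
 show "0 < al" "0 < be" using h d by (simp_all add: al_def be_def)
 have "al + be = ((2 * p) * (1 - s)) / (4 * (1 - s))"
  unfolding al_def be_def add_divide_distrib[symmetric] by (simp add: algebra_simps)
 moreover have "((2 * p) * (1 - s)) / (4 * (1 - s)) = p / 2"
  using d by (subst mult_divide_mult_cancel_right) auto
 ultimately show "al + be = p / 2" by simp
 have "(N - 2) * be + (N - 2 * s) * al = ((4 * N) * (1 - s)) / (4 * (1 - s))"
  unfolding al_def be_def times_divide_eq_right add_divide_distrib[symmetric] by (simp add: algebra_simps)
 moreover have "((4 * N) * (1 - s)) / (4 * (1 - s)) = N"
  using d by (subst mult_divide_mult_cancel_right) auto
 ultimately show "(N - 2) * be + (N - 2 * s) * al = N" by simp
 have "2 * (N - 2 * s) < p * (N - 2 * s)" using h(1) s0 by (simp add: algebra_simps)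
 then show "2 < p" using d(1) by (simp only: mult_less_cancel_right_pos)
qed

abbreviation "q1 \<equiv> 2 * N / (N - 2 * s)"
abbreviation "q2 \<equiv> 2 * N / (N - 2)"

text \<open>\<open>K1\<close> and \<open>K2\<close> are the constants of \<open>weak_type\<close>
  for \<tau> = s with S = 1 and for \<tau> = 1 with S the volume of the unit ball.\<close>

definition "K1 = (2 powr q1 * (1 * (2 / unit_ball_vol N) powr (1 + 2 * s / N))) powr (1 / (1 - 2 * s / N))"
definition "K2 = (2 powr q2 * (unit_ball_vol N * (2 / unit_ball_vol N) powr (1 + 2 / N))) powr (1 / (1 - 2 / N))"

lemma incr_bounds:
 fixes u :: "real^'n => real"
 assumes u: "test_fun u" and r: "r > 0"
 shows "incr u r <= ennreal (Ds2_sq s u * r powr (N + 2 * s))"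
  "incr u r <= ennreal (unit_ball_vol N * D12_sq u * r powr (N + 2 * 1))"
proof -
 have f: "fin_E s u" using fin_E_test[OF s0 s1 u] .
 show "incr u r <= ennreal (Ds2_sq s u * r powr (N + 2 * s))"
  using incr_le_Ds2[OF s0 test_fun_measurable[OF u], of r] r
  by (simp add: N_def Ds2_enn_ennreal[OF f] ennreal_mult[symmetric] mult.commute)
 have "r ^ (CARD('n) + 2) = r powr (N + 2 * 1)" using r by (simp add: N_def powr_add powr_realpow power_add power2_eq_square)
 then show "incr u r <= ennreal (unit_ball_vol N * D12_sq u * r powr (N + 2 * 1))"
  using incr_le_D12[OF u, of r] r by (simp add: N_def mult_ac)
qed

lemma level_bounds:
 fixes u :: "real^'n => real"
 assumes u: "test_fun u" and A: "D12_sq u <= 1" and B: "Ds2_sq s u <= 1" and t: "t > 0"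
 shows "measure \<L> {x. t < \<bar>u x\<bar>} <= K1 * t powr (- q1)"
  "measure \<L> {x. t < \<bar>u x\<bar>} <= K2 * t powr (- q2)"
proof -
 have v: "0 < unit_ball_vol N" using N3 by simp
 have "incr u r <= ennreal (1 * r powr (real CARD('n) + 2 * s))" if "r > 0" for r
  using B by (intro order_trans[OF incr_bounds(1)[OF u that]] ennreal_leI) (simp add: N_def mult_left_le_one_le)
 from weak_type[OF u t _ s0 _ this] show "measure \<L> {x. t < \<bar>u x\<bar>} <= K1 * t powr (- q1)"
  using N3 s1 by (simp add: K1_def[unfolded N_def] N_def)
 have "incr u r <= ennreal (unit_ball_vol N * r powr (real CARD('n) + 2 * 1))" if "r > 0" for r
  using A v by (intro order_trans[OF incr_bounds(2)[OF u that]] ennreal_leI)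
   (simp add: N_def mult_right_mono mult_left_le)
 from weak_type[OF u t _ _ _ this] show "measure \<L> {x. t < \<bar>u x\<bar>} <= K2 * t powr (- q2)"
  using N3 v by (simp add: K2_def[unfolded N_def] N_def)
qed

text \<open>Values of |u| from 2^m upwards are summed with the weak bound of exponent
  \<open>q2\<close>, values below 2^-m with that of exponent \<open>q1\<close>; p < q2 and q1 < p
  make the ratios \<rho> and \<sigma> smaller than 1. The middle range contributes at most 2^(pm)
  per unit of measure. \<epsilon> is the same for all u.\<close>

lemma tail_estimate:
 obtains \<epsilon> :: "nat => real" where "\<epsilon> \<longlonglongrightarrow> 0" "\<And>m. 0 <= \<epsilon> m"
  "\<And>(u :: real^'n => real) m. test_fun u ==> D12_sq u <= 1 ==> Ds2_sq s u <= 1 ==>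
   Lp_enn p u <= ennreal (\<epsilon> m) + ennreal ((2 powr p) ^ m) * emeasure \<L> {x. (1/2) ^ Suc m < \<bar>u x\<bar>}"
proof -
 define g where "g = 2 powr p"
 define \<rho> where "\<rho> = 2 powr (p - q2)"
 define \<sigma> where "\<sigma> = 2 powr (q1 - p)"
 define C2 where "C2 = g * K2 * 2 powr q2"
 define C1 where "C1 = K1 * (2 powr q1)\<^sup>2"
 have g: "g > 0" by (simp add: g_def)
 have \<rho>: "0 < \<rho>" "\<rho> < 1" unfolding \<rho>_def using p_hi powr_less_mono[of "p - q2" 0 2] by auto
 have \<sigma>: "0 < \<sigma>" "\<sigma> < 1" unfolding \<sigma>_def using p_lo powr_less_mono[of "q1 - p" 0 2] by auto
 have K: "0 <= K1" "0 <= K2" by (simp_all add: K1_def K2_def)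
 have C: "0 <= C1" "0 <= C2" using K g by (simp_all add: C1_def C2_def)
 have pw: "(2 ^ k) powr x = (2 powr x) ^ k" for k :: nat and x :: real
  by (simp add: powr_realpow[symmetric] powr_powr mult.commute)
 have pw2: "((1/2) ^ k) powr x = (1 / 2 powr x) ^ k" for k :: nat and x :: real
  using pw[of k x] by (simp add: power_one_over powr_divide)
 define \<epsilon> where "\<epsilon> m = C2 * \<rho> ^ m / (1 - \<rho>) + C1 * \<sigma> ^ m / (1 - \<sigma>)" for m
 have "\<epsilon> \<longlonglongrightarrow> C2 * 0 / (1 - \<rho>) + C1 * 0 / (1 - \<sigma>)"
  unfolding \<epsilon>_def[abs_def] using \<rho> \<sigma> by (intro tendsto_intros LIMSEQ_realpow_zero) auto
 moreover have "0 <= \<epsilon> m" for m unfolding \<epsilon>_def using \<rho> \<sigma> C by (intro add_nonneg_nonneg divide_nonneg_nonneg mult_nonneg_nonneg) auto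
 moreover have "Lp_enn p u <= ennreal (\<epsilon> m) + ennreal ((2 powr p) ^ m) * emeasure \<L> {x. (1/2) ^ Suc m < \<bar>u x\<bar>}"
  if u: "test_fun u" and A: "D12_sq u <= 1" and B: "Ds2_sq s u <= 1" for u :: "real^'n => real" and m
 proof -
  note [measurable] = test_fun_measurable[OF u]
  let ?L = "\<lambda>t. {x. t < \<bar>u x\<bar>}"
  \<comment> \<open>Upper, lower and middle shells. Each threshold is half the lower end of its
    shell, which secures the strict inequality in the level sets.\<close>
  let ?X = "\<lambda>x. \<Sum>n. ennreal (g ^ Suc (n + m)) * indicator (?L (2 ^ (n + m) / 2)) x"
  let ?Y = "\<lambda>x. \<Sum>n. ennreal ((1/g) ^ (n + m)) * indicator (?L ((1/2) ^ (n + m + 2))) x"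
  let ?Z = "\<lambda>x. ennreal (g ^ m) * indicator (?L ((1/2) ^ Suc m)) x"
  have pt: "ennreal (\<bar>u x\<bar> powr p) <= ?X x + ?Y x + ?Z x" for x
  proof -
   let ?w = "\<bar>u x\<bar>"
   consider "?w = 0" | "0 < ?w" "?w * 2 ^ m < 1" | "1 <= ?w * 2 ^ m" "?w < 2 ^ m" | "1 <= ?w / 2 ^ m"
    by (metis abs_ge_zero divide_le_eq_1 le_divide_eq_1_pos linorder_not_less not_less_iff_gr_or_eq zero_less_numeral zero_less_power)
   then show ?thesis
   proof cases
    case 1 then show ?thesis by simp
   next
    case 2
    then obtain n where n: "(1/2)^(Suc n) <= ?w * 2 ^ m" "?w * 2 ^ m < (1/2)^n"
     using dyadic_small[of "?w * 2 ^ m"] by (metis mult_pos_pos zero_less_numeral zero_less_power)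
    have h: "(1/2) ^ (n + m + 2) < ?w" "?w <= (1/2) ^ (n + m)"
    proof -
     have "(1/2)^(Suc n) * (1/2) ^ m <= ?w * 2 ^ m * (1/2) ^ m" using n by (intro mult_right_mono) auto
     then have "(1/2)^(Suc n + m) <= ?w" by (simp add: power_add power_one_over)
     moreover have "(1/2::real) ^ (n + m + 2) < (1/2)^(Suc n + m)" by (intro power_strict_decreasing) auto
     ultimately show "(1/2) ^ (n + m + 2) < ?w" by linarith
     have "?w * 2 ^ m * (1/2) ^ m <= (1/2) ^ n * (1/2) ^ m" using n by (intro mult_right_mono) auto
     then show "?w <= (1/2) ^ (n + m)" by (simp add: power_add power_one_over)
    qed
    have "?w powr p <= ((1/2) ^ (n + m)) powr p" using h exponents(4) by (intro powr_mono2) auto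
    then have "ennreal (?w powr p) <= ennreal ((1/g) ^ (n + m)) * indicator (?L ((1/2) ^ (n + m + 2))) x"
     using h unfolding pw2 g_def by (simp add: ennreal_leI)
    also have "\<dots> <= ?Y x" by (rule ennreal_term_le_suminf)
    finally show ?thesis by (rule order_trans) (simp add: add_increasing add_increasing2)
   next
    case 3
    then have "?w powr p <= (2 ^ m) powr p" using exponents(4) by (intro powr_mono2) auto
    moreover have "(1/2) ^ Suc m < ?w"
    proof -
     have "1 * (1/2) ^ m <= ?w * 2 ^ m * (1/2) ^ m" using 3 by (intro mult_right_mono) auto
     then have "(1/2) ^ m <= ?w" by (simp add: power_one_over)
     moreover have "(1/2::real) ^ Suc m < (1/2) ^ m" by (intro power_strict_decreasing) auto
     ultimately show ?thesis by linarith
    qed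
    ultimately have "ennreal (?w powr p) <= ?Z x" unfolding pw g_def by (simp add: ennreal_leI)
    then show ?thesis by (rule order_trans) (simp add: add_increasing add_increasing2)
   next
    case 4
    then obtain n where n: "2^n <= ?w / 2 ^ m" "?w / 2 ^ m < 2 ^ Suc n" using dyadic_large by blast
    then have h: "2 ^ (n + m) <= ?w" "?w <= 2 ^ Suc (n + m)" by (simp_all add: power_add field_simps)
    have "?w powr p <= (2 ^ Suc (n + m)) powr p" using h exponents(4) by (intro powr_mono2) auto
    moreover have "2 ^ (n + m) / 2 < ?w" using h(1) zero_less_power[of "2::real" "n + m"] by linarith
    ultimately have "ennreal (?w powr p) <= ennreal (g ^ Suc (n + m)) * indicator (?L (2 ^ (n + m) / 2)) x"
     unfolding pw g_def by (simp add: ennreal_leI del: power_Suc)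
    also have "\<dots> <= ?X x" by (rule ennreal_term_le_suminf)
    finally show ?thesis by (rule order_trans) (simp add: add_increasing add_increasing2)
   qed
  qed
  have lm: "?L t \<in> sets \<L>" for t by (rule level_set_measurable[OF test_fun_measurable[OF u]])
  have S: "(\<integral>\<^sup>+x. (\<Sum>n. ennreal (c n) * indicator (?L (r n)) x) \<partial>\<L>) = (\<Sum>n. ennreal (c n) * emeasure \<L> (?L (r n)))" for c r :: "nat => real"
  proof -
   have "(\<integral>\<^sup>+x. (\<Sum>n. ennreal (c n) * indicator (?L (r n)) x) \<partial>\<L>) = (\<Sum>n. (\<integral>\<^sup>+x. ennreal (c n) * indicator (?L (r n)) x \<partial>\<L>))"
    by (rule nn_integral_suminf) (intro borel_measurable_times_ennreal borel_measurable_const borel_measurable_indicator lm)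
   also have "\<dots> = (\<Sum>n. ennreal (c n) * emeasure \<L> (?L (r n)))"
    by (intro suminf_cong nn_integral_cmult_indicator lm)
   finally show ?thesis .
  qed
  have Xm: "(\<lambda>x. \<Sum>n. ennreal (c n) * indicator (?L (r n)) x) \<in> \<M>" for c r :: "nat => real"
   by (intro borel_measurable_suminf_order borel_measurable_times_ennreal borel_measurable_const borel_measurable_indicator lm)
  have "Lp_enn p u <= (\<integral>\<^sup>+x. ?X x + ?Y x + ?Z x \<partial>\<L>)" unfolding Lp_enn_def by (intro nn_integral_mono pt)
  also have "\<dots> = (\<Sum>n. ennreal (g ^ Suc (n + m)) * emeasure \<L> (?L (2 ^ (n + m) / 2))) + (\<Sum>n. ennreal ((1/g) ^ (n + m)) * emeasure \<L> (?L ((1/2) ^ (n + m + 2))))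
    + ennreal (g ^ m) * emeasure \<L> (?L ((1/2) ^ Suc m))"
   by (subst nn_integral_add, intro borel_measurable_add Xm, intro borel_measurable_times_ennreal borel_measurable_const borel_measurable_indicator lm,
    subst nn_integral_add, rule Xm, rule Xm, simp only: S nn_integral_cmult_indicator lm)
  also have "\<dots> <= ennreal (C2 * \<rho> ^ m / (1 - \<rho>)) + ennreal (C1 * \<sigma> ^ m / (1 - \<sigma>)) + ennreal (g ^ m) * emeasure \<L> (?L ((1/2) ^ Suc m))"
  proof (intro add_mono order_refl)
   have "(\<Sum>n. ennreal (g ^ Suc (n + m)) * emeasure \<L> (?L (2 ^ (n + m) / 2))) <= (\<Sum>n. ennreal (C2 * \<rho> ^ m * \<rho> ^ n))"
   proof (intro suminf_le summableI)
    fix n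
    let ?k = "n + m"
    have "ennreal (g ^ Suc ?k) * emeasure \<L> (?L (2 ^ ?k / 2)) <= ennreal (g ^ Suc ?k) * ennreal (K2 * (2 ^ ?k / 2) powr (- q2))"
     using level_bounds(2)[OF u A B, of "2 ^ ?k / 2"]
     by (subst level_set_finite[OF u]) (auto intro!: mult_left_mono ennreal_leI)
    also have "\<dots> = ennreal (g ^ Suc ?k * (K2 * (2 ^ ?k / 2) powr (- q2)))"
     using g K by (intro ennreal_mult[symmetric]) auto
    also have "g ^ Suc ?k * (K2 * (2 ^ ?k / 2) powr (- q2)) = C2 * \<rho> ^ m * \<rho> ^ n"
    proof -
     have "(2 ^ ?k / 2) powr (- q2) = (2 powr (- q2)) ^ ?k * 2 powr q2"
      by (simp only: powr_divide zero_le_power zero_le_numeral pw) (simp add: powr_minus divide_inverse)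
     moreover have "\<rho> = g * 2 powr (- q2)" unfolding \<rho>_def g_def powr_add[symmetric] by simp
     ultimately show ?thesis by (simp add: C2_def power_mult_distrib power_add mult_ac)
    qed
    finally show "ennreal (g ^ Suc ?k) * emeasure \<L> (?L (2 ^ ?k / 2)) <= ennreal (C2 * \<rho> ^ m * \<rho> ^ n)" .
   qed
   also have "\<dots> = ennreal (C2 * \<rho> ^ m / (1 - \<rho>))" using \<rho> C by (intro suminf_geometric_finite) auto
   finally show "(\<Sum>n. ennreal (g ^ Suc (n + m)) * emeasure \<L> (?L (2 ^ (n + m) / 2))) <= ennreal (C2 * \<rho> ^ m / (1 - \<rho>))" .
   have "(\<Sum>n. ennreal ((1/g) ^ (n + m)) * emeasure \<L> (?L ((1/2) ^ (n + m + 2)))) <= (\<Sum>n. ennreal (C1 * \<sigma> ^ m * \<sigma> ^ n))"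
   proof (intro suminf_le summableI)
    fix n
    let ?k = "n + m"
    have "ennreal ((1/g) ^ ?k) * emeasure \<L> (?L ((1/2) ^ (?k + 2))) <= ennreal ((1/g) ^ ?k) * ennreal (K1 * ((1/2) ^ (?k + 2)) powr (- q1))"
     using level_bounds(1)[OF u A B, of "(1/2) ^ (?k + 2)"]
     by (subst level_set_finite[OF u]) (auto intro!: mult_left_mono ennreal_leI)
    also have "\<dots> = ennreal ((1/g) ^ ?k * (K1 * ((1/2) ^ (?k + 2)) powr (- q1)))"
     using g K by (intro ennreal_mult[symmetric]) auto
    also have "(1/g) ^ ?k * (K1 * ((1/2) ^ (?k + 2)) powr (- q1)) = C1 * \<sigma> ^ m * \<sigma> ^ n"
    proof -
     have "((1/2) ^ (?k + 2)) powr (- q1) = (2 powr q1) ^ ?k * (2 powr q1)\<^sup>2"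
      unfolding pw2 by (simp add: powr_minus_divide power_add power2_eq_square)
     moreover have "\<sigma> = (1/g) * 2 powr q1" unfolding \<sigma>_def g_def by (simp add: powr_diff)
     ultimately show ?thesis by (simp only: C1_def power_mult_distrib power_add mult_ac)
    qed
    finally show "ennreal ((1/g) ^ ?k) * emeasure \<L> (?L ((1/2) ^ (?k + 2))) <= ennreal (C1 * \<sigma> ^ m * \<sigma> ^ n)" .
   qed
   also have "\<dots> = ennreal (C1 * \<sigma> ^ m / (1 - \<sigma>))" using \<sigma> C by (intro suminf_geometric_finite) auto
   finally show "(\<Sum>n. ennreal ((1/g) ^ (n + m)) * emeasure \<L> (?L ((1/2) ^ (n + m + 2)))) <= ennreal (C1 * \<sigma> ^ m / (1 - \<sigma>))" .
  qed
  also have "ennreal (C2 * \<rho> ^ m / (1 - \<rho>)) + ennreal (C1 * \<sigma> ^ m / (1 - \<sigma>)) = ennreal (\<epsilon> m)"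
   unfolding \<epsilon>_def using \<rho> \<sigma> C by (intro ennreal_plus[symmetric]) auto
  finally show ?thesis by (simp add: g_def)
 qed
 ultimately show thesis using that[of \<epsilon>] by simp
qed

end

section \<open>Local convergence and completeness\<close>

text \<open>Balls replace the compact sets of \<open>E_space\<close>, and the nonnegative integral
  avoids any presupposed integrability.\<close>

definition L1c :: "(nat => real^'n::finite => real) => (real^'n => real) => bool" where
 "L1c f u \<longleftrightarrow> (\<forall>R. (\<lambda>k. \<integral>\<^sup>+x. ennreal \<bar>f k x - u x\<bar> * indicator (ball 0 R) x \<partial>\<L>) \<longlonglongrightarrow> 0)"

lemma strict_mono_choice:
 assumes "\<And>k::nat. eventually (P k) sequentially"
 shows "\<exists>r::nat=>nat. strict_mono r \<and> (\<forall>k. P k (r k))"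
proof -
 have "\<exists>r. \<forall>k. P k (r k) \<and> r k < r (Suc k)"
 proof (rule dependent_nat_choice)
  show "\<exists>x. P 0 x" using assms[of 0] by (auto simp: eventually_sequentially)
  fix x n
  obtain m where "\<forall>y\<ge>m. P (Suc n) y" using assms[of "Suc n"] by (auto simp: eventually_sequentially)
  then show "\<exists>y. P (Suc n) y \<and> x < y" by (intro exI[of _ "max m (Suc x)"]) auto
 qed
 then show ?thesis by (metis strict_mono_Suc_iff)
qed

lemma Fatou_bound:
 fixes f :: "nat => 'a => ennreal"
 assumes [measurable]: "\<And>k. f k \<in> borel_measurable M"
  and lim: "AE x in M. (\<lambda>k. f k x) \<longlonglongrightarrow> g x" and le: "\<forall>\<^sub>F k in sequentially. (\<integral>\<^sup>+x. f k x \<partial>M) <= c"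
 shows "(\<integral>\<^sup>+x. g x \<partial>M) <= c"
proof -
 have "(\<integral>\<^sup>+x. g x \<partial>M) = (\<integral>\<^sup>+x. liminf (\<lambda>k. f k x) \<partial>M)"
  using lim by (intro nn_integral_cong_AE) (auto elim!: eventually_mono simp: lim_imp_Liminf)
 also have "\<dots> <= liminf (\<lambda>k. \<integral>\<^sup>+x. f k x \<partial>M)" by (rule nn_integral_liminf) measurable
 also have "\<dots> <= c"
 proof -
  have "liminf (\<lambda>k. \<integral>\<^sup>+x. f k x \<partial>M) <= limsup (\<lambda>k. \<integral>\<^sup>+x. f k x \<partial>M)" by (rule Liminf_le_Limsup) simp
  also have "\<dots> <= c" using le by (rule Limsup_bounded)
  finally show ?thesis .
 qed
 finally show ?thesis .
qed

text \<open>The truncated norms have integrals with finite sum, hence are summable almost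
  everywhere; a given point lies in all balls of radius \<open>k\<close> from some index on, where
  truncation has no effect.\<close>

lemma AE_summable_fast:
 fixes d :: "nat => real^'n::finite => 'b::{second_countable_topology, real_normed_vector}"
 assumes [measurable]: "\<And>k. d k \<in> \<M>"
  and le: "\<And>k. (\<integral>\<^sup>+x. ennreal (norm (d k x)) * indicator (ball 0 (real k)) x \<partial>\<L>) <= ennreal ((1/2)^k)"
 shows "AE x in \<L>. summable (\<lambda>k. norm (d k x))"
proof -
 let ?g = "\<lambda>k x. ennreal (norm (d k x)) * indicator (ball (0::real^'n) (real k)) x"
 have "(\<integral>\<^sup>+x. (\<Sum>k. ?g k x) \<partial>\<L>) = (\<Sum>k. \<integral>\<^sup>+x. ?g k x \<partial>\<L>)"
  by (rule nn_integral_suminf) measurable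
 also have "\<dots> <= (\<Sum>k. ennreal (1 * (1/2)^k))" using le by (intro suminf_le summableI) auto
 also have "\<dots> < \<infinity>" by (subst suminf_geometric_finite) auto
 finally have "AE x in \<L>. (\<Sum>k. ?g k x) \<noteq> \<infinity>" by (intro nn_integral_PInf_AE) (auto simp: less_top)
 then show ?thesis
 proof eventually_elim
  case (elim x)
  obtain K where K: "norm x < real K" using reals_Archimedean2 by blast
  have "?g k x = ennreal (norm (d k x) * indicator (ball 0 (real k)) x)" for k by (simp add: indicator_def)
  then have "summable (\<lambda>k. norm (d k x) * indicator (ball 0 (real k)) x)"
   using elim by (intro summable_suminf_not_top) (auto simp: top_ennreal_def[symmetric])
  moreover have "\<forall>\<^sub>F k in sequentially. norm (d k x) * indicator (ball 0 (real k)) x = norm (d k x)"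
   using eventually_ge_at_top[of K] by eventually_elim (use K in \<open>auto simp: indicator_def\<close>)
  ultimately show ?case by (subst (asm) summable_cong) auto
 qed
qed

lemma L1c_D:
 assumes "L1c f u" "e > 0"
 shows "\<forall>\<^sub>F k in sequentially. (\<integral>\<^sup>+x. ennreal \<bar>f k x - u x\<bar> * indicator (ball 0 R) x \<partial>\<L>) <= ennreal e"
proof -
 have "\<forall>\<^sub>F k in sequentially. (\<integral>\<^sup>+x. ennreal \<bar>f k x - u x\<bar> * indicator (ball 0 R) x \<partial>\<L>) < ennreal e"
  using assms by (intro order_tendstoD(2)[of _ 0]) (auto simp: L1c_def)
 then show ?thesis by eventually_elim simp
qed

lemma L1cI:
 assumes "\<And>R e. e > 0 ==> \<forall>\<^sub>F k in sequentially. (\<integral>\<^sup>+x. ennreal \<bar>f k x - u x\<bar> * indicator (ball 0 R) x \<partial>\<L>) <= ennreal e"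
 shows "L1c f u"
 unfolding L1c_def
proof (intro allI order_tendstoI)
 fix R a assume "(0::ennreal) < a"
 then obtain e where e: "e > 0" "ennreal e < a"
 proof (cases a)
  case (real b)
  then show ?thesis using \<open>0 < a\<close> by (intro that[of "b / 2"]) (auto simp: ennreal_less_iff)
 next
  case top
  then show ?thesis by (intro that[of 1]) auto
 qed
 show "\<forall>\<^sub>F k in sequentially. (\<integral>\<^sup>+x. ennreal \<bar>f k x - u x\<bar> * indicator (ball 0 R) x \<partial>\<L>) < a"
  using assms[OF e(1)] by eventually_elim (use e in \<open>auto intro: le_less_trans\<close>)
qed simp

lemma L1c_AE_subseq:
 assumes [measurable]: "\<And>k. f k \<in> \<M>" "u \<in> \<M>" and c: "L1c f u"
 shows "\<exists>r. strict_mono r \<and> (AE x in \<L>. (\<lambda>k. f (r k) x) \<longlonglongrightarrow> u x)"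
proof -
 have "\<exists>r. strict_mono r \<and> (\<forall>k. (\<integral>\<^sup>+x. ennreal \<bar>f (r k) x - u x\<bar> * indicator (ball 0 (real k)) x \<partial>\<L>) <= ennreal ((1/2)^k))"
  by (rule strict_mono_choice) (rule L1c_D[OF c], simp)
 then obtain r where r: "strict_mono r" "\<And>k. (\<integral>\<^sup>+x. ennreal \<bar>f (r k) x - u x\<bar> * indicator (ball 0 (real k)) x \<partial>\<L>) <= ennreal ((1/2)^k)"
  by blast
 have "AE x in \<L>. summable (\<lambda>k. norm (f (r k) x - u x))"
 proof (rule AE_summable_fast)
  show "(\<integral>\<^sup>+x. ennreal (norm (f (r k) x - u x)) * indicator (ball 0 (real k)) x \<partial>\<L>) <= ennreal ((1/2)^k)" for k
   using r(2)[of k] by simp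
 qed measurable
 then have "AE x in \<L>. (\<lambda>k. f (r k) x) \<longlonglongrightarrow> u x"
 proof eventually_elim
  case (elim x)
  show ?case by (rule LIM_zero_cancel[OF summable_LIMSEQ_zero[OF summable_norm_cancel[OF elim]]])
 qed
 then show ?thesis using r(1) by blast
qed

lemma L1c_subseq: "L1c f u ==> strict_mono r ==> L1c (\<lambda>k. f (r k)) u"
 unfolding L1c_def
proof
 fix R assume "\<forall>R. (\<lambda>k. \<integral>\<^sup>+x. ennreal \<bar>f k x - u x\<bar> * indicator (ball 0 R) x \<partial>\<L>) \<longlonglongrightarrow> 0" and r: "strict_mono r"
 from LIMSEQ_subseq_LIMSEQ[OF this(1)[rule_format, of R] r]
 show "(\<lambda>k. \<integral>\<^sup>+x. ennreal \<bar>f (r k) x - u x\<bar> * indicator (ball 0 R) x \<partial>\<L>) \<longlonglongrightarrow> 0" by (simp add: o_def)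
qed

lemma Cauchy_AE_subseq:
 fixes f :: "nat => real^'n::finite => 'b::{second_countable_topology, banach}"
 assumes [measurable]: "\<And>k. f k \<in> \<M>"
  and c: "\<And>R e. e > 0 ==> \<exists>n0. \<forall>m\<ge>n0. \<forall>n\<ge>n0. (\<integral>\<^sup>+x. ennreal (norm (f m x - f n x)) * indicator (ball 0 R) x \<partial>\<L>) <= ennreal e"
 shows "\<exists>r g. strict_mono r \<and> g \<in> \<M> \<and> (AE x in \<L>. (\<lambda>k. f (r k) x) \<longlonglongrightarrow> g x)"
proof -
 have "\<forall>\<^sub>F n in sequentially. \<forall>m\<ge>n. (\<integral>\<^sup>+x. ennreal (norm (f m x - f n x)) * indicator (ball 0 (real k)) x \<partial>\<L>) <= ennreal ((1/2)^k)" for k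
  using c[of "(1/2)^k" "real k"] by (auto simp: eventually_sequentially) (meson order_trans)
 then have "\<exists>r. strict_mono r \<and> (\<forall>k. \<forall>m\<ge>r k. (\<integral>\<^sup>+x. ennreal (norm (f m x - f (r k) x)) * indicator (ball 0 (real k)) x \<partial>\<L>) <= ennreal ((1/2)^k))"
  by (rule strict_mono_choice)
 then obtain r where r: "strict_mono r" "\<And>k m. m \<ge> r k ==> (\<integral>\<^sup>+x. ennreal (norm (f m x - f (r k) x)) * indicator (ball 0 (real k)) x \<partial>\<L>) <= ennreal ((1/2)^k)"
  by blast
 have "AE x in \<L>. summable (\<lambda>k. norm (f (r (Suc k)) x - f (r k) x))"
  by (rule AE_summable_fast) (use r in \<open>auto simp: strict_mono_def less_imp_le\<close>)
 then have "AE x in \<L>. (\<lambda>k. f (r k) x) \<longlonglongrightarrow> lim (\<lambda>k. f (r k) x)"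
 proof eventually_elim
  case (elim x)
  then have "summable (\<lambda>k. f (r (Suc k)) x - f (r k) x)" by (rule summable_norm_cancel)
  then have "convergent (\<lambda>n. \<Sum>k<n. f (r (Suc k)) x - f (r k) x)" by (simp add: summable_iff_convergent)
  then have "convergent (\<lambda>n. f (r n) x - f (r 0) x)" by (simp add: sum_lessThan_telescope[of "\<lambda>k. f (r k) x"])
  then have "convergent (\<lambda>n. (f (r n) x - f (r 0) x) + f (r 0) x)" by (intro convergent_add convergent_const)
  then show ?case by (simp add: convergent_LIMSEQ_iff)
 qed
 moreover have "(\<lambda>x. lim (\<lambda>k. f (r k) x)) \<in> \<M>"
  by (rule borel_measurable_lim_metric) measurable
 ultimately show ?thesis using r(1) by blast
qed

text \<open>Integrates |f| <= \<delta> + |f|^2 / \<delta>. The free \<delta> makes the volume term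
  small before the L^2 distance is.\<close>

lemma L1_le_L2_ball:
 fixes f :: "real^'n::finite => 'b::{second_countable_topology, real_normed_vector}"
 assumes [measurable]: "f \<in> \<M>" and \<delta>: "\<delta> > 0"
 shows "(\<integral>\<^sup>+x. ennreal (norm (f x)) * indicator (ball 0 R) x \<partial>\<L>) \<le>
  ennreal \<delta> * emeasure \<L> (ball (0::real^'n) R) + ennreal (1/\<delta>) * (\<integral>\<^sup>+x. ennreal ((norm (f x))\<^sup>2) \<partial>\<L>)"
proof -
 have "norm (f x) <= \<delta> + (1/\<delta>) * (norm (f x))\<^sup>2" for x
 proof (cases "norm (f x) <= \<delta>")
  case True
  have "0 <= (1/\<delta>) * (norm (f x))\<^sup>2" using \<delta> by simp
  then show ?thesis using True by linarith
 next
  case False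
  then have "norm (f x) * \<delta> <= (norm (f x))\<^sup>2" by (simp add: power2_eq_square mult_left_mono)
  then have "norm (f x) <= (1/\<delta>) * (norm (f x))\<^sup>2" using \<delta> by (simp add: field_simps)
  then show ?thesis using \<delta> by linarith
 qed
 then have "ennreal (norm (f x)) <= ennreal \<delta> + ennreal (1/\<delta>) * ennreal ((norm (f x))\<^sup>2)" for x
  using \<delta> by (simp add: ennreal_mult[symmetric] ennreal_plus[symmetric] del: ennreal_plus)
 then have "(\<integral>\<^sup>+x. ennreal (norm (f x)) * indicator (ball 0 R) x \<partial>\<L>)
  <= (\<integral>\<^sup>+x. ennreal \<delta> * indicator (ball 0 R) x + ennreal (1/\<delta>) * ennreal ((norm (f x))\<^sup>2) \<partial>\<L>)"
  by (intro nn_integral_mono) (auto simp: indicator_def)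
 also have "\<dots> = ennreal \<delta> * emeasure \<L> (ball (0::real^'n) R) + ennreal (1/\<delta>) * (\<integral>\<^sup>+x. ennreal ((norm (f x))\<^sup>2) \<partial>\<L>)"
  by (subst nn_integral_add) (auto simp: nn_integral_cmult nn_integral_cmult_indicator)
 finally show ?thesis .
qed

section \<open>Algebra of the forms and convergence of energies\<close>

lemma fdiff_diff: "fdiff s (\<lambda>x. u x - v x) z = fdiff s u z - fdiff s v z"
 by (simp add: fdiff_def diff_divide_distrib[symmetric] algebra_simps)

lemma fin_E_diff:
 assumes "fin_E s u" "fin_E s v"
 shows "fin_E s (\<lambda>x. u x - v x)"
  "D12_sq (\<lambda>x. u x - v x) = D12_sq u - 2 * D12_form u v + D12_sq v"
  "Ds2_sq s (\<lambda>x. u x - v x) = Ds2_sq s u - 2 * Ds2_form s u v + Ds2_sq s v"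
 using fin_E_lincomb[OF assms, of "-1"] by simp_all

lemma fin_E_add:
 assumes "fin_E s u" "fin_E s v"
 shows "fin_E s (\<lambda>x. u x + v x)"
  "D12_sq (\<lambda>x. u x + v x) = D12_sq u + 2 * D12_form u v + D12_sq v"
  "Ds2_sq s (\<lambda>x. u x + v x) = Ds2_sq s u + 2 * Ds2_form s u v + Ds2_sq s v"
 using fin_E_lincomb[OF assms, of "1"] by simp_all

lemma form_self: "fin_E s u ==> D12_form u u = D12_sq u" "fin_E s u ==> Ds2_form s u u = Ds2_sq s u"
 apply (simp add: D12_form_def D12_sq_eq power2_norm_eq_inner)
 apply (simp add: Ds2_form_def Ds2_sq_eq power2_eq_square)
 done

lemma form_commute: "D12_form u v = D12_form v u" "Ds2_form s u v = Ds2_form s v u"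
 by (simp_all add: D12_form_def Ds2_form_def inner_commute mult.commute)

lemma fin_E_scale:
 assumes u: "fin_E s u"
 shows "fin_E s (\<lambda>x. c * u x)" "D12_sq (\<lambda>x. c * u x) = c\<^sup>2 * D12_sq u" "Ds2_sq s (\<lambda>x. c * u x) = c\<^sup>2 * Ds2_sq s u"
proof -
 have e: "(\<lambda>x. c * u x) = (\<lambda>x. u x + (c - 1) * u x)" by (simp add: algebra_simps)
 show "fin_E s (\<lambda>x. c * u x)" "D12_sq (\<lambda>x. c * u x) = c\<^sup>2 * D12_sq u" "Ds2_sq s (\<lambda>x. c * u x) = c\<^sup>2 * Ds2_sq s u"
  unfolding e using fin_E_lincomb[OF u u, of "c - 1"] by (simp_all add: form_self[OF u] power2_eq_square algebra_simps)
qed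

lemma sqrt_triangle:
 assumes "0 <= a" "0 <= b" "\<bar>c\<bar> <= sqrt a * sqrt b" "0 <= a + 2 * c + b"
 shows "sqrt (a + 2 * c + b) <= sqrt a + sqrt b"
proof (rule real_le_lsqrt)
 have "a + 2 * c + b <= a + 2 * (sqrt a * sqrt b) + b" using assms by simp
 also have "\<dots> = (sqrt a + sqrt b)\<^sup>2" using assms by (simp add: power2_sum)
 finally show "a + 2 * c + b <= (sqrt a + sqrt b)\<^sup>2" .
qed (use assms in auto)

lemma form_triangle:
 assumes u: "fin_E s u" and v: "fin_E s v"
 shows "sqrt (D12_sq (\<lambda>x. u x + v x)) <= sqrt (D12_sq u) + sqrt (D12_sq v)"
  "sqrt (Ds2_sq s (\<lambda>x. u x + v x)) <= sqrt (Ds2_sq s u) + sqrt (Ds2_sq s v)"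
proof -
 show "sqrt (D12_sq (\<lambda>x. u x + v x)) <= sqrt (D12_sq u) + sqrt (D12_sq v)"
  unfolding fin_E_add(2)[OF u v]
  by (rule sqrt_triangle) (use forms_Cauchy_Schwarz(1)[OF u v] fin_E_add(2)[OF u v] D12_sq_nonneg[of "\<lambda>x. u x + v x"] in auto)
 show "sqrt (Ds2_sq s (\<lambda>x. u x + v x)) <= sqrt (Ds2_sq s u) + sqrt (Ds2_sq s v)"
  unfolding fin_E_add(3)[OF u v]
  by (rule sqrt_triangle) (use forms_Cauchy_Schwarz(2)[OF u v] fin_E_add(3)[OF u v] Ds2_sq_nonneg[of s "\<lambda>x. u x + v x"] in auto)
qed

lemma form_tendsto:
 assumes w: "\<And>n. fin_E s (w n)" and u: "fin_E s u"
  and lim: "(\<lambda>n. D12_sq (\<lambda>x. w n x - u x) + Ds2_sq s (\<lambda>x. w n x - u x)) \<longlonglongrightarrow> 0"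
 shows "(\<lambda>n. D12_sq (w n)) \<longlonglongrightarrow> D12_sq u" "(\<lambda>n. Ds2_sq s (w n)) \<longlonglongrightarrow> Ds2_sq s u"
proof -
 have d: "fin_E s (\<lambda>x. w n x - u x)" for n by (rule fin_E_diff(1)[OF w u])
 have d': "fin_E s (\<lambda>x. u x - w n x)" for n by (rule fin_E_diff(1)[OF u w])
 have neg: "D12_sq (\<lambda>x. u x - w n x) = D12_sq (\<lambda>x. w n x - u x)" "Ds2_sq s (\<lambda>x. u x - w n x) = Ds2_sq s (\<lambda>x. w n x - u x)" for n
  unfolding fin_E_diff(2,3)[OF u w[of n]] fin_E_diff(2,3)[OF w[of n] u]
  by (simp_all add: form_commute(1)[where u=u] form_commute(2)[where u=u])
 have z: "(\<lambda>n. sqrt (D12_sq (\<lambda>x. w n x - u x))) \<longlonglongrightarrow> 0" "(\<lambda>n. sqrt (Ds2_sq s (\<lambda>x. w n x - u x))) \<longlonglongrightarrow> 0"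
 proof -
  have "(\<lambda>n. D12_sq (\<lambda>x. w n x - u x)) \<longlonglongrightarrow> 0" "(\<lambda>n. Ds2_sq s (\<lambda>x. w n x - u x)) \<longlonglongrightarrow> 0"
   by (rule tendsto_sandwich[OF _ _ tendsto_const lim]; simp)+
  then show "(\<lambda>n. sqrt (D12_sq (\<lambda>x. w n x - u x))) \<longlonglongrightarrow> 0" "(\<lambda>n. sqrt (Ds2_sq s (\<lambda>x. w n x - u x))) \<longlonglongrightarrow> 0"
   using tendsto_real_sqrt by force+
 qed
 have "\<bar>sqrt (D12_sq (w n)) - sqrt (D12_sq u)\<bar> <= sqrt (D12_sq (\<lambda>x. w n x - u x))" 
  "\<bar>sqrt (Ds2_sq s (w n)) - sqrt (Ds2_sq s u)\<bar> <= sqrt (Ds2_sq s (\<lambda>x. w n x - u x))" for n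
  using form_triangle[OF u d[of n]] form_triangle[OF w[of n] d'[of n]] by (simp_all add: neg)
 then have "(\<lambda>n. sqrt (D12_sq (w n)) - sqrt (D12_sq u)) \<longlonglongrightarrow> 0" "(\<lambda>n. sqrt (Ds2_sq s (w n)) - sqrt (Ds2_sq s u)) \<longlonglongrightarrow> 0"
  by (auto intro: Lim_null_comparison[OF _ z(1)] Lim_null_comparison[OF _ z(2)])
 then have "(\<lambda>n. sqrt (D12_sq (w n))) \<longlonglongrightarrow> sqrt (D12_sq u)" "(\<lambda>n. sqrt (Ds2_sq s (w n))) \<longlonglongrightarrow> sqrt (Ds2_sq s u)"
  by (auto dest: LIM_zero_cancel)
 from this[THEN tendsto_power, of 2] show "(\<lambda>n. D12_sq (w n)) \<longlonglongrightarrow> D12_sq u" "(\<lambda>n. Ds2_sq s (w n)) \<longlonglongrightarrow> Ds2_sq s u"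
  by simp_all
qed

section \<open>Approximating sequences and completeness of the space E\<close>

lemma E_spaceI:
 fixes u :: "real^'n::finite => real"
 assumes s: "0 < s" "s < 1" and u: "fin_E s u" and \<phi>: "\<And>k. test_fun (\<phi> k)"
  and lim: "(\<lambda>k. D12_sq (\<lambda>x. \<phi> k x - u x) + Ds2_sq s (\<lambda>x. \<phi> k x - u x)) \<longlonglongrightarrow> 0" and c: "L1c \<phi> u"
 shows "u \<in> E_space s"
proof -
 have K: "(\<lambda>k. \<integral>\<^sup>+x\<in>K. ennreal \<bar>\<phi> k x - u x\<bar> \<partial>\<L>) \<longlonglongrightarrow> 0" if K: "compact K" for K
 proof -
  obtain R where R: "K \<subseteq> ball 0 R" using bounded_subset_ballD[OF compact_imp_bounded[OF K], of 0] by auto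
  show ?thesis
   by (rule tendsto_sandwich[OF _ _ tendsto_const c[unfolded L1c_def, rule_format, of R]])
    (use R in \<open>auto intro!: always_eventually nn_integral_mono simp: indicator_def\<close>)
 qed
 have "fin_E s (\<lambda>x. \<phi> k x - u x)" for k by (intro fin_E_diff fin_E_test s \<phi> u)
 then show ?thesis unfolding E_space_def mem_Collect_eq using u \<phi> lim K by (auto simp: fin_E_def intro!: exI[of _ \<phi>])
qed

lemma E_spaceD:
 fixes u :: "real^'n::finite => real"
 assumes "u \<in> E_space s"
 obtains \<phi> where "fin_E s u" "\<And>k. test_fun (\<phi> k)"
  "(\<lambda>k. D12_sq (\<lambda>x. \<phi> k x - u x) + Ds2_sq s (\<lambda>x. \<phi> k x - u x)) \<longlonglongrightarrow> 0" "L1c \<phi> u"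
proof -
 obtain \<phi> where \<phi>: "\<And>k. test_fun (\<phi> k)" "(\<lambda>k. D12_sq (\<lambda>x. \<phi> k x - u x) + Ds2_sq s (\<lambda>x. \<phi> k x - u x)) \<longlonglongrightarrow> 0"
  and K: "\<And>K. compact K ==> (\<lambda>k. \<integral>\<^sup>+x\<in>K. ennreal \<bar>\<phi> k x - u x\<bar> \<partial>\<L>) \<longlonglongrightarrow> 0"
  using assms unfolding E_space_def by blast
 have "L1c \<phi> u" unfolding L1c_def
 proof
  fix R
  show "(\<lambda>k. \<integral>\<^sup>+x. ennreal \<bar>\<phi> k x - u x\<bar> * indicator (ball 0 R) x \<partial>\<L>) \<longlonglongrightarrow> 0"
   by (rule tendsto_sandwich[OF _ _ tendsto_const K[OF compact_cball, of 0 R]])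
    (auto intro!: always_eventually nn_integral_mono simp: indicator_def)
 qed
 moreover have "fin_E s u" using assms by (auto simp: E_space_def fin_E_def)
 ultimately show thesis using that \<phi> by blast
qed

lemma L1c_locally_integrable:
 fixes u :: "real^'n::finite => real"
 assumes w: "\<And>n. test_fun (w n)" and u[measurable]: "u \<in> \<M>" and c: "L1c w u"
 shows "integrable \<L> (\<lambda>x. indicator (ball 0 R) x * u x)"
proof -
 note [measurable] = test_fun_measurable[OF w]
 obtain n where n: "(\<integral>\<^sup>+x. ennreal \<bar>w n x - u x\<bar> * indicator (ball 0 R) x \<partial>\<L>) <= ennreal 1"
  using L1c_D[OF c, of 1 R] by (auto simp: eventually_sequentially)
 have "(\<integral>\<^sup>+x. ennreal (norm (indicator (ball 0 R) x * u x)) \<partial>\<L>) <= (\<integral>\<^sup>+x. ennreal \<bar>w n x - u x\<bar> * indicator (ball 0 R) x + ennreal (norm (w n x)) \<partial>\<L>)"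
  by (intro nn_integral_mono) (auto simp: indicator_def ennreal_plus[symmetric] simp del: ennreal_plus intro!: ennreal_leI)
 also have "\<dots> = (\<integral>\<^sup>+x. ennreal \<bar>w n x - u x\<bar> * indicator (ball 0 R) x \<partial>\<L>) + (\<integral>\<^sup>+x. ennreal (norm (w n x)) \<partial>\<L>)"
  by (rule nn_integral_add) measurable
 also have "\<dots> < \<infinity>" using n test_fun_integrable[OF w[of n]] by (auto simp: integrable_iff_bounded intro: le_less_trans)
 finally show ?thesis by (simp add: integrable_iff_bounded)
qed

lemma grad_lincomb:
 assumes f: "smooth f" and g: "smooth g"
 shows "grad (\<lambda>x. f x + c * g x) x = grad f x + c *\<^sub>R grad g x"
proof -
 have z: "partial_d i (\<lambda>x. c) x = 0" for i and x :: "real^'a" by (subst partial_d_eqI[OF has_derivative_const]) simp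
 have "partial_d i (\<lambda>x. c * g x) x = c * partial_d i g x" for i
  using partial_d_mult[of "\<lambda>x. c" x g i] z smooth_differentiable[OF g] by simp
 moreover have "partial_d i (\<lambda>x. f x + c * g x) x = partial_d i f x + partial_d i (\<lambda>x. c * g x) x" for i
  by (rule partial_d_add) (use smooth_differentiable[OF f] smooth_differentiable[OF smooth_mult[OF smooth_const g]] in auto)
 ultimately show ?thesis by (simp add: vec_eq_iff)
qed

text \<open>The gradients are Cauchy in L^2, hence locally in L^1, so a subsequence has an almost
  everywhere limit g; Fatou upgrades this to L^2 convergence of the whole sequence, and g is
  identified as weak gradient by integration by parts. For the fractional part almost everywhere
  convergence of \<open>w\<close> and Fatou on pairs are enough.\<close>

lemma complete_E:
 fixes u :: "real^'n::finite => real"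
 assumes s: "0 < s" "s < 1" and w: "\<And>n. test_fun (w n)" and u[measurable]: "u \<in> \<M>"
  and C: "\<And>e. e > 0 ==> \<exists>n0. \<forall>m\<ge>n0. \<forall>n\<ge>n0. D12_sq (\<lambda>x. w m x - w n x) + Ds2_sq s (\<lambda>x. w m x - w n x) <= e"
  and c: "L1c w u"
 shows "u \<in> E_space s" "fin_E s u" "(\<lambda>n. D12_sq (\<lambda>x. w n x - u x) + Ds2_sq s (\<lambda>x. w n x - u x)) \<longlonglongrightarrow> 0"
proof -
 note wm[measurable] = test_fun_measurable[OF w] and gm[measurable] = grad_measurable[OF test_fun_smooth[OF w]]
 have wE: "fin_E s (w n)" for n by (intro fin_E_test s w)
 have td: "test_fun (\<lambda>x. w m x - w n x)" for m n by (intro test_fun_diff w)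
 have gd: "grad (\<lambda>x. w m x - w n x) x = grad (w m) x - grad (w n) x" for m n x
  using grad_lincomb[OF test_fun_smooth[OF w] test_fun_smooth[OF w], of m "-1" n x] by simp
 have DA: "(\<integral>\<^sup>+x. ennreal ((norm (grad (w m) x - grad (w n) x))\<^sup>2) \<partial>\<L>) = ennreal (D12_sq (\<lambda>x. w m x - w n x))" for m n
  using D12_enn_eq[OF weak_grad_test[OF td[of m n]]] D12_enn_ennreal[OF fin_E_test[OF s td[of m n]]] by (simp add: gd)
 have CA: "\<exists>n0. \<forall>m\<ge>n0. \<forall>n\<ge>n0. D12_sq (\<lambda>x. w m x - w n x) <= e" "\<exists>n0. \<forall>m\<ge>n0. \<forall>n\<ge>n0. Ds2_sq s (\<lambda>x. w m x - w n x) <= e" if e: "e > 0" for e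
 proof -
  obtain n0 where "\<forall>m\<ge>n0. \<forall>n\<ge>n0. D12_sq (\<lambda>x. w m x - w n x) + Ds2_sq s (\<lambda>x. w m x - w n x) <= e" using C[OF e] by blast
  moreover have "D12_sq (\<lambda>x. w m x - w n x) \<ge> 0" "Ds2_sq s (\<lambda>x. w m x - w n x) \<ge> 0" for m n by simp_all
  ultimately show "\<exists>n0. \<forall>m\<ge>n0. \<forall>n\<ge>n0. D12_sq (\<lambda>x. w m x - w n x) <= e" "\<exists>n0. \<forall>m\<ge>n0. \<forall>n\<ge>n0. Ds2_sq s (\<lambda>x. w m x - w n x) <= e"
   by (meson add_increasing add_increasing2 order_trans le_add_same_cancel1 le_add_same_cancel2)+
 qed
 have "\<exists>r g. strict_mono r \<and> g \<in> \<M> \<and> (AE x in \<L>. (\<lambda>k. grad (w (r k)) x) \<longlonglongrightarrow> g x)"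
 proof (rule Cauchy_AE_subseq)
  fix R e :: real assume e: "e > 0"
  define v where "v = unit_ball_vol (real CARD('n)) * \<bar>R\<bar> ^ CARD('n)"
  have v: "v \<ge> 0" by (simp add: v_def)
  \<comment> \<open>Balances \<open>L1_le_L2_ball\<close>: the volume term is at most e/2, and
    energies below \<delta> e/2 make the other term at most e/2.\<close>
  define \<delta> where "\<delta> = e / (2 * (v + 1))"
  have \<delta>: "\<delta> > 0" using e v by (simp add: \<delta>_def)
  have \<delta>v: "\<delta> * v <= e / 2" using e v by (simp add: \<delta>_def field_simps)
  obtain n0 where n0: "\<forall>m\<ge>n0. \<forall>n\<ge>n0. D12_sq (\<lambda>x. w m x - w n x) <= \<delta> * (e / 2)"
   using CA(1)[of "\<delta> * (e/2)"] \<delta> e by auto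
  show "\<exists>n0. \<forall>m\<ge>n0. \<forall>n\<ge>n0. (\<integral>\<^sup>+x. ennreal (norm (grad (w m) x - grad (w n) x)) * indicator (ball 0 R) x \<partial>\<L>) <= ennreal e"
  proof (intro exI allI impI)
   fix m n assume mn: "n0 <= m" "n0 <= n"
   have "(\<integral>\<^sup>+x. ennreal (norm (grad (w m) x - grad (w n) x)) * indicator (ball 0 R) x \<partial>\<L>)
    <= ennreal \<delta> * emeasure \<L> (ball (0::real^'n) R) + ennreal (1/\<delta>) * ennreal (D12_sq (\<lambda>x. w m x - w n x))"
    unfolding DA[symmetric] by (rule L1_le_L2_ball[OF _ \<delta>]) measurable
   also have "\<dots> <= ennreal \<delta> * ennreal v + ennreal (1/\<delta>) * ennreal (\<delta> * (e/2))"
   proof (intro add_mono mult_left_mono ennreal_leI)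
    show "emeasure \<L> (ball (0::real^'n) R) <= ennreal v"
     using emeasure_ball_leb[of "\<bar>R\<bar>" "0::real^'n"] emeasure_mono[OF subset_ball[OF abs_ge_self[of R]], of "0::real^'n" \<L>]
     by (simp add: v_def)
   qed (use n0 mn in auto)
   also have "\<dots> = ennreal (\<delta> * v + e / 2)" using \<delta> v e by (simp add: ennreal_mult[symmetric] ennreal_plus[symmetric] del: ennreal_plus)
   also have "\<dots> <= ennreal e" using \<delta>v by (intro ennreal_leI) simp
   finally show "(\<integral>\<^sup>+x. ennreal (norm (grad (w m) x - grad (w n) x)) * indicator (ball 0 R) x \<partial>\<L>) <= ennreal e" .
  qed
 qed measurable
 then obtain r g where r: "strict_mono r" and g[measurable]: "g \<in> \<M>"
  and gl: "AE x in \<L>. (\<lambda>k. grad (w (r k)) x) \<longlonglongrightarrow> g x" by blast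
 have FA: "\<exists>n0. \<forall>n\<ge>n0. (\<integral>\<^sup>+x. ennreal ((norm (grad (w n) x - g x))\<^sup>2) \<partial>\<L>) <= ennreal e" if e: "e > 0" for e
 proof -
  obtain n0 where n0: "\<forall>m\<ge>n0. \<forall>n\<ge>n0. D12_sq (\<lambda>x. w m x - w n x) <= e" using CA(1)[OF e] by blast
  show ?thesis
  proof (intro exI allI impI)
   fix n assume n: "n0 <= n"
   show "(\<integral>\<^sup>+x. ennreal ((norm (grad (w n) x - g x))\<^sup>2) \<partial>\<L>) <= ennreal e"
   proof (rule Fatou_bound[where f="\<lambda>k x. ennreal ((norm (grad (w n) x - grad (w (r k)) x))\<^sup>2)"])
    show "AE x in \<L>. (\<lambda>k. ennreal ((norm (grad (w n) x - grad (w (r k)) x))\<^sup>2)) \<longlonglongrightarrow> ennreal ((norm (grad (w n) x - g x))\<^sup>2)"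
     using gl by eventually_elim (intro tendsto_ennrealI tendsto_intros)
    show "\<forall>\<^sub>F k in sequentially. (\<integral>\<^sup>+x. ennreal ((norm (grad (w n) x - grad (w (r k)) x))\<^sup>2) \<partial>\<L>) <= ennreal e"
     using eventually_ge_at_top[of n0]
    proof eventually_elim
     case (elim k)
     have "r k \<ge> n0" using seq_suble[OF r, of k] elim by simp
     then show ?case unfolding DA using n0 n by (intro ennreal_leI) auto
    qed
   qed measurable
  qed
 qed
 have gL2: "L2 \<L> (\<lambda>x. grad (w n) x - g x)" if "(\<integral>\<^sup>+x. ennreal ((norm (grad (w n) x - g x))\<^sup>2) \<partial>\<L>) <= ennreal e" for n e
  unfolding L2_iff using that by (auto intro: le_less_trans)
 obtain n1 where n1: "\<forall>n\<ge>n1. (\<integral>\<^sup>+x. ennreal ((norm (grad (w n) x - g x))\<^sup>2) \<partial>\<L>) <= ennreal 1" using FA[of 1] by auto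
 have tL2: "L2 \<L> \<phi>" if \<phi>: "test_fun \<phi>" for \<phi> :: "real^'n => real"
  using test_fun_integrable[OF test_fun_power2[OF \<phi>]] test_fun_measurable[OF \<phi>] by (simp add: L2_def)
 have wgL2: "L2 \<L> (grad (w n))" for n
  using D12_sq_test(2)[OF w[of n]] by (simp add: L2_def)
 have gg: "L2 \<L> g"
  using L2_lincomb[OF wgL2[of n1] gL2[OF n1[rule_format, OF order_refl]], of "-1"] by simp
 have wgu: "weak_grad u g"
  unfolding weak_grad_def
 proof (intro conjI allI impI g)
  fix \<phi> :: "real^'n => real" and i assume \<phi>: "test_fun \<phi>"
  have p\<phi>: "test_fun (partial_d i \<phi>)" by (rule test_fun_partial[OF \<phi>])
  note [measurable] = test_fun_measurable[OF \<phi>] test_fun_measurable[OF p\<phi>]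
  obtain M where M: "M > 0" "\<And>x. \<bar>partial_d i \<phi> x\<bar> <= M" using test_fun_bounded[OF p\<phi>] by metis
  obtain R where R: "R > 0" "\<And>x. norm x \<ge> R ==> partial_d i \<phi> x = 0" using test_fun_support[OF p\<phi>] by metis
  have gi: "L2 \<L> (\<lambda>x. h x $ i)" if "L2 \<L> h" for h :: "real^'n => real^'n"
  proof -
   have [measurable]: "h \<in> \<M>" using that by (simp add: L2_def)
   have i: "integrable \<L> (\<lambda>x. (norm (h x))\<^sup>2)" using that by (simp add: L2_def)
   have "integrable \<L> (\<lambda>x. (norm (h x $ i))\<^sup>2)"
    by (rule Bochner_Integration.integrable_bound[OF i])
     (measurable, auto intro!: AE_I2 abs_le_square_iff[THEN iffD1] component_le_norm_cart)
   then show ?thesis by (simp add: L2_def)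
  qed
  show ui: "integrable \<L> (\<lambda>x. u x * partial_d i \<phi> x)"
  proof (rule Bochner_Integration.integrable_bound)
   show "integrable \<L> (\<lambda>x. (indicator (ball 0 R) x * u x) * M)"
    by (intro integrable_mult_left L1c_locally_integrable[OF w u c])
   show "AE x in \<L>. norm (u x * partial_d i \<phi> x) <= norm ((indicator (ball 0 R) x * u x) * M)"
    using M R by (intro AE_I2) (auto simp: indicator_def abs_mult intro!: mult_left_mono)
  qed measurable
  show gi\<phi>: "integrable \<L> (\<lambda>x. g x $ i * \<phi> x)"
   using L2_inner[OF gi[OF gg] tL2[OF \<phi>]] by simp
  \<comment> \<open>The functions converge only locally in L^1, so this side uses that the
    derivative of \<phi> is bounded with bounded support; the gradient side uses
    Cauchy-Schwarz.\<close>
  have l1: "(\<lambda>n. \<integral>x. w n x * partial_d i \<phi> x \<partial>\<L>) \<longlonglongrightarrow> (\<integral>x. u x * partial_d i \<phi> x \<partial>\<L>)"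
  proof (rule LIM_zero_cancel, rule tendstoI)
   fix e :: real assume e: "e > 0"
   have "\<forall>\<^sub>F n in sequentially. (\<integral>\<^sup>+x. ennreal \<bar>w n x - u x\<bar> * indicator (ball 0 R) x \<partial>\<L>) <= ennreal (e / (2 * M))"
    using e M by (intro L1c_D[OF c]) auto
   then show "\<forall>\<^sub>F n in sequentially. dist ((\<integral>x. w n x * partial_d i \<phi> x \<partial>\<L>) - (\<integral>x. u x * partial_d i \<phi> x \<partial>\<L>)) 0 < e"
   proof eventually_elim
    case (elim n)
    have wi: "integrable \<L> (\<lambda>x. w n x * partial_d i \<phi> x)"
     by (intro test_fun_integrable test_fun_mult test_fun_smooth w p\<phi>)
    have "ennreal (norm (\<integral>x. w n x * partial_d i \<phi> x - u x * partial_d i \<phi> x \<partial>\<L>)) <= (\<integral>\<^sup>+x. norm (w n x * partial_d i \<phi> x - u x * partial_d i \<phi> x) \<partial>\<L>)"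
     by (rule integral_norm_bound_ennreal) (intro Bochner_Integration.integrable_diff wi ui)
    also have "\<dots> <= (\<integral>\<^sup>+x. ennreal M * (ennreal \<bar>w n x - u x\<bar> * indicator (ball 0 R) x) \<partial>\<L>)"
    proof (rule nn_integral_mono)
     fix x
     show "ennreal (norm (w n x * partial_d i \<phi> x - u x * partial_d i \<phi> x)) <= ennreal M * (ennreal \<bar>w n x - u x\<bar> * indicator (ball 0 R) x)"
      using M R(2)[of x] by (cases "norm x < R")
       (auto simp: left_diff_distrib[symmetric] abs_mult ennreal_mult[symmetric] indicator_def mult.commute intro!: ennreal_leI mult_right_mono)
    qed
    also have "\<dots> <= ennreal M * ennreal (e / (2 * M))"
     using elim by (subst nn_integral_cmult) (auto intro!: mult_left_mono)
    also have "\<dots> = ennreal (e / 2)" using M e by (simp add: ennreal_mult[symmetric])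
    finally have "norm (\<integral>x. w n x * partial_d i \<phi> x - u x * partial_d i \<phi> x \<partial>\<L>) <= e / 2" using e by simp
    then show ?case using e wi ui by (simp add: dist_real_def)
   qed
  qed
  have l2: "(\<lambda>n. \<integral>x. grad (w n) x $ i * \<phi> x \<partial>\<L>) \<longlonglongrightarrow> (\<integral>x. g x $ i * \<phi> x \<partial>\<L>)"
  proof (rule LIM_zero_cancel, rule tendstoI)
   fix e :: real assume e: "e > 0"
   define P where "P = sqrt (\<integral>x. (norm (\<phi> x))\<^sup>2 \<partial>\<L>)"
   have P: "P \<ge> 0" by (simp add: P_def)
   obtain n0 where n0: "\<forall>n\<ge>n0. (\<integral>\<^sup>+x. ennreal ((norm (grad (w n) x - g x))\<^sup>2) \<partial>\<L>) <= ennreal ((e / (P + 1))\<^sup>2)"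
    using FA[of "(e / (P + 1))\<^sup>2"] e P by auto
   show "\<forall>\<^sub>F n in sequentially. dist ((\<integral>x. grad (w n) x $ i * \<phi> x \<partial>\<L>) - (\<integral>x. g x $ i * \<phi> x \<partial>\<L>)) 0 < e"
    using eventually_ge_at_top[of n0]
   proof eventually_elim
    case (elim n)
    note L = gL2[OF n0[rule_format, OF elim]]
    have "(\<integral>x. (norm ((grad (w n) x - g x) $ i))\<^sup>2 \<partial>\<L>) <= (\<integral>x. (norm (grad (w n) x - g x))\<^sup>2 \<partial>\<L>)"
     using L gi[OF L] unfolding L2_def
     by (intro integral_mono) (auto intro!: abs_le_square_iff[THEN iffD1] simp: component_le_norm_cart simp del: vector_minus_component)
    also have "\<dots> <= (e / (P + 1))\<^sup>2"
     using n0[rule_format, OF elim] L by (subst (asm) nn_integral_eq_integral) (auto simp: L2_def)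
    finally have "sqrt (\<integral>x. (norm ((grad (w n) x - g x) $ i))\<^sup>2 \<partial>\<L>) <= sqrt ((e / (P + 1))\<^sup>2)" by (rule real_sqrt_le_mono)
    then have q: "sqrt (\<integral>x. (norm ((grad (w n) x - g x) $ i))\<^sup>2 \<partial>\<L>) <= e / (P + 1)" using e P by simp
    have "\<bar>\<integral>x. (grad (w n) x - g x) $ i * \<phi> x \<partial>\<L>\<bar> <= sqrt (\<integral>x. (norm ((grad (w n) x - g x) $ i))\<^sup>2 \<partial>\<L>) * P"
     using L2_Cauchy_Schwarz[OF gi[OF L] tL2[OF \<phi>]] by (simp add: P_def)
    also have "\<dots> <= (e / (P + 1)) * P" using q P by (intro mult_right_mono)
    also have "\<dots> < e" using e P by (simp add: field_simps)
    finally have "\<bar>\<integral>x. (grad (w n) x - g x) $ i * \<phi> x \<partial>\<L>\<bar> < e" .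
    moreover have "integrable \<L> (\<lambda>x. grad (w n) x $ i * \<phi> x)" using L2_inner[OF gi[OF wgL2[of n]] tL2[OF \<phi>]] by simp
    ultimately show ?case using gi\<phi> by (simp add: dist_real_def left_diff_distrib)
   qed
  qed
  have "(\<integral>x. w n x * partial_d i \<phi> x \<partial>\<L>) = - (\<integral>x. grad (w n) x $ i * \<phi> x \<partial>\<L>)" for n
   using weak_grad_test[OF w[of n]] \<phi> by (auto simp: weak_grad_def)
  then have "(\<lambda>n. \<integral>x. w n x * partial_d i \<phi> x \<partial>\<L>) \<longlonglongrightarrow> - (\<integral>x. g x $ i * \<phi> x \<partial>\<L>)"
   using tendsto_minus[OF l2] by simp
  then show "(\<integral>x. u x * partial_d i \<phi> x \<partial>\<L>) = - (\<integral>x. g x $ i * \<phi> x \<partial>\<L>)"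
   using l1 LIMSEQ_unique by blast
 qed
 have wgd: "weak_grad (\<lambda>x. w n x - u x) (\<lambda>x. grad (w n) x - g x)" for n
  using weak_grad_lincomb[OF weak_grad_test[OF w[of n]] wgu, of "-1"] by simp
 have DE: "D12_enn (\<lambda>x. w n x - u x) = (\<integral>\<^sup>+x. ennreal ((norm (grad (w n) x - g x))\<^sup>2) \<partial>\<L>)" for n
  by (rule D12_enn_eq[OF wgd])
 obtain r' where r': "strict_mono r'" "AE x in \<L>. (\<lambda>k. w (r' k) x) \<longlonglongrightarrow> u x"
  using L1c_AE_subseq[OF wm u c] by blast
 have FB: "\<exists>n0. \<forall>n\<ge>n0. Ds2_enn s (\<lambda>x. w n x - u x) <= ennreal e" if e: "e > 0" for e
 proof -
  obtain n0 where n0: "\<forall>m\<ge>n0. \<forall>n\<ge>n0. Ds2_sq s (\<lambda>x. w m x - w n x) <= e" using CA(2)[OF e] by blast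
  show ?thesis
  proof (intro exI allI impI)
   fix n assume n: "n0 <= n"
   show "Ds2_enn s (\<lambda>x. w n x - u x) <= ennreal e"
    unfolding Ds2_enn_fdiff
   proof (rule Fatou_bound[where f="\<lambda>k z. ennreal ((norm (fdiff s (\<lambda>x. w n x - w (r' k) x) z))\<^sup>2)"])
    show "AE z in \<L> \<Otimes>\<^sub>M \<L>. (\<lambda>k. ennreal ((norm (fdiff s (\<lambda>x. w n x - w (r' k) x) z))\<^sup>2)) \<longlonglongrightarrow> ennreal ((norm (fdiff s (\<lambda>x. w n x - u x) z))\<^sup>2)"
     using AE_pair_leb[OF r'(2)]
    proof eventually_elim
     case (elim z)
     then have l: "(\<lambda>k. w (r' k) (fst z)) \<longlonglongrightarrow> u (fst z)" "(\<lambda>k. w (r' k) (snd z)) \<longlonglongrightarrow> u (snd z)" by auto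
     show ?case unfolding fdiff_def divide_inverse by (intro tendsto_ennrealI tendsto_power tendsto_norm tendsto_mult_right tendsto_diff tendsto_const l)
    qed
    show "\<forall>\<^sub>F k in sequentially. (\<integral>\<^sup>+z. ennreal ((norm (fdiff s (\<lambda>x. w n x - w (r' k) x) z))\<^sup>2) \<partial>\<L>\<^sub>2) <= ennreal e"
     using eventually_ge_at_top[of n0]
    proof eventually_elim
     case (elim k)
     have "r' k \<ge> n0" using seq_suble[OF r'(1), of k] elim by simp
     then show ?case unfolding Ds2_enn_fdiff[symmetric] Ds2_enn_ennreal[OF fin_E_test[OF s td]] using n0 n by (intro ennreal_leI) auto
    qed
   qed measurable
  qed
 qed
 obtain n2 where n2: "\<forall>n\<ge>n2. Ds2_enn s (\<lambda>x. w n x - u x) <= ennreal 1" using FB[of 1] by auto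
 let ?m = "max n1 n2"
 \<comment> \<open>\<open>u\<close> is a test function minus this difference, both energies of which
   are at most 1; so its own energies are finite.\<close>
 have f0: "fin_E s (\<lambda>x. w ?m x - u x)"
  unfolding fin_E_def DE using wgd n1[rule_format, of ?m] n2[rule_format, of ?m] by (auto intro: le_less_trans)
 show fu: "fin_E s u" using fin_E_diff(1)[OF wE[of ?m] f0] by simp
 have fd: "fin_E s (\<lambda>x. w n x - u x)" for n by (rule fin_E_diff(1)[OF wE fu])
 show lim: "(\<lambda>n. D12_sq (\<lambda>x. w n x - u x) + Ds2_sq s (\<lambda>x. w n x - u x)) \<longlonglongrightarrow> 0"
 proof (rule tendstoI)
  fix e :: real assume e: "e > 0"
  obtain n3 n4 where n3: "\<forall>n\<ge>n3. (\<integral>\<^sup>+x. ennreal ((norm (grad (w n) x - g x))\<^sup>2) \<partial>\<L>) <= ennreal (e/3)"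
   and n4: "\<forall>n\<ge>n4. Ds2_enn s (\<lambda>x. w n x - u x) <= ennreal (e/3)" using FA[of "e/3"] FB[of "e/3"] e by auto
  show "\<forall>\<^sub>F n in sequentially. dist (D12_sq (\<lambda>x. w n x - u x) + Ds2_sq s (\<lambda>x. w n x - u x)) 0 < e"
   using eventually_ge_at_top[of "max n3 n4"]
  proof eventually_elim
   case (elim n)
   have "D12_sq (\<lambda>x. w n x - u x) <= e/3" using n3 elim e unfolding DE[symmetric] D12_enn_ennreal[OF fd] by simp
   moreover have "Ds2_sq s (\<lambda>x. w n x - u x) <= e/3" using n4 elim e unfolding Ds2_enn_ennreal[OF fd] by simp
   ultimately show ?case using e by (simp add: dist_real_def abs_of_nonneg)
  qed
 qed
 show "u \<in> E_space s" by (rule E_spaceI[OF s fu w lim c])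
qed

lemma E_spaceD':
 fixes u :: "real^'n::finite => real"
 assumes "u \<in> E_space s"
 shows "fin_E s u \<and> (\<exists>\<phi>. (\<forall>k. test_fun (\<phi> k)) \<and>
  (\<lambda>k. D12_sq (\<lambda>x. \<phi> k x - u x) + Ds2_sq s (\<lambda>x. \<phi> k x - u x)) \<longlonglongrightarrow> 0 \<and> L1c \<phi> u)"
 by (rule E_spaceD[OF assms]) (intro conjI exI allI)

lemma L1c_const: "L1c (\<lambda>k. u) u"
 by (simp add: L1c_def)

lemma form_zero:
 assumes s: "0 < s" "s < 1"
 shows "D12_sq (\<lambda>x::real^'n::finite. 0::real) = 0" "Ds2_sq s (\<lambda>x::real^'n::finite. 0::real) = 0"
 using fin_E_scale(2,3)[OF fin_E_test[OF s test_fun_zero], of 0] by simp_all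

lemma test_in_E:
 assumes s: "0 < s" "s < 1" and u: "test_fun u" shows "u \<in> E_space s"
 by (rule E_spaceI[OF s fin_E_test[OF s u], of "\<lambda>k. u"]) (simp_all add: u form_zero[OF s] L1c_const)

lemma E_fin: "u \<in> E_space s ==> fin_E s u"
 by (auto simp: E_space_def fin_E_def)

lemma form_lincomb_le:
 assumes "fin_E s u" "fin_E s v"
 shows "D12_sq (\<lambda>x. u x + c * v x) <= 2 * D12_sq u + 2 * c\<^sup>2 * D12_sq v"
  "Ds2_sq s (\<lambda>x. u x + c * v x) <= 2 * Ds2_sq s u + 2 * c\<^sup>2 * Ds2_sq s v"
proof -
 have "0 <= D12_sq u + 2 * - c * D12_form u v + (- c)\<^sup>2 * D12_sq v"
  "0 <= Ds2_sq s u + 2 * - c * Ds2_form s u v + (- c)\<^sup>2 * Ds2_sq s v"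
  unfolding fin_E_lincomb(2,3)[OF assms, of "-c", symmetric] by (rule D12_sq_nonneg Ds2_sq_nonneg)+
 then show "D12_sq (\<lambda>x. u x + c * v x) <= 2 * D12_sq u + 2 * c\<^sup>2 * D12_sq v"
  "Ds2_sq s (\<lambda>x. u x + c * v x) <= 2 * Ds2_sq s u + 2 * c\<^sup>2 * Ds2_sq s v"
  unfolding fin_E_lincomb(2,3)[OF assms, of c] power2_minus by linarith+
qed

lemma L1c_lincomb:
 assumes f: "\<And>k. f k \<in> \<M>" "u \<in> \<M>" "L1c f u"
  and g: "\<And>k. g k \<in> \<M>" "v \<in> \<M>" "L1c g v"
 shows "L1c (\<lambda>k x. f k x + c * g k x) (\<lambda>x. u x + c * v x)"
 unfolding L1c_def
proof
 fix R
 note [measurable] = f(1,2) g(1,2)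
 let ?I = "\<lambda>f u k. \<integral>\<^sup>+x. ennreal \<bar>f k x - u x\<bar> * indicator (ball 0 R) x \<partial>\<L>"
 have "(\<lambda>k. ?I f u k + ennreal \<bar>c\<bar> * ?I g v k) \<longlonglongrightarrow> 0 + ennreal \<bar>c\<bar> * 0"
  using f(3) g(3) by (intro tendsto_add ennreal_tendsto_cmult) (auto simp: L1c_def)
 then have lim: "(\<lambda>k. ?I f u k + ennreal \<bar>c\<bar> * ?I g v k) \<longlonglongrightarrow> 0" by simp
 show "(\<lambda>k. \<integral>\<^sup>+x. ennreal \<bar>(f k x + c * g k x) - (u x + c * v x)\<bar> * indicator (ball 0 R) x \<partial>\<L>) \<longlonglongrightarrow> 0"
 proof (rule tendsto_sandwich[OF _ _ tendsto_const lim])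
  have "(\<integral>\<^sup>+x. ennreal \<bar>(f k x + c * g k x) - (u x + c * v x)\<bar> * indicator (ball 0 R) x \<partial>\<L>) <= ?I f u k + ennreal \<bar>c\<bar> * ?I g v k" for k
  proof -
   have "ennreal \<bar>(f k x + c * g k x) - (u x + c * v x)\<bar> <= ennreal \<bar>f k x - u x\<bar> + ennreal \<bar>c\<bar> * ennreal \<bar>g k x - v x\<bar>" for x
   proof -
    have "(f k x + c * g k x) - (u x + c * v x) = (f k x - u x) + c * (g k x - v x)" by (simp add: algebra_simps)
    then have "\<bar>(f k x + c * g k x) - (u x + c * v x)\<bar> <= \<bar>f k x - u x\<bar> + \<bar>c\<bar> * \<bar>g k x - v x\<bar>"
     by (metis abs_mult abs_triangle_ineq)
    then show ?thesis by (simp add: ennreal_mult[symmetric] ennreal_plus[symmetric] del: ennreal_plus)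
   qed
   then have "(\<integral>\<^sup>+x. ennreal \<bar>(f k x + c * g k x) - (u x + c * v x)\<bar> * indicator (ball 0 R) x \<partial>\<L>)
    <= (\<integral>\<^sup>+x. ennreal \<bar>f k x - u x\<bar> * indicator (ball 0 R) x + ennreal \<bar>c\<bar> * (ennreal \<bar>g k x - v x\<bar> * indicator (ball 0 R) x) \<partial>\<L>)"
    by (intro nn_integral_mono) (auto simp: indicator_def)
   also have "\<dots> = ?I f u k + ennreal \<bar>c\<bar> * ?I g v k"
    by (subst nn_integral_add) (auto simp: nn_integral_cmult)
   finally show ?thesis .
  qed
  then show "\<forall>\<^sub>F k in sequentially. (\<integral>\<^sup>+x. ennreal \<bar>(f k x + c * g k x) - (u x + c * v x)\<bar> * indicator (ball 0 R) x \<partial>\<L>) <= ?I f u k + ennreal \<bar>c\<bar> * ?I g v k"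
   by simp
 qed simp
qed

lemma E_lincomb:
 fixes u v :: "real^'n::finite => real"
 assumes s: "0 < s" "s < 1" and u: "u \<in> E_space s" and v: "v \<in> E_space s"
 shows "(\<lambda>x. u x + c * v x) \<in> E_space s"
proof -
 obtain \<phi> where fu: "fin_E s u" and \<phi>: "\<And>k. test_fun (\<phi> k)" "(\<lambda>k. D12_sq (\<lambda>x. \<phi> k x - u x) + Ds2_sq s (\<lambda>x. \<phi> k x - u x)) \<longlonglongrightarrow> 0" "L1c \<phi> u"
  using E_spaceD'[OF u] by blast
 obtain \<psi> where fv: "fin_E s v" and \<psi>: "\<And>k. test_fun (\<psi> k)" "(\<lambda>k. D12_sq (\<lambda>x. \<psi> k x - v x) + Ds2_sq s (\<lambda>x. \<psi> k x - v x)) \<longlonglongrightarrow> 0" "L1c \<psi> v"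
  using E_spaceD'[OF v] by blast
 show ?thesis
 proof (rule E_spaceI[OF s])
  show "fin_E s (\<lambda>x. u x + c * v x)" by (rule fin_E_lincomb(1)[OF fu fv])
  show "test_fun (\<lambda>x. \<phi> k x + c * \<psi> k x)" for k by (intro test_fun_add test_fun_scale \<phi> \<psi>)
  show "L1c (\<lambda>k x. \<phi> k x + c * \<psi> k x) (\<lambda>x. u x + c * v x)"
   by (intro L1c_lincomb test_fun_measurable \<phi> \<psi> fin_E_measurable[OF fu] fin_E_measurable[OF fv])
  let ?a = "\<lambda>k x. \<phi> k x - u x" and ?b = "\<lambda>k x. \<psi> k x - v x"
  have ab: "fin_E s (?a k)" "fin_E s (?b k)" for k
   by (intro fin_E_diff(1) fin_E_test s \<phi> \<psi> fu fv)+
  have e: "(\<lambda>x. (\<phi> k x + c * \<psi> k x) - (u x + c * v x)) = (\<lambda>x. ?a k x + c * ?b k x)" for k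
   by (simp add: algebra_simps)
  have le: "D12_sq (\<lambda>x. ?a k x + c * ?b k x) + Ds2_sq s (\<lambda>x. ?a k x + c * ?b k x)
   <= 2 * (D12_sq (?a k) + Ds2_sq s (?a k)) + 2 * c\<^sup>2 * (D12_sq (?b k) + Ds2_sq s (?b k))" for k
   using form_lincomb_le[OF ab(1)[of k] ab(2)[of k], of c] by (simp add: algebra_simps)
  have lim: "(\<lambda>k. 2 * (D12_sq (?a k) + Ds2_sq s (?a k)) + 2 * c\<^sup>2 * (D12_sq (?b k) + Ds2_sq s (?b k))) \<longlonglongrightarrow> 2 * 0 + 2 * c\<^sup>2 * 0"
   by (intro tendsto_intros \<phi>(2) \<psi>(2))
  show "(\<lambda>k. D12_sq (\<lambda>x. (\<phi> k x + c * \<psi> k x) - (u x + c * v x)) + Ds2_sq s (\<lambda>x. (\<phi> k x + c * \<psi> k x) - (u x + c * v x))) \<longlonglongrightarrow> 0"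
   unfolding e by (rule tendsto_sandwich[OF _ _ tendsto_const lim[simplified]]) (use le in auto)
 qed
qed

lemma E_scale:
 fixes u :: "real^'n::finite => real"
 assumes s: "0 < s" "s < 1" and u: "u \<in> E_space s" shows "(\<lambda>x. c * u x) \<in> E_space s"
 using E_lincomb[OF s test_in_E[OF s test_fun_zero] u, of c] by simp

lemma L1c_simil:
 fixes u :: "real^'n::finite => real"
 assumes T: "simil l T" and [measurable]: "\<And>k. \<phi> k \<in> \<M>" "u \<in> \<M>" and c: "L1c \<phi> u"
 shows "L1c (\<lambda>k x. \<phi> k (T x)) (\<lambda>x. u (T x))"
 unfolding L1c_def
proof
 fix R
 have l: "l > 0" by (rule simil_pos[OF T])
 let ?R = "norm (T 0) + l * \<bar>R\<bar> + 1"
 have sub: "T x \<in> ball 0 ?R" if "x \<in> ball 0 R" for x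
 proof -
  have "dist (T 0) (T x) <= l * \<bar>R\<bar>" using that l by (simp add: simil_dist[OF T])
  then show ?thesis using norm_triangle_sub[of "T x" "T 0"] by (simp add: dist_norm norm_minus_commute)
 qed
 have "(\<lambda>k. ennreal (1 / l ^ CARD('n)) * (\<integral>\<^sup>+x. ennreal \<bar>\<phi> k x - u x\<bar> * indicator (ball 0 ?R) x \<partial>\<L>)) \<longlonglongrightarrow> ennreal (1 / l ^ CARD('n)) * 0"
  using c by (intro ennreal_tendsto_cmult) (auto simp: L1c_def)
 then have lim: "(\<lambda>k. ennreal (1 / l ^ CARD('n)) * (\<integral>\<^sup>+x. ennreal \<bar>\<phi> k x - u x\<bar> * indicator (ball 0 ?R) x \<partial>\<L>)) \<longlonglongrightarrow> 0" by simp
 have "(\<integral>\<^sup>+x. ennreal \<bar>\<phi> k (T x) - u (T x)\<bar> * indicator (ball 0 R) x \<partial>\<L>)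
  <= (\<integral>\<^sup>+x. ennreal \<bar>\<phi> k (T x) - u (T x)\<bar> * indicator (ball 0 ?R) (T x) \<partial>\<L>)" for k
  using sub by (intro nn_integral_mono) (auto simp: indicator_def)
 moreover have "(\<integral>\<^sup>+x. ennreal \<bar>\<phi> k (T x) - u (T x)\<bar> * indicator (ball 0 ?R) (T x) \<partial>\<L>)
  = ennreal (1 / l ^ CARD('n)) * (\<integral>\<^sup>+x. ennreal \<bar>\<phi> k x - u x\<bar> * indicator (ball 0 ?R) x \<partial>\<L>)" for k
  by (rule simil_nn_integral[OF T]) measurable
 ultimately show "(\<lambda>k. \<integral>\<^sup>+x. ennreal \<bar>\<phi> k (T x) - u (T x)\<bar> * indicator (ball 0 R) x \<partial>\<L>) \<longlonglongrightarrow> 0"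
  by (intro tendsto_sandwich[OF _ _ tendsto_const lim]) (auto intro!: always_eventually)
qed

lemma E_simil:
 fixes u :: "real^'n::finite => real"
 assumes s: "0 < s" "s < 1" and u: "u \<in> E_space s" and T: "simil l T"
 shows "(\<lambda>x. u (T x)) \<in> E_space s"
proof -
 obtain \<phi> where fu: "fin_E s u" and \<phi>: "\<And>k. test_fun (\<phi> k)" "(\<lambda>k. D12_sq (\<lambda>x. \<phi> k x - u x) + Ds2_sq s (\<lambda>x. \<phi> k x - u x)) \<longlonglongrightarrow> 0" "L1c \<phi> u"
  using E_spaceD'[OF u] by blast
 note [measurable] = fin_E_measurable[OF fu] test_fun_measurable[OF \<phi>(1)]
 have l: "l > 0" by (rule simil_pos[OF T])
 show ?thesis
 proof (rule E_spaceI[OF s])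
  show "fin_E s (\<lambda>x. u (T x))" by (rule fin_E_simil(1)[OF T fu])
  show "test_fun (\<lambda>x. \<phi> k (T x))" for k by (rule test_fun_simil[OF \<phi>(1) T])
  have fd: "fin_E s (\<lambda>x. \<phi> k x - u x)" for k by (intro fin_E_diff(1) fin_E_test s \<phi> fu)
  have z: "(\<lambda>k. D12_sq (\<lambda>x. \<phi> k x - u x)) \<longlonglongrightarrow> 0" "(\<lambda>k. Ds2_sq s (\<lambda>x. \<phi> k x - u x)) \<longlonglongrightarrow> 0"
   by (rule tendsto_sandwich[OF _ _ tendsto_const \<phi>(2)]; simp)+
  have "(\<lambda>k. l\<^sup>2 / l ^ CARD('n) * D12_sq (\<lambda>x. \<phi> k x - u x) + l powr (real CARD('n) + 2 * s) / (l ^ CARD('n) * l ^ CARD('n)) * Ds2_sq s (\<lambda>x. \<phi> k x - u x)) \<longlonglongrightarrow>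
   l\<^sup>2 / l ^ CARD('n) * 0 + l powr (real CARD('n) + 2 * s) / (l ^ CARD('n) * l ^ CARD('n)) * 0"
   by (intro tendsto_add tendsto_mult_left z)
  then show "(\<lambda>k. D12_sq (\<lambda>x. \<phi> k (T x) - u (T x)) + Ds2_sq s (\<lambda>x. \<phi> k (T x) - u (T x))) \<longlonglongrightarrow> 0"
   unfolding fin_E_simil(2)[OF T fd] fin_E_simil(3)[OF T fd] by simp
  show "L1c (\<lambda>k x. \<phi> k (T x)) (\<lambda>x. u (T x))" by (rule L1c_simil[OF T _ _ \<phi>(3)]) auto
 qed
qed

lemma E_cong_AE:
 fixes u v :: "real^'n::finite => real"
 assumes s: "0 < s" "s < 1" and u: "u \<in> E_space s" and v[measurable]: "v \<in> \<M>" and ae: "AE x in \<L>. u x = v x"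
 shows "v \<in> E_space s"
proof -
 obtain \<phi> where fu: "fin_E s u" and \<phi>: "\<And>k. test_fun (\<phi> k)" "(\<lambda>k. D12_sq (\<lambda>x. \<phi> k x - u x) + Ds2_sq s (\<lambda>x. \<phi> k x - u x)) \<longlonglongrightarrow> 0" "L1c \<phi> u"
  using E_spaceD'[OF u] by blast
 note [measurable] = fin_E_measurable[OF fu] test_fun_measurable[OF \<phi>(1)]
 have fd: "fin_E s (\<lambda>x. \<phi> k x - u x)" for k by (intro fin_E_diff(1) fin_E_test s \<phi> fu)
 have aed: "AE x in \<L>. \<phi> k x - u x = \<phi> k x - v x" for k using ae by eventually_elim simp
 have mv: "(\<lambda>x. \<phi> k x - v x) \<in> \<M>" for k by measurable
 have "D12_sq (\<lambda>x. \<phi> k x - v x) = D12_sq (\<lambda>x. \<phi> k x - u x)" "Ds2_sq s (\<lambda>x. \<phi> k x - v x) = Ds2_sq s (\<lambda>x. \<phi> k x - u x)" for k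
  unfolding D12_sq_def Ds2_sq_def fin_E_cong_AE(2,3)[OF fd mv aed] by simp_all
 moreover have "L1c \<phi> v"
 proof -
  have "(\<integral>\<^sup>+x. ennreal \<bar>\<phi> k x - v x\<bar> * indicator (ball 0 R) x \<partial>\<L>) = (\<integral>\<^sup>+x. ennreal \<bar>\<phi> k x - u x\<bar> * indicator (ball 0 R) x \<partial>\<L>)" for k R
   using ae by (intro nn_integral_cong_AE) auto
  then show ?thesis using \<phi>(3) by (simp add: L1c_def)
 qed
 ultimately show ?thesis using \<phi> fin_E_cong_AE(1)[OF fu v ae] by (intro E_spaceI[OF s, of v \<phi>]) auto
qed

subsection \<open>Bounded sequences\<close>

text \<open>Dyadic convex combinations of the tail from index \<open>n\<close>. Midpoints are what
  the parallelogram law consumes, and bounds on the tail pass to the hull by rule induction.\<close>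

inductive mhull :: "(nat => real^'n::finite => real) => nat => (real^'n => real) => bool" for v n where
 base: "n <= k ==> mhull v n (v k)"
| mid: "mhull v n f ==> mhull v n g ==> mhull v n (\<lambda>x. 1/2 * (f x + g x))"

lemma mhull_mono: "mhull v m f ==> n <= m ==> mhull v n f"
proof (induction rule: mhull.induct)
 case (base k)
 then show ?case by (intro mhull.base) simp
next
 case (mid f g)
 then show ?case by (intro mhull.mid)
qed

lemma mhull_test: "mhull v n f ==> (\<And>k. test_fun (v k)) ==> test_fun f"
proof (induction rule: mhull.induct)
 case (mid f g)
 show ?case using mid.IH mid.prems by (intro test_fun_scale test_fun_add) blast+
qed

lemma parallelogram:
 assumes f: "fin_E s f" and g: "fin_E s g"
 shows "D12_sq (\<lambda>x. f x - g x) = 2 * D12_sq f + 2 * D12_sq g - 4 * D12_sq (\<lambda>x. 1/2 * (f x + g x))"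
  "Ds2_sq s (\<lambda>x. f x - g x) = 2 * Ds2_sq s f + 2 * Ds2_sq s g - 4 * Ds2_sq s (\<lambda>x. 1/2 * (f x + g x))"
 using fin_E_diff(2,3)[OF f g] fin_E_add(2,3)[OF f g] fin_E_scale(2,3)[OF fin_E_add(1)[OF f g], of "1/2"]
 by (simp_all add: power2_eq_square)

lemma ennreal_half_sum:
 assumes "0 <= a" "0 <= b" shows "ennreal (1/2 * (a + b)) = ennreal (1/2) * (ennreal a + ennreal b)"
proof -
 have "ennreal (1/2 * (a + b)) = ennreal (1/2) * ennreal (a + b)" by (rule ennreal_mult) (use assms in auto)
 also have "ennreal (a + b) = ennreal a + ennreal b" by (rule ennreal_plus) (use assms in auto)
 finally show ?thesis .
qed

lemma midpoint_le:
 assumes f: "fin_E s f" and g: "fin_E s g"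
 shows "D12_sq (\<lambda>x. 1/2 * (f x + g x)) <= (D12_sq f + D12_sq g) / 2"
  "Ds2_sq s (\<lambda>x. 1/2 * (f x + g x)) <= (Ds2_sq s f + Ds2_sq s g) / 2"
 using parallelogram[OF f g] D12_sq_nonneg[of "\<lambda>x. f x - g x"] Ds2_sq_nonneg[of s "\<lambda>x. f x - g x"] by auto

text \<open>Banach--Saks without weak compactness: elements of almost minimal energy in the midpoint hulls
 of the tails form a Cauchy sequence by the parallelogram law, and they still converge locally to \<open>u\<close>.\<close>

lemma closure_E:
 fixes u :: "real^'n::finite => real"
 assumes s: "0 < s" "s < 1" and v: "\<And>n. test_fun (v n)" and u[measurable]: "u \<in> \<M>"
  and a: "\<And>n. D12_sq (v n) <= a" and b: "\<And>n. Ds2_sq s (v n) <= b" and c: "L1c v u"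
 shows "u \<in> E_space s" "D12_sq u <= a" "Ds2_sq s u <= b"
proof -
 let ?q = "\<lambda>f. D12_sq f + Ds2_sq s f"
 have vE: "fin_E s (v n)" for n by (intro fin_E_test s v)
 have ht: "test_fun f" if "mhull v n f" for f n using mhull_test[OF that v] .
 have hE: "fin_E s f" if "mhull v n f" for f n by (intro fin_E_test s ht[OF that])
 have hb: "D12_sq f <= a \<and> Ds2_sq s f <= b" if "mhull v n f" for f n
  using that
 proof (induction rule: mhull.induct)
  case (mid f g)
  show ?case
  proof
   show "D12_sq (\<lambda>x. 1/2 * (f x + g x)) <= a"
    by (rule order_trans[OF midpoint_le(1)[OF hE[OF mid(1)] hE[OF mid(2)]]]) (use mid.IH in simp)
   show "Ds2_sq s (\<lambda>x. 1/2 * (f x + g x)) <= b"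
    by (rule order_trans[OF midpoint_le(2)[OF hE[OF mid(1)] hE[OF mid(2)]]]) (use mid.IH in simp)
  qed
 qed (use a b in auto)
 \<comment> \<open>The local L^1 distance to \<open>u\<close> is convex, so a bound on the tail of
   \<open>v\<close> holds on its midpoint hull.\<close>
 have hc: "(\<integral>\<^sup>+x. ennreal \<bar>f x - u x\<bar> * indicator (ball 0 R) x \<partial>\<L>) <= ennreal e"
  if h: "mhull v n f" and e: "e \<ge> 0" and le: "\<And>k. n <= k ==> (\<integral>\<^sup>+x. ennreal \<bar>v k x - u x\<bar> * indicator (ball 0 R) x \<partial>\<L>) <= ennreal e" for f n R e
  using h
 proof (induction rule: mhull.induct)
  case (mid f g)
  note [measurable] = test_fun_measurable[OF ht[OF mid(1)]] test_fun_measurable[OF ht[OF mid(2)]]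
  have "ennreal \<bar>1/2 * (f x + g x) - u x\<bar> <= ennreal (1/2) * (ennreal \<bar>f x - u x\<bar> + ennreal \<bar>g x - u x\<bar>)" for x
  proof -
   have "\<bar>1/2 * (f x + g x) - u x\<bar> <= 1/2 * (\<bar>f x - u x\<bar> + \<bar>g x - u x\<bar>)" by (auto simp: abs_if field_simps)
   then have "ennreal \<bar>1/2 * (f x + g x) - u x\<bar> <= ennreal (1/2 * (\<bar>f x - u x\<bar> + \<bar>g x - u x\<bar>))" by (rule ennreal_leI)
   also have "\<dots> = ennreal (1/2) * (ennreal \<bar>f x - u x\<bar> + ennreal \<bar>g x - u x\<bar>)"
    by (rule ennreal_half_sum) simp_all
   finally show ?thesis .
  qed
  then have "(\<integral>\<^sup>+x. ennreal \<bar>1/2 * (f x + g x) - u x\<bar> * indicator (ball 0 R) x \<partial>\<L>)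
   <= (\<integral>\<^sup>+x. ennreal (1/2) * (ennreal \<bar>f x - u x\<bar> * indicator (ball 0 R) x + ennreal \<bar>g x - u x\<bar> * indicator (ball 0 R) x) \<partial>\<L>)"
   by (intro nn_integral_mono) (auto simp: indicator_def)
  also have "\<dots> = ennreal (1/2) * ((\<integral>\<^sup>+x. ennreal \<bar>f x - u x\<bar> * indicator (ball 0 R) x \<partial>\<L>) + (\<integral>\<^sup>+x. ennreal \<bar>g x - u x\<bar> * indicator (ball 0 R) x \<partial>\<L>))"
   by (subst nn_integral_cmult, measurable, subst nn_integral_add, measurable)
  also have "\<dots> <= ennreal (1/2) * (ennreal e + ennreal e)" using mid.IH by (intro mult_left_mono add_mono) auto
  also have "\<dots> = ennreal (1/2 * (e + e))" using e by (rule ennreal_half_sum[symmetric]) (rule e)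
  finally show ?case by simp
 qed (use le in auto)
 define d where "d n = (INF f\<in>Collect (mhull v n). ?q f)" for n
 have ne: "Collect (mhull v n) \<noteq> {}" for n using mhull.base[of n n v] by auto
 have bb: "bdd_below (?q ` Collect (mhull v n))" for n by (rule bdd_belowI2[of _ 0]) simp
 have dle: "d n <= ?q f" if "mhull v n f" for n f unfolding d_def using that by (intro cINF_lower bb) auto
 have dmono: "d n <= d m" if "n <= m" for n m
  unfolding d_def[of m] using that by (intro cINF_greatest ne dle) (auto intro: mhull_mono)
 have dab: "d n <= a + b" for n using dle[OF mhull.base[of n n v]] a[of n] b[of n] by linarith
 have "convergent d" using dmono dab by (intro Bseq_mono_convergent BseqI'[of _ "\<bar>d 0\<bar> + \<bar>a + b\<bar>"])
  (smt (verit) real_norm_def zero_le, auto)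
 then have dC: "Cauchy d" by (rule convergent_Cauchy)
 have "\<exists>f. mhull v n f \<and> ?q f < d n + 1 / real (Suc n)" for n
  using cInf_lessD[of "?q ` Collect (mhull v n)" "d n + 1 / real (Suc n)"] ne[of n] unfolding d_def by auto
 then obtain w where w: "\<And>n. mhull v n (w n)" "\<And>n. ?q (w n) < d n + 1 / real (Suc n)" by metis
 have wt: "test_fun (w n)" for n using ht[OF w(1)] .
 have Cw: "\<exists>n0. \<forall>m\<ge>n0. \<forall>n\<ge>n0. ?q (\<lambda>x. w m x - w n x) <= e" if e: "e > 0" for e
 proof -
  obtain n1 where n1: "\<And>m n. m \<ge> n1 ==> n \<ge> n1 ==> \<bar>d m - d n\<bar> < e / 8"
   using dC e unfolding Cauchy_def dist_real_def by (metis divide_pos_pos zero_less_numeral)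
  obtain n2 where n2: "1 / real (Suc n2) < e / 8" using e nat_approx_posE[of "e/8"] by auto
  \<comment> \<open>The midpoint belongs to the hull from \<open>n\<close>, so its energy is at
    least \<open>d n\<close>, while the endpoints exceed \<open>d m\<close> and \<open>d n\<close>
    by less than e/8; only these excesses and the gap between \<open>d m\<close> and
    \<open>d n\<close> survive in the parallelogram law.\<close>
  have key: "?q (\<lambda>x. w m x - w n x) <= e" if mn: "n <= m" "n1 <= n" "n2 <= n" for m n
  proof -
   have "mhull v n (\<lambda>x. 1/2 * (w m x + w n x))" using w(1) mn by (intro mhull.mid) (auto intro: mhull_mono)
   then have "d n <= ?q (\<lambda>x. 1/2 * (w m x + w n x))" by (rule dle)
   moreover have "1 / real (Suc n) <= 1 / real (Suc n2)" "1 / real (Suc m) <= 1 / real (Suc n2)"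
    using mn by (intro divide_left_mono; simp)+
   ultimately show ?thesis
    using parallelogram[OF hE[OF w(1)[of m]] hE[OF w(1)[of n]]] w(2)[of m] w(2)[of n] n1[of m n] n2 mn by linarith
  qed
  have sym: "?q (\<lambda>x. w m x - w n x) = ?q (\<lambda>x. w n x - w m x)" for m n
   unfolding fin_E_diff(2,3)[OF hE[OF w(1)[of m]] hE[OF w(1)[of n]]] fin_E_diff(2,3)[OF hE[OF w(1)[of n]] hE[OF w(1)[of m]]]
   by (simp add: form_commute(1)[where u="w m"] form_commute(2)[where u="w m"])
  have "?q (\<lambda>x. w m x - w n x) <= e" if "max n1 n2 <= m" "max n1 n2 <= n" for m n
   using key[of n m] key[of m n] sym[of m n] that by (cases "n <= m") auto
  then show ?thesis by blast
 qed
 have cw: "L1c w u"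
 proof (rule L1cI)
  fix R e :: real assume e: "e > 0"
  obtain k0 where k0: "\<And>k. k \<ge> k0 ==> (\<integral>\<^sup>+x. ennreal \<bar>v k x - u x\<bar> * indicator (ball 0 R) x \<partial>\<L>) <= ennreal e"
   using L1c_D[OF c e, of R] by (auto simp: eventually_sequentially)
  show "\<forall>\<^sub>F k in sequentially. (\<integral>\<^sup>+x. ennreal \<bar>w k x - u x\<bar> * indicator (ball 0 R) x \<partial>\<L>) <= ennreal e"
   using eventually_ge_at_top[of k0] by eventually_elim (rule hc[OF w(1)], use e k0 in auto)
 qed
 note cE = complete_E[OF s wt u Cw cw]
 show "u \<in> E_space s" by (rule cE(1))
 note lim = form_tendsto[OF hE[OF w(1)] cE(2,3)]
 show "D12_sq u <= a" by (rule LIMSEQ_le_const2[OF lim(1)]) (use hb[OF w(1)] in auto)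
 show "Ds2_sq s u <= b" by (rule LIMSEQ_le_const2[OF lim(2)]) (use hb[OF w(1)] in auto)
qed

section \<open>The best constant\<close>

context GN_setting
begin

lemma Lp_test_finite:
 fixes u :: "real^'n => real"
 assumes u: "test_fun u" shows "Lp_enn p u < \<infinity>"
proof -
 note [measurable] = test_fun_measurable[OF u]
 obtain M where M: "M > 0" "\<And>x. \<bar>u x\<bar> <= M" using test_fun_bounded[OF u] by metis
 obtain R where R: "\<And>x. norm x \<ge> R ==> u x = 0" using test_fun_support[OF u] by metis
 have "integrable \<L> (\<lambda>x. \<bar>u x\<bar> powr p)"
  by (rule integrable_bounded_support[of _ "M powr p" R]) (use M R exponents(4) in \<open>auto intro!: powr_mono2\<close>)
 then show ?thesis by (simp add: Lp_enn_def integrable_iff_bounded)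
qed

lemma Lp_cong_AE: "AE x in \<L>. u x = v x ==> Lp_enn p u = Lp_enn p (v :: real^'n => real)"
 unfolding Lp_enn_def by (intro nn_integral_cong_AE) auto

lemma Lp_zero: "AE x in \<L>. u x = 0 ==> Lp_enn p (u :: real^'n => real) = 0"
 using Lp_cong_AE[of u "\<lambda>x. 0"] by (simp add: Lp_enn_def)

lemma Lp_zero_iff:
 fixes u :: "real^'n => real"
 assumes [measurable]: "u \<in> \<M>"
 shows "Lp_enn p u = 0 \<longleftrightarrow> (AE x in \<L>. u x = 0)"
 unfolding Lp_enn_def by (subst nn_integral_0_iff_AE) auto

lemma test_zero:
 fixes u :: "real^'n => real"
 assumes u: "test_fun u" and z: "D12_sq u = 0 \<or> Ds2_sq s u = 0"
 shows "AE x in \<L>. u x = 0"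
proof -
 note [measurable] = test_fun_measurable[OF u]
 have mz: "measure \<L> {x. 2 * t < \<bar>u x\<bar>} = 0" if t: "t > 0" for t
 proof -
  have "measure \<L> {x. 2 * t < \<bar>u x\<bar>} * t\<^sup>2 <= 0"
   using z
  proof
   assume "D12_sq u = 0"
   then have "incr u r <= ennreal (0 * r powr (real CARD('n) + 2 * 1))" if "r > 0" for r
    using incr_bounds(2)[OF u that] by (simp add: N_def)
   from weak_type_step[OF u t order_refl zero_less_one this] show ?thesis by simp
  next
   assume "Ds2_sq s u = 0"
   then have "incr u r <= ennreal (0 * r powr (real CARD('n) + 2 * s))" if "r > 0" for r
    using incr_bounds(1)[OF u that] by (simp add: N_def)
   from weak_type_step[OF u t order_refl s0 this] show ?thesis by simp
  qed
  then show ?thesis using t measure_nonneg[of \<L> "{x. 2 * t < \<bar>u x\<bar>}"]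
   by (metis dual_order.antisym mult_le_0_iff not_less zero_less_power)
 qed
 have "{x. 2 * (1 / real (Suc n)) < \<bar>u x\<bar>} \<in> null_sets \<L>" for n
 proof (rule null_setsI)
  have t: "(0::real) < 1 / real (Suc n)" by simp
  then have t': "(0::real) <= 2 * (1 / real (Suc n))" by linarith
  show "emeasure \<L> {x. 2 * (1 / real (Suc n)) < \<bar>u x\<bar>} = 0"
   unfolding level_set_finite[OF u t'] mz[OF t] by (rule ennreal_0)
  show "{x. 2 * (1 / real (Suc n)) < \<bar>u x\<bar>} \<in> sets \<L>" by (rule level_set_measurable[OF test_fun_measurable[OF u]])
 qed
 then have "AE x in \<L>. \<forall>n. x \<notin> {x. 2 * (1 / real (Suc n)) < \<bar>u x\<bar>}"
  unfolding AE_all_countable by (intro allI AE_not_in)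
 then show ?thesis
 proof eventually_elim
  case (elim x)
  show ?case
  proof (rule ccontr)
   assume "u x \<noteq> 0"
   then obtain n where "1 / real (Suc n) < \<bar>u x\<bar> / 2" using nat_approx_posE[of "\<bar>u x\<bar> / 2"] by auto
   then show False using elim by (auto simp: not_less dest!: spec[of _ n])
  qed
 qed
qed

lemma scaled:
 fixes u :: "real^'n => real"
 assumes u: "fin_E s u" and l: "l > 0"
 shows "fin_E s (\<lambda>x. c * u (l *\<^sub>R x))"
  "D12_sq (\<lambda>x. c * u (l *\<^sub>R x)) = c\<^sup>2 * l powr (2 - N) * D12_sq u"
  "Ds2_sq s (\<lambda>x. c * u (l *\<^sub>R x)) = c\<^sup>2 * l powr (2 * s - N) * Ds2_sq s u"
  "Lp_enn p (\<lambda>x. c * u (l *\<^sub>R x)) = ennreal (\<bar>c\<bar> powr p * l powr (- N)) * Lp_enn p u"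
proof -
 have T: "simil l (\<lambda>x::real^'n. l *\<^sub>R x)" by (rule simil_scale[OF l])
 note f = fin_E_simil[OF T u]
 have p1: "l\<^sup>2 / l ^ CARD('n) = l powr (2 - N)" using l by (simp add: powr_diff N_def powr_realpow)
 have p2: "l powr (real CARD('n) + 2 * s) / (l ^ CARD('n) * l ^ CARD('n)) = l powr (2 * s - N)"
 proof -
  have "l ^ CARD('n) = l powr N" using l by (simp add: N_def powr_realpow)
  then show ?thesis using l by (simp add: powr_add[symmetric] powr_diff[symmetric] N_def[symmetric])
 qed
 have p3: "1 / l ^ CARD('n) = l powr (- N)" using l by (simp add: N_def powr_minus_divide powr_realpow)
 show "fin_E s (\<lambda>x. c * u (l *\<^sub>R x))" "D12_sq (\<lambda>x. c * u (l *\<^sub>R x)) = c\<^sup>2 * l powr (2 - N) * D12_sq u"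
  "Ds2_sq s (\<lambda>x. c * u (l *\<^sub>R x)) = c\<^sup>2 * l powr (2 * s - N) * Ds2_sq s u"
  using fin_E_scale[OF f(1), of c] f(2,3) by (simp_all add: p1 p2)
 show "Lp_enn p (\<lambda>x. c * u (l *\<^sub>R x)) = ennreal (\<bar>c\<bar> powr p * l powr (- N)) * Lp_enn p u"
  unfolding Lp_enn_simil[OF T fin_E_measurable[OF u]] p3[symmetric] by simp
qed

lemma scale_exponents:
 assumes "c > 0" "l > 0"
 shows "(c\<^sup>2 * l powr (2 * s - N)) powr al * (c\<^sup>2 * l powr (2 - N)) powr be = c powr p * l powr (- N)"
proof -
 have "(c\<^sup>2) powr x = c powr (2 * x)" for x using assms by (simp add: powr_powr powr_numeral[symmetric] del: powr_numeral)
 then have "(c\<^sup>2 * l powr (2 * s - N)) powr al * (c\<^sup>2 * l powr (2 - N)) powr be =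
  (c powr (2 * al) * c powr (2 * be)) * (l powr ((2 * s - N) * al) * l powr ((2 - N) * be))"
  using assms by (simp add: powr_mult powr_powr)
 also have "\<dots> = c powr (2 * (al + be)) * l powr (- ((N - 2) * be + (N - 2 * s) * al))"
  unfolding powr_add[symmetric] by (simp add: algebra_simps)
 finally show ?thesis using exponents(3,5) by simp
qed

text \<open>Two parameters fix two seminorms: the dilation makes them equal, the multiple brings
  them to 1. \<open>scale_exponents\<close> then says how the L^p integral changes.\<close>

lemma normalize:
 fixes u :: "real^'n => real"
 assumes u: "fin_E s u" and a: "D12_sq u > 0" and b: "Ds2_sq s u > 0"
 shows "\<exists>c>0. \<exists>l>0. D12_sq (\<lambda>x. c * u (l *\<^sub>R x)) = 1 \<and> Ds2_sq s (\<lambda>x. c * u (l *\<^sub>R x)) = 1 \<and>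
  ennreal (Ds2_sq s u powr al * D12_sq u powr be) * Lp_enn p (\<lambda>x. c * u (l *\<^sub>R x)) = Lp_enn p u"
proof -
 let ?a = "D12_sq u" and ?b = "Ds2_sq s u"
 define l where "l = (?b / ?a) powr (1 / (2 - 2 * s))"
 define c where "c = sqrt (l powr (N - 2) / ?a)"
 have l: "l > 0" using a b by (simp add: l_def)
 have c: "c > 0" using a l by (simp add: c_def)
 have c2: "c\<^sup>2 = l powr (N - 2) / ?a" using a by (simp add: c_def)
 have A: "c\<^sup>2 * l powr (2 - N) * ?a = 1" unfolding c2 using a l by (simp add: powr_add[symmetric])
 have ll: "l powr (2 - 2 * s) = ?b / ?a" using a b s1 by (simp add: l_def powr_powr)
 have "l powr (N - 2) * l powr (2 * s - N) = 1 / l powr (2 - 2 * s)"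
  by (simp add: powr_add[symmetric] powr_minus_divide[symmetric] algebra_simps)
 then have B: "c\<^sup>2 * l powr (2 * s - N) * ?b = 1" unfolding c2 ll using a b by simp
 have e: "c powr p * l powr (- N) = 1 / (?b powr al * ?a powr be)"
 proof -
  have "c\<^sup>2 * l powr (2 * s - N) = 1 / ?b" "c\<^sup>2 * l powr (2 - N) = 1 / ?a"
   using A B a b by (simp_all add: eq_divide_eq)
  then have "c powr p * l powr (- N) = (1 / ?b) powr al * (1 / ?a) powr be"
   using scale_exponents[OF c l] by simp
  then show ?thesis using a b by (simp add: powr_divide)
 qed
 note sc = scaled[OF u l, of c]
 have "ennreal (?b powr al * ?a powr be) * Lp_enn p (\<lambda>x. c * u (l *\<^sub>R x)) = ennreal (?b powr al * ?a powr be) * ennreal (1 / (?b powr al * ?a powr be)) * Lp_enn p u"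
  unfolding sc(4) using c by (simp only: abs_of_pos e mult.assoc)
 also have "\<dots> = Lp_enn p u" using a b by (subst ennreal_mult[symmetric]) auto
 finally have E: "ennreal (?b powr al * ?a powr be) * Lp_enn p (\<lambda>x. c * u (l *\<^sub>R x)) = Lp_enn p u" .
 have "D12_sq (\<lambda>x. c * u (l *\<^sub>R x)) = 1" "Ds2_sq s (\<lambda>x. c * u (l *\<^sub>R x)) = 1"
  unfolding sc A B by simp_all
 then show ?thesis using c l E by blast
qed

definition NT :: "(real^'n => real) set" where
 "NT = {u. test_fun u \<and> D12_sq u = 1 \<and> Ds2_sq s u = 1}"

text \<open>The supremum over normalised test functions: homogeneity and approximation extend the
  bound to the whole space, and optimality is inherited because test functions belong to it.\<close>

definition "Cgn = (SUP u\<in>NT. enn2real (Lp_enn p u))"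

lemma tail_ex:
 "\<exists>\<epsilon> :: nat => real. \<epsilon> \<longlonglongrightarrow> 0 \<and> (\<forall>m. 0 <= \<epsilon> m) \<and>
  (\<forall>(u :: real^'n => real) m. test_fun u \<longrightarrow> D12_sq u <= 1 \<longrightarrow> Ds2_sq s u <= 1 \<longrightarrow>
   Lp_enn p u <= ennreal (\<epsilon> m) + ennreal ((2 powr p) ^ m) * emeasure \<L> {x. (1/2) ^ Suc m < \<bar>u x\<bar>})"
 by (rule tail_estimate) (intro exI conjI allI impI)

text \<open>The tail estimate at m = 0, with the remaining level set {|u| > 1/2} bounded by the
  weak-type estimate.\<close>

lemma NT_bdd: "bdd_above ((\<lambda>u. enn2real (Lp_enn p u)) ` NT)"
proof -
 obtain \<epsilon> :: "nat => real" where \<epsilon>: "\<And>m. 0 <= \<epsilon> m"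
  "\<And>(u :: real^'n => real) m. test_fun u ==> D12_sq u <= 1 ==> Ds2_sq s u <= 1 ==>
   Lp_enn p u <= ennreal (\<epsilon> m) + ennreal ((2 powr p) ^ m) * emeasure \<L> {x. (1/2) ^ Suc m < \<bar>u x\<bar>}"
  using tail_ex by blast
 show ?thesis
 proof (rule bdd_aboveI2)
  fix u assume "u \<in> NT"
  then have u: "test_fun u" "D12_sq u <= 1" "Ds2_sq s u <= 1" by (auto simp: NT_def)
  have "Lp_enn p u <= ennreal (\<epsilon> 0) + emeasure \<L> {x. (1/2) ^ Suc 0 < \<bar>u x\<bar>}" using \<epsilon>(2)[OF u, of 0] by simp
  also have "\<dots> <= ennreal (\<epsilon> 0) + ennreal (K1 * (1/2) powr (- q1))"
   using level_bounds(1)[OF u, of "1/2"] level_set_finite[OF u(1), of "1/2"] by (intro add_mono) (auto intro: ennreal_leI)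
  also have "\<dots> = ennreal (\<epsilon> 0 + K1 * (1/2) powr (- q1))" using \<epsilon>(1) by (subst ennreal_plus) (auto simp: K1_def)
  finally show "enn2real (Lp_enn p u) <= \<epsilon> 0 + K1 * (1/2) powr (- q1)"
   using \<epsilon>(1)[of 0] by (intro enn2real_leI add_nonneg_nonneg) (auto simp: K1_def)
 qed
qed

lemma test_fun_scaled:
 "l > 0 ==> test_fun u ==> test_fun (\<lambda>x. c * u (l *\<^sub>R x))" for u :: "real^'n => real"
 by (rule test_fun_scale[OF test_fun_simil[OF _ simil_scale]])

lemma NT_positive: "\<exists>u\<in>NT. 0 < Lp_enn p u"
proof -
 let ?b = "bump 0 1 :: real^'n => real"
 have nz: "\<not> (AE x in \<L>. ?b x = 0)"
 proof
  assume "AE x in \<L>. ?b x = 0"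
  then obtain M where M: "M \<in> null_sets \<L>" "{x. ?b x \<noteq> 0} \<subseteq> M" by (auto simp: eventually_ae_filter)
  have "ball 0 1 \<subseteq> M" using M(2) bump_pos[of _ 0 1] by (force simp: dist_commute)
  then have "emeasure \<L> (ball (0::real^'n) 1) <= emeasure \<L> M" using M(1) by (intro emeasure_mono) auto
  then have "emeasure \<L> (ball (0::real^'n) 1) = 0" using M(1) by auto
  then show False using emeasure_ball_leb[of 1 "0::real^'n"] unit_ball_vol_pos[of "real CARD('n)"] by simp
 qed
 have ab: "D12_sq ?b > 0" "Ds2_sq s ?b > 0"
  using test_zero[OF test_fun_bump[of 0 1]] nz D12_sq_nonneg[of ?b] Ds2_sq_nonneg[of s ?b] by (metis less_eq_real_def)+
 obtain c l where cl: "c > 0" "l > 0" "D12_sq (\<lambda>x. c * ?b (l *\<^sub>R x)) = 1" "Ds2_sq s (\<lambda>x. c * ?b (l *\<^sub>R x)) = 1"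
  "ennreal (Ds2_sq s ?b powr al * D12_sq ?b powr be) * Lp_enn p (\<lambda>x. c * ?b (l *\<^sub>R x)) = Lp_enn p ?b"
  using normalize[OF fin_E_test[OF s0 s1 test_fun_bump] ab] by metis
 have "Lp_enn p ?b \<noteq> 0" using nz Lp_zero_iff[OF test_fun_measurable[OF test_fun_bump]] by simp
 then have "Lp_enn p (\<lambda>x. c * ?b (l *\<^sub>R x)) \<noteq> 0" using cl(5) by auto
 moreover have "(\<lambda>x. c * ?b (l *\<^sub>R x)) \<in> NT" using cl by (simp add: NT_def test_fun_scaled test_fun_bump)
 ultimately show ?thesis by (auto simp: zero_less_iff_neq_zero)
qed

lemma NT_le: "u \<in> NT ==> Lp_enn p u <= ennreal Cgn"
proof -
 assume u: "u \<in> NT"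
 then have "enn2real (Lp_enn p u) <= Cgn" unfolding Cgn_def by (intro cSUP_upper NT_bdd)
 moreover have "Lp_enn p u < \<infinity>" using u Lp_test_finite by (simp add: NT_def)
 ultimately show ?thesis by (metis ennreal_enn2real ennreal_leI infinity_ennreal_def)
qed

lemma Cgn_pos: "Cgn > 0"
proof -
 obtain u where u: "u \<in> NT" "0 < Lp_enn p u" using NT_positive by blast
 have "0 < ennreal Cgn" using NT_le[OF u(1)] u(2) by (rule less_le_trans[rotated])
 then show ?thesis by simp
qed

lemma Cgn_least:
 assumes "\<And>u. u \<in> NT ==> Lp_enn p u <= ennreal C'" shows "Cgn <= C'"
proof -
 obtain u where u: "u \<in> NT" "0 < Lp_enn p u" using NT_positive by blast
 have "0 < ennreal C'" using assms[OF u(1)] u(2) by (rule less_le_trans[rotated])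
 then have C': "C' > 0" by simp
 show ?thesis unfolding Cgn_def
  by (rule cSUP_least) (use u assms C' in \<open>auto intro!: enn2real_leI\<close>)
qed

lemma GN_test:
 fixes u :: "real^'n => real"
 assumes u: "test_fun u"
 shows "Lp_enn p u <= ennreal (Cgn * (Ds2_sq s u powr al * D12_sq u powr be))"
proof (cases "D12_sq u = 0 \<or> Ds2_sq s u = 0")
 case True
 then show ?thesis using Lp_zero[OF test_zero[OF u]] by simp
next
 case False
 then have ab: "D12_sq u > 0" "Ds2_sq s u > 0" using D12_sq_nonneg[of u] Ds2_sq_nonneg[of s u] by linarith+
 obtain c l where cl: "c > 0" "l > 0" "D12_sq (\<lambda>x. c * u (l *\<^sub>R x)) = 1" "Ds2_sq s (\<lambda>x. c * u (l *\<^sub>R x)) = 1"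
  "ennreal (Ds2_sq s u powr al * D12_sq u powr be) * Lp_enn p (\<lambda>x. c * u (l *\<^sub>R x)) = Lp_enn p u"
  using normalize[OF fin_E_test[OF s0 s1 u] ab] by metis
 have "(\<lambda>x. c * u (l *\<^sub>R x)) \<in> NT" using cl u by (simp add: NT_def test_fun_scaled)
 then have "ennreal (Ds2_sq s u powr al * D12_sq u powr be) * Lp_enn p (\<lambda>x. c * u (l *\<^sub>R x)) <= ennreal (Ds2_sq s u powr al * D12_sq u powr be) * ennreal Cgn"
  by (intro mult_left_mono NT_le) auto
 then show ?thesis unfolding cl(5) using Cgn_pos by (simp add: ennreal_mult[symmetric] mult_ac)
qed

text \<open>The right side is continuous along the approximating sequence; the left side is lower
  semicontinuous by Fatou along an almost everywhere convergent subsequence.\<close>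

lemma GN_E:
 fixes u :: "real^'n => real"
 assumes "u \<in> E_space s"
 shows "Lp_enn p u <= ennreal (Cgn * (Ds2_sq s u powr al * D12_sq u powr be))"
proof -
 obtain \<phi> where fu: "fin_E s u" and \<phi>: "\<And>k. test_fun (\<phi> k)" "(\<lambda>k. D12_sq (\<lambda>x. \<phi> k x - u x) + Ds2_sq s (\<lambda>x. \<phi> k x - u x)) \<longlonglongrightarrow> 0" "L1c \<phi> u"
  using E_spaceD'[OF assms] by blast
 note [measurable] = fin_E_measurable[OF fu] test_fun_measurable[OF \<phi>(1)]
 obtain r where r: "strict_mono r" "AE x in \<L>. (\<lambda>k. \<phi> (r k) x) \<longlonglongrightarrow> u x"
  using L1c_AE_subseq[OF _ _ \<phi>(3)] fin_E_measurable[OF fu] test_fun_measurable[OF \<phi>(1)] by blast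
 have fE: "fin_E s (\<phi> k)" for k by (intro fin_E_test s0 s1 \<phi>)
 let ?f = "\<lambda>k. Cgn * (Ds2_sq s (\<phi> k) powr al * D12_sq (\<phi> k) powr be)"
 have "?f \<longlonglongrightarrow> Cgn * (Ds2_sq s u powr al * D12_sq u powr be)"
  using exponents(1,2) by (intro tendsto_mult tendsto_const tendsto_powr' form_tendsto[OF fE fu \<phi>(2)]) auto
 then have lim: "(\<lambda>k. ?f (r k)) \<longlonglongrightarrow> Cgn * (Ds2_sq s u powr al * D12_sq u powr be)"
  using LIMSEQ_subseq_LIMSEQ[OF _ r(1)] by (auto simp: o_def)
 show ?thesis
 proof (rule ennreal_le_epsilon)
  fix e :: real assume e: "0 < e"
  have "Lp_enn p u <= ennreal (Cgn * (Ds2_sq s u powr al * D12_sq u powr be) + e)"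
   unfolding Lp_enn_def
  proof (rule Fatou_bound[where f="\<lambda>k x. ennreal (\<bar>\<phi> (r k) x\<bar> powr p)"])
   show "AE x in \<L>. (\<lambda>k. ennreal (\<bar>\<phi> (r k) x\<bar> powr p)) \<longlonglongrightarrow> ennreal (\<bar>u x\<bar> powr p)"
    using r(2) by eventually_elim (use exponents(4) in \<open>auto intro!: tendsto_ennrealI tendsto_powr' tendsto_rabs\<close>)
   have "\<forall>\<^sub>F k in sequentially. ?f (r k) < Cgn * (Ds2_sq s u powr al * D12_sq u powr be) + e"
    using e by (intro order_tendstoD(2)[OF lim]) simp
   then show "\<forall>\<^sub>F k in sequentially. (\<integral>\<^sup>+x. ennreal (\<bar>\<phi> (r k) x\<bar> powr p) \<partial>\<L>) <= ennreal (Cgn * (Ds2_sq s u powr al * D12_sq u powr be) + e)"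
   proof eventually_elim
    case (elim k)
    then show ?case using GN_test[OF \<phi>(1), of "r k"] unfolding Lp_enn_def by (auto elim!: order_trans intro!: ennreal_leI)
   qed
  qed measurable
  also have "\<dots> = ennreal (Cgn * (Ds2_sq s u powr al * D12_sq u powr be)) + ennreal e"
   using Cgn_pos e by (intro ennreal_plus) auto
  finally show "Lp_enn p u <= ennreal (Cgn * (Ds2_sq s u powr al * D12_sq u powr be)) + ennreal e" .
 qed
qed

lemma GN_rhs:
 fixes u :: "real^'n => real"
 shows "C * Ds2_norm s u powr ((2*N - p*(N-2)) / (2*(1-s))) * D12_norm u powr ((p*(N-2 * s) - 2*N) / (2*(1-s)))
  = C * (Ds2_sq s u powr al * D12_sq u powr be)"
proof -
 have h: "sqrt x powr y = x powr (y / 2)" if "x \<ge> 0" for x y :: real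
  using that by (simp add: powr_half_sqrt[symmetric] powr_powr)
 have "(2*N - p*(N-2)) / (2*(1-s)) / 2 = al" "(p*(N-2 * s) - 2*N) / (2*(1-s)) / 2 = be"
  by (simp_all add: al_def be_def)
 then show ?thesis unfolding Ds2_norm_def D12_norm_def by (simp add: h)
qed

lemma GN_ineq_iff:
 fixes u :: "real^'n => real"
 shows "GN_ineq s p C u \<longleftrightarrow> Lp_enn p u <= ennreal (C * (Ds2_sq s u powr al * D12_sq u powr be))"
 unfolding GN_ineq_def Let_def N_def[symmetric] GN_rhs ..

lemma GN_optimizer_iff:
 fixes u :: "real^'n => real"
 shows "GN_optimizer s p C u \<longleftrightarrow> u \<in> E_space s \<and> \<not> (AE x in \<L>. u x = 0) \<and>
  Lp_enn p u = ennreal (C * (Ds2_sq s u powr al * D12_sq u powr be))"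
 unfolding GN_optimizer_def Let_def N_def[symmetric] GN_rhs ..

lemma Cgn_best:
 assumes "\<forall>u\<in>E_space s. GN_ineq s p C' (u :: real^'n => real)" shows "Cgn <= C'"
proof (rule Cgn_least)
 fix u :: "real^'n => real" assume u: "u \<in> NT"
 then have "u \<in> E_space s" using test_in_E[OF s0 s1, of u] by (simp add: NT_def)
 then have "GN_ineq s p C' u" using assms by blast
 then show "Lp_enn p u <= ennreal C'" using u unfolding GN_ineq_iff by (simp add: NT_def)
qed

end

section \<open>Local compactness by dyadic cells\<close>

text \<open>Index of the half-open cube of side 2^-m containing the point. Integer vectors form a
  countable type, as the diagonal extraction demands.\<close>

definition cell :: "nat => real^'n::finite => int^'n" where
 "cell m x = (\<chi> i. \<lfloor>2 ^ m * x $ i\<rfloor>)"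

definition cellset :: "nat => int^'n::finite => (real^'n) set" where
 "cellset m k = {x. cell m x = k}"

lemma cellset_iff: "x \<in> cellset m k \<longleftrightarrow> (\<forall>i. real_of_int (k $ i) <= 2 ^ m * x $ i \<and> 2 ^ m * x $ i < real_of_int (k $ i) + 1)"
 by (auto simp: cellset_def cell_def vec_eq_iff floor_eq_iff)

lemma cellset_sets [measurable]: "cellset m k \<in> sets \<L>"
proof -
 have "(\<lambda>x::real^'a. 2 ^ m * x $ i) -` {real_of_int (k $ i)..<real_of_int (k $ i) + 1} \<inter> space \<L> \<in> sets \<L>" for i
  by (rule measurable_sets[OF borel_measurable_times[OF borel_measurable_const borel_measurable_nth[OF borel_ident_lebesgue]]]) simp
 then have "(\<Inter>i. (\<lambda>x::real^'a. 2 ^ m * x $ i) -` {real_of_int (k $ i)..<real_of_int (k $ i) + 1} \<inter> space \<L>) \<in> sets \<L>"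
  by (intro sets.finite_INT) auto
 also have "(\<Inter>i. (\<lambda>x::real^'a. 2 ^ m * x $ i) -` {real_of_int (k $ i)..<real_of_int (k $ i) + 1} \<inter> space \<L>) = cellset m k"
  by (auto simp: cellset_iff)
 finally show ?thesis .
qed

lemma cellset_dist:
 fixes x y :: "real^'n::finite"
 assumes "x \<in> cellset m k" "y \<in> cellset m k" shows "dist x y < 2 * real CARD('n) * (1/2) ^ m"
proof -
 have "\<bar>(x - y) $ i\<bar> <= (1/2) ^ m" for i
 proof -
  have "\<bar>2 ^ m * x $ i - 2 ^ m * y $ i\<bar> <= 1" using assms unfolding cellset_iff by (smt (verit))
  then have "2 ^ m * \<bar>x $ i - y $ i\<bar> <= 1" by (simp add: abs_mult right_diff_distrib[symmetric])
  then show ?thesis by (simp add: power_one_over field_simps)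
 qed
 then have "norm (x - y) <= (\<Sum>i::'n\<in>UNIV. (1/2) ^ m)" by (intro order_trans[OF norm_le_l1_cart] sum_mono) auto
 also have "\<dots> < 2 * real CARD('n) * (1/2) ^ m" by simp
 finally show ?thesis by (simp add: dist_norm)
qed

lemma cellset_emeasure: "emeasure \<L> (cellset m k :: (real^'n::finite) set) = ennreal (((1/2) ^ m) ^ CARD('n))"
proof -
 define a :: "real^'n" where "a = (\<chi> i. real_of_int (k $ i) / 2 ^ m)"
 define b :: "real^'n" where "b = (\<chi> i. (real_of_int (k $ i) + 1) / 2 ^ m)"
 have ab: "(b - a) \<bullet> e = (1/2) ^ m" "a \<bullet> e <= b \<bullet> e" if e: "e \<in> Basis" for e
 proof -
  obtain i where "e = axis i 1" using e by (auto simp: Basis_vec_def)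
  then show "(b - a) \<bullet> e = (1/2) ^ m" "a \<bullet> e <= b \<bullet> e"
   by (simp_all add: inner_axis a_def b_def diff_divide_distrib[symmetric] power_one_over divide_right_mono)
 qed
 have pr: "(\<Prod>e\<in>Basis. (b - a) \<bullet> e) = ((1/2) ^ m) ^ CARD('n)" using ab(1) by simp
 have sub: "box a b \<subseteq> cellset m k" "cellset m k \<subseteq> cbox a b"
  by (auto simp: cellset_iff mem_box_cart a_def b_def field_simps less_imp_le)
 have e: "emeasure \<L> (box a b) = ennreal (((1/2) ^ m) ^ CARD('n))" "emeasure \<L> (cbox a b) = ennreal (((1/2) ^ m) ^ CARD('n))"
  using emeasure_lborel_box[of a b] emeasure_lborel_cbox[of a b] ab(2) pr by auto
 show ?thesis
 proof (rule antisym)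
  show "emeasure \<L> (cellset m k) <= ennreal (((1/2) ^ m) ^ CARD('n))"
   unfolding e(2)[symmetric] by (rule emeasure_mono[OF sub(2)]) simp
  show "ennreal (((1/2) ^ m) ^ CARD('n)) <= emeasure \<L> (cellset m k)"
   unfolding e(1)[symmetric] by (rule emeasure_mono[OF sub(1) cellset_sets])
 qed
qed

lemma cellset_disjoint: "disjoint_family_on (cellset m) I"
 by (auto simp: disjoint_family_on_def cellset_def)

text \<open>Cells that meet the ball are disjoint, of equal volume, and lie in the ball enlarged by
  2N. Comparing volumes bounds the number of cells, first for finite subfamilies and thereby for
  all.\<close>

lemma cells_of_ball:
 fixes R :: real
 assumes R: "R > 0"
 shows "finite (cell m ` ball (0::real^'n::finite) R)"
  and "real (card (cell m ` ball (0::real^'n) R)) * ((1/2) ^ m) ^ CARD('n) <= unit_ball_vol (real CARD('n)) * (R + 2 * real CARD('n)) ^ CARD('n)"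
proof -
 let ?I = "cell m ` ball (0::real^'n) R" and ?V = "unit_ball_vol (real CARD('n)) * (R + 2 * real CARD('n)) ^ CARD('n)" and ?\<mu> = "((1/2::real) ^ m) ^ CARD('n)"
 have key: "real (card J) * ?\<mu> <= ?V" if J: "J \<subseteq> ?I" "finite J" for J
 proof -
  have sub: "(\<Union>k\<in>J. cellset m k) \<subseteq> ball 0 (R + 2 * real CARD('n))"
  proof
   fix y assume "y \<in> (\<Union>k\<in>J. cellset m k)"
   then obtain k x where kx: "y \<in> cellset m k" "k = cell m x" "norm x < R" using J(1) by force
   then have "dist x y < 2 * real CARD('n) * (1/2) ^ m" by (intro cellset_dist[of x m k]) (auto simp: cellset_def)
   also have "\<dots> <= 2 * real CARD('n) * 1" by (intro mult_left_mono power_le_one) auto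
   finally show "y \<in> ball 0 (R + 2 * real CARD('n))"
    using kx(3) norm_triangle_sub[of y x] by (simp add: dist_norm norm_minus_commute)
  qed
  have "ennreal (real (card J) * ?\<mu>) = (\<Sum>k\<in>J. emeasure \<L> (cellset m k :: (real^'n) set))"
   by (simp add: cellset_emeasure ennreal_mult ennreal_of_nat_eq_real_of_nat)
  also have "\<dots> = emeasure \<L> (\<Union>k\<in>J. cellset m k)"
   by (rule sum_emeasure) (use J cellset_disjoint cellset_sets in auto)
  also have "\<dots> <= emeasure \<L> (ball (0::real^'n) (R + 2 * real CARD('n)))" using sub by (intro emeasure_mono) auto
  also have "\<dots> = ennreal ?V" using R by (intro emeasure_ball_leb) simp
  finally show ?thesis using R by simp
 qed
 have \<mu>: "?\<mu> > 0" by simp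
 have "finite ?I \<and> card ?I <= nat \<lceil>?V / ?\<mu>\<rceil>"
 proof (rule finite_if_finite_subsets_card_bdd)
  fix G assume "G \<subseteq> ?I" "finite G"
  then have "real (card G) <= ?V / ?\<mu>" using key \<mu> by (simp only: pos_le_divide_eq)
  then show "card G <= nat \<lceil>?V / ?\<mu>\<rceil>" by linarith
 qed
 then show f: "finite ?I" ..
 show "real (card ?I) * ?\<mu> <= ?V" by (rule key[OF order_refl f])
qed

text \<open>A Poincare-type estimate: f(x) minus the mean over the cell is the mean of f(x) - f(y),
  and these differences are treated by |d| <= \<delta> + d^2 / \<delta>.\<close>

lemma cell_L1_bound:
 fixes f :: "real^'n::finite => real" and m :: nat
 assumes f: "integrable \<L> f" and \<delta>: "\<delta> > 0"
 defines "\<mu> \<equiv> ((1/2::real) ^ m) ^ CARD('n)"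
 shows "(\<integral>\<^sup>+x. ennreal \<bar>f x\<bar> * indicator (cellset m k) x \<partial>\<L>) \<le>
  ennreal \<bar>\<integral>x. indicator (cellset m k) x * f x \<partial>\<L>\<bar> + ennreal (\<delta> * \<mu>) +
  ennreal (1 / (\<mu> * \<delta>)) * (\<integral>\<^sup>+z. ennreal ((f (fst z) - f (snd z))\<^sup>2) * indicator (cellset m k \<times> cellset m k) z \<partial>\<L>\<^sub>2)"
proof -
 let ?Q = "cellset m k :: (real^'n) set"
 let ?m = "\<integral>x. indicator ?Q x * f x \<partial>\<L>"
 have \<mu>: "\<mu> > 0" by (simp add: \<mu>_def)
 have Qm: "emeasure \<L> ?Q = ennreal \<mu>" by (simp add: cellset_emeasure \<mu>_def)
 have [measurable]: "f \<in> \<M>" using f by auto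
 have fQ: "integrable \<L> (\<lambda>x. indicator ?Q x * f x)"
  using integrable_mult_indicator[OF cellset_sets f, of m k] by simp
 have cQ: "integrable \<L> (\<lambda>y. indicator ?Q y * c)" for c :: real
  using Qm by (intro integrable_mult_left integrable_real_indicator) auto
 have mQ: "measure \<L> ?Q = \<mu>" using Qm \<mu> by (simp add: measure_def)
 let ?g = "\<lambda>z. ennreal ((f (fst z) - f (snd z))\<^sup>2) * indicator (?Q \<times> ?Q) z"
 have gm[measurable]: "?g \<in> borel_measurable \<L>\<^sub>2"
  by (intro borel_measurable_times_ennreal incr_measurable borel_measurable_indicator pair_measureI cellset_sets) measurable
 have pt: "ennreal \<bar>f x\<bar> * indicator ?Q x <= ennreal (\<bar>?m\<bar> / \<mu> + \<delta>) * indicator ?Q x + ennreal (1 / (\<mu> * \<delta>)) * (\<integral>\<^sup>+y. ?g (x, y) \<partial>\<L>)" for x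
 proof (cases "x \<in> ?Q")
  case True
  have di: "integrable \<L> (\<lambda>y. indicator ?Q y * (f x - f y))"
   using Bochner_Integration.integrable_diff[OF cQ[of "f x"] fQ] by (simp add: algebra_simps)
  have "f x * \<mu> - ?m = (\<integral>y. indicator ?Q y * (f x - f y) \<partial>\<L>)"
   using Bochner_Integration.integral_diff[OF cQ[of "f x"] fQ] by (simp add: mQ algebra_simps)
  then have "ennreal (norm (f x * \<mu> - ?m)) <= (\<integral>\<^sup>+y. norm (indicator ?Q y * (f x - f y)) \<partial>\<L>)"
   using integral_norm_bound_ennreal[OF di] by simp
  also have "\<dots> <= (\<integral>\<^sup>+y. ennreal \<delta> * indicator ?Q y + ennreal (1/\<delta>) * ?g (x, y) \<partial>\<L>)"
  proof (rule nn_integral_mono)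
   fix y
   have "\<bar>d\<bar> <= \<delta> + (1/\<delta>) * d\<^sup>2" for d :: real
   proof (cases "\<bar>d\<bar> <= \<delta>")
    case True
    have "0 <= (1/\<delta>) * d\<^sup>2" using \<delta> by simp
    then show ?thesis using True by linarith
   next
    case False
    then have "\<bar>d\<bar> * \<delta> <= \<bar>d\<bar> * \<bar>d\<bar>" by (intro mult_left_mono) auto
    then have "\<bar>d\<bar> <= (1/\<delta>) * d\<^sup>2" using \<delta> by (simp add: field_simps power2_eq_square)
    then show ?thesis using \<delta> by linarith
   qed
   then have "ennreal \<bar>f x - f y\<bar> <= ennreal \<delta> + ennreal (1/\<delta>) * ennreal ((f x - f y)\<^sup>2)"
    using \<delta> by (simp add: ennreal_mult[symmetric] ennreal_plus[symmetric] del: ennreal_plus)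
   then show "ennreal (norm (indicator ?Q y * (f x - f y))) <= ennreal \<delta> * indicator ?Q y + ennreal (1/\<delta>) * ?g (x, y)"
    using True by (simp add: indicator_def)
  qed
  also have "\<dots> = ennreal \<delta> * ennreal \<mu> + ennreal (1/\<delta>) * (\<integral>\<^sup>+y. ?g (x, y) \<partial>\<L>)"
  proof -
   have gx: "(\<lambda>y. ?g (x, y)) \<in> \<M>" by (rule measurable_Pair2[OF gm]) simp
   have "(\<integral>\<^sup>+y. ennreal \<delta> * indicator ?Q y + ennreal (1/\<delta>) * ?g (x, y) \<partial>\<L>) =
    (\<integral>\<^sup>+y. ennreal \<delta> * indicator ?Q y \<partial>\<L>) + (\<integral>\<^sup>+y. ennreal (1/\<delta>) * ?g (x, y) \<partial>\<L>)"
    by (rule nn_integral_add) (auto intro!: borel_measurable_times_ennreal gx simp del: fst_conv snd_conv)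
   also have "(\<integral>\<^sup>+y. ennreal (1/\<delta>) * ?g (x, y) \<partial>\<L>) = ennreal (1/\<delta>) * (\<integral>\<^sup>+y. ?g (x, y) \<partial>\<L>)"
    by (rule nn_integral_cmult[OF gx])
   also have "(\<integral>\<^sup>+y. ennreal \<delta> * indicator ?Q y \<partial>\<L>) = ennreal \<delta> * ennreal \<mu>"
    by (subst nn_integral_cmult_indicator) (auto simp: Qm)
   finally show ?thesis .
  qed
  finally have 1: "ennreal \<bar>f x * \<mu> - ?m\<bar> <= ennreal \<delta> * ennreal \<mu> + ennreal (1/\<delta>) * (\<integral>\<^sup>+y. ?g (x, y) \<partial>\<L>)" by simp
  have "ennreal \<bar>f x\<bar> <= ennreal (\<bar>?m\<bar> / \<mu> + (1/\<mu>) * \<bar>f x * \<mu> - ?m\<bar>)"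
  proof (rule ennreal_leI)
   have "\<bar>f x\<bar> = (1/\<mu>) * \<bar>f x * \<mu>\<bar>" using \<mu> by (simp add: abs_mult)
   also have "\<dots> <= (1/\<mu>) * (\<bar>?m\<bar> + \<bar>f x * \<mu> - ?m\<bar>)" using \<mu> by (intro mult_left_mono) auto
   finally show "\<bar>f x\<bar> <= \<bar>?m\<bar> / \<mu> + (1/\<mu>) * \<bar>f x * \<mu> - ?m\<bar>" by (simp add: distrib_left)
  qed
  also have "\<dots> = ennreal (\<bar>?m\<bar> / \<mu>) + ennreal (1/\<mu>) * ennreal \<bar>f x * \<mu> - ?m\<bar>"
   using \<mu> by (simp add: ennreal_mult[symmetric] ennreal_plus[symmetric] del: ennreal_plus)
  also have "\<dots> <= ennreal (\<bar>?m\<bar> / \<mu>) + ennreal (1/\<mu>) * (ennreal \<delta> * ennreal \<mu> + ennreal (1/\<delta>) * (\<integral>\<^sup>+y. ?g (x, y) \<partial>\<L>))"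
   by (intro add_mono mult_left_mono order_refl 1) auto
  also have "\<dots> = ennreal (\<bar>?m\<bar> / \<mu>) + (ennreal (1/\<mu>) * (ennreal \<delta> * ennreal \<mu>) + (ennreal (1/\<mu>) * ennreal (1/\<delta>)) * (\<integral>\<^sup>+y. ?g (x, y) \<partial>\<L>))"
   by (simp only: distrib_left mult.assoc)
  also have "ennreal (1/\<mu>) * (ennreal \<delta> * ennreal \<mu>) = ennreal \<delta>"
   using \<mu> \<delta> by (simp add: ennreal_mult[symmetric])
  also have "ennreal (1/\<mu>) * ennreal (1/\<delta>) = ennreal (1/(\<mu> * \<delta>))"
   using \<mu> \<delta> by (simp add: ennreal_mult[symmetric])
  also have "ennreal (\<bar>?m\<bar> / \<mu>) + (ennreal \<delta> + ennreal (1/(\<mu> * \<delta>)) * (\<integral>\<^sup>+y. ?g (x, y) \<partial>\<L>)) = ennreal (\<bar>?m\<bar> / \<mu> + \<delta>) + ennreal (1/(\<mu> * \<delta>)) * (\<integral>\<^sup>+y. ?g (x, y) \<partial>\<L>)"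
   using \<mu> \<delta> by (simp add: add.assoc)
  finally show ?thesis using True by simp
 qed simp
 have "(\<integral>\<^sup>+x. ennreal \<bar>f x\<bar> * indicator ?Q x \<partial>\<L>) <= (\<integral>\<^sup>+x. ennreal (\<bar>?m\<bar> / \<mu> + \<delta>) * indicator ?Q x + ennreal (1 / (\<mu> * \<delta>)) * (\<integral>\<^sup>+y. ?g (x, y) \<partial>\<L>) \<partial>\<L>)"
  by (intro nn_integral_mono pt)
 also have "\<dots> = (\<integral>\<^sup>+x. ennreal (\<bar>?m\<bar> / \<mu> + \<delta>) * indicator ?Q x \<partial>\<L>) + (\<integral>\<^sup>+x. ennreal (1 / (\<mu> * \<delta>)) * (\<integral>\<^sup>+y. ?g (x, y) \<partial>\<L>) \<partial>\<L>)"
  by (rule nn_integral_add) (auto intro!: borel_measurable_times_ennreal leb.borel_measurable_nn_integral_fst gm simp del: fst_conv snd_conv)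
 also have "(\<integral>\<^sup>+x. ennreal (\<bar>?m\<bar> / \<mu> + \<delta>) * indicator ?Q x \<partial>\<L>) = ennreal (\<bar>?m\<bar> / \<mu> + \<delta>) * ennreal \<mu>"
  by (subst nn_integral_cmult_indicator) (auto simp: Qm)
 also have "(\<integral>\<^sup>+x. ennreal (1 / (\<mu> * \<delta>)) * (\<integral>\<^sup>+y. ?g (x, y) \<partial>\<L>) \<partial>\<L>) = ennreal (1 / (\<mu> * \<delta>)) * (\<integral>\<^sup>+x. \<integral>\<^sup>+y. ?g (x, y) \<partial>\<L> \<partial>\<L>)"
  by (rule nn_integral_cmult) (rule leb.borel_measurable_nn_integral_fst[OF gm])
 also have "(\<integral>\<^sup>+x. \<integral>\<^sup>+y. ?g (x, y) \<partial>\<L> \<partial>\<L>) = (\<integral>\<^sup>+z. ?g z \<partial>\<L>\<^sub>2)"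
  by (rule leb.nn_integral_fst[OF gm])
 also have "ennreal (\<bar>?m\<bar> / \<mu> + \<delta>) * ennreal \<mu> = ennreal \<bar>?m\<bar> + ennreal (\<delta> * \<mu>)"
  using \<mu> \<delta> by (simp add: ennreal_mult[symmetric] ennreal_plus[symmetric] distrib_right del: ennreal_plus)
 finally show ?thesis .
qed

text \<open>The squares of distinct cells are disjoint sets of pairs at distance below 2N 2^-m, so a
  single \<open>incr\<close> bounds the increment terms of all cells together.\<close>

lemma ball_L1_bound:
 fixes f :: "real^'n::finite => real" and m :: nat
 assumes f: "integrable \<L> f" and \<delta>: "\<delta> > 0" and R: "R > 0"
 defines "\<mu> \<equiv> ((1/2::real) ^ m) ^ CARD('n)" and "I \<equiv> cell m ` ball (0::real^'n) R"
 shows "(\<integral>\<^sup>+x. ennreal \<bar>f x\<bar> * indicator (ball 0 R) x \<partial>\<L>) \<le>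
  ennreal (\<Sum>k\<in>I. \<bar>\<integral>x. indicator (cellset m k) x * f x \<partial>\<L>\<bar>)
  + ennreal (\<delta> * (unit_ball_vol (real CARD('n)) * (R + 2 * real CARD('n)) ^ CARD('n)))
  + ennreal (1 / (\<mu> * \<delta>)) * incr f (2 * real CARD('n) * (1/2) ^ m)"
proof -
 have [measurable]: "f \<in> \<M>" using f by auto
 note fin = cells_of_ball[OF R, of m, where 'n='n, folded I_def]
 let ?r = "2 * real CARD('n) * (1/2) ^ m"
 let ?h = "\<lambda>k z. ennreal ((f (fst z) - f (snd z))\<^sup>2) * indicator (cellset m k \<times> cellset m k) z"
 have hm: "?h k \<in> borel_measurable \<L>\<^sub>2" for k
  by (intro borel_measurable_times_ennreal incr_measurable borel_measurable_indicator pair_measureI cellset_sets) measurable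
 have "(\<integral>\<^sup>+x. ennreal \<bar>f x\<bar> * indicator (ball 0 R) x \<partial>\<L>) <= (\<integral>\<^sup>+x. (\<Sum>k\<in>I. ennreal \<bar>f x\<bar> * indicator (cellset m k) x) \<partial>\<L>)"
 proof (rule nn_integral_mono)
  fix x
  show "ennreal \<bar>f x\<bar> * indicator (ball 0 R) x <= (\<Sum>k\<in>I. ennreal \<bar>f x\<bar> * indicator (cellset m k) x)"
  proof (cases "x \<in> ball 0 R")
   case True
   then have "cell m x \<in> I" by (simp add: I_def)
   then have "ennreal \<bar>f x\<bar> * indicator (cellset m (cell m x)) x <= (\<Sum>k\<in>I. ennreal \<bar>f x\<bar> * indicator (cellset m k) x)"
    using fin by (intro member_le_sum) auto
   then show ?thesis using True by (simp add: cellset_def)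
  qed simp
 qed
 also have "\<dots> = (\<Sum>k\<in>I. (\<integral>\<^sup>+x. ennreal \<bar>f x\<bar> * indicator (cellset m k) x \<partial>\<L>))"
  by (rule nn_integral_sum) measurable
 also have "\<dots> <= (\<Sum>k\<in>I. ennreal \<bar>\<integral>x. indicator (cellset m k) x * f x \<partial>\<L>\<bar> + ennreal (\<delta> * \<mu>) + ennreal (1 / (\<mu> * \<delta>)) * (\<integral>\<^sup>+z. ?h k z \<partial>\<L>\<^sub>2))"
  unfolding \<mu>_def by (intro sum_mono cell_L1_bound f \<delta>)
 also have "\<dots> = (\<Sum>k\<in>I. ennreal \<bar>\<integral>x. indicator (cellset m k) x * f x \<partial>\<L>\<bar>) + (\<Sum>k\<in>I. ennreal (\<delta> * \<mu>)) + ennreal (1 / (\<mu> * \<delta>)) * (\<Sum>k\<in>I. \<integral>\<^sup>+z. ?h k z \<partial>\<L>\<^sub>2)"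
  by (simp only: sum.distrib sum_distrib_left)
 also have "\<dots> <= ennreal (\<Sum>k\<in>I. \<bar>\<integral>x. indicator (cellset m k) x * f x \<partial>\<L>\<bar>)
  + ennreal (\<delta> * (unit_ball_vol (real CARD('n)) * (R + 2 * real CARD('n)) ^ CARD('n))) + ennreal (1 / (\<mu> * \<delta>)) * incr f ?r"
 proof (intro add_mono mult_left_mono)
  show "(\<Sum>k\<in>I. ennreal \<bar>\<integral>x. indicator (cellset m k) x * f x \<partial>\<L>\<bar>) <= ennreal (\<Sum>k\<in>I. \<bar>\<integral>x. indicator (cellset m k) x * f x \<partial>\<L>\<bar>)"
   by (subst sum_ennreal) auto
  have "(\<Sum>k\<in>I. ennreal (\<delta> * \<mu>)) = ennreal (\<Sum>k\<in>I. \<delta> * \<mu>)" using \<delta> by (intro sum_ennreal) (auto simp: \<mu>_def)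
  also have "(\<Sum>k\<in>I. \<delta> * \<mu>) = \<delta> * (real (card I) * \<mu>)" by simp
  also have "ennreal (\<delta> * (real (card I) * \<mu>)) <= ennreal (\<delta> * (unit_ball_vol (real CARD('n)) * (R + 2 * real CARD('n)) ^ CARD('n)))"
   using fin(2) \<delta> unfolding \<mu>_def by (intro ennreal_leI mult_left_mono) auto
  finally show "(\<Sum>k\<in>I. ennreal (\<delta> * \<mu>)) <= ennreal (\<delta> * (unit_ball_vol (real CARD('n)) * (R + 2 * real CARD('n)) ^ CARD('n)))" .
  have "(\<Sum>k\<in>I. \<integral>\<^sup>+z. ?h k z \<partial>\<L>\<^sub>2) = (\<integral>\<^sup>+z. (\<Sum>k\<in>I. ?h k z) \<partial>\<L>\<^sub>2)"
   by (rule nn_integral_sum[symmetric]) (rule hm)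
  also have "\<dots> <= incr f ?r"
   unfolding incr_def
  proof (rule nn_integral_mono)
   fix z :: "(real^'n) \<times> (real^'n)"
   let ?k = "cell m (fst z)"
   have "(\<Sum>k\<in>I. ?h k z) = (\<Sum>k\<in>I. if k = ?k then ?h ?k z else 0)"
    by (intro sum.cong refl) (auto simp: indicator_def cellset_def)
   also have "\<dots> <= ?h ?k z" using fin(1) by (simp add: sum.delta)
   also have "\<dots> <= ennreal ((f (fst z) - f (snd z))\<^sup>2) * indicator {z. dist (fst z) (snd z) < ?r} z"
    using cellset_dist[of "fst z" m ?k "snd z"] by (auto simp: indicator_def)
   finally show "(\<Sum>k\<in>I. ?h k z) <= ennreal ((f (fst z) - f (snd z))\<^sup>2) * indicator {z. dist (fst z) (snd z) < ?r} z" .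
  qed
  finally show "(\<Sum>k\<in>I. \<integral>\<^sup>+z. ?h k z \<partial>\<L>\<^sub>2) <= incr f ?r" .
 qed simp
 finally show ?thesis .
qed

lemma bounded_family_subseq:
 fixes a :: "nat => 'j::countable => real"
 assumes b: "\<And>n j. \<bar>a n j\<bar> <= B j"
 shows "\<exists>r. strict_mono (r::nat=>nat) \<and> (\<forall>j. convergent (\<lambda>n. a (r n) j))"
proof -
 interpret subseqs "\<lambda>n r. convergent (\<lambda>i. a (r i) (from_nat n))"
 proof
  fix n and q :: "nat => nat" assume "strict_mono q"
  have "bounded (range (\<lambda>i. a (q i) (from_nat n)))"
   using b by (auto simp: bounded_iff)
  then obtain l r where "strict_mono r" "((\<lambda>i. a (q i) (from_nat n)) \<circ> r) \<longlonglongrightarrow> l"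
   using bounded_imp_convergent_subsequence by blast
  then show "\<exists>r'. strict_mono r' \<and> convergent (\<lambda>i. a ((q \<circ> r') i) (from_nat n))"
   by (auto simp: o_def convergent_def)
 qed
 have "convergent (\<lambda>i. a (diagseq i) j)" for j
 proof -
  have "convergent (\<lambda>i. a ((diagseq \<circ> (+) (Suc (to_nat j))) i) (from_nat (to_nat j)))"
  proof (rule diagseq_holds)
   fix n and r q :: "nat => nat"
   assume r: "strict_mono r" and "convergent (\<lambda>i. a (q i) (from_nat n))"
   then show "convergent (\<lambda>i. a ((q \<circ> r) i) (from_nat n))"
    using LIMSEQ_subseq_LIMSEQ[OF _ r] by (auto simp: o_def convergent_def)
  qed
  then have "convergent (\<lambda>i. a (diagseq (i + Suc (to_nat j))) j)" by (simp add: o_def add.commute)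
  then show ?thesis by (subst (asm) convergent_ignore_initial_segment)
 qed
 then show ?thesis using subseq_diagseq by blast
qed

context GN_setting
begin

text \<open>Along a diagonal subsequence the integrals over all dyadic cells converge. Oscillation
  inside cells of size 2^-m is uniformly small: \<open>incr\<close> has order r^(N+2s), and division
  by the cell volume leaves 2^(-2sm). So the subsequence is Cauchy in L^1 on each ball.\<close>

lemma local_compactness:
 fixes v :: "nat => real^'n => real"
 assumes v: "\<And>n. test_fun (v n)" and A: "\<And>n. D12_sq (v n) <= 1" and B: "\<And>n. Ds2_sq s (v n) <= 1"
 shows "\<exists>r u. strict_mono r \<and> u \<in> \<M> \<and> L1c (\<lambda>n. v (r n)) u \<and> (AE x in \<L>. (\<lambda>n. v (r n) x) \<longlonglongrightarrow> u x)"
proof -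
 note vm[measurable] = test_fun_measurable[OF v]
 have vE: "fin_E s (v n)" for n by (intro fin_E_test s0 s1 v)
 have vi: "integrable \<L> (v n)" for n by (rule test_fun_integrable[OF v])
 let ?a = "\<lambda>n (j :: nat \<times> (int^'n)). \<integral>x. indicator (cellset (fst j) (snd j)) x * v n x \<partial>\<L>"
 \<comment> \<open>A bound free of \<open>n\<close>, from |v| <= 1 + |v|^p, the volume of the cell
   and the inequality for test functions.\<close>
 have ab: "\<bar>?a n j\<bar> <= ((1/2) ^ fst j) ^ CARD('n) + Cgn" for n j
 proof -
  let ?Q = "cellset (fst j) (snd j)"
  have iQ: "integrable \<L> (\<lambda>x. indicator ?Q x * v n x)"
   using integrable_mult_indicator[OF cellset_sets vi[of n], of "fst j" "snd j"] by simp
  have "ennreal (norm (?a n j)) <= (\<integral>\<^sup>+x. norm (indicator ?Q x * v n x) \<partial>\<L>)"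
   by (rule integral_norm_bound_ennreal[OF iQ])
  also have "\<dots> <= (\<integral>\<^sup>+x. indicator ?Q x + ennreal (\<bar>v n x\<bar> powr p) \<partial>\<L>)"
  proof (rule nn_integral_mono)
   fix x
   have "\<bar>v n x\<bar> <= 1 + \<bar>v n x\<bar> powr p"
   proof (cases "\<bar>v n x\<bar> <= 1")
    case False
    then have "\<bar>v n x\<bar> powr 1 <= \<bar>v n x\<bar> powr p" using exponents(4) by (intro powr_mono) auto
    then show ?thesis using False by simp
   qed (simp add: add_increasing2)
   then have "ennreal \<bar>v n x\<bar> <= 1 + ennreal (\<bar>v n x\<bar> powr p)"
    by (metis ennreal_1 ennreal_leI ennreal_plus powr_ge_zero zero_le_one)
   then show "ennreal (norm (indicator ?Q x * v n x)) <= indicator ?Q x + ennreal (\<bar>v n x\<bar> powr p)"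
    by (simp add: indicator_def)
  qed
  also have "\<dots> = emeasure \<L> ?Q + Lp_enn p (v n)"
   unfolding Lp_enn_def by (subst nn_integral_add) auto
  also have "\<dots> <= ennreal (((1/2) ^ fst j) ^ CARD('n)) + ennreal Cgn"
  proof (rule add_mono)
   have "Ds2_sq s (v n) powr al * D12_sq (v n) powr be <= 1 * 1"
    using A[of n] B[of n] exponents(1,2) by (intro mult_mono powr_le1) auto
   then show "Lp_enn p (v n) <= ennreal Cgn"
    using Cgn_pos by (intro order_trans[OF GN_test[OF v]] ennreal_leI) (simp add: mult_left_le)
  qed (simp add: cellset_emeasure)
  also have "\<dots> = ennreal (((1/2) ^ fst j) ^ CARD('n) + Cgn)" using Cgn_pos by (intro ennreal_plus[symmetric]) auto
  finally have "ennreal (norm (?a n j)) <= ennreal (((1/2) ^ fst j) ^ CARD('n) + Cgn)" .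
  then show ?thesis using Cgn_pos by (subst (asm) ennreal_le_iff) auto
 qed
 obtain r where r: "strict_mono r" and rc: "\<And>j. convergent (\<lambda>n. ?a (r n) j)"
  using bounded_family_subseq[of ?a, OF ab] by blast
 have C: "\<exists>n0. \<forall>i\<ge>n0. \<forall>j\<ge>n0. (\<integral>\<^sup>+x. ennreal (norm (v (r i) x - v (r j) x)) * indicator (ball 0 R) x \<partial>\<L>) <= ennreal e" if e: "e > 0" for R e
 proof -
  define R' where "R' = \<bar>R\<bar> + 1"
  have R': "R' > 0" "R <= R'" by (auto simp: R'_def)
  define V where "V = unit_ball_vol N * (R' + 2 * N) ^ CARD('n)"
  have V: "V > 0" using R' N3 by (simp add: V_def)
  \<comment> \<open>Order of choices: \<delta> sets the volume term to e/3, then the level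
    \<open>m\<close> makes the increment term small, and for this \<open>m\<close> the finitely many
    cell integrals are compared.\<close>
  define \<delta> where "\<delta> = e / (3 * V)"
  have \<delta>: "\<delta> > 0" using e V by (simp add: \<delta>_def)
  have \<delta>V: "\<delta> * V = e / 3" using V by (simp add: \<delta>_def)
  define c where "c = (1/2) powr (2 * s)"
  have c: "0 < c" "c < 1" using s0 powr_less_mono'[of "1/2" 0 "2 * s"] by (auto simp: c_def)
  let ?r = "\<lambda>m. 2 * N * (1/2) ^ m"
  have id: "(1 / (((1/2) ^ m) ^ CARD('n) * \<delta>)) * (4 * ?r m powr (N + 2 * s)) = (4 / \<delta> * (2 * N) powr (N + 2 * s)) * c ^ m" for m
  proof -
   have h: "((1/2::real) ^ m) ^ CARD('n) = ((1/2) ^ m) powr N" by (simp add: N_def powr_realpow)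
   have "((1/2::real) ^ m) powr (2 * s) = c ^ m"
    by (simp add: c_def powr_realpow[symmetric] powr_powr mult.commute)
   then have "?r m powr (N + 2 * s) = (2 * N) powr (N + 2 * s) * (((1/2) ^ m) ^ CARD('n) * c ^ m)"
    using N3 by (simp add: powr_mult powr_add h)
   then show ?thesis using \<delta> by (simp add: field_simps)
  qed
  have "(\<lambda>m. (4 / \<delta> * (2 * N) powr (N + 2 * s)) * c ^ m) \<longlonglongrightarrow> (4 / \<delta> * (2 * N) powr (N + 2 * s)) * 0"
   using c by (intro tendsto_intros LIMSEQ_realpow_zero) auto
  then have "\<forall>\<^sub>F m in sequentially. (4 / \<delta> * (2 * N) powr (N + 2 * s)) * c ^ m < e / 3"
   using e by (intro order_tendstoD(2)) auto
  then obtain m where m: "(4 / \<delta> * (2 * N) powr (N + 2 * s)) * c ^ m < e / 3" by (auto simp: eventually_sequentially)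
  let ?I = "cell m ` ball (0::real^'n) R'"
  have fI: "finite ?I" by (rule cells_of_ball(1)[OF R'(1)])
  define \<gamma> where "\<gamma> = e / (3 * (real (card ?I) + 1))"
  have \<gamma>: "\<gamma> > 0" using e by (simp add: \<gamma>_def)
  have "\<forall>k\<in>?I. \<exists>n0. \<forall>i\<ge>n0. \<forall>j\<ge>n0. \<bar>?a (r i) (m, k) - ?a (r j) (m, k)\<bar> < \<gamma>"
  proof
   fix k
   show "\<exists>n0. \<forall>i\<ge>n0. \<forall>j\<ge>n0. \<bar>?a (r i) (m, k) - ?a (r j) (m, k)\<bar> < \<gamma>"
    using convergent_Cauchy[OF rc[of "(m, k)"]] \<gamma> unfolding Cauchy_def dist_real_def by blast
  qed
  then have "\<exists>n0. \<forall>k\<in>?I. \<forall>i\<ge>n0 k. \<forall>j\<ge>n0 k. \<bar>?a (r i) (m, k) - ?a (r j) (m, k)\<bar> < \<gamma>"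
   by (rule bchoice)
  then obtain n0 where n0: "\<And>k i j. k \<in> ?I ==> i \<ge> n0 k ==> j \<ge> n0 k ==> \<bar>?a (r i) (m, k) - ?a (r j) (m, k)\<bar> < \<gamma>"
   by blast
  define M where "M = Max (insert 0 (n0 ` ?I))"
  have M: "n0 k <= M" if "k \<in> ?I" for k unfolding M_def using fI that by (intro Max_ge) auto
  show ?thesis
  proof (intro exI allI impI)
   fix i j assume ij: "M <= i" "M <= j"
   let ?f = "\<lambda>x. v (r i) x - v (r j) x"
   have tf: "test_fun ?f" by (intro test_fun_diff v)
   have "Ds2_sq s ?f <= 4"
    using form_lincomb_le(2)[OF vE[of "r i"] vE[of "r j"], of "-1"] B[of "r i"] B[of "r j"] by simp
   then have inc: "incr ?f (?r m) <= ennreal (4 * ?r m powr (N + 2 * s))"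
    using N3 by (intro order_trans[OF incr_bounds(1)[OF tf]] ennreal_leI mult_right_mono) auto
   have sm: "(\<Sum>k\<in>?I. \<bar>\<integral>x. indicator (cellset m k) x * ?f x \<partial>\<L>\<bar>) <= e / 3"
   proof -
    have iQ: "integrable \<L> (\<lambda>x. indicator (cellset m k) x * v n x)" for k n
     using integrable_mult_indicator[OF cellset_sets vi[of n], of m k] by simp
    have "(\<integral>x. indicator (cellset m k) x * ?f x \<partial>\<L>) = ?a (r i) (m, k) - ?a (r j) (m, k)" for k
     using Bochner_Integration.integral_diff[OF iQ[of k "r i"] iQ[of k "r j"]] by (simp add: right_diff_distrib)
    then have "(\<Sum>k\<in>?I. \<bar>\<integral>x. indicator (cellset m k) x * ?f x \<partial>\<L>\<bar>) = (\<Sum>k\<in>?I. \<bar>?a (r i) (m, k) - ?a (r j) (m, k)\<bar>)"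
     by simp
    also have "\<dots> <= (\<Sum>k\<in>?I. \<gamma>)"
    proof (rule sum_mono)
     fix k assume k: "k \<in> ?I"
     show "\<bar>?a (r i) (m, k) - ?a (r j) (m, k)\<bar> <= \<gamma>"
      using n0[OF k order_trans[OF M[OF k] ij(1)] order_trans[OF M[OF k] ij(2)]] by (rule less_imp_le)
    qed
    also have "\<dots> <= e / 3" using e by (simp add: \<gamma>_def field_simps)
    finally show ?thesis .
   qed
   have "(\<integral>\<^sup>+x. ennreal (norm (?f x)) * indicator (ball 0 R) x \<partial>\<L>) <= (\<integral>\<^sup>+x. ennreal \<bar>?f x\<bar> * indicator (ball 0 R') x \<partial>\<L>)"
    using R' by (intro nn_integral_mono) (auto simp: indicator_def)
   also have "\<dots> <= ennreal (\<Sum>k\<in>?I. \<bar>\<integral>x. indicator (cellset m k) x * ?f x \<partial>\<L>\<bar>) + ennreal (\<delta> * V) + ennreal (1 / (((1/2) ^ m) ^ CARD('n) * \<delta>)) * incr ?f (?r m)"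
    using ball_L1_bound[OF test_fun_integrable[OF tf] \<delta> R'(1), of m] by (simp add: V_def N_def)
   also have "\<dots> <= ennreal (e / 3) + ennreal (e / 3) + ennreal (1 / (((1/2) ^ m) ^ CARD('n) * \<delta>)) * ennreal (4 * ?r m powr (N + 2 * s))"
    unfolding \<delta>V by (intro add_mono mult_left_mono ennreal_leI sm inc order_refl) auto
   also have "ennreal (1 / (((1/2) ^ m) ^ CARD('n) * \<delta>)) * ennreal (4 * ?r m powr (N + 2 * s)) = ennreal ((4 / \<delta> * (2 * N) powr (N + 2 * s)) * c ^ m)"
    unfolding id[symmetric] using \<delta> by (intro ennreal_mult[symmetric]) auto
   also have "ennreal (e / 3) + ennreal (e / 3) + ennreal ((4 / \<delta> * (2 * N) powr (N + 2 * s)) * c ^ m) <= ennreal (e / 3) + ennreal (e / 3) + ennreal (e / 3)"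
    using m by (intro add_mono ennreal_leI) auto
   also have "\<dots> = ennreal e" using e by (simp add: ennreal_plus[symmetric] del: ennreal_plus)
   finally show "(\<integral>\<^sup>+x. ennreal (norm (?f x)) * indicator (ball 0 R) x \<partial>\<L>) <= ennreal e" .
  qed
 qed
 obtain r' u where r': "strict_mono r'" and u[measurable]: "u \<in> \<M>" and ae: "AE x in \<L>. (\<lambda>k. v (r (r' k)) x) \<longlonglongrightarrow> u x"
  using Cauchy_AE_subseq[of "\<lambda>n. v (r n)", OF vm C] by blast
 have "L1c (\<lambda>n. v (r (r' n))) u"
 proof (rule L1cI)
  fix R e :: real assume e: "e > 0"
  obtain n0 where n0: "\<And>i j. i \<ge> n0 ==> j \<ge> n0 ==> (\<integral>\<^sup>+x. ennreal (norm (v (r i) x - v (r j) x)) * indicator (ball 0 R) x \<partial>\<L>) <= ennreal e"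
   using C[OF e, of R] by blast
  show "\<forall>\<^sub>F k in sequentially. (\<integral>\<^sup>+x. ennreal \<bar>v (r (r' k)) x - u x\<bar> * indicator (ball 0 R) x \<partial>\<L>) <= ennreal e"
   using eventually_ge_at_top[of n0]
  proof eventually_elim
   case (elim k)
   have k: "r' k \<ge> n0" using seq_suble[OF r', of k] elim by simp
   show ?case
   proof (rule Fatou_bound[where f="\<lambda>l x. ennreal \<bar>v (r (r' k)) x - v (r (r' l)) x\<bar> * indicator (ball 0 R) x"])
    show "AE x in \<L>. (\<lambda>l. ennreal \<bar>v (r (r' k)) x - v (r (r' l)) x\<bar> * indicator (ball 0 R) x) \<longlonglongrightarrow> ennreal \<bar>v (r (r' k)) x - u x\<bar> * indicator (ball 0 R) x"
     using ae
    proof eventually_elim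
     case (elim x)
     have "(\<lambda>l. ennreal (\<bar>v (r (r' k)) x - v (r (r' l)) x\<bar> * indicator (ball 0 R) x)) \<longlonglongrightarrow> ennreal (\<bar>v (r (r' k)) x - u x\<bar> * indicator (ball 0 R) x)"
      by (intro tendsto_ennrealI tendsto_intros elim)
     then show ?case by (simp add: ennreal_mult'' ennreal_indicator)
    qed
    show "\<forall>\<^sub>F l in sequentially. (\<integral>\<^sup>+x. ennreal \<bar>v (r (r' k)) x - v (r (r' l)) x\<bar> * indicator (ball 0 R) x \<partial>\<L>) <= ennreal e"
     using eventually_ge_at_top[of n0]
    proof eventually_elim
     case (elim l)
     have "r' l \<ge> n0" using seq_suble[OF r', of l] elim by simp
     then show ?case using n0[OF k] by simp
    qed
   qed measurable
  qed
 qed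
 then show ?thesis using r r' u ae
  by (intro exI[of _ "r \<circ> r'"] exI[of _ u]) (auto simp: strict_mono_o)
qed

text \<open>The tail estimate yields a level set {|u| > \<delta>} of measure at least
  \<open>c1\<close>. If {|u| > \<delta>/2} filled at most half of every ball of radius \<rho>, each
  point of that level set would see increments of size \<delta>/2 on the other half of its ball, too
  much for the bound on \<open>incr\<close>.\<close>

lemma nonvanishing:
 assumes c0: "c0 > 0"
 shows "\<exists>\<rho> \<eta>. 0 < \<eta> \<and> (\<forall>u :: real^'n => real. test_fun u \<longrightarrow> D12_sq u <= 1 \<longrightarrow> Ds2_sq s u <= 1 \<longrightarrow> ennreal c0 <= Lp_enn p u \<longrightarrow>
  (\<exists>y. ennreal \<eta> <= (\<integral>\<^sup>+x. ennreal \<bar>u (x + y)\<bar> * indicator (ball 0 \<rho>) x \<partial>\<L>)))"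
proof -
 obtain \<epsilon> :: "nat => real" where \<epsilon>: "\<epsilon> \<longlonglongrightarrow> 0" "\<And>m. 0 <= \<epsilon> m"
  "\<And>(u :: real^'n => real) m. test_fun u ==> D12_sq u <= 1 ==> Ds2_sq s u <= 1 ==>
   Lp_enn p u <= ennreal (\<epsilon> m) + ennreal ((2 powr p) ^ m) * emeasure \<L> {x. (1/2) ^ Suc m < \<bar>u x\<bar>}"
  using tail_ex by blast
 have "\<forall>\<^sub>F m in sequentially. \<epsilon> m < c0 / 2" using c0 by (intro order_tendstoD(2)[OF \<epsilon>(1)]) simp
 then obtain m where m: "\<epsilon> m < c0 / 2" by (auto simp: eventually_sequentially)
 define \<delta> :: real where "\<delta> = (1/2) ^ Suc m"
 have \<delta>: "\<delta> > 0" by (simp add: \<delta>_def)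
 define g where "g = (2 powr p) ^ m"
 have g: "g > 0" by (simp add: g_def)
 define c1 where "c1 = c0 / (2 * g)"
 have c1: "c1 > 0" using c0 g by (simp add: c1_def)
 define \<omega> where "\<omega> = unit_ball_vol N"
 have \<omega>: "\<omega> > 0" using N3 by (simp add: \<omega>_def)
 \<comment> \<open>Makes \<rho>^(2s) half of c1 \<omega> \<delta>^2 / 8, the lower bound that the
   increments would force.\<close>
 define \<rho> where "\<rho> = (c1 * \<omega> * \<delta>\<^sup>2 / 16) powr (1 / (2 * s))"
 have \<rho>: "\<rho> > 0" using c1 \<omega> \<delta> by (simp add: \<rho>_def)
 have \<rho>s: "\<rho> powr (2 * s) = c1 * \<omega> * \<delta>\<^sup>2 / 16" using c1 \<omega> \<delta> s0 by (simp add: \<rho>_def powr_powr)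
 define h where "h = \<omega> * \<rho> ^ CARD('n) / 2"
 have h: "h > 0" using \<omega> \<rho> by (simp add: h_def)
 show ?thesis
 proof (rule exI[of _ \<rho>], rule exI[of _ "\<delta> / 2 * h"], intro conjI allI impI)
  show "0 < \<delta> / 2 * h" using \<delta> h by simp
  fix u :: "real^'n => real"
  assume u: "test_fun u" and A: "D12_sq u <= 1" and B: "Ds2_sq s u <= 1" and P: "ennreal c0 <= Lp_enn p u"
  note um[measurable] = test_fun_measurable[OF u]
  let ?L = "\<lambda>t. {x. t < \<bar>u x\<bar>}"
  have a: "c1 <= measure \<L> (?L \<delta>)"
  proof -
   have "ennreal c0 <= ennreal (\<epsilon> m) + ennreal g * ennreal (measure \<L> (?L \<delta>))"
    using order_trans[OF P \<epsilon>(3)[OF u A B, of m]] level_set_finite[OF u, of \<delta>] \<delta> by (simp add: \<delta>_def g_def)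
   also have "\<dots> = ennreal (\<epsilon> m + g * measure \<L> (?L \<delta>))"
    using \<epsilon>(2)[of m] g by (simp add: ennreal_mult[symmetric] ennreal_plus[symmetric] del: ennreal_plus)
   finally have "c0 <= \<epsilon> m + g * measure \<L> (?L \<delta>)" using \<epsilon>(2)[of m] g by (subst (asm) ennreal_le_iff) auto
   then have "c0 / 2 <= measure \<L> (?L \<delta>) * g" using m by (simp add: mult.commute)
   then show ?thesis using g by (simp add: c1_def pos_divide_le_eq mult_ac)
  qed
  have "\<exists>y. ennreal h < emeasure \<L> (?L (\<delta>/2) \<inter> ball y \<rho>)"
  proof (rule ccontr)
   assume "\<not> ?thesis"
   then have H: "emeasure \<L> (?L (\<delta>/2) \<inter> ball y \<rho>) <= ennreal h" for y by (auto simp: not_less)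
   let ?F = "\<lambda>z. ennreal ((u (fst z) - u (snd z))\<^sup>2) * indicator {z. dist (fst z) (snd z) < \<rho>} z"
   have Fm: "?F \<in> borel_measurable \<L>\<^sub>2"
    by (intro borel_measurable_times_ennreal incr_measurable borel_measurable_indicator dist_set_measurable' um)
   have Lm: "?L t \<in> sets \<L>" for t by (rule level_set_measurable[OF um])
   have "ennreal (\<delta>\<^sup>2 / 4 * h) * emeasure \<L> (?L \<delta>) = (\<integral>\<^sup>+x. ennreal (\<delta>\<^sup>2 / 4 * h) * indicator (?L \<delta>) x \<partial>\<L>)"
    by (rule nn_integral_cmult_indicator[OF Lm, symmetric])
   also have "\<dots> <= (\<integral>\<^sup>+x. \<integral>\<^sup>+y. ?F (x, y) \<partial>\<L> \<partial>\<L>)"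
   proof (rule nn_integral_mono)
    fix x
    show "ennreal (\<delta>\<^sup>2 / 4 * h) * indicator (?L \<delta>) x <= (\<integral>\<^sup>+y. ?F (x, y) \<partial>\<L>)"
    proof (cases "x \<in> ?L \<delta>")
     case True
     have "ennreal (2 * h) = emeasure \<L> (ball x \<rho>)"
      using emeasure_ball_leb[of \<rho> x] \<rho> by (simp add: h_def \<omega>_def N_def)
     also have "\<dots> <= emeasure \<L> ((ball x \<rho> - ?L (\<delta>/2)) \<union> (?L (\<delta>/2) \<inter> ball x \<rho>))" by (intro emeasure_mono sets.Un sets.Diff sets.Int Lm) auto
     also have "\<dots> <= emeasure \<L> (ball x \<rho> - ?L (\<delta>/2)) + emeasure \<L> (?L (\<delta>/2) \<inter> ball x \<rho>)"
      by (intro emeasure_subadditive sets.Diff sets.Int Lm) auto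
     also have "\<dots> <= emeasure \<L> (ball x \<rho> - ?L (\<delta>/2)) + ennreal h" by (intro add_mono order_refl H)
     finally have "ennreal (2 * h) - ennreal h <= emeasure \<L> (ball x \<rho> - ?L (\<delta>/2))"
      by (simp add: ennreal_minus_le_iff add.commute)
     then have "ennreal h <= emeasure \<L> (ball x \<rho> - ?L (\<delta>/2))" using h by (simp add: ennreal_minus)
     then have "ennreal (\<delta>\<^sup>2 / 4) * ennreal h <= ennreal (\<delta>\<^sup>2 / 4) * emeasure \<L> (ball x \<rho> - ?L (\<delta>/2))"
      by (rule mult_left_mono) simp
     also have "\<dots> = (\<integral>\<^sup>+y. ennreal (\<delta>\<^sup>2 / 4) * indicator (ball x \<rho> - ?L (\<delta>/2)) y \<partial>\<L>)"
      by (intro nn_integral_cmult_indicator[symmetric] sets.Diff Lm) auto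
     also have "\<dots> <= (\<integral>\<^sup>+y. ?F (x, y) \<partial>\<L>)"
     proof (rule nn_integral_mono)
      fix y
      have "\<delta>\<^sup>2 / 4 <= (u x - u y)\<^sup>2" if "y \<notin> ?L (\<delta>/2)"
      proof -
       have "\<delta> / 2 <= \<bar>u x - u y\<bar>" using that True abs_triangle_ineq2[of "u x" "u y"] by simp
       then have "(\<delta> / 2)\<^sup>2 <= \<bar>u x - u y\<bar>\<^sup>2" using \<delta> by (intro power_mono) auto
       then show ?thesis by (simp add: power_divide)
      qed
      then show "ennreal (\<delta>\<^sup>2 / 4) * indicator (ball x \<rho> - ?L (\<delta>/2)) y <= ?F (x, y)"
       by (auto simp: indicator_def intro!: ennreal_leI)
     qed
     finally have "ennreal (\<delta>\<^sup>2 / 4 * h) <= (\<integral>\<^sup>+y. ?F (x, y) \<partial>\<L>)"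
      using ennreal_mult[of "\<delta>\<^sup>2 / 4" h] h by (simp only: zero_le_power2 divide_nonneg_nonneg zero_le_numeral less_imp_le)
     then show ?thesis using True by simp
    qed simp
   qed
   also have "\<dots> = incr u \<rho>" unfolding incr_def by (rule leb.nn_integral_fst[OF Fm])
   also have "\<dots> <= ennreal (1 * \<rho> powr (N + 2 * s))"
    by (intro order_trans[OF incr_bounds(1)[OF u \<rho>]] ennreal_leI mult_right_mono B) simp
   finally have "\<delta>\<^sup>2 / 4 * h * measure \<L> (?L \<delta>) <= \<rho> powr (N + 2 * s)"
    using level_set_finite[OF u, of \<delta>] \<delta> h by (simp add: ennreal_mult[symmetric])
   moreover have "\<delta>\<^sup>2 / 4 * h * c1 <= \<delta>\<^sup>2 / 4 * h * measure \<L> (?L \<delta>)" using a h by (intro mult_left_mono) auto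
   moreover have "\<rho> powr (N + 2 * s) = (2 * h / \<omega>) * (c1 * \<omega> * \<delta>\<^sup>2 / 16)"
    using \<rho> \<omega> by (simp add: powr_add \<rho>s h_def N_def powr_realpow)
   ultimately have "\<delta>\<^sup>2 / 4 * h * c1 <= h * c1 * \<delta>\<^sup>2 / 8" using \<omega> by (simp add: field_simps)
   moreover have "h * c1 * \<delta>\<^sup>2 > 0" using h c1 \<delta> by simp
   ultimately show False by (simp add: mult_ac)
  qed
  then obtain y where y: "ennreal h < emeasure \<L> (?L (\<delta>/2) \<inter> ball y \<rho>)" by blast
  have "ennreal (\<delta>/2 * h) = ennreal (\<delta>/2) * ennreal h" using \<delta> h by (intro ennreal_mult) auto
  also have "\<dots> <= ennreal (\<delta>/2) * emeasure \<L> (?L (\<delta>/2) \<inter> ball y \<rho>)" using y by (intro mult_left_mono) auto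
  also have "\<dots> = (\<integral>\<^sup>+x. ennreal (\<delta>/2) * indicator (?L (\<delta>/2) \<inter> ball y \<rho>) x \<partial>\<L>)"
   by (intro nn_integral_cmult_indicator[symmetric] sets.Int level_set_measurable[OF um]) auto
  also have "\<dots> <= (\<integral>\<^sup>+x. ennreal \<bar>u x\<bar> * indicator (ball y \<rho>) x \<partial>\<L>)"
   by (intro nn_integral_mono) (auto simp: indicator_def intro!: ennreal_leI)
  also have "\<dots> = (\<integral>\<^sup>+x. ennreal \<bar>u (x + y)\<bar> * indicator (ball y \<rho>) (x + y) \<partial>\<L>)"
   using simil_nn_integral[OF simil_translate[of y], of "\<lambda>x. ennreal \<bar>u x\<bar> * indicator (ball y \<rho>) x"] by simp
  also have "\<dots> = (\<integral>\<^sup>+x. ennreal \<bar>u (x + y)\<bar> * indicator (ball 0 \<rho>) x \<partial>\<L>)"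
   by (intro nn_integral_cong) (auto simp: indicator_def dist_norm)
  finally show "\<exists>y. ennreal (\<delta>/2 * h) <= (\<integral>\<^sup>+x. ennreal \<bar>u (x + y)\<bar> * indicator (ball 0 \<rho>) x \<partial>\<L>)" by blast
 qed
qed

end

section \<open>Existence of a maximizer\<close>

text \<open>Plays the role of weak convergence: the positive part of |V U| - \<delta> V^2 is
  dominated by U^2 / \<delta> and tends to 0 in L^1, and the subtracted term contributes at most
  \<delta> K.\<close>

lemma cross_term_tendsto:
 fixes V :: "nat => 'a => real"
 assumes V: "\<And>n. L2 M (V n)" and K: "\<And>n. (\<integral>z. (norm (V n z))\<^sup>2 \<partial>M) <= K" and U: "L2 M U"
  and ae: "AE z in M. (\<lambda>n. V n z) \<longlonglongrightarrow> 0"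
 shows "(\<lambda>n. \<integral>z. V n z * U z \<partial>M) \<longlonglongrightarrow> 0"
proof (rule tendstoI)
 fix e :: real assume e: "e > 0"
 have K0: "K \<ge> 0" using K[of 0] L2_nonneg[of M "V 0"] by linarith
 define \<delta> where "\<delta> = e / (2 * (K + 1))"
 have \<delta>: "\<delta> > 0" using e K0 by (simp add: \<delta>_def)
 have \<delta>K: "\<delta> * K < e / 2" using e K0 by (simp add: \<delta>_def field_simps)
 note [measurable] = L2_measurable[OF V] L2_measurable[OF U]
 let ?h = "\<lambda>n z. max 0 (\<bar>V n z * U z\<bar> - \<delta> * (V n z)\<^sup>2)"
 have Vi: "integrable M (\<lambda>z. (V n z)\<^sup>2)" for n using V[of n] by (simp add: L2_def)
 have Ui: "integrable M (\<lambda>z. (U z)\<^sup>2)" using U by (simp add: L2_def)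
 have bound: "norm (?h n z) <= (1/\<delta>) * (U z)\<^sup>2" for n z
 proof -
  have "\<bar>V n z * U z\<bar> <= \<delta> * (V n z)\<^sup>2 + (1/\<delta>) * (U z)\<^sup>2"
  proof -
   have "0 <= (\<delta> * \<bar>V n z\<bar> - \<bar>U z\<bar>)\<^sup>2 + \<delta> * \<bar>V n z\<bar> * \<bar>U z\<bar>" using \<delta> by (intro add_nonneg_nonneg mult_nonneg_nonneg) auto
   then have "\<delta> * (\<bar>V n z\<bar> * \<bar>U z\<bar>) <= \<delta> * (\<delta> * (V n z)\<^sup>2 + (1/\<delta>) * (U z)\<^sup>2)"
    using \<delta> by (simp add: power2_eq_square algebra_simps)
   then show ?thesis using \<delta> by (simp add: abs_mult)
  qed
  then show ?thesis using \<delta> by simp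
 qed
 have hi: "integrable M (?h n)" for n
  by (rule Bochner_Integration.integrable_bound[OF integrable_mult_right[OF Ui, of "1/\<delta>"]])
   (use bound[of n] order_trans[OF bound[of n] abs_ge_self] in auto)
 have "(\<lambda>n. \<integral>z. ?h n z \<partial>M) \<longlonglongrightarrow> (\<integral>z. 0 \<partial>M)"
 proof (rule integral_dominated_convergence[where w="\<lambda>z. (1/\<delta>) * (U z)\<^sup>2"])
  show "AE z in M. (\<lambda>n. ?h n z) \<longlonglongrightarrow> 0" using ae
  proof eventually_elim
   case (elim z)
   have "(\<lambda>n. ?h n z) \<longlonglongrightarrow> max 0 (\<bar>0 * U z\<bar> - \<delta> * 0\<^sup>2)" by (intro tendsto_intros elim)
   then show ?case by simp
  qed
 qed (use bound Ui in auto)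
 then have "(\<lambda>n. \<integral>z. ?h n z \<partial>M) \<longlonglongrightarrow> 0" by simp
 then have "\<forall>\<^sub>F n in sequentially. (\<integral>z. ?h n z \<partial>M) < e / 2" using e by (intro order_tendstoD(2)) auto
 then show "\<forall>\<^sub>F n in sequentially. dist (\<integral>z. V n z * U z \<partial>M) 0 < e"
 proof eventually_elim
  case (elim n)
  have "\<bar>\<integral>z. V n z * U z \<partial>M\<bar> <= (\<integral>z. \<bar>V n z * U z\<bar> \<partial>M)" by (rule integral_abs_bound)
  also have "\<dots> <= (\<integral>z. \<delta> * (V n z)\<^sup>2 + ?h n z \<partial>M)"
   using L2_inner[OF V[of n] U] Vi hi by (intro integral_mono) auto
  also have "\<dots> = \<delta> * (\<integral>z. (V n z)\<^sup>2 \<partial>M) + (\<integral>z. ?h n z \<partial>M)" using Vi hi by simp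
  also have "\<dots> <= \<delta> * K + (\<integral>z. ?h n z \<partial>M)" using K[of n] \<delta> by (intro add_right_mono mult_left_mono) auto
  also have "\<dots> < e" using elim \<delta>K by linarith
  finally show ?case by (simp add: dist_real_def)
 qed
qed

text \<open>\<open>t\<close> solves (1 + t)^p = 1 + \<epsilon>. If b <= t a, the first term absorbs
  the whole sum; otherwise \<open>b\<close> controls \<open>a\<close>.\<close>

lemma powr_add_le:
 assumes "p \<ge> 1" "\<epsilon> > 0"
 obtains C :: real where "C \<ge> 0" "\<And>a b. 0 <= a ==> 0 <= b ==> (a + b) powr p <= (1 + \<epsilon>) * a powr p + C * b powr p"
proof -
 define t where "t = (1 + \<epsilon>) powr (1/p) - 1"
 have t: "t > 0" using assms powr_less_mono2[of "1/p" 1 "1+\<epsilon>"] by (simp add: t_def)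
 have tp: "(1 + t) powr p = 1 + \<epsilon>" using assms by (simp add: t_def powr_powr)
 have "(a + b) powr p <= (1 + \<epsilon>) * a powr p + (1 / t + 1) powr p * b powr p" if "0 <= a" "0 <= b" for a b :: real
 proof (cases "b <= t * a")
  case True
  then have "(a + b) powr p <= ((1 + t) * a) powr p" using that assms by (intro powr_mono2) (auto simp: algebra_simps)
  also have "\<dots> = (1 + \<epsilon>) * a powr p" using that t by (simp add: powr_mult tp)
  finally show ?thesis by (rule order_trans) simp
 next
  case False
  then have "a <= b / t" using t by (simp add: field_simps)
  then have "(a + b) powr p <= ((1 / t + 1) * b) powr p" using that assms by (intro powr_mono2) (auto simp: algebra_simps)
  also have "\<dots> = (1 / t + 1) powr p * b powr p" using that t by (simp add: powr_mult)
  finally show ?thesis using assms by (simp add: add_increasing)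
 qed
 then show thesis using that[of "(1 / t + 1) powr p"] by simp
qed

text \<open>The factor 1 + \<epsilon> in front of |f n - g|^p leaves an excess whose positive part
  is dominated by a multiple of |g|^p, so its integral tends to 0. The upper estimate is the half
  that a maximizing sequence calls for.\<close>

lemma Brezis_Lieb_le:
 fixes f :: "nat => real^'n::finite => real"
 assumes [measurable]: "\<And>n. f n \<in> \<M>" "g \<in> \<M>"
  and p: "p \<ge> 1" and ae: "AE x in \<L>. (\<lambda>n. f n x) \<longlonglongrightarrow> g x" and g: "Lp_enn p g < \<infinity>" and \<epsilon>: "\<epsilon> > 0"
 shows "\<forall>\<^sub>F n in sequentially. Lp_enn p (f n) <= ennreal (1 + \<epsilon>) * Lp_enn p (\<lambda>x. f n x - g x) + Lp_enn p g + ennreal \<epsilon>"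
proof -
 obtain C where C: "C \<ge> 0" "\<And>a b. 0 <= a ==> 0 <= b ==> (a + b) powr p <= (1 + \<epsilon>) * a powr p + C * b powr p"
  using powr_add_le[OF p \<epsilon>] by metis
 let ?h = "\<lambda>n x. max 0 (\<bar>f n x\<bar> powr p - (1 + \<epsilon>) * \<bar>f n x - g x\<bar> powr p - \<bar>g x\<bar> powr p)"
 have gi: "integrable \<L> (\<lambda>x. \<bar>g x\<bar> powr p)"
  using g by (simp add: Lp_enn_def integrable_iff_bounded)
 have bound: "norm (?h n x) <= C * \<bar>g x\<bar> powr p" for n x
 proof -
  have "\<bar>f n x\<bar> powr p <= (\<bar>f n x - g x\<bar> + \<bar>g x\<bar>) powr p" using p by (intro powr_mono2) auto
  also have "\<dots> <= (1 + \<epsilon>) * \<bar>f n x - g x\<bar> powr p + C * \<bar>g x\<bar> powr p" by (rule C(2)) auto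
  finally have 1: "\<bar>f n x\<bar> powr p <= (1 + \<epsilon>) * \<bar>f n x - g x\<bar> powr p + C * \<bar>g x\<bar> powr p" .
  have 2: "0 <= \<bar>g x\<bar> powr p" "0 <= C * \<bar>g x\<bar> powr p" using C(1) by simp_all
  have "?h n x <= C * \<bar>g x\<bar> powr p" by (rule max.boundedI) (use 1 2 in linarith)+
  then show ?thesis by simp
 qed
 have hi: "integrable \<L> (?h n)" for n
  by (rule Bochner_Integration.integrable_bound[OF integrable_mult_right[OF gi, of C]])
   (use order_trans[OF bound[of n] abs_ge_self] in auto)
 have "(\<lambda>n. \<integral>x. ?h n x \<partial>\<L>) \<longlonglongrightarrow> (\<integral>x. 0 \<partial>(\<L> :: (real^'n) measure))"
 proof (rule integral_dominated_convergence[where w="\<lambda>x. C * \<bar>g x\<bar> powr p" and s="?h" and f="\<lambda>x. 0"])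
  show "AE x in \<L>. (\<lambda>n. ?h n x) \<longlonglongrightarrow> 0" using ae
  proof eventually_elim
   case (elim x)
   have "(\<lambda>n. ?h n x) \<longlonglongrightarrow> max 0 (\<bar>g x\<bar> powr p - (1 + \<epsilon>) * \<bar>g x - g x\<bar> powr p - \<bar>g x\<bar> powr p)"
    using p by (intro tendsto_intros tendsto_powr' elim) auto
   then show ?case by simp
  qed
 qed (use bound gi in auto)
 then have "(\<lambda>n. \<integral>x. ?h n x \<partial>\<L>) \<longlonglongrightarrow> 0" by simp
 then have "\<forall>\<^sub>F n in sequentially. (\<integral>x. ?h n x \<partial>\<L>) < \<epsilon>" using \<epsilon> by (intro order_tendstoD(2)) auto
 then show ?thesis
 proof eventually_elim
  case (elim n)
  have "Lp_enn p (f n) <= (\<integral>\<^sup>+x. (ennreal (1 + \<epsilon>) * ennreal (\<bar>f n x - g x\<bar> powr p) + ennreal (\<bar>g x\<bar> powr p)) + ennreal (?h n x) \<partial>\<L>)"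
   unfolding Lp_enn_def
  proof (rule nn_integral_mono)
   fix x
   have "\<bar>f n x\<bar> powr p <= (1 + \<epsilon>) * \<bar>f n x - g x\<bar> powr p + \<bar>g x\<bar> powr p + ?h n x" by simp
   then have "ennreal (\<bar>f n x\<bar> powr p) <= ennreal ((1 + \<epsilon>) * \<bar>f n x - g x\<bar> powr p + \<bar>g x\<bar> powr p + ?h n x)" by (rule ennreal_leI)
   also have "\<dots> = (ennreal (1 + \<epsilon>) * ennreal (\<bar>f n x - g x\<bar> powr p) + ennreal (\<bar>g x\<bar> powr p)) + ennreal (?h n x)"
    using \<epsilon> by (simp add: ennreal_plus ennreal_mult)
   finally show "ennreal (\<bar>f n x\<bar> powr p) <= (ennreal (1 + \<epsilon>) * ennreal (\<bar>f n x - g x\<bar> powr p) + ennreal (\<bar>g x\<bar> powr p)) + ennreal (?h n x)" .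
  qed
  also have "\<dots> = ennreal (1 + \<epsilon>) * Lp_enn p (\<lambda>x. f n x - g x) + Lp_enn p g + (\<integral>\<^sup>+x. ennreal (?h n x) \<partial>\<L>)"
   unfolding Lp_enn_def by (simp add: nn_integral_add nn_integral_cmult)
  also have "(\<integral>\<^sup>+x. ennreal (?h n x) \<partial>\<L>) = ennreal (\<integral>x. ?h n x \<partial>\<L>)"
   using hi by (intro nn_integral_eq_integral) auto
  also have "ennreal (\<integral>x. ?h n x \<partial>\<L>) <= ennreal \<epsilon>" using elim by (intro ennreal_leI) simp
  finally show ?case by (simp add: add_left_mono)
 qed
qed

lemma L1c_integral_tendsto:
 fixes u :: "real^'n::finite => real"
 assumes w: "\<And>n. test_fun (w n)" and u[measurable]: "u \<in> \<M>" and c: "L1c w u" and \<psi>: "test_fun \<psi>"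
 shows "integrable \<L> (\<lambda>x. u x * \<psi> x)" "(\<lambda>n. \<integral>x. (w n x - u x) * \<psi> x \<partial>\<L>) \<longlonglongrightarrow> 0"
proof -
 note [measurable] = test_fun_measurable[OF \<psi>] test_fun_measurable[OF w]
 obtain M where M: "M > 0" "\<And>x. \<bar>\<psi> x\<bar> <= M" using test_fun_bounded[OF \<psi>] by metis
 obtain R where R: "R > 0" "\<And>x. norm x \<ge> R ==> \<psi> x = 0" using test_fun_support[OF \<psi>] by metis
 show ui: "integrable \<L> (\<lambda>x. u x * \<psi> x)"
 proof (rule Bochner_Integration.integrable_bound)
  show "integrable \<L> (\<lambda>x. (indicator (ball 0 R) x * u x) * M)"
   by (intro integrable_mult_left L1c_locally_integrable[OF w u c])
  show "AE x in \<L>. norm (u x * \<psi> x) <= norm ((indicator (ball 0 R) x * u x) * M)"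
   using M R by (intro AE_I2) (auto simp: indicator_def abs_mult intro!: mult_left_mono)
 qed measurable
 show "(\<lambda>n. \<integral>x. (w n x - u x) * \<psi> x \<partial>\<L>) \<longlonglongrightarrow> 0"
 proof (rule tendstoI)
  fix e :: real assume e: "e > 0"
  have "\<forall>\<^sub>F n in sequentially. (\<integral>\<^sup>+x. ennreal \<bar>w n x - u x\<bar> * indicator (ball 0 R) x \<partial>\<L>) <= ennreal (e / (2 * M))"
   using e M by (intro L1c_D[OF c]) auto
  then show "\<forall>\<^sub>F n in sequentially. dist (\<integral>x. (w n x - u x) * \<psi> x \<partial>\<L>) 0 < e"
  proof eventually_elim
   case (elim n)
   have wi: "integrable \<L> (\<lambda>x. w n x * \<psi> x)" by (intro test_fun_integrable test_fun_mult test_fun_smooth w \<psi>)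
   have di: "integrable \<L> (\<lambda>x. (w n x - u x) * \<psi> x)"
    using Bochner_Integration.integrable_diff[OF wi ui] by (simp add: left_diff_distrib)
   have "ennreal (norm (\<integral>x. (w n x - u x) * \<psi> x \<partial>\<L>)) <= (\<integral>\<^sup>+x. norm ((w n x - u x) * \<psi> x) \<partial>\<L>)"
    by (rule integral_norm_bound_ennreal[OF di])
   also have "\<dots> <= (\<integral>\<^sup>+x. ennreal M * (ennreal \<bar>w n x - u x\<bar> * indicator (ball 0 R) x) \<partial>\<L>)"
   proof (rule nn_integral_mono)
    fix x
    show "ennreal (norm ((w n x - u x) * \<psi> x)) <= ennreal M * (ennreal \<bar>w n x - u x\<bar> * indicator (ball 0 R) x)"
     using M R(2)[of x] by (cases "norm x < R")
      (auto simp: abs_mult ennreal_mult[symmetric] indicator_def mult.commute intro!: ennreal_leI mult_right_mono)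
   qed
   also have "\<dots> <= ennreal M * ennreal (e / (2 * M))"
    using elim by (subst nn_integral_cmult) (auto intro!: mult_left_mono)
   also have "\<dots> = ennreal (e / 2)" using M e by (simp add: ennreal_mult[symmetric])
   finally have "norm (\<integral>x. (w n x - u x) * \<psi> x \<partial>\<L>) <= e / 2" using e by simp
   then show ?case using e by (simp add: dist_real_def)
  qed
 qed
qed

lemma D12_form_lincomb_right:
 assumes u: "fin_E s u" and v: "fin_E s v" and w: "fin_E s w"
 shows "D12_form w (\<lambda>x. u x + c * v x) = D12_form w u + c * D12_form w v"
proof -
 have W: "weak_grad (\<lambda>x. u x + c * v x) (\<lambda>x. wgrad u x + c *\<^sub>R wgrad v x)"
  by (intro weak_grad_lincomb fin_E_weak_grad[OF u] fin_E_weak_grad[OF v])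
 have i: "integrable \<L> (\<lambda>x. wgrad w x \<bullet> wgrad u x)" "integrable \<L> (\<lambda>x. wgrad w x \<bullet> wgrad v x)"
  by (intro L2_inner fin_E_L2(1)[OF u] fin_E_L2(1)[OF v] fin_E_L2(1)[OF w])+
 have "D12_form w (\<lambda>x. u x + c * v x) = (\<integral>x. wgrad w x \<bullet> (wgrad u x + c *\<^sub>R wgrad v x) \<partial>\<L>)"
  unfolding D12_form_def
  using wgrad_AE[OF W] weak_grad_measurable[OF W] weak_grad_measurable[OF weak_grad_wgrad[OF W]] weak_grad_measurable[OF fin_E_weak_grad[OF w]]
  by (intro integral_cong_AE borel_measurable_inner) auto
 then show ?thesis using i by (simp add: D12_form_def inner_add_right)
qed

text \<open>Integration by parts puts both derivatives on \<psi>, after which local L^1 convergence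
  is sufficient.\<close>

lemma D12_form_test_tendsto:
 fixes u :: "real^'n::finite => real"
 assumes s: "0 < s" "s < 1" and w: "\<And>n. test_fun (w n)" and u: "fin_E s u" and c: "L1c w u" and \<psi>: "test_fun \<psi>"
 shows "(\<lambda>n. D12_form (\<lambda>x. w n x - u x) \<psi>) \<longlonglongrightarrow> 0"
proof -
 have d: "fin_E s (\<lambda>x. w n x - u x)" for n by (intro fin_E_diff(1) fin_E_test s w u)
 note W = weak_grad_test[OF \<psi>]
 have "D12_form (\<lambda>x. w n x - u x) \<psi> = - (\<Sum>i\<in>UNIV. \<integral>x. (w n x - u x) * partial_d i (partial_d i \<psi>) x \<partial>\<L>)" for n
 proof -
  let ?g = "wgrad (\<lambda>x. w n x - u x)"
  note Wd = fin_E_weak_grad[OF d[of n]]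
  have p: "test_fun (partial_d i \<psi>)" for i by (rule test_fun_partial[OF \<psi>])
  have "D12_form (\<lambda>x. w n x - u x) \<psi> = (\<integral>x. ?g x \<bullet> grad \<psi> x \<partial>\<L>)"
   unfolding D12_form_def using wgrad_AE[OF W] weak_grad_measurable[OF W] weak_grad_measurable[OF weak_grad_wgrad[OF W]] weak_grad_measurable[OF Wd]
   by (intro integral_cong_AE borel_measurable_inner) auto
  also have "\<dots> = (\<integral>x. (\<Sum>i\<in>UNIV. ?g x $ i * partial_d i \<psi> x) \<partial>\<L>)" by (simp add: inner_vec_def)
  also have "\<dots> = (\<Sum>i\<in>UNIV. \<integral>x. ?g x $ i * partial_d i \<psi> x \<partial>\<L>)"
   using Wd p unfolding weak_grad_def by (intro Bochner_Integration.integral_sum) blast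
  also have "\<dots> = (\<Sum>i\<in>UNIV. - (\<integral>x. (w n x - u x) * partial_d i (partial_d i \<psi>) x \<partial>\<L>))"
  proof (rule sum.cong[OF refl])
   fix i
   have "(\<integral>x. (w n x - u x) * partial_d i (partial_d i \<psi>) x \<partial>\<L>) = - (\<integral>x. ?g x $ i * partial_d i \<psi> x \<partial>\<L>)"
    using Wd p[of i] unfolding weak_grad_def by blast
   then show "(\<integral>x. ?g x $ i * partial_d i \<psi> x \<partial>\<L>) = - (\<integral>x. (w n x - u x) * partial_d i (partial_d i \<psi>) x \<partial>\<L>)" by simp
  qed
  finally show ?thesis by (simp add: sum_negf)
 qed
 moreover have "(\<lambda>n. - (\<Sum>i\<in>UNIV. \<integral>x. (w n x - u x) * partial_d i (partial_d i \<psi>) x \<partial>\<L>)) \<longlonglongrightarrow> - (\<Sum>i\<in>(UNIV::'n set). 0)"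
  by (intro tendsto_minus tendsto_sum L1c_integral_tendsto[OF w _ c] fin_E_measurable[OF u] test_fun_partial \<psi>)
 ultimately show ?thesis by simp
qed

text \<open>With k = al + be, weighted means bound the k-th roots of the two products by affine
  functions of a and b that add up to 1, whereas X^(1/k) + (1 - X)^(1/k) exceeds 1 for 0 < X < 1. So
  nothing can be split off.\<close>

lemma split_arith:
 fixes al be a b X :: real
 assumes e: "0 < al" "0 < be" "1 < al + be" and ab: "0 <= a" "a <= 1" "0 <= b" "b <= 1"
  and X: "0 < X" "X <= b powr al * a powr be" "1 - X <= (1 - b) powr al * (1 - a) powr be"
 shows "X = 1" "a = 1" "b = 1"
proof -
 define k where "k = al + be"
 have k: "1 < k" using e by (simp add: k_def)
 have young: "(y powr al * x powr be) powr (1/k) <= (al / k) * y + (be / k) * x" if xy: "0 <= x" "0 <= y" for x y :: real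
 proof (cases "x = 0 \<or> y = 0")
  case True
  then show ?thesis using e xy k by auto
 next
  case False
  then have "y powr (al / k) * x powr (be / k) <= (al / k) * y + (be / k) * x"
   using xy e k by (intro Youngs_inequality_0) (auto simp: k_def add_divide_distrib[symmetric])
  then show ?thesis by (simp add: powr_mult powr_powr)
 qed
 have le1: "b powr al * a powr be <= 1 * 1" using ab e by (intro mult_mono powr_le1) auto
 have root: "y < y powr (1/k)" if "0 < y" "y < 1" for y :: real
 proof -
  have "y powr 1 < y powr (1/k)" using that k by (intro powr_less_mono') auto
  then show ?thesis using that by simp
 qed
 show X1: "X = 1"
 proof (rule ccontr)
  assume "X \<noteq> 1"
  then have lt: "X < 1" using le1 X by simp
  have "X powr (1/k) <= (b powr al * a powr be) powr (1/k)" using X k by (intro powr_mono2) auto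
  moreover have "(1 - X) powr (1/k) <= ((1 - b) powr al * (1 - a) powr be) powr (1/k)" using X lt k by (intro powr_mono2) auto
  ultimately have "X powr (1/k) + (1 - X) powr (1/k) <= ((al / k) * b + (be / k) * a) + ((al / k) * (1 - b) + (be / k) * (1 - a))"
   using young[of a b] young[of "1 - a" "1 - b"] ab by linarith
  also have "\<dots> = (al + be) / k" using k by (simp add: field_simps)
  also have "\<dots> = 1" using k by (simp add: k_def)
  finally show False using root[of X] root[of "1 - X"] X lt by simp
 qed
 have 1: "b powr al <= 1" "a powr be <= 1" using ab e by (auto intro: powr_le1)
 have "1 <= b powr al * a powr be" using X X1 by simp
 moreover have "b powr al * a powr be <= b powr al * 1" "b powr al * a powr be <= 1 * a powr be"
  using 1 by (intro mult_left_mono mult_right_mono; simp)+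
 ultimately have 2: "b powr al = 1" "a powr be = 1" using 1 by linarith+
 show "a = 1"
 proof (rule ccontr)
  assume "a \<noteq> 1"
  then have "a powr be < 1 powr be" using ab e by (intro powr_less_mono2) auto
  then show False using 2 by simp
 qed
 show "b = 1"
 proof (rule ccontr)
  assume "b \<noteq> 1"
  then have "b powr al < 1 powr al" using ab e by (intro powr_less_mono2) auto
  then show False using 2 by simp
 qed
qed

context GN_setting
begin

text \<open>Translations change neither the normalisation nor the L^p integral, so the ball on which
  a function keeps mass can be moved to the origin.\<close>

lemma maximizing_sequence:
 "\<exists>w \<rho> \<eta>. 0 < \<eta> \<and> (\<forall>n. w n \<in> NT) \<and> (\<forall>n. ennreal (Cgn - 1 / real (Suc n)) <= Lp_enn p (w n)) \<and>
  (\<forall>n. ennreal \<eta> <= (\<integral>\<^sup>+x. ennreal \<bar>w n x\<bar> * indicator (ball 0 \<rho>) x \<partial>\<L>))"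
proof -
 obtain \<rho> \<eta> where \<eta>: "0 < \<eta>" and nv: "\<And>u :: real^'n => real. test_fun u ==> D12_sq u <= 1 ==> Ds2_sq s u <= 1 ==> ennreal (Cgn / 2) <= Lp_enn p u ==>
  (\<exists>y. ennreal \<eta> <= (\<integral>\<^sup>+x. ennreal \<bar>u (x + y)\<bar> * indicator (ball 0 \<rho>) x \<partial>\<L>))"
  using nonvanishing[of "Cgn / 2"] Cgn_pos by auto
 have "\<exists>w\<in>NT. ennreal (Cgn - 1 / real (Suc n)) <= Lp_enn p w \<and> ennreal \<eta> <= (\<integral>\<^sup>+x. ennreal \<bar>w x\<bar> * indicator (ball 0 \<rho>) x \<partial>\<L>)" for n
 proof -
  \<comment> \<open>\<open>Cgn / 2\<close> supplies a mass bound independent of \<open>n\<close>;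
    for small \<open>n\<close> the other entry may be too small for
    \<open>nonvanishing\<close>.\<close>
  define c where "c = max (Cgn - 1 / real (Suc n)) (Cgn / 2)"
  have "c < Cgn" using Cgn_pos by (simp add: c_def)
  then obtain v where v: "v \<in> NT" "c < enn2real (Lp_enn p v)"
   using less_cSUP_iff[OF _ NT_bdd, of c] NT_positive unfolding Cgn_def by auto
  have vt: "test_fun v" "D12_sq v = 1" "Ds2_sq s v = 1" using v by (auto simp: NT_def)
  have cP: "ennreal c <= Lp_enn p v"
   using v(2) Lp_test_finite[OF vt(1)] by (metis ennreal_enn2real ennreal_leI infinity_ennreal_def less_imp_le)
  then have "ennreal (Cgn / 2) <= Lp_enn p v" by (rule order_trans[rotated]) (simp add: c_def ennreal_leI)
  then obtain y where y: "ennreal \<eta> <= (\<integral>\<^sup>+x. ennreal \<bar>v (x + y)\<bar> * indicator (ball 0 \<rho>) x \<partial>\<L>)"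
   using nv[OF vt(1)] vt by auto
  let ?w = "\<lambda>x. v (x + y)"
  note sm = fin_E_simil[OF simil_translate[of y] fin_E_test[OF s0 s1 vt(1)]]
  have "?w \<in> NT" using vt sm(2,3) by (simp add: NT_def test_fun_translate)
  moreover have "Lp_enn p ?w = Lp_enn p v"
   using Lp_enn_simil[OF simil_translate[of y] test_fun_measurable[OF vt(1)], of p 1] by simp
  then have "ennreal (Cgn - 1 / real (Suc n)) <= Lp_enn p ?w"
   using cP by (auto intro: order_trans[rotated] simp: c_def ennreal_leI)
  ultimately show ?thesis using y by blast
 qed
 then obtain w where "\<And>n. w n \<in> NT" "\<And>n. ennreal (Cgn - 1 / real (Suc n)) <= Lp_enn p (w n)"
  "\<And>n. ennreal \<eta> <= (\<integral>\<^sup>+x. ennreal \<bar>w n x\<bar> * indicator (ball 0 \<rho>) x \<partial>\<L>)" by metis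
 then show ?thesis using \<eta> by blast
qed

lemma maximizer_exists:
 "\<exists>u :: real^'n => real. u \<in> E_space s \<and> D12_sq u = 1 \<and> Ds2_sq s u = 1 \<and> Lp_enn p u = ennreal Cgn"
proof -
 obtain v \<rho> \<eta> where \<eta>: "0 < \<eta>" and v: "\<And>n. v n \<in> NT" "\<And>n. ennreal (Cgn - 1 / real (Suc n)) <= Lp_enn p (v n)"
  and vn: "\<And>n. ennreal \<eta> <= (\<integral>\<^sup>+x. ennreal \<bar>v n x\<bar> * indicator (ball 0 \<rho>) x \<partial>\<L>)"
  using maximizing_sequence by blast
 have vt: "test_fun (v n)" "D12_sq (v n) = 1" "Ds2_sq s (v n) = 1" for n using v by (auto simp: NT_def)
 obtain r u where r: "strict_mono r" and um[measurable]: "u \<in> \<M>" and c: "L1c (\<lambda>n. v (r n)) u"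
  and ae: "AE x in \<L>. (\<lambda>n. v (r n) x) \<longlonglongrightarrow> u x"
 proof -
  have "\<exists>r u. strict_mono r \<and> u \<in> \<M> \<and> L1c (\<lambda>n. v (r n)) u \<and> (AE x in \<L>. (\<lambda>n. v (r n) x) \<longlonglongrightarrow> u x)"
   by (rule local_compactness) (simp_all add: vt)
  then show ?thesis using that by blast
 qed
 define w where "w n = v (r n)" for n
 have wt: "test_fun (w n)" "D12_sq (w n) = 1" "Ds2_sq s (w n) = 1" for n using vt by (auto simp: w_def)
 note wm[measurable] = test_fun_measurable[OF wt(1)]
 have cw: "L1c w u" using c by (simp add: w_def[abs_def])
 have aew: "AE x in \<L>. (\<lambda>n. w n x) \<longlonglongrightarrow> u x" using ae by (simp add: w_def)
 have wP: "ennreal (Cgn - 1 / real (Suc n)) <= Lp_enn p (w n)" for n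
 proof -
  have "1 / real (Suc (r n)) <= 1 / real (Suc n)" using seq_suble[OF r, of n] by (intro divide_left_mono) auto
  then show ?thesis unfolding w_def by (intro order_trans[OF ennreal_leI v(2)[of "r n"]]) linarith
 qed
 have uE: "u \<in> E_space s" and a1: "D12_sq u <= 1" and b1: "Ds2_sq s u <= 1"
  using closure_E[OF s0 s1 wt(1) um _ _ cw, of 1 1] wt by auto
 have fu: "fin_E s u" by (rule E_fin[OF uE])
 have wE: "fin_E s (w n)" for n by (intro fin_E_test s0 s1 wt)
 let ?a = "D12_sq u" and ?b = "Ds2_sq s u" and ?z = "\<lambda>n x. w n x - u x"
 have zE: "fin_E s (?z n)" for n by (rule fin_E_diff(1)[OF wE fu])
 have zEs: "?z n \<in> E_space s" for n using E_lincomb[OF s0 s1 test_in_E[OF s0 s1 wt(1)[of n]] uE, of "-1"] by simp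
 \<comment> \<open>The mass kept in a fixed ball survives local L^1 convergence.\<close>
 have nz: "\<not> (AE x in \<L>. u x = 0)"
 proof
  assume 0: "AE x in \<L>. u x = 0"
  obtain n where n: "(\<integral>\<^sup>+x. ennreal \<bar>w n x - u x\<bar> * indicator (ball 0 \<rho>) x \<partial>\<L>) <= ennreal (\<eta> / 2)"
   using L1c_D[OF cw, of "\<eta> / 2" \<rho>] \<eta> by (auto simp: eventually_sequentially)
  have "(\<integral>\<^sup>+x. ennreal \<bar>w n x\<bar> * indicator (ball 0 \<rho>) x \<partial>\<L>) = (\<integral>\<^sup>+x. ennreal \<bar>w n x - u x\<bar> * indicator (ball 0 \<rho>) x \<partial>\<L>)"
   using 0 by (intro nn_integral_cong_AE) auto
  then have "ennreal \<eta> <= ennreal (\<eta> / 2)" using n vn[of "r n"] unfolding w_def by (auto intro: order_trans)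
  then show False using \<eta> by simp
 qed
 have zA: "D12_sq (?z n) <= 4" "Ds2_sq s (?z n) <= 4" for n
  using form_lincomb_le[OF wE[of n] fu, of "-1"] wt(2,3)[of n] a1 b1 by auto
 \<comment> \<open>Gradients are not known to converge almost everywhere, so \<open>u\<close> is
   replaced by a test function close in energy, for which the cross term tends to 0; Cauchy-Schwarz
   controls the error.\<close>
 have formA: "(\<lambda>n. D12_form (?z n) u) \<longlonglongrightarrow> 0"
 proof (rule tendstoI)
  fix e :: real assume e: "e > 0"
  obtain \<phi> where \<phi>: "\<And>k. test_fun (\<phi> k)" "(\<lambda>k. D12_sq (\<lambda>x. \<phi> k x - u x) + Ds2_sq s (\<lambda>x. \<phi> k x - u x)) \<longlonglongrightarrow> 0"
   using E_spaceD'[OF uE] by blast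
  have "\<forall>\<^sub>F k in sequentially. D12_sq (\<lambda>x. \<phi> k x - u x) + Ds2_sq s (\<lambda>x. \<phi> k x - u x) < (e / 8)\<^sup>2"
   using e by (intro order_tendstoD(2)[OF \<phi>(2)]) simp
  then obtain k where k: "D12_sq (\<lambda>x. \<phi> k x - u x) + Ds2_sq s (\<lambda>x. \<phi> k x - u x) < (e / 8)\<^sup>2" by (auto simp: eventually_sequentially)
  have pE: "fin_E s (\<phi> k)" by (intro fin_E_test s0 s1 \<phi>)
  have dE: "fin_E s (\<lambda>x. \<phi> k x - u x)" by (rule fin_E_diff(1)[OF pE fu])
  have "sqrt (D12_sq (\<lambda>x. \<phi> k x - u x)) <= sqrt ((e / 8)\<^sup>2)" using k Ds2_sq_nonneg[of s "\<lambda>x. \<phi> k x - u x"] by (intro real_sqrt_le_mono) linarith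
  then have sd: "sqrt (D12_sq (\<lambda>x. \<phi> k x - u x)) <= e / 8" using e by simp
  have "\<forall>\<^sub>F n in sequentially. dist (D12_form (?z n) (\<phi> k)) 0 < e / 2"
   using D12_form_test_tendsto[OF s0 s1 wt(1) fu cw \<phi>(1), of k] e by (intro tendstoD) auto
  then show "\<forall>\<^sub>F n in sequentially. dist (D12_form (?z n) u) 0 < e"
  proof eventually_elim
   case (elim n)
   have eq: "D12_form (?z n) (\<lambda>x. \<phi> k x - u x) = D12_form (?z n) (\<phi> k) - D12_form (?z n) u"
    using D12_form_lincomb_right[OF pE fu zE[of n], of "-1"] by simp
   have "\<bar>D12_form (?z n) (\<lambda>x. \<phi> k x - u x)\<bar> <= sqrt (D12_sq (?z n)) * sqrt (D12_sq (\<lambda>x. \<phi> k x - u x))"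
    by (rule forms_Cauchy_Schwarz(1)[OF zE dE])
   also have "\<dots> <= sqrt 4 * (e / 8)" by (intro mult_mono real_sqrt_le_mono zA(1) sd) auto
   also have "\<dots> = e / 4" by simp
   finally have "\<bar>D12_form (?z n) (\<phi> k) - D12_form (?z n) u\<bar> <= e / 4" unfolding eq .
   moreover have "\<bar>P - U\<bar> <= e / 4 ==> \<bar>P\<bar> < e / 2 ==> \<bar>U\<bar> < e" for P U :: real using e by linarith
   ultimately show ?case using elim by (simp only: dist_real_def diff_zero)
  qed
 qed
 \<comment> \<open>Here almost everywhere convergence is available on pairs and gives the cross term
   directly.\<close>
 have formB: "(\<lambda>n. Ds2_form s (?z n) u) \<longlonglongrightarrow> 0"
  unfolding Ds2_form_def
 proof (rule cross_term_tendsto[where K=4])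
  show "(\<integral>z. (norm (fdiff s (?z n) z))\<^sup>2 \<partial>\<L>\<^sub>2) <= 4" for n
   using zA(2)[of n] unfolding Ds2_sq_eq[OF zE] .
  show "AE z in \<L> \<Otimes>\<^sub>M \<L>. (\<lambda>n. fdiff s (?z n) z) \<longlonglongrightarrow> 0"
   using AE_pair_leb[OF aew]
  proof eventually_elim
   case (elim z)
   then have "(\<lambda>n. w n (fst z) - u (fst z)) \<longlonglongrightarrow> 0" "(\<lambda>n. w n (snd z) - u (snd z)) \<longlonglongrightarrow> 0" by (auto intro: LIM_zero)
   then have "(\<lambda>n. (w n (fst z) - u (fst z)) - (w n (snd z) - u (snd z))) \<longlonglongrightarrow> 0 - 0" by (intro tendsto_diff)
   then show ?case unfolding fdiff_def divide_inverse by (intro tendsto_mult_left_zero) simp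
  qed
 qed (intro fin_E_L2 zE fu)+
 have A: "D12_sq (?z n) = 1 - ?a - 2 * D12_form (?z n) u" "Ds2_sq s (?z n) = 1 - ?b - 2 * Ds2_form s (?z n) u" for n
  using fin_E_add(2,3)[OF zE[of n] fu] wt(2,3)[of n] by simp_all
 have "(\<lambda>n. 1 - ?a - 2 * D12_form (?z n) u) \<longlonglongrightarrow> 1 - ?a - 2 * 0" "(\<lambda>n. 1 - ?b - 2 * Ds2_form s (?z n) u) \<longlonglongrightarrow> 1 - ?b - 2 * 0"
  by (intro tendsto_intros formA formB)+
 then have limA: "(\<lambda>n. D12_sq (?z n)) \<longlonglongrightarrow> 1 - ?a" "(\<lambda>n. Ds2_sq s (?z n)) \<longlonglongrightarrow> 1 - ?b" unfolding A by simp_all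
 have limP: "(\<lambda>n. Cgn * (Ds2_sq s (?z n) powr al * D12_sq (?z n) powr be)) \<longlonglongrightarrow> Cgn * ((1 - ?b) powr al * (1 - ?a) powr be)"
  using exponents(1,2) by (intro tendsto_mult tendsto_const tendsto_powr' limA) auto
 have Pu: "Lp_enn p u <= ennreal (Cgn * (?b powr al * ?a powr be))" by (rule GN_E[OF uE])
 then have Pfin: "Lp_enn p u < \<infinity>" by (auto intro: le_less_trans)
 define P where "P = enn2real (Lp_enn p u)"
 have PP: "Lp_enn p u = ennreal P" using Pfin by (simp add: P_def)
 have P0: "P > 0"
  using nz Lp_zero_iff[OF um] unfolding PP by (auto simp: P_def less_le)
 \<comment> \<open>Brezis-Lieb splits the mass into the part P kept by the limit and the part
   carried by \<open>w n - u\<close>. The inequality bounds the latter, and the energies of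
   \<open>w n - u\<close> tend to 1 minus those of \<open>u\<close>.\<close>
 have up: "Cgn <= (1 + \<epsilon>) * (Cgn * ((1 - ?b) powr al * (1 - ?a) powr be)) + P + \<epsilon>" if \<epsilon>: "\<epsilon> > 0" for \<epsilon>
 proof -
  have BL: "\<forall>\<^sub>F n in sequentially. Lp_enn p (w n) <= ennreal (1 + \<epsilon>) * Lp_enn p (?z n) + Lp_enn p u + ennreal \<epsilon>"
   using exponents(4) by (intro Brezis_Lieb_le aew Pfin \<epsilon>) auto
  have "(\<lambda>n. Cgn - 1 / real (Suc n)) \<longlonglongrightarrow> Cgn - 0" by (intro tendsto_intros LIMSEQ_Suc[OF lim_1_over_n])
  then have l1: "(\<lambda>n. Cgn - 1 / real (Suc n)) \<longlonglongrightarrow> Cgn" by simp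
  have l2: "(\<lambda>n. (1 + \<epsilon>) * (Cgn * (Ds2_sq s (?z n) powr al * D12_sq (?z n) powr be)) + P + \<epsilon>) \<longlonglongrightarrow> (1 + \<epsilon>) * (Cgn * ((1 - ?b) powr al * (1 - ?a) powr be)) + P + \<epsilon>"
   by (intro tendsto_intros limP)
  show ?thesis
  proof (rule tendsto_le[OF _ l2 l1])
   show "\<forall>\<^sub>F n in sequentially. Cgn - 1 / real (Suc n) <= (1 + \<epsilon>) * (Cgn * (Ds2_sq s (?z n) powr al * D12_sq (?z n) powr be)) + P + \<epsilon>"
    using BL
   proof eventually_elim
    case (elim n)
    let ?r = "Cgn * (Ds2_sq s (?z n) powr al * D12_sq (?z n) powr be)"
    have r0: "0 <= ?r" using Cgn_pos by simp
    have "ennreal (Cgn - 1 / real (Suc n)) <= ennreal (1 + \<epsilon>) * Lp_enn p (?z n) + Lp_enn p u + ennreal \<epsilon>"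
     using wP elim by (rule order_trans)
    also have "\<dots> <= ennreal (1 + \<epsilon>) * ennreal ?r + ennreal P + ennreal \<epsilon>"
     unfolding PP by (intro add_mono mult_left_mono GN_E zEs order_refl) auto
    also have "\<dots> = ennreal ((1 + \<epsilon>) * ?r + P + \<epsilon>)"
    proof -
     have "ennreal (1 + \<epsilon>) * ennreal ?r = ennreal ((1 + \<epsilon>) * ?r)" using \<epsilon> r0 by (intro ennreal_mult[symmetric]) auto
     moreover have "ennreal ((1 + \<epsilon>) * ?r) + ennreal P = ennreal ((1 + \<epsilon>) * ?r + P)" using \<epsilon> r0 P0 by (intro ennreal_plus[symmetric]) auto
     moreover have "ennreal ((1 + \<epsilon>) * ?r + P) + ennreal \<epsilon> = ennreal ((1 + \<epsilon>) * ?r + P + \<epsilon>)" using \<epsilon> r0 P0 by (intro ennreal_plus[symmetric]) auto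
     ultimately show ?thesis by simp
    qed
    finally show ?case using \<epsilon> r0 P0 by (subst (asm) ennreal_le_iff) auto
   qed
  qed simp
 qed
 have "(\<lambda>n. (1 + 1 / real (Suc n)) * (Cgn * ((1 - ?b) powr al * (1 - ?a) powr be)) + P + 1 / real (Suc n)) \<longlonglongrightarrow> (1 + 0) * (Cgn * ((1 - ?b) powr al * (1 - ?a) powr be)) + P + 0"
  by (intro tendsto_intros LIMSEQ_Suc[OF lim_1_over_n])
 then have fin: "Cgn <= (1 + 0) * (Cgn * ((1 - ?b) powr al * (1 - ?a) powr be)) + P + 0"
  by (rule LIMSEQ_le_const) (use up in auto)
 have "P <= Cgn * (?b powr al * ?a powr be)" using Pu Cgn_pos unfolding PP by (subst (asm) ennreal_le_iff) auto
 then have X: "0 < P / Cgn" "P / Cgn <= ?b powr al * ?a powr be" "1 - P / Cgn <= (1 - ?b) powr al * (1 - ?a) powr be"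
  using fin P0 Cgn_pos by (simp_all add: field_simps)
 have "1 < al + be" using exponents(3,4) by simp
 from split_arith[OF exponents(1,2) this _ a1 _ b1 X]
 have "P / Cgn = 1" "?a = 1" "?b = 1" by simp_all
 then have "P = Cgn" using Cgn_pos by simp
 then show ?thesis using uE \<open>?a = 1\<close> \<open>?b = 1\<close> PP by auto
qed

end

section \<open>Contractions and polarization\<close>

text \<open>A smooth positive part: t exp(-1/t) for t > 0, with slope between 0 and 1 and within
  distance 1 of the positive part.\<close>

definition psi :: "real => real" where "psi t = t * flat 0 t"

text \<open>A smooth modulus: even, 1-Lipschitz, within 2 \<delta> of |t|, and zero on
  [-\<delta>, \<delta>]. The flat piece cancels the jump of the sign in \<open>pol\<close>.\<close>

definition eta :: "real => real => real" where
 "eta \<delta> t = \<delta> * psi ((t - \<delta>) / \<delta>) + \<delta> * psi ((- t - \<delta>) / \<delta>)"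

lemma psi_nonpos: "t <= 0 ==> psi t = 0" by (simp add: psi_def flat_def)

lemma psi_bounds: "0 <= psi t" "t - 1 <= psi t" "t > 0 ==> psi t <= t"
proof -
 show "0 <= psi t" by (simp add: psi_def flat_def)
 show "t > 0 ==> psi t <= t" using flat0_le1[of t] by (simp add: psi_def)
 show "t - 1 <= psi t"
 proof (cases "t > 0")
  case True
  have "t * (1 + - (1/t)) <= t * exp (- (1/t))" using True exp_ge_add_one_self[of "- (1/t)"] by (intro mult_left_mono) auto
  then show ?thesis using True by (simp add: psi_def flat_def algebra_simps)
 qed (simp add: psi_nonpos)
qed

lemma Ck1_psi: "Ck1 k psi"
 unfolding psi_def[abs_def] by (intro Ck1_mult Ck1_ident Ck1_flat)

lemma psi_deriv: "\<exists>d. 0 <= d \<and> d <= 1 \<and> (psi has_real_derivative d) (at t)"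
proof (intro exI conjI)
 show "(psi has_real_derivative (flat 0 t + t * flat 2 t)) (at t)"
  unfolding psi_def[abs_def] using flat_has_derivative[of 0 t]
  by (auto intro!: derivative_eq_intros simp: numeral_2_eq_2)
 show "0 <= flat 0 t + t * flat 2 t" by (auto simp: flat_def)
 show "flat 0 t + t * flat 2 t <= 1"
 proof (cases "t > 0")
  case True
  have "exp (- (1/t)) * (1 + 1/t) <= exp (- (1/t)) * exp (1/t)" by (intro mult_left_mono exp_ge_add_one_self) auto
  also have "\<dots> = 1" by (simp add: exp_minus)
  finally show ?thesis using True by (simp add: flat_def power2_eq_square distrib_left)
 qed (simp add: flat_def)
qed

lemma Ck1_eta: "Ck1 k (eta \<delta>)"
proof -
 have 1: "Ck1 k (\<lambda>t. a * t + b)" for a b :: real by (intro Ck1_add Ck1_mult Ck1_const Ck1_ident)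
 have "eta \<delta> = (\<lambda>t. \<delta> * psi ((1/\<delta>) * t + (- \<delta>/\<delta>)) + \<delta> * psi ((- 1/\<delta>) * t + (- \<delta>/\<delta>)))"
  by (auto simp: eta_def diff_divide_distrib)
 then show ?thesis by (simp only:) (intro Ck1_add[of k "\<lambda>t. \<delta> * psi ((1/\<delta>) * t + (- \<delta>/\<delta>))"] Ck1_mult Ck1_const Ck1_compose[OF Ck1_psi 1])
qed

lemma eta_deriv:
 assumes "\<delta> > 0" obtains d where "\<bar>d\<bar> <= 1" "(eta \<delta> has_real_derivative d) (at t)"
proof -
 obtain d1 where d1: "0 <= d1" "d1 <= 1" "(psi has_real_derivative d1) (at ((t - \<delta>) / \<delta>))" using psi_deriv by blast
 obtain d2 where d2: "0 <= d2" "d2 <= 1" "(psi has_real_derivative d2) (at ((- t - \<delta>) / \<delta>))" using psi_deriv by blast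
 have l1: "((\<lambda>t. (t - \<delta>) / \<delta>) has_real_derivative 1 / \<delta>) (at t)" and l2: "((\<lambda>t. (- t - \<delta>) / \<delta>) has_real_derivative - 1 / \<delta>) (at t)"
  using assms by (auto intro!: derivative_eq_intros)
 have "(eta \<delta> has_real_derivative \<delta> * (d1 * (1 / \<delta>)) + \<delta> * (d2 * (- 1 / \<delta>))) (at t)"
  unfolding eta_def[abs_def]
  by (intro DERIV_add DERIV_cmult DERIV_chain2[OF d1(3) l1] DERIV_chain2[OF d2(3) l2])
 then have "(eta \<delta> has_real_derivative d1 - d2) (at t)" using assms by simp
 then show thesis using that[of "d1 - d2"] d1 d2 by (auto simp: abs_le_iff)
qed

lemma eta_props:
 assumes \<delta>: "\<delta> > 0"
 shows "eta \<delta> (- t) = eta \<delta> t" "\<bar>t\<bar> <= \<delta> ==> eta \<delta> t = 0" "0 <= eta \<delta> t" "\<bar>eta \<delta> t - \<bar>t\<bar>\<bar> <= 2 * \<delta>"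
  "\<bar>eta \<delta> a - eta \<delta> b\<bar> <= \<bar>a - b\<bar>"
proof -
 show "eta \<delta> (- t) = eta \<delta> t" by (simp add: eta_def)
 have z: "psi ((x - \<delta>) / \<delta>) = 0" if "x <= \<delta>" for x
  using that \<delta> by (intro psi_nonpos) (simp add: divide_nonpos_pos)
 show e0: "\<bar>t\<bar> <= \<delta> ==> eta \<delta> t = 0" using z[of t] z[of "-t"] by (simp add: eta_def)
 show "0 <= eta \<delta> t" using \<delta> psi_bounds(1) by (simp add: eta_def)
 have main: "\<bar>eta \<delta> x - x\<bar> <= 2 * \<delta>" if x: "x > \<delta>" for x
 proof -
  have "eta \<delta> x = \<delta> * psi ((x - \<delta>) / \<delta>)" using z[of "-x"] x \<delta> by (simp add: eta_def)
  moreover have e1: "\<delta> * ((x - \<delta>) / \<delta>) = x - \<delta>" using \<delta> by simp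
  then have e2: "\<delta> * ((x - \<delta>) / \<delta> - 1) = x - 2 * \<delta>" by (simp add: right_diff_distrib)
  have "\<delta> * psi ((x - \<delta>) / \<delta>) <= \<delta> * ((x - \<delta>) / \<delta>)"
   using x \<delta> by (intro mult_left_mono psi_bounds(3)) auto
  then have "\<delta> * psi ((x - \<delta>) / \<delta>) <= x - \<delta>" unfolding e1 .
  moreover have "\<delta> * ((x - \<delta>) / \<delta> - 1) <= \<delta> * psi ((x - \<delta>) / \<delta>)"
   using \<delta> by (intro mult_left_mono psi_bounds(2)) auto
  then have "x - 2 * \<delta> <= \<delta> * psi ((x - \<delta>) / \<delta>)" unfolding e2 .
  ultimately show ?thesis using \<delta> by (simp add: abs_le_iff)
 qed
 show "\<bar>eta \<delta> t - \<bar>t\<bar>\<bar> <= 2 * \<delta>"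
 proof (cases "\<bar>t\<bar> <= \<delta>")
  case True then show ?thesis using e0 \<delta> by simp
 next
  case False
  then have "eta \<delta> t = eta \<delta> \<bar>t\<bar>" by (simp add: eta_def abs_if)
  then show ?thesis using main[of "\<bar>t\<bar>"] False by simp
 qed
 have "\<bar>eta \<delta> a - eta \<delta> b\<bar> <= \<bar>a - b\<bar>" if ab: "a < b" for a b
 proof -
  have "\<forall>x. \<exists>d. \<bar>d\<bar> <= 1 \<and> (eta \<delta> has_real_derivative d) (at x)" using eta_deriv[OF \<delta>] by metis
  then obtain D where D: "\<And>x. \<bar>D x\<bar> <= 1" "\<And>x. (eta \<delta> has_real_derivative D x) (at x)" by metis
  obtain z where "eta \<delta> b - eta \<delta> a = (b - a) * D z" using MVT2[OF ab, of "eta \<delta>" D] D(2) by blast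
  then have "\<bar>eta \<delta> b - eta \<delta> a\<bar> = (b - a) * \<bar>D z\<bar>" using ab by (simp add: abs_mult)
  also have "\<dots> <= (b - a) * 1" using ab D by (intro mult_left_mono) auto
  finally show ?thesis using ab by simp
 qed
 from this[of a b] this[of b a] show "\<bar>eta \<delta> a - eta \<delta> b\<bar> <= \<bar>a - b\<bar>" by (cases a b rule: linorder_cases) auto
qed

lemma closure_E_lim:
 fixes u :: "real^'n::finite => real"
 assumes s: "0 < s" "s < 1" and v: "\<And>n. test_fun (v n)" and u: "u \<in> \<M>"
  and a: "\<And>n. D12_sq (v n) <= a n" "a \<longlonglongrightarrow> A" and b: "\<And>n. Ds2_sq s (v n) <= b n" "b \<longlonglongrightarrow> B" and c: "L1c v u"
 shows "u \<in> E_space s" "D12_sq u <= A" "Ds2_sq s u <= B"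
proof -
 have *: "u \<in> E_space s \<and> D12_sq u <= A + e \<and> Ds2_sq s u <= B + e" if e: "e > 0" for e
 proof -
  have "\<forall>\<^sub>F n in sequentially. a n < A + e \<and> b n < B + e"
   using e by (intro eventually_conj order_tendstoD(2)[OF a(2)] order_tendstoD(2)[OF b(2)]) auto
  then obtain K where K: "\<And>n. n \<ge> K ==> a n < A + e \<and> b n < B + e" by (auto simp: eventually_sequentially)
  have "L1c (\<lambda>n. v (n + K)) u" by (rule L1c_subseq[OF c]) (simp add: strict_mono_def)
  moreover have "D12_sq (v (n + K)) <= A + e" "Ds2_sq s (v (n + K)) <= B + e" for n
   using a(1)[of "n + K"] b(1)[of "n + K"] K[of "n + K"] by auto
  ultimately show ?thesis
   using closure_E[OF s, of "\<lambda>n. v (n + K)" u "A + e" "B + e"] v u by blast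
 qed
 show "u \<in> E_space s" using *[of 1] by simp
 show "D12_sq u <= A" "Ds2_sq s u <= B" using * by (auto intro: field_le_epsilon)
qed

lemma L1c_dom:
 assumes [measurable]: "\<And>k. g k \<in> \<M>" "g' \<in> \<M>" "\<And>k. h k \<in> \<M>" "h' \<in> \<M>"
  and g: "L1c g g'" and h: "L1c h h'" and c: "c \<longlonglongrightarrow> (0::real)" "\<And>k. c k \<ge> 0"
  and le: "\<And>k x. \<bar>f k x - f' x\<bar> <= \<bar>g k x - g' x\<bar> + \<bar>h k x - h' x\<bar> + c k"
 shows "L1c f (f' :: real^'n::finite => real)"
 unfolding L1c_def
proof
 fix R
 let ?I = "\<lambda>f u k. \<integral>\<^sup>+x. ennreal \<bar>f k x - u x\<bar> * indicator (ball 0 R) x \<partial>\<L>"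
 let ?v = "emeasure \<L> (ball (0::real^'n) R)"
 have "(\<lambda>k. ?v * ennreal (c k)) \<longlonglongrightarrow> ?v * ennreal 0"
  using finite_ball[of "0::real^'n" R] c by (intro ennreal_tendsto_cmult tendsto_ennrealI) auto
 then have "(\<lambda>k. ?I g g' k + ?I h h' k + ?v * ennreal (c k)) \<longlonglongrightarrow> 0 + 0 + ?v * ennreal 0"
  using g h by (intro tendsto_add) (auto simp: L1c_def)
 then have lim: "(\<lambda>k. ?I g g' k + ?I h h' k + ?v * ennreal (c k)) \<longlonglongrightarrow> 0" by simp
 have "?I f f' k <= ?I g g' k + ?I h h' k + ?v * ennreal (c k)" for k
 proof -
  have "ennreal \<bar>f k x - f' x\<bar> <= ennreal \<bar>g k x - g' x\<bar> + ennreal \<bar>h k x - h' x\<bar> + ennreal (c k)" for x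
   using le[of k x] c(2)[of k] by (simp add: ennreal_plus[symmetric] ennreal_leI del: ennreal_plus)
  then have "?I f f' k <= (\<integral>\<^sup>+x. (ennreal \<bar>g k x - g' x\<bar> * indicator (ball 0 R) x + ennreal \<bar>h k x - h' x\<bar> * indicator (ball 0 R) x) + ennreal (c k) * indicator (ball 0 R) x \<partial>\<L>)"
   by (intro nn_integral_mono) (auto simp: indicator_def)
  also have "\<dots> = ?I g g' k + ?I h h' k + ?v * ennreal (c k)"
   by (subst nn_integral_add, measurable, subst nn_integral_add, measurable) (simp add: nn_integral_cmult_indicator mult.commute)
  finally show ?thesis .
 qed
 then show "?I f f' \<longlonglongrightarrow> 0"
  by (intro tendsto_sandwich[OF _ _ tendsto_const lim]) (auto intro: always_eventually)
qed

lemma D12_sq_mono_grad: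
 assumes f: "test_fun f" and g: "test_fun g" and le: "\<And>x. norm (grad f x) <= norm (grad g x)"
 shows "D12_sq f <= D12_sq g"
 unfolding D12_sq_test(3)[OF f] D12_sq_test(3)[OF g]
 using le D12_sq_test(2)[OF f] D12_sq_test(2)[OF g] by (intro integral_mono power_mono) auto

lemma grad_chain:
 assumes "smooth f" "(h has_real_derivative d) (at (f x))" shows "grad (\<lambda>x. h (f x)) x = d *\<^sub>R grad f x"
 using partial_d_chain[OF smooth_differentiable[OF assms(1)] assms(2)] by (simp add: vec_eq_iff)

lemma Ds2_enn_contraction:
 assumes "\<And>x y. \<bar>f x - f y\<bar> <= \<bar>g x - g y\<bar>" shows "Ds2_enn s f <= Ds2_enn s g"
 unfolding Ds2_enn_def using assms
 by (intro nn_integral_mono ennreal_leI divide_right_mono) (auto simp: abs_le_square_iff[symmetric])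

text \<open>The smoothed modulus maps test functions to test functions and increases neither energy,
  having slope at most 1. The closure principle gives the modulus itself as \<delta> = 1/(k+1) tends
  to 0.\<close>

lemma abs_E:
 fixes u :: "real^'n::finite => real"
 assumes s: "0 < s" "s < 1" and u: "u \<in> E_space s"
 shows "(\<lambda>x. \<bar>u x\<bar>) \<in> E_space s" "D12_sq (\<lambda>x. \<bar>u x\<bar>) <= D12_sq u" "Ds2_sq s (\<lambda>x. \<bar>u x\<bar>) <= Ds2_sq s u"
proof -
 obtain \<phi> where fu: "fin_E s u" and \<phi>: "\<And>k. test_fun (\<phi> k)" "(\<lambda>k. D12_sq (\<lambda>x. \<phi> k x - u x) + Ds2_sq s (\<lambda>x. \<phi> k x - u x)) \<longlonglongrightarrow> 0" "L1c \<phi> u"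
  using E_spaceD'[OF u] by blast
 note [measurable] = fin_E_measurable[OF fu] test_fun_measurable[OF \<phi>(1)]
 have pE: "fin_E s (\<phi> k)" for k by (intro fin_E_test s \<phi>)
 let ?\<delta> = "\<lambda>k. 1 / real (Suc k)"
 let ?v = "\<lambda>k x. eta (?\<delta> k) (\<phi> k x)"
 have \<delta>: "?\<delta> k > 0" for k by simp
 note ep = eta_props[OF \<delta>]
 have vt: "test_fun (?v k)" for k 
  by (rule test_fun_compose[OF Ck1_eta _ \<phi>(1)]) (rule ep(2), simp)
 have A: "D12_sq (?v k) <= D12_sq (\<phi> k)" for k
 proof (rule D12_sq_mono_grad[OF vt \<phi>(1)])
  fix x
  obtain d where d: "\<bar>d\<bar> <= 1" "(eta (?\<delta> k) has_real_derivative d) (at (\<phi> k x))" using eta_deriv[OF \<delta>] by blast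
  show "norm (grad (?v k) x) <= norm (grad (\<phi> k) x)"
   using grad_chain[OF test_fun_smooth[OF \<phi>(1)] d(2)] d(1) by (simp add: mult_left_le_one_le)
 qed
 have B: "Ds2_sq s (?v k) <= Ds2_sq s (\<phi> k)" for k
 proof -
  have "Ds2_enn s (?v k) <= Ds2_enn s (\<phi> k)" by (rule Ds2_enn_contraction) (rule ep(5))
  then show ?thesis unfolding Ds2_enn_ennreal[OF fin_E_test[OF s vt]] Ds2_enn_ennreal[OF pE] by simp
 qed
 have "(\<lambda>k. 2 * ?\<delta> k) \<longlonglongrightarrow> 2 * 0" by (intro tendsto_intros LIMSEQ_Suc[OF lim_1_over_n])
 then have c0: "(\<lambda>k. 2 * ?\<delta> k) \<longlonglongrightarrow> 0" by simp
 have c: "L1c ?v (\<lambda>x. \<bar>u x\<bar>)"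
 proof (rule L1c_dom[OF _ _ _ _ \<phi>(3) L1c_const[of "\<lambda>x. 0"] c0])
  fix k x
  show "\<bar>?v k x - \<bar>u x\<bar>\<bar> <= \<bar>\<phi> k x - u x\<bar> + \<bar>0 - 0\<bar> + 2 * ?\<delta> k"
  proof -
   have "\<bar>?v k x - \<bar>u x\<bar>\<bar> <= \<bar>?v k x - \<bar>\<phi> k x\<bar>\<bar> + \<bar>\<bar>\<phi> k x\<bar> - \<bar>u x\<bar>\<bar>"
    using abs_triangle_ineq[of "?v k x - \<bar>\<phi> k x\<bar>" "\<bar>\<phi> k x\<bar> - \<bar>u x\<bar>"] by simp
   also have "\<dots> <= 2 * ?\<delta> k + \<bar>\<phi> k x - u x\<bar>" by (intro add_mono ep(4) abs_triangle_ineq3)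
   finally show ?thesis by simp
  qed
 qed auto
 have m: "(\<lambda>x. \<bar>u x\<bar>) \<in> \<M>" by measurable
 from closure_E_lim[OF s vt m A form_tendsto(1)[OF pE fu \<phi>(2)] B form_tendsto(2)[OF pE fu \<phi>(2)] c]
 show "(\<lambda>x. \<bar>u x\<bar>) \<in> E_space s" "D12_sq (\<lambda>x. \<bar>u x\<bar>) <= D12_sq u" "Ds2_sq s (\<lambda>x. \<bar>u x\<bar>) <= Ds2_sq s u" by auto
qed

subsection \<open>Reflections\<close>

definition refl_map :: "real^'n::finite => real => real^'n => real^'n" where
 "refl_map e t x = x - (2 * (x \<bullet> e - t)) *\<^sub>R e"

text \<open>Polarization written by even and odd parts. With \<open>h = abs\<close> and
  \<open>c = 1\<close> the larger of the values at two mirror points goes to the side x . e > t,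
  with \<open>c = -1\<close> to the other side; \<open>h = eta \<delta>\<close> is the smooth
  version.\<close>

definition pol :: "real^'n::finite => real => real => (real => real) => (real^'n => real) => real^'n => real" where
 "pol e t c h u x = (u x + u (refl_map e t x)) / 2 + c * sgn (x \<bullet> e - t) * h ((u x - u (refl_map e t x)) / 2)"

locale reflection =
 fixes e :: "real^'n::finite" and t :: real
 assumes e1: "norm e = 1"
begin

abbreviation "\<sigma> \<equiv> refl_map e t"
abbreviation "ht x \<equiv> x \<bullet> e - t"

lemma ee: "e \<bullet> e = 1" using e1 by (simp add: dot_square_norm)

lemma ht_refl [simp]: "ht (\<sigma> x) = - ht x"
 by (simp add: refl_map_def inner_diff_left ee algebra_simps)

lemma refl_refl [simp]: "\<sigma> (\<sigma> x) = x"
 unfolding refl_map_def[of e t "\<sigma> x"] ht_refl unfolding refl_map_def by (simp only: mult_minus_right scaleR_minus_left) simp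

lemma refl_fixed: "ht x = 0 ==> \<sigma> x = x" by (simp add: refl_map_def)

lemma refl_simil: "simil 1 \<sigma>"
proof -
 have "orthogonal_transformation (\<lambda>x. x - (2 * (x \<bullet> e)) *\<^sub>R e)"
  unfolding orthogonal_transformation_def
  by (auto intro!: linearI simp: inner_add_left inner_diff_left inner_diff_right ee scaleR_add_left scaleR_diff_left inner_commute algebra_simps)
 from similI[OF zero_less_one this, of "(2 * t) *\<^sub>R e"] show ?thesis
  by (simp add: refl_map_def[abs_def] algebra_simps)
qed

lemma dist_refl_sq: "(dist (\<sigma> x) y)\<^sup>2 = (dist x y)\<^sup>2 + 4 * ht x * ht y"
proof -
 have gen: "(norm (w - k *\<^sub>R e))\<^sup>2 = (norm w)\<^sup>2 - 2 * k * (w \<bullet> e) + k\<^sup>2" for w k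
  unfolding power2_norm_eq_inner by (simp add: inner_diff_left inner_diff_right inner_commute ee power2_eq_square algebra_simps)
 have "\<sigma> x - y = (x - y) - (2 * ht x) *\<^sub>R e" by (simp add: refl_map_def)
 then have "(dist (\<sigma> x) y)\<^sup>2 = (dist x y)\<^sup>2 - 2 * (2 * ht x) * ((x - y) \<bullet> e) + (2 * ht x)\<^sup>2"
  unfolding dist_norm by (simp only: gen)
 moreover have "(x - y) \<bullet> e = ht x - ht y" by (simp add: inner_diff_left)
 ultimately show ?thesis by (simp only:) (simp add: power2_eq_square algebra_simps)
qed

lemma dist_refl_refl: "dist (\<sigma> x) (\<sigma> y) = dist x y"
 using simil_dist[OF refl_simil] by simp

lemma dist_refl_swap: "dist x (\<sigma> y) = dist (\<sigma> x) y"
 using dist_refl_refl[of x "\<sigma> y"] by simp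

text \<open>Squared differences summed over the four pairs obtained by reflecting either variable.
  The integral is just four times the seminorm, but this sum can be compared pointwise with that of
  the polarization.\<close>

definition G4 :: "real => (real^'n => real) => (real^'n) \<times> (real^'n) => real" where
 "G4 s u z = (fdiff s u z)\<^sup>2 + (fdiff s u (pmap \<sigma> \<sigma> z))\<^sup>2 + ((fdiff s u (pmap \<sigma> (\<lambda>x. x) z))\<^sup>2 + (fdiff s u (pmap (\<lambda>x. x) \<sigma> z))\<^sup>2)"

lemma G4_nonneg: "0 <= G4 s u z" by (simp add: G4_def)

lemma G4_measurable [measurable]:
 assumes "u \<in> \<M>" shows "G4 s u \<in> borel_measurable \<L>\<^sub>2"
proof -
 have id: "(\<lambda>x::real^'n. x) \<in> \<L> \<rightarrow>\<^sub>M \<L>" by simp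
 note m = simil_pmap_measurable[OF simil_measurable[OF refl_simil] simil_measurable[OF refl_simil]]
  simil_pmap_measurable[OF simil_measurable[OF refl_simil] id] simil_pmap_measurable[OF id simil_measurable[OF refl_simil]]
 note f = fdiff_measurable[OF assms, of s]
 show ?thesis unfolding G4_def[abs_def]
  by (intro borel_measurable_add borel_measurable_power f measurable_compose[OF m(1) f] measurable_compose[OF m(2) f] measurable_compose[OF m(3) f])
qed

lemma G4_integral:
 assumes u: "u \<in> \<M>"
 shows "(\<integral>\<^sup>+z. ennreal (G4 s u z) \<partial>\<L>\<^sub>2) = 4 * Ds2_enn s u"
proof -
 let ?F = "\<lambda>z. ennreal ((fdiff s u z)\<^sup>2)"
 have F: "?F \<in> borel_measurable \<L>\<^sub>2" using fdiff_measurable[OF u] by measurable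
 have D: "Ds2_enn s u = (\<integral>\<^sup>+z. ?F z \<partial>\<L>\<^sub>2)" by (simp add: Ds2_enn_fdiff)
 have id: "(\<lambda>x::real^'n. x) \<in> \<L> \<rightarrow>\<^sub>M \<L>" by simp
 note m = simil_pmap_measurable[OF simil_measurable[OF refl_simil] simil_measurable[OF refl_simil]]
  simil_pmap_measurable[OF simil_measurable[OF refl_simil] id] simil_pmap_measurable[OF id simil_measurable[OF refl_simil]]
 note i = simil_nn_integral_pair[OF refl_simil refl_simil F] simil_nn_integral_pair[OF refl_simil simil_id F] simil_nn_integral_pair[OF simil_id refl_simil F]
 have Fc: "(\<lambda>z. ?F (pmap \<sigma> \<sigma> z)) \<in> borel_measurable \<L>\<^sub>2"
  "(\<lambda>z. ?F (pmap \<sigma> (\<lambda>x. x) z)) \<in> borel_measurable \<L>\<^sub>2"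
  "(\<lambda>z. ?F (pmap (\<lambda>x. x) \<sigma> z)) \<in> borel_measurable \<L>\<^sub>2"
  by (intro measurable_compose[OF _ F] m)+
 have "(\<integral>\<^sup>+z. ennreal (G4 s u z) \<partial>\<L>\<^sub>2) =
  (\<integral>\<^sup>+z. (?F z + ?F (pmap \<sigma> \<sigma> z)) + (?F (pmap \<sigma> (\<lambda>x. x) z) + ?F (pmap (\<lambda>x. x) \<sigma> z)) \<partial>\<L>\<^sub>2)"
  by (simp add: G4_def)
 also have "\<dots> = (Ds2_enn s u + Ds2_enn s u) + (Ds2_enn s u + Ds2_enn s u)"
  unfolding nn_integral_add[OF borel_measurable_add[OF F Fc(1)] borel_measurable_add[OF Fc(2,3)]]
   nn_integral_add[OF F Fc(1)] nn_integral_add[OF Fc(2,3)] using i by (simp add: D)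
 also have "\<dots> = 4 * Ds2_enn s u" by (simp only: mult_2[symmetric]) (simp add: mult.assoc[symmetric])
 finally show ?thesis .
qed

definition "ker s x y = 1 / dist x y powr (real CARD('n) + 2 * s)"

text \<open>In terms of the even part m and the odd part d: polarization keeps m and replaces d by a
  signed h(d), so only the last bracket has to be compared.\<close>

lemma G4_eq:
 fixes u :: "real^'n => real" and x y s
 defines "K1 \<equiv> ker s x y" and "K2 \<equiv> ker s (\<sigma> x) y"
  and "m \<equiv> \<lambda>x. (u x + u (\<sigma> x)) / 2" and "d \<equiv> \<lambda>x. (u x - u (\<sigma> x)) / 2"
 shows "G4 s u (x, y) = 2 * (K1 + K2) * (m x - m y)\<^sup>2 + 2 * (K1 * (d x - d y)\<^sup>2 + K2 * (d x + d y)\<^sup>2)"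
proof -
 have k: "ker s (\<sigma> x) (\<sigma> y) = K1" "ker s x (\<sigma> y) = K2"
  by (simp_all add: K1_def K2_def ker_def dist_refl_refl dist_refl_swap)
 have f: "(fdiff s u (a, b))\<^sup>2 = (u a - u b)\<^sup>2 * ker s a b" for a b by (simp add: fdiff_sq ker_def)
 have ux: "u x = m x + d x" "u (\<sigma> x) = m x - d x" "u y = m y + d y" "u (\<sigma> y) = m y - d y"
  by (simp_all add: m_def d_def field_simps)
 have "G4 s u (x, y) = ((u x - u y)\<^sup>2 + (u (\<sigma> x) - u (\<sigma> y))\<^sup>2) * K1 + ((u (\<sigma> x) - u y)\<^sup>2 + (u x - u (\<sigma> y))\<^sup>2) * K2"
  unfolding G4_def pmap_def f by (simp add: f k K1_def[symmetric] K2_def[symmetric] algebra_simps)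
 also have "\<dots> = 2 * (K1 + K2) * (m x - m y)\<^sup>2 + 2 * (K1 * (d x - d y)\<^sup>2 + K2 * (d x + d y)\<^sup>2)"
  unfolding ux by (simp add: power2_eq_square algebra_simps)
 finally show ?thesis .
qed

lemma ker_nonneg: "0 <= ker s x y" by (simp add: ker_def)

text \<open>Two points on the same side of the mirror are nearer to each other than to each other's
  images, by \<open>dist_refl_sq\<close>, and the kernel decreases with distance.\<close>

lemma ker_mono:
 assumes "s > 0" "0 < ht x * ht y" "x \<noteq> y" shows "ker s (\<sigma> x) y < ker s x y"
proof -
 have d: "0 < dist x y" using assms by simp
 have "0 < 4 * (ht x * ht y)" by (rule mult_pos_pos[OF _ assms(2)]) simp
 then have "(dist x y)\<^sup>2 < (dist (\<sigma> x) y)\<^sup>2" unfolding dist_refl_sq mult.assoc by linarith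
 then have "dist x y < dist (\<sigma> x) y" by (rule power2_less_imp_less) simp
 then have "dist x y powr (real CARD('n) + 2 * s) < dist (\<sigma> x) y powr (real CARD('n) + 2 * s)"
  using assms by (intro powr_less_mono2) auto
 then show ?thesis unfolding ker_def using d by (intro divide_strict_left_mono mult_pos_pos) auto
qed

end

text \<open>With c = K1 + K2 and e = |K1 - K2| the left side equals e (\<alpha> - \<beta>)^2 + (c -
  e)(\<alpha>^2 + \<beta>^2), since the sign condition makes the cross term as favourable as
  possible; both summands grow when \<alpha>, \<beta> become |P|, |Q|.\<close>

lemma two_point_inequality:
 fixes K1 K2 P Q p q \<alpha> \<beta> sg :: real
 assumes K: "0 <= K1" "0 <= K2" and ab: "0 <= \<alpha>" "\<alpha> <= \<bar>P\<bar>" "0 <= \<beta>" "\<beta> <= \<bar>Q\<bar>" "\<bar>\<alpha> - \<beta>\<bar> <= \<bar>\<bar>P\<bar> - \<bar>Q\<bar>\<bar>"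
  and pq: "p\<^sup>2 = \<alpha>\<^sup>2" "q\<^sup>2 = \<beta>\<^sup>2" "(K1 - K2) * (p * q) = \<bar>K1 - K2\<bar> * (\<alpha> * \<beta>)"
 shows "K1 * (p - q)\<^sup>2 + K2 * (p + q)\<^sup>2 <= (K1 + K2) * (P\<^sup>2 + Q\<^sup>2) - 2 * \<bar>K1 - K2\<bar> * \<bar>P * Q\<bar>"
  "K1 * (p - q)\<^sup>2 + K2 * (p + q)\<^sup>2 <= K1 * (P - Q)\<^sup>2 + K2 * (P + Q)\<^sup>2"
proof -
 let ?c = "K1 + K2" and ?e = "\<bar>K1 - K2\<bar>"
 have ce: "0 <= ?c - ?e" using K by auto
 have "K1 * (p - q)\<^sup>2 + K2 * (p + q)\<^sup>2 = ?c * (p\<^sup>2 + q\<^sup>2) - 2 * ((K1 - K2) * (p * q))"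
  by (simp add: power2_eq_square algebra_simps)
 also have "\<dots> = ?e * \<bar>\<alpha> - \<beta>\<bar>\<^sup>2 + (?c - ?e) * (\<alpha>\<^sup>2 + \<beta>\<^sup>2)"
  unfolding pq by (simp add: power2_eq_square algebra_simps)
 also have "\<dots> <= ?e * \<bar>\<bar>P\<bar> - \<bar>Q\<bar>\<bar>\<^sup>2 + (?c - ?e) * (\<bar>P\<bar>\<^sup>2 + \<bar>Q\<bar>\<^sup>2)"
  by (intro add_mono mult_left_mono power_mono ce ab) auto
 also have "\<dots> = ?c * (P\<^sup>2 + Q\<^sup>2) - 2 * ?e * \<bar>P * Q\<bar>"
  by (simp add: power2_diff abs_mult algebra_simps)
 finally show 1: "K1 * (p - q)\<^sup>2 + K2 * (p + q)\<^sup>2 <= ?c * (P\<^sup>2 + Q\<^sup>2) - 2 * ?e * \<bar>P * Q\<bar>" .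
 have "(K1 - K2) * (P * Q) <= ?e * \<bar>P * Q\<bar>" by (metis abs_ge_self abs_mult)
 then have "?c * (P\<^sup>2 + Q\<^sup>2) - 2 * ?e * \<bar>P * Q\<bar> <= ?c * (P\<^sup>2 + Q\<^sup>2) - 2 * ((K1 - K2) * (P * Q))" by simp
 also have "\<dots> = K1 * (P - Q)\<^sup>2 + K2 * (P + Q)\<^sup>2" by (simp add: power2_eq_square algebra_simps)
 finally show "K1 * (p - q)\<^sup>2 + K2 * (p + q)\<^sup>2 <= K1 * (P - Q)\<^sup>2 + K2 * (P + Q)\<^sup>2" using 1 by linarith
qed

context reflection
begin

text \<open>The properties shared by \<open>abs\<close> and \<open>eta \<delta>\<close>, so that one
  pointwise inequality covers the smooth polarization of test functions and the polarization
  proper.\<close>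

definition contraction :: "(real => real) => bool" where
 "contraction h \<longleftrightarrow> h 0 = 0 \<and> (\<forall>a. h (- a) = h a) \<and> (\<forall>a. 0 <= h a) \<and> (\<forall>a b. \<bar>h a - h b\<bar> <= \<bar>a - b\<bar>)"

lemma contraction_abs: "contraction abs" by (auto simp: contraction_def abs_triangle_ineq3)

lemma contraction_eta: "\<delta> > 0 ==> contraction (eta \<delta>)"
 using eta_props[of \<delta>] by (auto simp: contraction_def)

lemma pol_parts:
 assumes h: "contraction h"
 shows "(pol e t c h u x + pol e t c h u (\<sigma> x)) / 2 = (u x + u (\<sigma> x)) / 2"
  "(pol e t c h u x - pol e t c h u (\<sigma> x)) / 2 = c * sgn (ht x) * h ((u x - u (\<sigma> x)) / 2)"
  "pol e t c h u (\<sigma> x) = pol e t (- c) h u x"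
proof -
 have "h ((u (\<sigma> x) - u x) / 2) = h ((u x - u (\<sigma> x)) / 2)"
 proof -
  have "(b - a) / 2 = - ((a - b) / 2)" for a b :: real by (metis minus_diff_eq minus_divide_left)
  from this[of "u (\<sigma> x)" "u x"] have "(u (\<sigma> x) - u x) / 2 = - ((u x - u (\<sigma> x)) / 2)" .
  then show ?thesis using h by (simp only: contraction_def)
 qed
 then have 1: "pol e t c h u (\<sigma> x) = (u x + u (\<sigma> x)) / 2 - c * sgn (ht x) * h ((u x - u (\<sigma> x)) / 2)"
  unfolding pol_def ht_refl refl_refl sgn_minus by (simp only: minus_mult_left[symmetric] mult_minus_right add.commute)
 show "(pol e t c h u x + pol e t c h u (\<sigma> x)) / 2 = (u x + u (\<sigma> x)) / 2"
  "(pol e t c h u x - pol e t c h u (\<sigma> x)) / 2 = c * sgn (ht x) * h ((u x - u (\<sigma> x)) / 2)"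
  "pol e t c h u (\<sigma> x) = pol e t (- c) h u x"
  unfolding 1 by (simp_all add: pol_def)
qed

text \<open>In the second claim the kernels differ strictly, so equality leaves (K1 - K2) |P Q| <=
  (K1 - K2) P Q: the odd parts at two points of the half space cannot have opposite signs.\<close>

lemma G4_pol_le:
 assumes s: "s > 0" and h: "contraction h"
 shows "G4 s (pol e t 1 h u) (x, y) <= G4 s u (x, y)"
  and "h = abs ==> 0 < ht x ==> 0 < ht y ==> G4 s (pol e t 1 h u) (x, y) = G4 s u (x, y) ==> 0 <= (u x - u (\<sigma> x)) * (u y - u (\<sigma> y))"
proof -
 let ?d = "\<lambda>x. (u x - u (\<sigma> x)) / 2" and ?m = "\<lambda>x. (u x + u (\<sigma> x)) / 2"
 let ?P = "?d x" and ?Q = "?d y" and ?\<alpha> = "h (?d x)" and ?\<beta> = "h (?d y)"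
 let ?p = "1 * sgn (ht x) * ?\<alpha>" and ?q = "1 * sgn (ht y) * ?\<beta>"
 let ?K1 = "ker s x y" and ?K2 = "ker s (\<sigma> x) y"
 have h0: "h 0 = 0" and he: "\<And>a. h (- a) = h a" and hn: "\<And>a. 0 <= h a" and hl: "\<And>a b. \<bar>h a - h b\<bar> <= \<bar>a - b\<bar>"
  using h by (auto simp: contraction_def)
 have hle: "h a <= \<bar>a\<bar>" for a using hl[of a 0] h0 hn[of a] by simp
 have habs: "h \<bar>a\<bar> = h a" for a using he by (simp add: abs_if)
 have hd: "\<bar>?\<alpha> - ?\<beta>\<bar> <= \<bar>\<bar>?P\<bar> - \<bar>?Q\<bar>\<bar>" using hl[of "\<bar>?P\<bar>" "\<bar>?Q\<bar>"] by (simp only: habs)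
 have zero: "?d x = 0" if "ht x = 0" for x using refl_fixed[OF that] by simp
 have sq: "(sgn (ht x))\<^sup>2 * (h (?d x))\<^sup>2 = (h (?d x))\<^sup>2" for x
  by (cases "ht x = 0") (auto simp: zero h0 sgn_if)
 have p2: "?p\<^sup>2 = ?\<alpha>\<^sup>2" "?q\<^sup>2 = ?\<beta>\<^sup>2" using sq by (simp_all add: power_mult_distrib)
 have gu: "G4 s u (x, y) = 2 * (?K1 + ?K2) * (?m x - ?m y)\<^sup>2 + 2 * (?K1 * (?P - ?Q)\<^sup>2 + ?K2 * (?P + ?Q)\<^sup>2)"
  by (rule G4_eq)
 have gp: "G4 s (pol e t 1 h u) (x, y) = 2 * (?K1 + ?K2) * (?m x - ?m y)\<^sup>2 + 2 * (?K1 * (?p - ?q)\<^sup>2 + ?K2 * (?p + ?q)\<^sup>2)"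
  unfolding G4_eq[of s "pol e t 1 h u"] pol_parts(1,2)[OF h] ..
 have Kn: "0 <= ?K1" "0 <= ?K2" by (rule ker_nonneg)+
 have pqe: "?p * ?q = (sgn (ht x) * sgn (ht y)) * (?\<alpha> * ?\<beta>)" by (simp only: mult_1_left mult_ac)
 \<comment> \<open>The sign of the product follows the sign of K1 - K2: on the same side the
   original pair is nearer, on opposite sides the reflected pair is, and on the mirror the odd part
   vanishes.\<close>
 have sgs: "(?K1 - ?K2) * (?p * ?q) = \<bar>?K1 - ?K2\<bar> * (?\<alpha> * ?\<beta>)" if xy: "x \<noteq> y" "\<sigma> x \<noteq> y"
 proof (cases "ht x * ht y" "0::real" rule: linorder_cases)
  case greater
  then have "?K2 < ?K1" using s xy by (intro ker_mono) auto
  moreover have "sgn (ht x) * sgn (ht y) = 1" using greater by (simp add: sgn_mult[symmetric])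
  then have "?p * ?q = ?\<alpha> * ?\<beta>" using pqe by simp
  ultimately show ?thesis by simp
 next
  case less
  have "0 < ht (\<sigma> x) * ht y" unfolding ht_refl using less by (simp only: mult_minus_left neg_0_less_iff_less)
  then have "ker s (\<sigma> (\<sigma> x)) y < ker s (\<sigma> x) y" by (rule ker_mono[OF s _ xy(2)])
  then have "?K1 < ?K2" by simp
  moreover have "sgn (ht x) * sgn (ht y) = - 1" using less by (simp add: sgn_mult[symmetric])
  then have "?p * ?q = - (?\<alpha> * ?\<beta>)" using pqe by simp
  ultimately show ?thesis by (simp add: algebra_simps)
 next
  case equal
  then show ?thesis using zero[of x] zero[of y] by (auto simp: h0)
 qed
 have pP: "?p\<^sup>2 <= ?P\<^sup>2" unfolding p2(1) using power_mono[OF hle[of ?P] hn, of 2] unfolding power2_abs .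
 have main: "?K1 * (?p - ?q)\<^sup>2 + ?K2 * (?p + ?q)\<^sup>2 <= ?K1 * (?P - ?Q)\<^sup>2 + ?K2 * (?P + ?Q)\<^sup>2"
 proof -
  \<comment> \<open>At y = x or y = \<sigma> x one kernel takes the value 1 / 0 = 0 and the
    comparison of kernels breaks down; one of the two terms vanishes in each case.\<close>
  consider "x = y" | "\<sigma> x = y" | "x \<noteq> y" "\<sigma> x \<noteq> y" by blast
  then show ?thesis
  proof cases
   case 1
   have "K * (q - q)\<^sup>2 + K' * (q + q)\<^sup>2 <= K * (Q - Q)\<^sup>2 + K' * (Q + Q)\<^sup>2" if "q\<^sup>2 <= Q\<^sup>2" "0 <= K'" for K K' q Q :: real
    using mult_left_mono[OF that(1), of "4 * K'"] that(2) by (simp add: power2_eq_square algebra_simps)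
   from this[OF pP Kn(2)] show ?thesis unfolding 1[symmetric] .
  next
   case 2
   have k: "?K2 = 0" using 2 by (simp add: ker_def)
   have "(b - a) / 2 = - ((a - b) / 2)" for a b :: real by (metis minus_diff_eq minus_divide_left)
   from this[of "u y" "u x"] have Q: "?Q = - ?P" unfolding 2[symmetric] refl_refl .
   have "?\<beta> = ?\<alpha>" unfolding Q by (rule he)
   moreover have "sgn (ht y) = - sgn (ht x)" unfolding 2[symmetric] ht_refl by (rule sgn_minus)
   ultimately have q: "?q = - ?p" by (simp only: mult_minus_left mult_minus_right)
   have "K * (q - - q)\<^sup>2 + 0 * (q + - q)\<^sup>2 <= K * (Q - - Q)\<^sup>2 + 0 * (Q + - Q)\<^sup>2" if "q\<^sup>2 <= Q\<^sup>2" "0 <= K" for K q Q :: real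
    using mult_left_mono[OF that(1), of "4 * K"] that(2) by (simp add: power2_eq_square algebra_simps)
   from this[OF pP Kn(1)] show ?thesis unfolding k unfolding q unfolding Q .
  next
   case 3
   show ?thesis by (rule two_point_inequality(2)[OF Kn hn hle hn hle hd p2 sgs[OF 3]])
  qed
 qed
 then show "G4 s (pol e t 1 h u) (x, y) <= G4 s u (x, y)" unfolding gu gp by simp
 assume ha: "h = abs" and xy: "0 < ht x" "0 < ht y" and eq: "G4 s (pol e t 1 h u) (x, y) = G4 s u (x, y)"
 show "0 <= (u x - u (\<sigma> x)) * (u y - u (\<sigma> y))"
 proof (cases "x = y")
  case False
  have K: "?K2 < ?K1" using s xy False by (intro ker_mono) auto
  have sx: "\<sigma> x \<noteq> y"
  proof
   assume "\<sigma> x = y"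
   then have "ht y = - ht x" using ht_refl[of x] by metis
   then show False using xy by linarith
  qed
  have 1: "?K1 * (?p - ?q)\<^sup>2 + ?K2 * (?p + ?q)\<^sup>2 <= (?K1 + ?K2) * (?P\<^sup>2 + ?Q\<^sup>2) - 2 * \<bar>?K1 - ?K2\<bar> * \<bar>?P * ?Q\<bar>"
   by (rule two_point_inequality(1)[OF Kn hn hle hn hle hd p2 sgs[OF False sx]])
  have exp: "k1 * (a - b)\<^sup>2 + k2 * (a + b)\<^sup>2 = (k1 + k2) * (a\<^sup>2 + b\<^sup>2) - 2 * (k1 - k2) * (a * b)" for k1 k2 a b :: real
   by (simp add: power2_eq_square algebra_simps)
  have "b = c" if "A + 2 * b = A + 2 * c" for A b c :: real using that by simp
  note 2 = this[OF eq[unfolded gu gp]]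
  have "0 <= r" if "L <= T - 2 * \<bar>k1 - k2\<bar> * \<bar>r\<bar>" "L = M" "M = T - 2 * (k1 - k2) * r" "k2 < k1" for L M T k1 k2 r :: real
  proof -
   have "(k1 - k2) * \<bar>r\<bar> <= (k1 - k2) * r" using that by simp
   then show "0 <= r" using that(4) by simp
  qed
  from this[OF 1 2 exp K] have "0 <= ?P * ?Q" .
  then show ?thesis by simp
 qed simp
qed

end

lemma grad_cong_open:
 assumes "open U" "x \<in> U" "\<And>y. y \<in> U ==> f y = g y" shows "grad f x = grad g x"
 using partial_d_cong_open[OF assms] by (simp add: vec_eq_iff)

context reflection
begin

lemma refl_measurable: "u \<in> \<M> ==> (\<lambda>x. u (\<sigma> x)) \<in> \<M>"
 by (rule simil_measurable_comp[OF refl_simil])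

lemma pol_measurable:
 assumes [measurable]: "u \<in> \<M>" "h \<in> borel_measurable borel"
 shows "pol e t c h u \<in> \<M>"
proof -
 note [measurable] = refl_measurable[OF assms(1)] borel_ident_lebesgue
 show ?thesis unfolding pol_def[abs_def] sgn_if by measurable
qed

text \<open>Off the mirror the sign is locally constant; near it the odd part is smaller than
  \<delta> and \<open>eta \<delta>\<close> kills it together with the jump. So there is locally one
  smooth formula with a constant \<open>k\<close> in {-1, 0, 1}, and the gradient bound is the
  parallelogram law with a damped odd part.\<close>

lemma pol_test:
 assumes \<phi>: "test_fun \<phi>" and \<delta>: "\<delta> > 0"
 shows "test_fun (pol e t c (eta \<delta>) \<phi>)"
  and "(norm (grad (pol e t 1 (eta \<delta>) \<phi>) x))\<^sup>2 + (norm (grad (pol e t (- 1) (eta \<delta>) \<phi>) x))\<^sup>2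
   <= (norm (grad \<phi> x))\<^sup>2 + (norm (grad (\<lambda>x. \<phi> (\<sigma> x)) x))\<^sup>2"
proof -
 let ?d = "\<lambda>x. (\<phi> x + (- 1) * \<phi> (\<sigma> x)) * (1/2)" and ?m = "\<lambda>x. (\<phi> x + 1 * \<phi> (\<sigma> x)) * (1/2)"
 have \<phi>': "test_fun (\<lambda>x. \<phi> (\<sigma> x))" by (rule test_fun_simil[OF \<phi> refl_simil])
 note sp = test_fun_smooth[OF \<phi>] test_fun_smooth[OF \<phi>']
 have sd: "smooth ?d" "smooth ?m" by (intro smooth_mult smooth_add smooth_const sp)+
 have se: "smooth (\<lambda>x. eta \<delta> (?d x))" using smooth_compose[OF Ck1_eta sd(1), of \<delta>] .
 have "continuous_on UNIV ?d" by (rule smooth_continuous[OF sd(1)])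
 then have o0: "open {y. \<bar>?d y\<bar> < \<delta>}" by (intro open_Collect_less continuous_on_rabs continuous_on_const)
 have o1: "open {y. 0 < ht y}" "open {y. ht y < 0}" by (intro open_Collect_less continuous_intros)+
 have loc: "\<exists>U k. open U \<and> x \<in> U \<and> \<bar>k\<bar> <= 1 \<and> (\<forall>c. \<forall>y\<in>U. pol e t c (eta \<delta>) \<phi> y = ?m y + (c * k) * eta \<delta> (?d y))" for x
 proof (cases "ht x" "0::real" rule: linorder_cases)
  case greater
  show ?thesis by (rule exI[of _ "{y. 0 < ht y}"], rule exI[of _ 1]) (use o1 greater in \<open>auto simp: pol_def sgn_if\<close>)
 next
  case less
  show ?thesis by (rule exI[of _ "{y. ht y < 0}"], rule exI[of _ "-1"]) (use o1 less in \<open>auto simp: pol_def sgn_if\<close>)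
 next
  case equal
  have z: "eta \<delta> (?d y) = 0" if "\<bar>?d y\<bar> < \<delta>" for y using that eta_props(2)[OF \<delta>, of "?d y"] by linarith
  have "pol e t c (eta \<delta>) \<phi> y = ?m y + (c * 0) * eta \<delta> (?d y)" if "\<bar>?d y\<bar> < \<delta>" for c y
   using z[OF that] by (simp add: pol_def)
  moreover have "\<bar>?d x\<bar> < \<delta>" using refl_fixed[OF equal] \<delta> by simp
  ultimately show ?thesis using o0 by (intro exI[of _ "{y. \<bar>?d y\<bar> < \<delta>}"] exI[of _ 0]) auto
 qed
 show tf: "test_fun (pol e t c (eta \<delta>) \<phi>)"
 proof (rule test_funI)
  show "test_fun (\<lambda>x. (\<phi> x)\<^sup>2 + (\<phi> (\<sigma> x))\<^sup>2)" by (intro test_fun_add test_fun_power2 \<phi> \<phi>')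
  show "(\<phi> x)\<^sup>2 + (\<phi> (\<sigma> x))\<^sup>2 = 0 ==> pol e t c (eta \<delta>) \<phi> x = 0" for x
   using eta_props(2)[OF \<delta>, of 0] \<delta> by (simp add: pol_def sum_power2_eq_zero_iff)
  show "smooth (pol e t c (eta \<delta>) \<phi>)"
  proof (rule smooth_local)
   fix x
   obtain U k where U: "open U" "x \<in> U" "\<forall>y\<in>U. pol e t c (eta \<delta>) \<phi> y = ?m y + (c * k) * eta \<delta> (?d y)" using loc[of x] by blast
   show "\<exists>g U. open U \<and> x \<in> U \<and> (\<forall>y\<in>U. pol e t c (eta \<delta>) \<phi> y = g y) \<and> smooth g"
    by (rule exI[of _ "\<lambda>y. ?m y + (c * k) * eta \<delta> (?d y)"], rule exI[of _ U])
     (use U smooth_add[OF sd(2) smooth_mult[OF smooth_const se]] in blast)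
  qed
 qed
 obtain U k where U: "open U" "x \<in> U" "\<bar>k\<bar> <= 1" "\<And>c y. y \<in> U ==> pol e t c (eta \<delta>) \<phi> y = ?m y + (c * k) * eta \<delta> (?d y)"
  using loc[of x] by blast
 obtain d where d: "\<bar>d\<bar> <= 1" "(eta \<delta> has_real_derivative d) (at (?d x))" using eta_deriv[OF \<delta>] by blast
 have g: "grad (pol e t c (eta \<delta>) \<phi>) x = grad ?m x + (c * (k * d)) *\<^sub>R grad ?d x" for c
 proof -
  have "grad (pol e t c (eta \<delta>) \<phi>) x = grad (\<lambda>y. ?m y + (c * k) * eta \<delta> (?d y)) x"
   by (rule grad_cong_open[OF U(1,2)]) (rule U(4))
  then show ?thesis unfolding grad_lincomb[OF sd(2) se] grad_chain[OF sd(1) d(2)] by (simp only: scaleR_scaleR mult.assoc)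
 qed
 have "grad \<phi> x = grad (\<lambda>x. ?m x + 1 * ?d x) x" "grad (\<lambda>x. \<phi> (\<sigma> x)) x = grad (\<lambda>x. ?m x + (- 1) * ?d x) x"
  by (rule grad_cong_open[OF open_UNIV]; simp add: algebra_simps)+
 then have gp: "grad \<phi> x = grad ?m x + grad ?d x" "grad (\<lambda>x. \<phi> (\<sigma> x)) x = grad ?m x - grad ?d x"
  unfolding grad_lincomb[OF sd(2,1)] by simp_all
 have par: "(norm (a + l *\<^sub>R b))\<^sup>2 + (norm (a + (- l) *\<^sub>R b))\<^sup>2 = 2 * (norm a)\<^sup>2 + 2 * l\<^sup>2 * (norm b)\<^sup>2" for a b :: "real^'n" and l
  unfolding power2_norm_eq_inner by (simp add: inner_add_left inner_add_right inner_diff_left inner_diff_right power2_eq_square algebra_simps)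
 have "\<bar>k * d\<bar> <= 1" using U(3) d(1) by (simp add: abs_mult mult_le_one)
 then have "(k * d)\<^sup>2 <= 1" by (simp add: abs_square_le_1)
 then have "(k * d)\<^sup>2 * (norm (grad ?d x))\<^sup>2 <= 1 * (norm (grad ?d x))\<^sup>2" by (intro mult_right_mono) auto
 then show "(norm (grad (pol e t 1 (eta \<delta>) \<phi>) x))\<^sup>2 + (norm (grad (pol e t (- 1) (eta \<delta>) \<phi>) x))\<^sup>2
   <= (norm (grad \<phi> x))\<^sup>2 + (norm (grad (\<lambda>x. \<phi> (\<sigma> x)) x))\<^sup>2"
  using par[of "grad ?m x" "k * d" "grad ?d x"] par[of "grad ?m x" 1 "grad ?d x"] unfolding g gp by simp
qed

text \<open>The pointwise gradient bound concerns the sum of the polarization and the opposite one.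
  The latter is the mirror image of the former and has the same energy.\<close>

lemma D12_pol_test:
 fixes s :: real
 assumes s: "0 < s" "s < 1" and \<phi>: "test_fun \<phi>" and \<delta>: "\<delta> > 0"
 shows "D12_sq (pol e t 1 (eta \<delta>) \<phi>) <= D12_sq \<phi>"
proof -
 let ?v = "\<lambda>c. pol e t c (eta \<delta>) \<phi>"
 have \<phi>': "test_fun (\<lambda>x. \<phi> (\<sigma> x))" by (rule test_fun_simil[OF \<phi> refl_simil])
 note vt = pol_test(1)[OF \<phi> \<delta>]
 have "D12_sq (?v (- 1)) = D12_sq (?v 1)"
  using fin_E_simil(2)[OF refl_simil fin_E_test[OF s vt[of 1]]] pol_parts(3)[OF contraction_eta[OF \<delta>], of 1 \<phi>] by simp
 moreover have "D12_sq (\<lambda>x. \<phi> (\<sigma> x)) = D12_sq \<phi>"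
  using fin_E_simil(2)[OF refl_simil fin_E_test[OF s \<phi>]] by simp
 moreover have "D12_sq (?v 1) + D12_sq (?v (- 1)) <= D12_sq \<phi> + D12_sq (\<lambda>x. \<phi> (\<sigma> x))"
  unfolding D12_sq_test(3)[OF vt] D12_sq_test(3)[OF \<phi>] D12_sq_test(3)[OF \<phi>']
  using D12_sq_test(2)[OF vt] D12_sq_test(2)[OF \<phi>] D12_sq_test(2)[OF \<phi>'] pol_test(2)[OF \<phi> \<delta>]
  by (simp only: Bochner_Integration.integral_add[symmetric]) (intro integral_mono Bochner_Integration.integrable_add)
 ultimately show ?thesis by simp
qed

lemma Ds2_pol_le:
 assumes s: "0 < s" and h: "contraction h" "h \<in> borel_measurable borel" and u: "u \<in> \<M>"
 shows "Ds2_enn s (pol e t 1 h u) <= Ds2_enn s u"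
proof -
 have "4 * Ds2_enn s (pol e t 1 h u) <= 4 * Ds2_enn s u"
  unfolding G4_integral[OF u, symmetric] G4_integral[OF pol_measurable[OF u h(2)], symmetric]
  by (intro nn_integral_mono ennreal_leI) (auto intro: G4_pol_le(1)[OF s h(1)] simp: split_paired_all)
 then show ?thesis by (subst (asm) ennreal_mult_le_mult_iff) auto
qed

text \<open>At each pair of mirror points the two values are at most exchanged, so after adding the
  reflected integral the integrands agree pointwise.\<close>

lemma Lp_pol:
 assumes [measurable]: "u \<in> \<M>"
 shows "Lp_enn p (pol e t 1 abs u) = Lp_enn p u"
proof -
 let ?v = "pol e t 1 abs u"
 have [measurable]: "?v \<in> \<M>" by (rule pol_measurable) auto
 note [measurable] = refl_measurable[OF assms] refl_measurable[of ?v]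
 have sym: "2 * Lp_enn p f = (\<integral>\<^sup>+x. ennreal (\<bar>f x\<bar> powr p) + ennreal (\<bar>f (\<sigma> x)\<bar> powr p) \<partial>\<L>)"
  if [measurable]: "f \<in> \<M>" for f
 proof -
  have [measurable]: "(\<lambda>x. f (\<sigma> x)) \<in> \<M>" by (rule refl_measurable) fact
  have "Lp_enn p (\<lambda>x. f (\<sigma> x)) = Lp_enn p f" using Lp_enn_simil[OF refl_simil that, of p 1] by simp
  then show ?thesis by (subst nn_integral_add) (auto simp: Lp_enn_def mult_2)
 qed
 have gen: "ennreal (\<bar>((a + b) / 2 + 1 * k * \<bar>(a - b) / 2\<bar>)\<bar> powr p) + ennreal (\<bar>((a + b) / 2 - k * \<bar>(a - b) / 2\<bar>)\<bar> powr p)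
  = ennreal (\<bar>a\<bar> powr p) + ennreal (\<bar>b\<bar> powr p)" if "k = 1 \<or> k = - 1 \<or> a = b" for a b k :: real
 proof -
  have 1: "(a + b) / 2 + \<bar>(a - b) / 2\<bar> = max a b" "(a + b) / 2 - \<bar>(a - b) / 2\<bar> = min a b" by (auto simp: abs_if field_simps)
  from that show ?thesis
  proof (elim disjE)
   assume "k = 1"
   then show ?thesis using 1 by (cases "a <= b") (simp_all add: add.commute)
  next
   assume "k = - 1"
   then have "(a + b) / 2 + 1 * k * \<bar>(a - b) / 2\<bar> = min a b" "(a + b) / 2 - k * \<bar>(a - b) / 2\<bar> = max a b"
    using 1 by (simp_all only: mult_1_left mult_minus_left minus_minus diff_minus_eq_add add_uminus_conv_diff)
   then show ?thesis by (simp only:) (cases "a <= b"; simp add: add.commute)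
  qed simp
 qed
 have "2 * Lp_enn p ?v = 2 * Lp_enn p u"
  unfolding sym[OF \<open>?v \<in> \<M>\<close>] sym[OF assms]
 proof (rule nn_integral_cong)
  fix x
  have k: "sgn (ht x) = 1 \<or> sgn (ht x) = - 1 \<or> u x = u (\<sigma> x)" using refl_fixed[of x] by (auto simp: sgn_if)
  have "?v (\<sigma> x) = (u x + u (\<sigma> x)) / 2 - sgn (ht x) * \<bar>(u x - u (\<sigma> x)) / 2\<bar>"
   unfolding pol_parts(3)[OF contraction_abs] by (simp add: pol_def)
  then show "ennreal (\<bar>?v x\<bar> powr p) + ennreal (\<bar>?v (\<sigma> x)\<bar> powr p) = ennreal (\<bar>u x\<bar> powr p) + ennreal (\<bar>u (\<sigma> x)\<bar> powr p)"
   using gen[OF k] by (simp only: pol_def)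
 qed
 then show ?thesis by (simp add: ennreal_mult_cancel_left)
qed

lemma eta_measurable: "eta \<delta> \<in> borel_measurable borel"
 using Ck1_eta[of 0 \<delta>] by (intro borel_measurable_continuous_onI) simp

lemma pol_E:
 assumes s: "0 < s" "s < 1" and u: "u \<in> E_space s"
 shows "pol e t 1 abs u \<in> E_space s" "D12_sq (pol e t 1 abs u) <= D12_sq u" "Ds2_sq s (pol e t 1 abs u) <= Ds2_sq s u"
proof -
 obtain \<phi> where fu: "fin_E s u" and \<phi>: "\<And>k. test_fun (\<phi> k)" "(\<lambda>k. D12_sq (\<lambda>x. \<phi> k x - u x) + Ds2_sq s (\<lambda>x. \<phi> k x - u x)) \<longlonglongrightarrow> 0" "L1c \<phi> u"
  using E_spaceD'[OF u] by blast
 note [measurable] = fin_E_measurable[OF fu] test_fun_measurable[OF \<phi>(1)]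
 note [measurable] = refl_measurable[of u] refl_measurable[of "\<phi> _"]
 have pE: "fin_E s (\<phi> k)" for k by (intro fin_E_test s \<phi>)
 let ?\<delta> = "\<lambda>k. 1 / real (Suc k)"
 let ?v = "\<lambda>k. pol e t 1 (eta (?\<delta> k)) (\<phi> k)"
 have \<delta>: "?\<delta> k > 0" for k by simp
 note vt = pol_test(1)[OF \<phi>(1) \<delta>, of 1]
 have A: "D12_sq (?v k) <= D12_sq (\<phi> k)" for k by (rule D12_pol_test[OF s \<phi>(1) \<delta>])
 have B: "Ds2_sq s (?v k) <= Ds2_sq s (\<phi> k)" for k
 proof -
  have "Ds2_enn s (?v k) <= Ds2_enn s (\<phi> k)"
   by (rule Ds2_pol_le[OF s(1) contraction_eta[OF \<delta>] eta_measurable]) measurable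
  then show ?thesis unfolding Ds2_enn_ennreal[OF fin_E_test[OF s vt]] Ds2_enn_ennreal[OF pE] by simp
 qed
 have "(\<lambda>k. 2 * ?\<delta> k) \<longlonglongrightarrow> 2 * 0" by (intro tendsto_intros LIMSEQ_Suc[OF lim_1_over_n])
 then have c0: "(\<lambda>k. 2 * ?\<delta> k) \<longlonglongrightarrow> 0" by simp
 have c: "L1c ?v (pol e t 1 abs u)"
 proof (rule L1c_dom[OF _ _ _ _ \<phi>(3) L1c_simil[OF refl_simil _ _ \<phi>(3)] c0])
  fix k x
  have gen: "\<bar>((a + b) / 2 + 1 * g * h1) - ((a' + b') / 2 + 1 * g * \<bar>(a' - b') / 2\<bar>)\<bar> <= \<bar>a - a'\<bar> + \<bar>b - b'\<bar> + D"
   if "\<bar>g\<bar> <= 1" "\<bar>h1 - \<bar>(a - b) / 2\<bar>\<bar> <= D" for a b a' b' g h1 D :: real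
  proof -
   have "\<bar>((a + b) / 2 + 1 * g * h1) - ((a' + b') / 2 + 1 * g * \<bar>(a' - b') / 2\<bar>)\<bar> = \<bar>((a - a') + (b - b')) / 2 + g * (h1 - \<bar>(a' - b') / 2\<bar>)\<bar>"
    by (simp add: algebra_simps add_divide_distrib diff_divide_distrib)
   also have "\<dots> <= \<bar>((a - a') + (b - b')) / 2\<bar> + \<bar>g * (h1 - \<bar>(a' - b') / 2\<bar>)\<bar>" by (rule abs_triangle_ineq)
   also have "\<dots> <= \<bar>((a - a') + (b - b')) / 2\<bar> + 1 * \<bar>h1 - \<bar>(a' - b') / 2\<bar>\<bar>"
    unfolding abs_mult using that(1) by (intro add_left_mono mult_right_mono) auto
   also have "\<bar>((a - a') + (b - b')) / 2\<bar> + 1 * \<bar>h1 - \<bar>(a' - b') / 2\<bar>\<bar> <= \<bar>a - a'\<bar> + \<bar>b - b'\<bar> + D"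
    using that(2) abs_triangle_ineq3[of "(a - b) / 2" "(a' - b') / 2"] by argo
   finally show ?thesis .
  qed
  show "\<bar>?v k x - pol e t 1 abs u x\<bar> <= \<bar>\<phi> k x - u x\<bar> + \<bar>\<phi> k (\<sigma> x) - u (\<sigma> x)\<bar> + 2 * ?\<delta> k"
   unfolding pol_def by (rule gen[OF _ eta_props(4)[OF \<delta>]]) (simp add: sgn_if)
 qed (simp_all add: refl_measurable)
 have m: "pol e t 1 abs u \<in> \<M>" by (rule pol_measurable) auto
 from closure_E_lim[OF s vt m A form_tendsto(1)[OF pE fu \<phi>(2)] B form_tendsto(2)[OF pE fu \<phi>(2)] c]
 show "pol e t 1 abs u \<in> E_space s" "D12_sq (pol e t 1 abs u) <= D12_sq u" "Ds2_sq s (pol e t 1 abs u) <= Ds2_sq s u" by auto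
qed

end

context reflection
begin

text \<open>Equality in the polarization inequality for the fractional seminorm prevents
 \<^term>\<open>\<lambda>x. u x - u (\<sigma> x)\<close> from changing sign on the half space.\<close>

lemma dichotomy:
 assumes s: "0 < s" and u[measurable]: "u \<in> \<M>" and fin: "Ds2_enn s u < \<infinity>"
  and eq: "Ds2_enn s (pol e t 1 abs u) = Ds2_enn s u"
 shows "(AE x in \<L>. 0 < ht x \<longrightarrow> u (\<sigma> x) <= u x) \<or> (AE x in \<L>. 0 < ht x \<longrightarrow> u x <= u (\<sigma> x))"
proof -
 let ?v = "pol e t 1 abs u"
 have v[measurable]: "?v \<in> \<M>" by (rule pol_measurable) auto
 note le = G4_pol_le(1)[OF s contraction_abs]
 have I: "(\<integral>\<^sup>+z. ennreal (G4 s ?v z) \<partial>\<L>\<^sub>2) = (\<integral>\<^sup>+z. ennreal (G4 s u z) \<partial>\<L>\<^sub>2)"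
  "(\<integral>\<^sup>+z. ennreal (G4 s ?v z) \<partial>\<L>\<^sub>2) \<noteq> \<infinity>"
  using fin by (simp_all add: G4_integral[OF u] G4_integral[OF v] eq ennreal_mult_eq_top_iff)
 have "(\<integral>\<^sup>+z. ennreal (G4 s u z) - ennreal (G4 s ?v z) \<partial>\<L>\<^sub>2) = 0"
  using I by (subst nn_integral_diff) (auto intro!: AE_I2 ennreal_leI le simp: split_paired_all)
 then have "AE z in \<L> \<Otimes>\<^sub>M \<L>. ennreal (G4 s u z) - ennreal (G4 s ?v z) = 0"
  by (subst (asm) nn_integral_0_iff_AE) auto
 then have "AE z in \<L> \<Otimes>\<^sub>M \<L>. G4 s u z <= G4 s ?v z"
  by eventually_elim (simp add: diff_eq_0_iff_ennreal ennreal_le_iff[OF G4_nonneg])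
 from leb2.AE_pair[OF this]
 have ae: "AE x in \<L>. AE y in \<L>. G4 s u (x, y) <= G4 s ?v (x, y)" .
 have pos: "0 <= (u x - u (\<sigma> x)) * (u y - u (\<sigma> y))" if "G4 s u (x, y) <= G4 s ?v (x, y)" "0 < ht x" "0 < ht y" for x y
  by (rule G4_pol_le(2)[OF s contraction_abs refl that(2,3)]) (use that(1) le in \<open>auto intro: antisym\<close>)
 show ?thesis
 proof (rule ccontr)
  assume n: "\<not> ?thesis"
  \<comment> \<open>For almost every x the comparison holds for almost every y. If the second
    alternative fails, one such x in the half space has a strictly positive difference, and it fixes
    the sign at almost every y.\<close>
  obtain x where x: "AE y in \<L>. G4 s u (x, y) <= G4 s ?v (x, y)" "0 < ht x" "u (\<sigma> x) < u x"
  proof (rule ccontr)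
   assume "\<not> thesis"
   then have h: "\<not> (AE y in \<L>. G4 s u (x, y) <= G4 s ?v (x, y)) \<or> \<not> 0 < ht x \<or> \<not> u (\<sigma> x) < u x" for x using that by blast
   have "AE x in \<L>. 0 < ht x \<longrightarrow> u x <= u (\<sigma> x)" using ae by (rule eventually_mono) (use h in force)
   then show False using n by blast
  qed
  have "AE y in \<L>. 0 < ht y \<longrightarrow> u (\<sigma> y) <= u y"
   using x(1)
  proof (rule eventually_mono, intro impI)
   fix y assume "G4 s u (x, y) <= G4 s ?v (x, y)" "0 < ht y"
   from pos[OF this(1) x(2) this(2)] have "0 <= u y - u (\<sigma> y)" using x(3) by (simp add: zero_le_mult_iff)
   then show "u (\<sigma> y) <= u y" by simp
  qed
  then show False using n by blast
 qed
qed

text \<open>On the half space u^p and its mirror image are ordered by \<open>d\<close> and have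
  equal integrals by \<open>half\<close>; hence they coincide almost everywhere.\<close>

lemma mirror_symmetric:
 fixes u :: "real^'n => real"
 assumes p: "p > 0" and u: "\<And>x. 0 <= u x" "u \<in> \<M>" and int: "integrable \<L> (\<lambda>x. u x powr p)"
  and half: "(\<integral>x. u x powr p * indicator {x. 0 < ht x} x \<partial>\<L>) = (\<integral>x. u x powr p * indicator {x. ht x < 0} x \<partial>\<L>)"
  and d: "(AE x in \<L>. 0 < ht x \<longrightarrow> u (\<sigma> x) <= u x) \<or> (AE x in \<L>. 0 < ht x \<longrightarrow> u x <= u (\<sigma> x))"
 shows "AE x in \<L>. u (\<sigma> x) = u x"
proof -
 let ?H = "{x. 0 < ht x}"
 note [measurable] = u(2) borel_ident_lebesgue refl_measurable[OF u(2)]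
 have H: "Measurable.pred \<L> (\<lambda>x. 0 < ht x)" "Measurable.pred \<L> (\<lambda>x. ht x < 0)" by measurable
 then have Hs[measurable]: "?H \<in> sets \<L>" "{x. ht x < 0} \<in> sets \<L>" by (simp_all add: pred_def)
 have int': "integrable \<L> (\<lambda>x. u (\<sigma> x) powr p)"
  using int simil_integral(1)[OF refl_simil, of "\<lambda>x. u x powr p"] by simp
 have m1: "(\<lambda>x. u x powr p * indicator {x. ht x < 0} x) \<in> \<M>"
  by (intro borel_measurable_times borel_measurable_indicator Hs borel_measurable_integrable[OF int])
 have "(\<integral>x. u (\<sigma> x) powr p * indicator {x. ht x < 0} (\<sigma> x) \<partial>\<L>) = (\<integral>x. u x powr p * indicator {x. ht x < 0} x \<partial>\<L>)"
  using simil_integral(2)[OF refl_simil m1] by simp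
 moreover have "indicator {x. ht x < 0} (\<sigma> x) = (indicator ?H x :: real)" for x unfolding indicator_def mem_Collect_eq ht_refl by simp
 ultimately have eq: "(\<integral>x. u (\<sigma> x) powr p * indicator ?H x \<partial>\<L>) = (\<integral>x. u x powr p * indicator ?H x \<partial>\<L>)"
  using half by simp
 have i1: "integrable \<L> (\<lambda>x. u x powr p * indicator ?H x)" "integrable \<L> (\<lambda>x. u (\<sigma> x) powr p * indicator ?H x)"
  by (intro integrable_real_mult_indicator Hs int int')+
 have "AE x in \<L>. u x powr p * indicator ?H x - u (\<sigma> x) powr p * indicator ?H x = 0"
  using d
 proof
  assume "AE x in \<L>. 0 < ht x \<longrightarrow> u (\<sigma> x) <= u x"
  then have "AE x in \<L>. 0 <= u x powr p * indicator ?H x - u (\<sigma> x) powr p * indicator ?H x"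
   by eventually_elim (use p u in \<open>auto simp: indicator_def intro!: powr_mono2\<close>)
  from integral_nonneg_eq_0_iff_AE[OF Bochner_Integration.integrable_diff[OF i1] this] show ?thesis using i1 eq by simp
 next
  assume "AE x in \<L>. 0 < ht x \<longrightarrow> u x <= u (\<sigma> x)"
  then have "AE x in \<L>. 0 <= u (\<sigma> x) powr p * indicator ?H x - u x powr p * indicator ?H x"
   by eventually_elim (use p u in \<open>auto simp: indicator_def intro!: powr_mono2\<close>)
  from integral_nonneg_eq_0_iff_AE[OF Bochner_Integration.integrable_diff[OF i1(2,1)] this] show ?thesis using i1 eq
   by (simp only: Bochner_Integration.integral_diff) (auto elim!: eventually_mono)
 qed
 then have ae: "AE x in \<L>. 0 < ht x \<longrightarrow> u (\<sigma> x) = u x"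
 proof (rule eventually_mono, intro impI)
  fix x assume *: "u x powr p * indicator ?H x - u (\<sigma> x) powr p * indicator ?H x = 0" "0 < ht x"
  then have "(u x powr p) powr (1/p) = (u (\<sigma> x) powr p) powr (1/p)" by simp
  then show "u (\<sigma> x) = u x" using p u by (simp add: powr_powr)
 qed
 show ?thesis using ae AE_simil[OF refl_simil ae]
 proof eventually_elim
  case (elim x)
  then show ?case using refl_fixed[of x] by (cases "ht x" "0::real" rule: linorder_cases) auto
 qed
qed

end

section \<open>Reflection symmetry of maximizers\<close>

lemma hyperplane_AE: "norm e = 1 ==> AE x in \<L>. x \<bullet> e \<noteq> (t::real)" for e :: "real^'n::finite"
proof -
 assume "norm e = 1"
 then have "negligible {x. e \<bullet> x = t}" by (intro negligible_hyperplane) auto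
 then show ?thesis by (intro AE_I'[of "{x. e \<bullet> x = t}"]) (auto simp: negligible_iff_null_sets inner_commute)
qed

context GN_setting
begin

definition maximizer :: "(real^'n => real) => bool" where
 "maximizer u \<longleftrightarrow> u \<in> E_space s \<and> (\<forall>x. 0 <= u x) \<and> D12_sq u = 1 \<and> Ds2_sq s u = 1 \<and> Lp_enn p u = ennreal Cgn"

lemma maximizerD:
 assumes "maximizer u"
 shows "u \<in> E_space s" "0 <= u x" "D12_sq u = 1" "Ds2_sq s u = 1" "Lp_enn p u = ennreal Cgn" "fin_E s u"
  "u \<in> \<M>" "integrable \<L> (\<lambda>x. u x powr p)" "(\<integral>x. u x powr p \<partial>\<L>) = Cgn"
proof -
 show *: "u \<in> E_space s" "D12_sq u = 1" "Ds2_sq s u = 1" "Lp_enn p u = ennreal Cgn" "fin_E s u" and n: "0 <= u x" for x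
  using assms by (auto simp: maximizer_def intro: E_fin)
 show [measurable]: "u \<in> \<M>" using *(5) by (rule fin_E_measurable)
 have "(\<integral>\<^sup>+x. ennreal (u x powr p) \<partial>\<L>) = ennreal Cgn" using *(4) n by (simp add: Lp_enn_def)
 then have "has_bochner_integral \<L> (\<lambda>x. u x powr p) Cgn"
  using Cgn_pos by (intro has_bochner_integral_nn_integral) auto
 then show "integrable \<L> (\<lambda>x. u x powr p)" "(\<integral>x. u x powr p \<partial>\<L>) = Cgn"
  by (auto simp: has_bochner_integral_iff)
qed

text \<open>Modulus and polarization bound the energies only from above. With the full mass
  \<open>Cgn\<close>, an energy below 1 would violate the inequality because \<open>al\<close> and
  \<open>be\<close> are positive.\<close>

lemma maximizerI:
 assumes w: "w \<in> E_space s" "\<And>x. 0 <= w x" "D12_sq w <= 1" "Ds2_sq s w <= 1" "Lp_enn p w = ennreal Cgn"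
 shows "maximizer w"
proof -
 have "ennreal Cgn <= ennreal (Cgn * (Ds2_sq s w powr al * D12_sq w powr be))" using GN_E[OF w(1)] w(5) by simp
 then have "Cgn <= Cgn * (Ds2_sq s w powr al * D12_sq w powr be)" using Cgn_pos by (subst (asm) ennreal_le_iff) auto
 then have ge: "1 <= Ds2_sq s w powr al * D12_sq w powr be" using Cgn_pos by simp
 have le: "Ds2_sq s w powr al <= 1" "D12_sq w powr be <= 1"
  using w(3,4) exponents(1,2) by (auto intro!: powr_le1)
 have "D12_sq w = 1"
 proof (rule ccontr)
  assume "D12_sq w \<noteq> 1"
  then have "D12_sq w powr be < 1 powr be" using w(3) exponents(2) by (intro powr_less_mono2) auto
  moreover have "Ds2_sq s w powr al * D12_sq w powr be <= 1 * D12_sq w powr be" using le by (intro mult_right_mono) auto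
  ultimately show False using ge by simp
 qed
 moreover have "Ds2_sq s w = 1"
 proof (rule ccontr)
  assume "Ds2_sq s w \<noteq> 1"
  then have "Ds2_sq s w powr al < 1 powr al" using w(4) exponents(1) by (intro powr_less_mono2) auto
  moreover have "Ds2_sq s w powr al * D12_sq w powr be <= Ds2_sq s w powr al * 1" using le by (intro mult_left_mono) auto
  ultimately show False using ge by simp
 qed
 ultimately show ?thesis using w by (simp add: maximizer_def)
qed

lemma maximizer_ex: "\<exists>u. maximizer u"
proof -
 obtain u :: "real^'n => real" where u: "u \<in> E_space s" "D12_sq u = 1" "Ds2_sq s u = 1" "Lp_enn p u = ennreal Cgn"
  using maximizer_exists by blast
 have "maximizer (\<lambda>x. \<bar>u x\<bar>)"
  using abs_E[OF s0 s1 u(1)] u by (intro maximizerI) (auto simp: Lp_enn_def)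
 then show ?thesis by blast
qed

lemma maximizer_simil:
 assumes u: "maximizer u" and T: "simil 1 T" shows "maximizer (\<lambda>x. u (T x))"
 using maximizerD[OF u] E_simil[OF s0 s1 _ T] fin_E_simil(2,3)[OF T] Lp_enn_simil[OF T, of u p 1]
 by (auto simp: maximizer_def)

text \<open>The polarization is again a maximizer, so its fractional seminorm is unchanged and the
  equality case applies.\<close>

lemma maximizer_mirror:
 assumes u: "maximizer u" and e: "norm e = 1"
  and half: "(\<integral>x. u x powr p * indicator {x. 0 < x \<bullet> e - t} x \<partial>\<L>) = (\<integral>x. u x powr p * indicator {x. x \<bullet> e - t < 0} x \<partial>\<L>)"
 shows "AE x in \<L>. u (refl_map e t x) = u x"
proof -
 interpret reflection e t by unfold_locales (rule e)
 note m = maximizerD[OF u]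
 let ?v = "pol e t 1 abs u"
 note P = pol_E[OF s0 s1 m(1)]
 have "maximizer ?v"
 proof (rule maximizerI)
  have *: "0 <= (a + b) / 2 + 1 * k * \<bar>(a - b) / 2\<bar>" if "0 <= a" "0 <= b" "\<bar>k\<bar> <= 1" for a b k :: real
  proof -
   have "\<bar>k * \<bar>(a - b) / 2\<bar>\<bar> <= 1 * \<bar>(a - b) / 2\<bar>" unfolding abs_mult abs_abs using that by (intro mult_right_mono) auto
   then show ?thesis using that by (simp add: abs_le_iff) argo
  qed
  show "0 <= ?v x" for x unfolding pol_def by (rule *) (use m(2) in \<open>auto simp: sgn_if\<close>)
 qed (use P m Lp_pol[OF m(7), of p] in auto)
 note v = maximizerD[OF this]
 have "Ds2_enn s ?v = Ds2_enn s u"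
  unfolding Ds2_enn_ennreal[OF v(6)] Ds2_enn_ennreal[OF m(6)] v(4) m(4) ..
 moreover have "Ds2_enn s u < \<infinity>" unfolding Ds2_enn_ennreal[OF m(6)] by simp
 ultimately show ?thesis
  using exponents(4) by (intro mirror_symmetric[OF _ m(2,7,8) half] dichotomy[OF s0 m(7)]) auto
qed

text \<open>The mass beyond a hyperplane depends continuously on its position, since hyperplanes are
  null sets, and runs from \<open>Cgn\<close> to 0; the intermediate value Cgn / 2 is
  attained.\<close>

lemma halving:
 assumes u: "maximizer u" and e: "norm e = 1"
 shows "\<exists>t. (\<integral>x. u x powr p * indicator {x. 0 < x \<bullet> e - t} x \<partial>\<L>) = (\<integral>x. u x powr p * indicator {x. x \<bullet> e - t < 0} x \<partial>\<L>)"
proof -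
 note m = maximizerD[OF u]
 note [measurable] = m(7) borel_ident_lebesgue
 have H: "Measurable.pred \<L> (\<lambda>x. 0 < x \<bullet> e - t)" "Measurable.pred \<L> (\<lambda>x. x \<bullet> e - t < 0)" for t by measurable
 then have Hs[measurable]: "{x. 0 < x \<bullet> e - t} \<in> sets \<L>" "{x. x \<bullet> e - t < 0} \<in> sets \<L>" for t by (simp_all add: pred_def)
 let ?F = "\<lambda>t. \<integral>x. u x powr p * indicator {x. 0 < x \<bullet> e - t} x \<partial>\<L>"
 have conv: "(\<lambda>n. ?F (T n)) \<longlonglongrightarrow> (\<integral>x. u x powr p * c x \<partial>\<L>)"
  if "AE x in \<L>. \<forall>\<^sub>F n in sequentially. indicator {x. 0 < x \<bullet> e - T n} x = (c x :: real)" "c \<in> \<M>" for T c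
 proof (rule integral_dominated_convergence[where w = "\<lambda>x. u x powr p"])
  show "AE x in \<L>. (\<lambda>n. u x powr p * indicator {x. 0 < x \<bullet> e - T n} x) \<longlonglongrightarrow> u x powr p * c x"
   using that(1) by eventually_elim (intro tendsto_mult_left tendsto_eventually)
  show "(\<lambda>x. u x powr p * c x) \<in> \<M>" using that(2) by measurable
 qed (use m(8) in \<open>auto simp: indicator_def\<close>)
 have cont: "continuous_on UNIV ?F"
 proof (rule continuous_on_sequentiallyI)
  fix T :: "nat => real" and a assume T: "T \<longlonglongrightarrow> a"
  show "(\<lambda>n. ?F (T n)) \<longlonglongrightarrow> ?F a"
  proof (rule conv)
   show "AE x in \<L>. \<forall>\<^sub>F n in sequentially. indicator {x. 0 < x \<bullet> e - T n} x = (indicator {x. 0 < x \<bullet> e - a} x :: real)"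
    using hyperplane_AE[OF e, of a]
   proof eventually_elim
    case (elim x)
    then consider "x \<bullet> e < a" | "a < x \<bullet> e" by linarith
    then show ?case
     by cases (auto elim!: eventually_mono[OF order_tendstoD(1)[OF T]] eventually_mono[OF order_tendstoD(2)[OF T]])
   qed
  qed measurable
 qed
 have ev: "\<forall>\<^sub>F n in sequentially. y < real n" for y :: real
  using filterlim_real_sequentially by (simp add: filterlim_at_top_dense)
 have "(\<lambda>n. ?F (real n)) \<longlonglongrightarrow> (\<integral>x. u x powr p * 0 \<partial>\<L>)"
 proof (rule conv, rule AE_I2)
  fix x show "\<forall>\<^sub>F n in sequentially. indicator {x. 0 < x \<bullet> e - real n} x = (0::real)"
   using ev[of "x \<bullet> e"] by eventually_elim (auto simp: indicator_def)
 qed simp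
 then have "\<forall>\<^sub>F n in sequentially. ?F (real n) < Cgn / 2" using Cgn_pos by (intro order_tendstoD(2)) auto
 from eventually_happens'[OF sequentially_bot this] obtain b where b: "?F (real b) < Cgn / 2" ..
 have "(\<lambda>n. ?F (- real n)) \<longlonglongrightarrow> (\<integral>x. u x powr p * 1 \<partial>\<L>)"
 proof (rule conv, rule AE_I2)
  fix x show "\<forall>\<^sub>F n in sequentially. indicator {x. 0 < x \<bullet> e - - real n} x = (1::real)"
   using ev[of "- (x \<bullet> e)"] by eventually_elim (auto simp: indicator_def)
 qed simp
 then have "\<forall>\<^sub>F n in sequentially. Cgn / 2 < ?F (- real n)" using Cgn_pos m(9) by (intro order_tendstoD(1)) auto
 from eventually_happens'[OF sequentially_bot this] obtain a where a: "Cgn / 2 < ?F (- real a)" ..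
 obtain t where t: "?F t = Cgn / 2"
  using IVT2'[OF less_imp_le[OF b] less_imp_le[OF a] _ continuous_on_subset[OF cont]] by auto
 have "Cgn = (\<integral>x. u x powr p * indicator {x. 0 < x \<bullet> e - t} x + u x powr p * indicator {x. x \<bullet> e - t < 0} x \<partial>\<L>)"
  unfolding m(9)[symmetric]
 proof (rule integral_cong_AE)
  show "AE x in \<L>. u x powr p = u x powr p * indicator {x. 0 < x \<bullet> e - t} x + u x powr p * indicator {x. x \<bullet> e - t < 0} x"
   using hyperplane_AE[OF e, of t] by eventually_elim (auto simp: indicator_def)
 qed measurable
 also have "\<dots> = ?F t + (\<integral>x. u x powr p * indicator {x. x \<bullet> e - t < 0} x \<partial>\<L>)"
  by (rule Bochner_Integration.integral_add; rule integrable_real_mult_indicator[OF _ m(8)]) measurable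
 finally show ?thesis using t by (intro exI[of _ t]) simp
qed

text \<open>\<open>maximizer_mirror\<close> gives a symmetry of the original function, so one
  maximizer has mirrors in all coordinate directions at once. With their common point at the origin,
  the coordinate reflections compose to -x.\<close>

lemma maximizer_centred: "\<exists>w. maximizer w \<and> (AE x in \<L>. w (- x) = w x)"
proof -
 obtain u where u: "maximizer u" using maximizer_ex by blast
 have na: "norm (axis i 1 :: real^'n) = 1" for i by simp
 have "\<exists>t. AE x in \<L>. u (refl_map (axis i 1) t x) = u x" for i
  using halving[OF u na[of i]] maximizer_mirror[OF u na[of i]] by (elim exE) (rule exI)
 then have "\<forall>i. \<exists>t. AE x in \<L>. u (refl_map (axis i 1) t x) = u x" by (rule allI)
 from choice[OF this] obtain T where T: "\<forall>i. AE x in \<L>. u (refl_map (axis i 1) (T i) x) = u x" ..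
 define w where "w x = u (x + vec_lambda T)" for x
 have w: "maximizer w" unfolding w_def by (rule maximizer_simil[OF u simil_translate])
 have wi: "AE x in \<L>. w (refl_map (axis i 1) 0 x) = w x" for i
  using AE_simil[OF simil_translate T[rule_format, of i], of "vec_lambda T"]
  by eventually_elim (simp add: w_def refl_map_def inner_axis algebra_simps)
 have "AE x in \<L>. w (\<chi> i. if i \<in> I then - x $ i else x $ i) = w x" for I
 proof (induction I rule: finite_induct[OF finite])
  case 1 then show ?case by simp
 next
  case (2 j I)
  interpret reflection "axis j 1 :: real^'n" 0 by unfold_locales simp
  have "\<sigma> x = x - (2 * x $ j) *\<^sub>R axis j 1" for x by (simp add: refl_map_def inner_axis)
  then have e: "(\<chi> i. if i \<in> insert j I then - x $ i else x $ i) = (\<chi> i. if i \<in> I then - \<sigma> x $ i else \<sigma> x $ i)" for x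
   using 2(2) by (auto simp: vec_eq_iff axis_def)
  show ?case using AE_simil[OF refl_simil 2(3)] wi[of j] unfolding e by eventually_elim simp
 qed
 from this[of UNIV] have "AE x in \<L>. w (- x) = w x" by (simp add: vec_lambda_unique[symmetric] uminus_vec_def)
 then show ?thesis using w by blast
qed

text \<open>For an even function each hyperplane through the origin halves the mass, so all mirrors
  pass through one point.\<close>

lemma centred_mirror:
 assumes w: "maximizer w" and even: "AE x in \<L>. w (- x) = w x" and e: "norm e = 1"
 shows "AE x in \<L>. w (refl_map e 0 x) = w x"
proof (rule maximizer_mirror[OF w e])
 note [measurable] = maximizerD(7)[OF w] borel_ident_lebesgue
 have H: "Measurable.pred \<L> (\<lambda>x. 0 < x \<bullet> e - 0)" by measurable
 then have Hs[measurable]: "{x. 0 < x \<bullet> e - 0} \<in> sets \<L>" by (simp add: pred_def)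
 have "orthogonal_transformation (\<lambda>x::real^'n. - x)" by (auto simp: orthogonal_transformation_def intro!: linearI)
 from similI[OF zero_less_one this, of 0] have neg: "simil 1 (\<lambda>x::real^'n. - x)" by simp
 have m: "(\<lambda>x. w x powr p * indicator {x. 0 < x \<bullet> e - 0} x) \<in> \<M>" by measurable
 from simil_integral(2)[OF neg m]
 have "(\<integral>x. w x powr p * indicator {x. 0 < x \<bullet> e - 0} x \<partial>\<L>) = (\<integral>x. w (- x) powr p * indicator {x. 0 < x \<bullet> e - 0} (- x) \<partial>\<L>)" by simp
 also have "\<dots> = (\<integral>x. w x powr p * indicator {x. x \<bullet> e - 0 < 0} x \<partial>\<L>)"
 proof (rule integral_cong_AE)
  show "AE x in \<L>. w (- x) powr p * indicator {x. 0 < x \<bullet> e - 0} (- x) = w x powr p * indicator {x. x \<bullet> e - 0 < 0} x"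
   using even by eventually_elim (auto simp: indicator_def)
  show "(\<lambda>x. w (- x) powr p * indicator {x. 0 < x \<bullet> e - 0} (- x)) \<in> \<M>"
   by (rule simil_measurable_comp[OF neg m])
  have "Measurable.pred \<L> (\<lambda>x. x \<bullet> e - 0 < 0)" by measurable
  then have [measurable]: "{x. x \<bullet> e - 0 < 0} \<in> sets \<L>" by (simp add: pred_def)
  show "(\<lambda>x. w x powr p * indicator {x. x \<bullet> e - 0 < 0} x) \<in> \<M>" by measurable
 qed
 finally show "(\<integral>x. w x powr p * indicator {x. 0 < x \<bullet> e - 0} x \<partial>\<L>) = (\<integral>x. w x powr p * indicator {x. x \<bullet> e - 0 < 0} x \<partial>\<L>)" .
qed

end

section \<open>Ball averages and the pointwise radial representative\<close>

definition avg :: "(real^'n::finite => real) => real => real^'n => real" where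
 "avg u r x = (\<integral>y. u y * indicator (ball x r) y \<partial>\<L>) / measure \<L> (ball (0::real^'n) r)"

lemma avg_measurable:
 fixes u :: "real^'n::finite => real"
 assumes u: "u \<in> \<M>" shows "avg u r \<in> \<M>"
proof -
 have u2: "(\<lambda>z::(real^'n)\<times>(real^'n). u (snd z)) \<in> borel_measurable \<L>\<^sub>2"
  using measurable_compose[OF measurable_snd u] .
 have "Measurable.pred \<L>\<^sub>2 (\<lambda>z::(real^'n)\<times>(real^'n). dist (fst z) (snd z) < r)"
  using measurable_dist_leb by measurable
 then have "(\<lambda>z::(real^'n)\<times>(real^'n). u (snd z) * indicator {z. dist (fst z) (snd z) < r} z) \<in> borel_measurable \<L>\<^sub>2"
  using u2 by (intro borel_measurable_times borel_measurable_indicator) (auto simp: pred_def space_pair_measure)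
 then have "(\<lambda>x. \<integral>y. u y * indicator {z. dist (fst z) (snd z) < r} (x, y) \<partial>\<L>) \<in> \<M>"
  by (intro leb.borel_measurable_lebesgue_integral) (simp add: split_beta')
 moreover have "indicator {z. dist (fst z) (snd z) < r} (x, y) = (indicator (ball x r) y :: real)" for x y :: "real^'n"
  by (simp add: indicator_def)
 ultimately show ?thesis unfolding avg_def[abs_def] by simp
qed

text \<open>The fractional seminorm gives a rate: |a| <= d + a^2 / d with d = r^s, applied to u(x) -
  u(y) and averaged over the ball, leaves r^s (|B_R| + D / \<omega>), where \<omega> is the volume
  of the unit ball.\<close>

lemma avg_L1c:
 fixes u :: "real^'n::finite => real"
 assumes s: "0 < s" and u: "u \<in> \<M>" and loc: "\<And>R. integrable \<L> (\<lambda>x. indicator (ball 0 R) x * u x)"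
  and fin: "Ds2_enn s u = ennreal D" "0 <= D"
 shows "L1c (\<lambda>k. avg u (1 / real (Suc k))) u"
 unfolding L1c_def
proof
 fix R
 let ?w = "unit_ball_vol (real CARD('n))" and ?V = "measure \<L> (ball (0::real^'n) R)"
 have w: "?w > 0" by simp
 note w0 = w[THEN less_imp_neq, symmetric]
 have bound: "(\<integral>\<^sup>+x. ennreal \<bar>avg u r x - u x\<bar> * indicator (ball 0 R) x \<partial>\<L>) <= ennreal (r powr s * (?V + D / ?w))" if r: "r > 0" for r
 proof -
  let ?v = "?w * r ^ CARD('n)" and ?d = "r powr s"
  have v: "?v > 0" and d: "?d > 0" using r w by auto
  have em: "emeasure \<L> (ball x r) = ennreal ?v" for x :: "real^'n" using emeasure_ball_leb[of r x] r by simp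
  then have me: "measure \<L> (ball x r) = ?v" for x :: "real^'n" unfolding measure_def em using v by (simp only: enn2real_ennreal less_imp_le)
  let ?J = "\<lambda>x. \<integral>\<^sup>+y. ennreal ((u x - u y)\<^sup>2) * indicator (ball x r) y \<partial>\<L>"
  have pt: "ennreal \<bar>avg u r x - u x\<bar> <= ennreal ?d + ennreal (1 / (?d * ?v)) * ?J x" for x
  proof -
   have "ball x r \<subseteq> ball 0 (norm x + r)" by (auto simp: dist_norm intro: le_less_trans[OF norm_triangle_sub[of _ x]]) (metis add_strict_left_mono le_less_trans norm_minus_commute norm_triangle_sub)
   then have eq: "u y * indicator (ball x r) y = indicator (ball 0 (norm x + r)) y * u y * indicator (ball x r) y" for y
    by (auto simp: indicator_def)
   have i1: "integrable \<L> (\<lambda>y. u y * indicator (ball x r) y)"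
    unfolding eq by (intro integrable_real_mult_indicator loc) auto
   have i2: "integrable \<L> (\<lambda>y. u x * indicator (ball x r) y)" by simp
   have "avg u r x - u x = (\<integral>y. u y * indicator (ball x r) y - u x * indicator (ball x r) y \<partial>\<L>) / ?v"
    unfolding Bochner_Integration.integral_diff[OF i1 i2] using r w0 by (simp add: avg_def me diff_divide_distrib)
   moreover have gen: "ennreal \<bar>a / k\<bar> = ennreal (1 / k) * ennreal (norm a)" if "k > 0" for a k :: real
    using that by (simp add: ennreal_mult[symmetric] abs_mult)
   ultimately have "ennreal \<bar>avg u r x - u x\<bar> = ennreal (1 / ?v) * ennreal (norm (\<integral>y. u y * indicator (ball x r) y - u x * indicator (ball x r) y \<partial>\<L>))"
    by (simp only: gen[OF v])
   also have "\<dots> <= ennreal (1 / ?v) * (\<integral>\<^sup>+y. ennreal (norm (u y * indicator (ball x r) y - u x * indicator (ball x r) y)) \<partial>\<L>)"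
    by (intro mult_left_mono integral_norm_bound_ennreal Bochner_Integration.integrable_diff i1 i2) simp
   also have "\<dots> <= ennreal (1 / ?v) * (\<integral>\<^sup>+y. ennreal ?d * indicator (ball x r) y + ennreal (1 / ?d) * (ennreal ((u x - u y)\<^sup>2) * indicator (ball x r) y) \<partial>\<L>)"
   proof (intro mult_left_mono nn_integral_mono)
    fix y
    have "\<bar>a\<bar> <= ?d + 1 / ?d * a\<^sup>2" for a
    proof -
     have "2 * (\<bar>a\<bar> * ?d) <= \<bar>a\<bar>\<^sup>2 + ?d\<^sup>2" using zero_le_power2[of "\<bar>a\<bar> - ?d"] unfolding power2_diff by linarith
     moreover have "0 <= \<bar>a\<bar> * ?d" by simp
     ultimately have "\<bar>a\<bar> * ?d <= ?d * ?d + a\<^sup>2" unfolding power2_abs power2_eq_square[of ?d] by linarith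
     then have "\<bar>a\<bar> <= (?d * ?d + a\<^sup>2) / ?d" using d by (simp only: pos_le_divide_eq)
     then show ?thesis using d by (simp add: add_divide_distrib)
    qed
    from this[of "u x - u y"] have "ennreal \<bar>u x - u y\<bar> <= ennreal ?d + ennreal (1 / ?d) * ennreal ((u x - u y)\<^sup>2)"
     using d by (simp add: ennreal_mult[symmetric] ennreal_plus[symmetric] del: ennreal_plus)
    then show "ennreal (norm (u y * indicator (ball x r) y - u x * indicator (ball x r) y))
     <= ennreal ?d * indicator (ball x r) y + ennreal (1 / ?d) * (ennreal ((u x - u y)\<^sup>2) * indicator (ball x r) y)"
     by (simp add: indicator_def abs_minus_commute)
   qed simp
   also have "\<dots> = ennreal (1 / ?v) * (ennreal ?d * ennreal ?v + ennreal (1 / ?d) * ?J x)"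
    by (subst nn_integral_add, use u in measurable, subst nn_integral_cmult, use u in measurable) (simp only: nn_integral_cmult_indicator[OF lmeasurable_ball[THEN fmeasurableD]] em)
   also have "\<dots> = ennreal (1 / ?v) * (ennreal ?d * ennreal ?v) + ennreal (1 / ?v) * (ennreal (1 / ?d) * ?J x)"
    by (rule distrib_left)
   also have "ennreal (1 / ?v) * (ennreal ?d * ennreal ?v) = ennreal ?d"
    using v d r by (simp add: w0 ennreal_mult[symmetric])
   also have "ennreal (1 / ?v) * (ennreal (1 / ?d) * ?J x) = ennreal (1 / (?d * ?v)) * ?J x"
   proof -
    have "ennreal (1 / k) * (ennreal (1 / l) * J) = ennreal (1 / (l * k)) * J" if "k > 0" "l > 0" for k l J
     unfolding mult.assoc[symmetric] using that by (simp add: ennreal_mult[symmetric] mult.commute)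
    from this[OF v d] show ?thesis .
   qed
   finally show ?thesis .
  qed
  have Fm: "(\<lambda>z::(real^'n)\<times>(real^'n). ennreal ((u (fst z) - u (snd z))\<^sup>2) * indicator {z. dist (fst z) (snd z) < r} z) \<in> borel_measurable \<L>\<^sub>2"
  proof -
   have "Measurable.pred \<L>\<^sub>2 (\<lambda>z::(real^'n)\<times>(real^'n). dist (fst z) (snd z) < r)"
    using measurable_dist_leb by measurable
   then show ?thesis using incr_measurable[OF u]
    by (intro borel_measurable_times_ennreal borel_measurable_indicator) (auto simp: pred_def space_pair_measure)
  qed
  have Jeq: "?J x = (\<integral>\<^sup>+y. ennreal ((u (fst (x, y)) - u (snd (x, y)))\<^sup>2) * indicator {z. dist (fst z) (snd z) < r} (x, y) \<partial>\<L>)" for x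
   by (intro nn_integral_cong) (simp add: indicator_def)
  have Jm: "?J \<in> \<M>" unfolding Jeq by (rule leb.borel_measurable_nn_integral_fst[OF Fm])
  have "(\<integral>\<^sup>+x. ennreal \<bar>avg u r x - u x\<bar> * indicator (ball 0 R) x \<partial>\<L>)
   <= (\<integral>\<^sup>+x. ennreal ?d * indicator (ball 0 R) x + ennreal (1 / (?d * ?v)) * ?J x \<partial>\<L>)"
   using pt by (intro nn_integral_mono) (auto simp: indicator_def)
  also have "\<dots> = ennreal ?d * emeasure \<L> (ball (0::real^'n) R) + ennreal (1 / (?d * ?v)) * (\<integral>\<^sup>+x. ?J x \<partial>\<L>)"
  proof -
   have "(\<integral>\<^sup>+x. a * indicator B x + c * J x \<partial>\<L>) = a * emeasure \<L> B + c * (\<integral>\<^sup>+x. J x \<partial>\<L>)"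
    if [measurable]: "J \<in> \<M>" "B \<in> sets \<L>" for a c and J :: "real^'n => ennreal" and B
    by (simp add: nn_integral_add nn_integral_cmult nn_integral_cmult_indicator)
   from this[OF Jm lmeasurable_ball[THEN fmeasurableD]] show ?thesis .
  qed
  also have "(\<integral>\<^sup>+x. ?J x \<partial>\<L>) = incr u r"
   unfolding Jeq incr_def by (rule leb.nn_integral_fst[OF Fm])
  also have "emeasure \<L> (ball (0::real^'n) R) = ennreal ?V"
   by (rule emeasure_eq_ennreal_measure) (use finite_ball[of "0::real^'n" R] in auto)
  also have "ennreal (1 / (?d * ?v)) * incr u r <= ennreal (1 / (?d * ?v)) * (ennreal (r powr (real CARD('n) + 2 * s)) * ennreal D)"
   using incr_le_Ds2[OF s u, of r] unfolding fin(1) by (rule mult_left_mono) simp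
  also have "\<dots> = ennreal (?d * (D / ?w))"
  proof -
   have "r powr (real CARD('n) + 2 * s) = r ^ CARD('n) * (?d * ?d)"
    by (simp only: powr_add mult_2 powr_realpow[OF r])
   moreover have "ennreal (1 / (a * (b * k))) * (ennreal (k * (a * a)) * ennreal D) = ennreal (a * (D / b))"
    if "0 < a" "0 < b" "0 < k" for a b k :: real
    using that fin(2) by (subst ennreal_mult[symmetric], simp, simp, subst ennreal_mult[symmetric]) simp_all
   note this[OF d w zero_less_power[OF r, of "CARD('n)"]]
   ultimately show ?thesis by (simp only:)
  qed
  finally have "(\<integral>\<^sup>+x. ennreal \<bar>avg u r x - u x\<bar> * indicator (ball 0 R) x \<partial>\<L>) <= ennreal ?d * ennreal ?V + ennreal (?d * (D / ?w))"
   by (simp add: add_left_mono)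
  also have "\<dots> = ennreal (?d * (?V + D / ?w))"
  proof -
   have "ennreal a * ennreal b + ennreal (a * c) = ennreal (a * (b + c))" if "0 <= a" "0 <= b" "0 <= c" for a b c
    using that by (simp add: distrib_left ennreal_mult)
   from this[of ?d ?V "D / ?w"] show ?thesis using fin(2) by simp
  qed
  finally show ?thesis .
 qed
 have "(\<lambda>k. (1 / real (Suc k)) powr s) \<longlonglongrightarrow> 0"
  using s tendsto_neg_powr[of "- s" "\<lambda>k. real (Suc k)" sequentially] filterlim_compose[OF filterlim_real_sequentially filterlim_Suc]
  by (simp add: powr_minus powr_divide inverse_eq_divide o_def)
 then have "(\<lambda>k. (1 / real (Suc k)) powr s * (?V + D / ?w)) \<longlonglongrightarrow> 0 * (?V + D / ?w)" by (intro tendsto_mult_right)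
 from tendsto_ennrealI[OF this] have lim: "(\<lambda>k. ennreal ((1 / real (Suc k)) powr s * (?V + D / ?w))) \<longlonglongrightarrow> 0"
  unfolding mult_zero_left ennreal_0 .
 show "(\<lambda>k. \<integral>\<^sup>+x. ennreal \<bar>avg u (1 / real (Suc k)) x - u x\<bar> * indicator (ball 0 R) x \<partial>\<L>) \<longlonglongrightarrow> 0"
  by (rule tendsto_sandwich[OF _ _ tendsto_const lim]) (simp, intro always_eventually allI bound, simp)
qed

text \<open>A ball average exists at every point and ignores null sets, so an almost everywhere
  symmetry becomes an exact one.\<close>

lemma (in reflection) avg_refl:
 assumes u: "u \<in> \<M>" and sym: "AE x in \<L>. u (\<sigma> x) = u x"
 shows "avg u r (\<sigma> x) = avg u r x"
proof -
 have m: "(\<lambda>y. u y * indicator (ball z r) y) \<in> \<M>" for z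
  using u by (intro borel_measurable_times borel_measurable_indicator) auto
 have "(\<integral>y. u y * indicator (ball (\<sigma> x) r) y \<partial>\<L>) = (\<integral>y. u (\<sigma> y) * indicator (ball (\<sigma> x) r) (\<sigma> y) \<partial>\<L>)"
  using simil_integral(2)[OF refl_simil m] by simp
 also have "\<dots> = (\<integral>y. u y * indicator (ball x r) y \<partial>\<L>)"
 proof (rule integral_cong_AE[OF simil_measurable_comp[OF refl_simil m] m])
  show "AE y in \<L>. u (\<sigma> y) * indicator (ball (\<sigma> x) r) (\<sigma> y) = u y * indicator (ball x r) y"
   using sym by eventually_elim (simp add: indicator_def dist_refl_refl)
 qed
 finally show ?thesis by (simp add: avg_def)
qed

text \<open>For points of equal norm the hyperplane through the origin with normal x - y is their
  perpendicular bisector.\<close>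

lemma refl_map_exchange:
 fixes x y :: "real^'n::finite"
 assumes "norm x = norm y" "x \<noteq> y"
 shows "refl_map ((1 / norm (x - y)) *\<^sub>R (x - y)) 0 x = y"
proof -
 have n: "norm (x - y) \<noteq> 0" using assms by simp
 have "x \<bullet> x = y \<bullet> y" using assms(1) by (simp add: norm_eq_sqrt_inner)
 then have "(norm (x - y))\<^sup>2 = 2 * (x \<bullet> (x - y))"
  unfolding power2_norm_eq_inner by (simp add: inner_diff_left inner_diff_right inner_commute)
 then have e: "2 * (x \<bullet> (x - y)) = norm (x - y) * norm (x - y)" by (simp add: power2_eq_square)
 have "2 * (b / k) * (1 / k) = 1" if "2 * b = k * k" "k \<noteq> 0" for b k :: real using that by (simp add: field_simps)
 note c = this[OF e n]
 have "refl_map ((1 / norm (x - y)) *\<^sub>R (x - y)) 0 x = x - (2 * (x \<bullet> (x - y) / norm (x - y)) * (1 / norm (x - y))) *\<^sub>R (x - y)"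
  by (simp add: refl_map_def)
 then show ?thesis unfolding c by simp
qed

context GN_setting
begin

lemma radial_maximizer: "\<exists>v. maximizer v \<and> radial v"
proof -
 obtain w where w: "maximizer w" and even: "AE x in \<L>. w (- x) = w x" using maximizer_centred by blast
 note m = maximizerD[OF w]
 obtain \<phi> where \<phi>: "\<And>k. test_fun (\<phi> k)" "L1c \<phi> w" using E_spaceD'[OF m(1)] by blast
 have c: "L1c (\<lambda>k. avg w (1 / real (Suc k))) w"
  by (rule avg_L1c[OF s0 m(7) L1c_locally_integrable[OF \<phi>(1) m(7) \<phi>(2)] Ds2_enn_ennreal[OF m(6)]]) simp
 from L1c_AE_subseq[OF avg_measurable[OF m(7)] m(7) c]
 obtain r where r: "AE x in \<L>. (\<lambda>k. avg w (1 / real (Suc (r k))) x) \<longlonglongrightarrow> w x" by (elim exE conjE)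
 \<comment> \<open>\<open>lim\<close> has some value even where the averages diverge, and points of
   equal norm have identical sequences of averages, so radiality holds there too. The maximum with 0
   gives nonnegativity at every point.\<close>
 define v where "v x = max 0 (lim (\<lambda>k. avg w (1 / real (Suc (r k))) x))" for x
 note [measurable] = avg_measurable[OF m(7)]
 have vm: "v \<in> \<M>" unfolding v_def[abs_def] by measurable
 have ae: "AE x in \<L>. w x = v x"
  using r by eventually_elim (use m(2) in \<open>simp add: v_def limI max_def\<close>)
 have "v x = v y" if "norm x = norm y" for x y
 proof (cases "x = y")
  case False
  let ?e = "(1 / norm (x - y)) *\<^sub>R (x - y)"
  interpret reflection ?e 0 by unfold_locales (use False in simp)
  have "avg w q y = avg w q x" for q
   using avg_refl[OF m(7) centred_mirror[OF w even e1], of q x] unfolding refl_map_exchange[OF that False] .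
  then show ?thesis by (simp add: v_def)
 qed simp
 then have "radial v" unfolding radial_def by (intro allI impI)
 moreover have nv: "0 <= v x" for x by (simp add: v_def)
 then have "maximizer v"
  unfolding maximizer_def D12_sq_def Ds2_sq_def fin_E_cong_AE(2,3)[OF m(6) vm ae] Lp_cong_AE[OF ae, symmetric]
  unfolding D12_sq_def[symmetric] Ds2_sq_def[symmetric]
  using E_cong_AE[OF s0 s1 m(1) vm ae] m(3,4,5) nv by simp
 ultimately show ?thesis by blast
qed

end

section \<open>The Euler-Lagrange equation of a maximizer\<close>

lemma form_scale_left:
 assumes u: "fin_E s u" and v: "fin_E s v"
 shows "D12_form (\<lambda>x. c * u x) v = c * D12_form u v" "Ds2_form s (\<lambda>x. c * u x) v = c * Ds2_form s u v"
 using fin_E_lincomb(2,3)[OF v u, of c] fin_E_lincomb(2,3)[OF v fin_E_scale(1)[OF u], of 1 c] fin_E_scale(2,3)[OF u, of c]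
 by (simp_all add: form_commute(1)[of v] form_commute(2)[of s v])

text \<open>The p-th power of the modulus lies above its tangent at \<open>a\<close>: Young's
  inequality for |a + b| / a and 1 with exponents p and p/(p - 1), multiplied by a^p.\<close>

lemma powr_tangent:
 fixes a b p :: real
 assumes p: "1 < p" and a: "0 <= a"
 shows "a powr p + p * (a powr (p - 1) * b) <= \<bar>a + b\<bar> powr p"
proof (cases "a = 0")
 case False
 then have a: "a > 0" using assms by simp
 define x where "x = \<bar>a + b\<bar> / a"
 have "1 < p / (p - 1)" "1 / p + 1 / (p / (p - 1)) = 1" using p by (simp_all add: field_simps)
 from Youngs_inequality[OF p this, of x 1] have "x <= x powr p / p + 1 / (p / (p - 1))" using a by (simp add: x_def)
 then have "p * x <= p * (x powr p / p + 1 / (p / (p - 1)))" using p by (intro mult_left_mono) auto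
 also have "\<dots> = x powr p + (p - 1)" using p by (simp add: distrib_left)
 finally have "p * x - (p - 1) <= x powr p" by simp
 moreover have "p * ((a + b) / a) <= p * x" unfolding x_def using p a by (intro mult_left_mono divide_right_mono) auto
 ultimately have "p * ((a + b) / a) - (p - 1) <= x powr p" by linarith
 then have "a powr p * (p * ((a + b) / a) - (p - 1)) <= a powr p * x powr p" by (rule mult_left_mono) simp
 also have "a powr p * x powr p = \<bar>a + b\<bar> powr p" using a by (simp add: x_def powr_divide)
 also have "p * ((a + b) / a) - (p - 1) = 1 + p * (b / a)" using a by (simp add: field_simps)
 also have "a powr p * (1 + p * (b / a)) = a powr p + p * (a powr (p - 1) * b)"
  using a by (simp add: powr_diff distrib_left)
 finally show ?thesis .
qed simp

context GN_setting
begin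

text \<open>The convexity of the \<open>p\<close>-th power replaces differentiation under the integral: both sides
 of the Gagliardo--Nirenberg inequality along \<open>u + t \<phi>\<close> are compared with an affine function of \<open>t\<close>.\<close>

lemma Euler_Lagrange:
 assumes u: "maximizer u" and \<phi>: "\<phi> \<in> E_space s"
 shows "integrable \<L> (\<lambda>x. u x powr (p - 1) * \<phi> x)"
  "Cgn * (2 * al * Ds2_form s u \<phi> + 2 * be * D12_form u \<phi>) = p * (\<integral>x. u x powr (p - 1) * \<phi> x \<partial>\<L>)"
proof -
 note m = maximizerD[OF u]
 have f\<phi>: "fin_E s \<phi>" by (rule E_fin[OF \<phi>])
 note [measurable] = m(7) fin_E_measurable[OF f\<phi>]
 have Lp: "integrable \<L> (\<lambda>x. \<bar>w x\<bar> powr p)" if "w \<in> E_space s" for w :: "real^'n => real"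
 proof -
  note [measurable] = fin_E_measurable[OF E_fin[OF that]]
  have "Lp_enn p w < \<infinity>" using GN_E[OF that] by (rule le_less_trans) simp
  then show ?thesis unfolding Lp_enn_def by (intro integrableI_bounded) auto
 qed
 show int: "integrable \<L> (\<lambda>x. u x powr (p - 1) * \<phi> x)"
 proof (rule Bochner_Integration.integrable_bound[OF Bochner_Integration.integrable_add[OF m(8) Lp[OF \<phi>]]])
  show "AE x in \<L>. norm (u x powr (p - 1) * \<phi> x) <= norm (u x powr p + \<bar>\<phi> x\<bar> powr p)"
  proof (rule AE_I2)
   fix x
   have pp: "a powr (p - 1) * a = a powr p" if "0 <= a" for a :: real
    using that powr_add[of a "p - 1" 1] by simp
   have "u x powr (p - 1) * \<bar>\<phi> x\<bar> <= u x powr p + \<bar>\<phi> x\<bar> powr p"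
   proof (cases "\<bar>\<phi> x\<bar> <= u x")
    case True
    then have "u x powr (p - 1) * \<bar>\<phi> x\<bar> <= u x powr (p - 1) * u x" by (intro mult_left_mono) auto
    then show ?thesis using pp[OF m(2)[of x]] by (simp add: add_increasing2)
   next
    case False
    then have "u x powr (p - 1) * \<bar>\<phi> x\<bar> <= \<bar>\<phi> x\<bar> powr (p - 1) * \<bar>\<phi> x\<bar>"
     using m(2)[of x] exponents(4) by (intro mult_right_mono powr_mono2) auto
    then show ?thesis using pp[of "\<bar>\<phi> x\<bar>"] by (simp add: add_increasing)
   qed
   then show "norm (u x powr (p - 1) * \<phi> x) <= norm (u x powr p + \<bar>\<phi> x\<bar> powr p)" by (simp add: abs_mult)
  qed
 qed measurable
 let ?I = "\<integral>x. u x powr (p - 1) * \<phi> x \<partial>\<L>"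
 let ?b = "Ds2_form s u \<phi>" and ?a = "D12_form u \<phi>"
 \<comment> \<open>The right side of the inequality along u + t \<phi>, minus an affine function
   lying below the left side. It is nonnegative, zero at t = 0 and differentiable there, so its
   derivative at 0 vanishes.\<close>
 define h where "h t = Cgn * ((1 + 2 * t * ?b + t\<^sup>2 * Ds2_sq s \<phi>) powr al * (1 + 2 * t * ?a + t\<^sup>2 * D12_sq \<phi>) powr be) - (Cgn + p * (t * ?I))" for t
 have h0: "h 0 = 0" by (simp add: h_def)
 have h_nonneg: "0 <= h t" for t
 proof -
  have w: "(\<lambda>x. u x + t * \<phi> x) \<in> E_space s" by (rule E_lincomb[OF s0 s1 m(1) \<phi>])
  have i2: "integrable \<L> (\<lambda>x. p * (t * (u x powr (p - 1) * \<phi> x)))" using int by simp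
  have "Cgn + p * (t * ?I) = (\<integral>x. u x powr p + p * (t * (u x powr (p - 1) * \<phi> x)) \<partial>\<L>)"
   unfolding Bochner_Integration.integral_add[OF m(8) i2] m(9) by simp
  also have "\<dots> <= (\<integral>x. \<bar>u x + t * \<phi> x\<bar> powr p \<partial>\<L>)"
  proof (rule integral_mono[OF Bochner_Integration.integrable_add[OF m(8) i2] Lp[OF w]])
   fix x show "u x powr p + p * (t * (u x powr (p - 1) * \<phi> x)) <= \<bar>u x + t * \<phi> x\<bar> powr p"
    using powr_tangent[of p "u x" "t * \<phi> x"] exponents(4) m(2)[of x] by (simp add: mult.left_commute)
  qed
  finally have 1: "Cgn + p * (t * ?I) <= (\<integral>x. \<bar>u x + t * \<phi> x\<bar> powr p \<partial>\<L>)" .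
  have "ennreal (\<integral>x. \<bar>u x + t * \<phi> x\<bar> powr p \<partial>\<L>) = Lp_enn p (\<lambda>x. u x + t * \<phi> x)"
   unfolding Lp_enn_def by (rule nn_integral_eq_integral[symmetric, OF Lp[OF w]]) simp
  also have "\<dots> <= ennreal (Cgn * (Ds2_sq s (\<lambda>x. u x + t * \<phi> x) powr al * D12_sq (\<lambda>x. u x + t * \<phi> x) powr be))" by (rule GN_E[OF w])
  finally have "(\<integral>x. \<bar>u x + t * \<phi> x\<bar> powr p \<partial>\<L>) <= Cgn * (Ds2_sq s (\<lambda>x. u x + t * \<phi> x) powr al * D12_sq (\<lambda>x. u x + t * \<phi> x) powr be)"
   using Cgn_pos by (subst (asm) ennreal_le_iff) auto
  then show ?thesis using 1 unfolding fin_E_lincomb(2,3)[OF m(6) f\<phi>] m(3,4) h_def by linarith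
 qed
 have q: "((\<lambda>t. 1 + 2 * t * c + t\<^sup>2 * k) has_real_derivative 2 * c) (at 0)" for c k :: real
  by (auto intro!: derivative_eq_intros)
 have d: "((\<lambda>t. (1 + 2 * t * c + t\<^sup>2 * k) powr r) has_real_derivative r * (2 * c)) (at 0)" for c k r :: real
  using DERIV_fun_powr[OF q, of c k r] by simp
 have "(h has_real_derivative Cgn * (al * (2 * ?b) * (1 + 2 * 0 * ?a + 0\<^sup>2 * D12_sq \<phi>) powr be
   + be * (2 * ?a) * (1 + 2 * 0 * ?b + 0\<^sup>2 * Ds2_sq s \<phi>) powr al) - (0 + p * (1 * ?I))) (at 0)"
  unfolding h_def[abs_def]
  by (intro DERIV_diff DERIV_cmult DERIV_mult DERIV_add DERIV_const DERIV_cmult_right DERIV_ident d)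
 then have "(h has_real_derivative Cgn * (al * (2 * ?b) + be * (2 * ?a)) - p * ?I) (at 0)" by simp
 from DERIV_local_min[OF this, of 1] have "Cgn * (al * (2 * ?b) + be * (2 * ?a)) - p * ?I = 0"
  using h_nonneg h0 by simp
 then show "Cgn * (2 * al * ?b + 2 * be * ?a) = p * ?I" by (simp add: algebra_simps)
qed

end

section \<open>Rescaling a maximizer to the normalised equation\<close>

context GN_setting
begin

text \<open>The equation of \<open>u\<close> carries the weights 2 be Cgn / p and 2 al Cgn / p on
  the two operators: the dilation \<open>lam2\<close> makes them equal and the multiple
  \<open>lam1\<close> brings them to 1. The two energies and the L^p integral of \<open>Q\<close>
  are then in the ratio 2 be / p : 2 al / p : 1, so the Pohozaev identity is the dilation identity
  of the exponents, and equality in the inequality gives the value of \<open>Cgn\<close>.\<close>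

lemma rescaled_solution:
 fixes u :: "real^'n => real"
 assumes u: "maximizer u" and rad: "radial u"
 defines "lam1 \<equiv> (be / al) powr (1 / ((1 - s) * (p - 2))) * (p / (2 * be) * (1 / Cgn)) powr (1 / (p - 2))"
  and "lam2 \<equiv> (be / al) powr (1 / (2 - 2 * s))"
 defines "Q \<equiv> \<lambda>x. lam1 * u (lam2 *\<^sub>R x)"
 shows "radial Q" "nonneg Q" "weak_solution s p Q" "GN_optimizer s p Cgn Q"
  "D12_sq Q = be / al * Ds2_sq s Q" "D12_sq Q = 2 * be / p * Lp_pow p Q"
  "(N-2)/2 * D12_sq Q + (N-2 * s)/2 * Ds2_sq s Q = N / p * Lp_pow p Q"
  "1 / Cgn = (2 * al / p) powr al * (2 * be / p) powr be * Lp_norm p Q powr (p*(p-2)/2)"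
proof -
 note m = maximizerD[OF u]
 note ex = exponents
 have p: "p > 0" and sp: "0 < (1 - s) * (p - 2)" "0 < 2 - 2 * s" using ex(4) s1 by auto
 have C: "Cgn > 0" by (rule Cgn_pos)
 have l: "lam1 > 0" "lam2 > 0" using ex(1,2) p C by (simp_all add: lam1_def lam2_def)
 have l2: "lam2\<^sup>2 = (be / al) powr (1 / (1 - s))" "lam2 powr (2 - 2 * s) = be / al"
 proof -
  have "lam2 powr 2 = (be / al) powr (1 / (2 - 2 * s) * 2)" unfolding lam2_def powr_powr ..
  also have "1 / (2 - 2 * s) * 2 = 1 / (1 - s)" using s1 by (simp add: field_simps)
  finally show "lam2\<^sup>2 = (be / al) powr (1 / (1 - s))" using l by (simp add: powr_numeral)
  show "lam2 powr (2 - 2 * s) = be / al" using sp(2) ex(1,2) by (simp add: lam2_def powr_powr)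
 qed
 have "lam1 powr (p - 2) = (be / al) powr (1 / ((1 - s) * (p - 2)) * (p - 2)) * (p / (2 * be) * (1 / Cgn)) powr (1 / (p - 2) * (p - 2))"
  using ex(1,2) p C by (simp only: lam1_def powr_mult powr_powr powr_ge_zero)
 also have "1 / ((1 - s) * (p - 2)) * (p - 2) = 1 / (1 - s)"
 proof -
  have "1 / (a * b) * b = 1 / a" if "b > 0" for a b :: real using that by simp
  then show ?thesis using ex(4) by (simp only: diff_gt_0_iff_gt)
 qed
 also have "1 / (p - 2) * (p - 2) = 1" using ex(4) by simp
 \<comment> \<open>The link between the two scalings: it produces the energy ratios and gives the
   nonlinear term coefficient 1.\<close>
 finally have l1: "lam1 powr (p - 2) * Cgn * (2 * be / p) = lam2\<^sup>2"
  using ex(1,2) p C by (simp add: l2(1))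
 have l1p: "lam1 powr p = lam1\<^sup>2 * lam1 powr (p - 2)" "lam1 powr (p - 1) = lam1 * lam1 powr (p - 2)"
  using l(1) powr_add[of lam1 2 "p - 2"] powr_add[of lam1 1 "p - 2"] by (simp_all add: powr_numeral)
 have w2: "lam2 powr (2 - N) = lam2\<^sup>2 * lam2 powr (- N)" "lam2 powr (2 * s - N) = lam2\<^sup>2 * lam2 powr (- N) / (be / al)"
 proof -
  show a: "lam2 powr (2 - N) = lam2\<^sup>2 * lam2 powr (- N)"
   using l(2) powr_add[of lam2 2 "- N"] by (simp add: powr_numeral)
  have "lam2 powr (2 * s - N) * (be / al) = lam2 powr (2 - N)"
   unfolding l2(2)[symmetric] powr_add[symmetric] by simp
  then show "lam2 powr (2 * s - N) = lam2\<^sup>2 * lam2 powr (- N) / (be / al)"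
   using ex(1,2) unfolding a by (simp add: field_simps)
 qed
 have S: "fin_E s Q" "D12_sq Q = lam1\<^sup>2 * lam2 powr (2 - N)" "Ds2_sq s Q = lam1\<^sup>2 * lam2 powr (2 * s - N)"
  "Lp_enn p Q = ennreal (lam1 powr p * lam2 powr (- N) * Cgn)"
  using scaled[OF m(6) l(2), of lam1] l C unfolding Q_def m(3,4,5) by (simp_all add: ennreal_mult)
 have P: "Lp_pow p Q = lam1 powr p * lam2 powr (- N) * Cgn" unfolding Lp_pow_def S(4) using C l by simp
 then have P0: "Lp_pow p Q > 0" using l C by simp
 show A: "D12_sq Q = 2 * be / p * Lp_pow p Q"
  unfolding S P w2(1) l1[symmetric] l1p(1) by (simp only: mult_ac)
 show AB: "D12_sq Q = be / al * Ds2_sq s Q"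
  unfolding S w2 using ex(1,2) by simp
 have B: "Ds2_sq s Q = 2 * al / p * Lp_pow p Q"
 proof -
  have "Ds2_sq s Q = al / be * D12_sq Q" unfolding AB using ex(1,2) by simp
  then show ?thesis unfolding A using ex(1,2) by simp
 qed
 show "(N-2)/2 * D12_sq Q + (N-2 * s)/2 * Ds2_sq s Q = N / p * Lp_pow p Q"
 proof -
  have "(N-2)/2 * (2 * be / p * k) + (N-2 * s)/2 * (2 * al / p * k) = ((N - 2) * be + (N - 2 * s) * al) / p * k" for k
  proof -
   have "a / 2 * (2 * b / p * k) = a * b / p * k" for a b by simp
   then show ?thesis by (simp only: add_divide_distrib distrib_right)
  qed
  then show ?thesis unfolding A B ex(5) .
 qed
 have GN: "Lp_pow p Q = Cgn * (Ds2_sq s Q powr al * D12_sq Q powr be)"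
  unfolding S P scale_exponents[OF l] by simp
 have QE: "Q \<in> E_space s" unfolding Q_def by (intro E_scale[OF s0 s1 E_simil[OF s0 s1 m(1) simil_scale[OF l(2)]]])
 show "GN_optimizer s p Cgn Q"
  unfolding GN_optimizer_iff
 proof (intro conjI QE)
  show "Lp_enn p Q = ennreal (Cgn * (Ds2_sq s Q powr al * D12_sq Q powr be))" unfolding GN[symmetric] S(4) P ..
  then show "\<not> (AE x in \<L>. Q x = 0)" using Lp_zero[of Q] P0 GN by auto
 qed
 have "Lp_norm p Q powr (p*(p-2)/2) = Lp_pow p Q powr (p/2 - 1)"
  using p by (simp add: Lp_norm_def powr_powr diff_divide_distrib)
 moreover have "Lp_pow p Q = Cgn * (((2 * al / p) powr al * (2 * be / p) powr be) * (Lp_pow p Q * Lp_pow p Q powr (p/2 - 1)))"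
 proof -
  have 1: "Lp_pow p Q powr al * Lp_pow p Q powr be = Lp_pow p Q * Lp_pow p Q powr (p/2 - 1)"
   unfolding powr_add[symmetric] ex(3) using powr_add[of "Lp_pow p Q" 1 "p/2 - 1"] P0 by simp
  have 2: "(2 * al / p * Lp_pow p Q) powr al = (2 * al / p) powr al * Lp_pow p Q powr al"
   "(2 * be / p * Lp_pow p Q) powr be = (2 * be / p) powr be * Lp_pow p Q powr be"
   using ex(1,2) p P0 by (intro powr_mult; simp)+
  have 3: "(x * a) * (y * b) = (x * y) * (a * b)" for x y a b :: real by simp
  from trans[OF GN[unfolded A B 2] arg_cong[of _ _ "(*) Cgn", OF 3]] show ?thesis unfolding 1 .
 qed
 then have "1 = Cgn * (((2 * al / p) powr al * (2 * be / p) powr be) * Lp_pow p Q powr (p/2 - 1))"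
  using P0 by (simp add: field_simps)
 ultimately show "1 / Cgn = (2 * al / p) powr al * (2 * be / p) powr be * Lp_norm p Q powr (p*(p-2)/2)"
  using C by (simp add: field_simps)
 show Qn: "nonneg Q" using l m(2) by (simp add: nonneg_def Q_def)
 show "radial Q" using rad l by (simp add: radial_def Q_def)
 show "weak_solution s p Q"
  unfolding weak_solution_def
 proof (intro conjI ballI QE)
  fix \<phi> :: "real^'n => real" assume \<phi>: "\<phi> \<in> E_space s"
  note f\<phi> = E_fin[OF \<phi>]
  \<comment> \<open>Undoes the dilation on the test side: \<open>Q\<close> and \<phi> then come from
    \<open>u\<close>, up to the factor \<open>lam1\<close>, and \<psi> by the same dilation, and the
    equation of \<open>u\<close> can be tested with \<psi>.\<close>
  define \<psi> where "\<psi> x = \<phi> ((1 / lam2) *\<^sub>R x)" for x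
  have \<psi>: "\<psi> \<in> E_space s" unfolding \<psi>_def using l by (intro E_simil[OF s0 s1 \<phi> simil_scale]) simp
  note f\<psi> = E_fin[OF \<psi>]
  have \<phi>e: "\<phi> = (\<lambda>x. \<psi> (lam2 *\<^sub>R x))" using l by (simp add: \<psi>_def)
  have Q1: "fin_E s (\<lambda>x. u (lam2 *\<^sub>R x))" by (rule fin_E_simil(1)[OF simil_scale[OF l(2)] m(6)])
  note sc = simil_scale[OF l(2)]
  show "integrable \<L> (\<lambda>x. wgrad Q x \<bullet> wgrad \<phi> x)" by (rule L2_inner[OF fin_E_L2(1)[OF S(1)] fin_E_L2(1)[OF f\<phi>]])
  have "integrable \<L>\<^sub>2 (\<lambda>z. fdiff s Q z * fdiff s \<phi> z)"
   using L2_inner[OF fin_E_L2(2)[OF S(1)] fin_E_L2(2)[OF f\<phi>]] by simp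
  then show "integrable \<L>\<^sub>2 (\<lambda>z. (Q (fst z) - Q (snd z)) * (\<phi> (fst z) - \<phi> (snd z))
      / dist (fst z) (snd z) powr (real CARD('n) + 2 * s))" by (simp only: fdiff_mult)
  have nl: "\<bar>Q x\<bar> powr (p - 2) * Q x * \<phi> x = lam1 powr (p - 1) * (u (lam2 *\<^sub>R x) powr (p - 1) * \<psi> (lam2 *\<^sub>R x))" for x
  proof -
   have "Q x \<ge> 0" using Qn by (simp add: nonneg_def)
   then have "\<bar>Q x\<bar> powr (p - 2) * Q x = Q x powr (p - 1)" using powr_add[of "Q x" "p - 2" 1] by simp
   also have "\<dots> = lam1 powr (p - 1) * u (lam2 *\<^sub>R x) powr (p - 1)" using l m(2) by (simp add: Q_def powr_mult)
   finally show ?thesis unfolding \<phi>e by simp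
  qed
  note EL = Euler_Lagrange[OF u \<psi>]
  note gm = borel_measurable_integrable[OF EL(1)]
  show "integrable \<L> (\<lambda>x. \<bar>Q x\<bar> powr (p - 2) * Q x * \<phi> x)"
   unfolding nl using simil_integral(1)[OF sc gm] EL(1) by simp
  let ?I = "\<integral>x. u x powr (p - 1) * \<psi> x \<partial>\<L>"
  have lN: "1 / lam2 ^ CARD('n) = lam2 powr (- N)" using l by (simp add: N_def powr_minus powr_realpow inverse_eq_divide)
  have R: "(\<integral>x. \<bar>Q x\<bar> powr (p - 2) * Q x * \<phi> x \<partial>\<L>) = lam1 powr (p - 1) * (lam2 powr (- N) * ?I)"
   unfolding nl using simil_integral(2)[OF sc gm] by (simp add: lN[symmetric])
  have "D12_form Q \<phi> = lam1 * (lam2\<^sup>2 * lam2 powr (- N) * D12_form u \<psi>)"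
   unfolding Q_def form_scale_left(1)[OF Q1 f\<phi>] unfolding \<phi>e fin_E_simil(4)[OF sc m(6) f\<psi>] by (simp add: lN[symmetric])
  moreover have "Ds2_form s Q \<phi> = lam1 * (lam2\<^sup>2 * lam2 powr (- N) / (be / al) * Ds2_form s u \<psi>)"
  proof -
   have "lam2 powr (real CARD('n) + 2 * s) / (lam2 ^ CARD('n) * lam2 ^ CARD('n)) = lam2 powr (2 * s - N)"
    using l(2) by (simp add: N_def powr_realpow[symmetric] powr_add powr_diff)
   then show ?thesis
    unfolding Q_def form_scale_left(2)[OF Q1 f\<phi>] unfolding \<phi>e fin_E_simil(5)[OF sc m(6) f\<psi>] w2(2) by simp
  qed
  moreover have "lam1 powr (p - 1) * (L * ?I) = lam1 * (lam2\<^sup>2 * L * D12_form u \<psi>) + lam1 * (lam2\<^sup>2 * L / (be / al) * Ds2_form s u \<psi>)" for L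
  proof -
   have "a * K * (L * I) = a * (K * Cgn * (2 * be / p) * L * v) + a * (K * Cgn * (2 * be / p) * L / (be / al) * w)"
    if "Cgn * (2 * al * w + 2 * be * v) = p * I" for a K I v w
   proof -
    have I: "I = Cgn * (2 * al * w + 2 * be * v) / p" unfolding that using p by simp
    show ?thesis unfolding I using ex(1,2) p by (simp add: field_simps)
   qed
   from this[OF EL(2)] show ?thesis unfolding l1p(2) l1[symmetric] .
  qed
  ultimately have "D12_form Q \<phi> + Ds2_form s Q \<phi> = (\<integral>x. \<bar>Q x\<bar> powr (p - 2) * Q x * \<phi> x \<partial>\<L>)" unfolding R by simp
  then show "(\<integral>x. wgrad Q x \<bullet> wgrad \<phi> x \<partial>\<L>)
    + (\<integral>z. (Q (fst z) - Q (snd z)) * (\<phi> (fst z) - \<phi> (snd z))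
      / dist (fst z) (snd z) powr (real CARD('n) + 2 * s) \<partial>\<L>\<^sub>2)
    = (\<integral>x. \<bar>Q x\<bar> powr (p - 2) * Q x * \<phi> x \<partial>\<L>)"
   unfolding D12_form_def Ds2_form_def fdiff_mult .
 qed
qed

text \<open>The quotients as they stand in the theorem; numerators and denominators are
  \<open>al\<close> and \<open>be\<close> times the common factor 4 (1 - s), or p against
  it.\<close>

lemma exponent_ratios:
 "(p*(N-2 * s) - 2*N) / (2*N - p*(N-2)) = be / al" "(2*p*(1-s)) / (p*(N-2 * s) - 2*N) = p / (2 * be)"
 "(p*(N-2 * s) - 2*N) / (2*p*(1-s)) = 2 * be / p" "(2*N - p*(N-2)) / (2*p*(1-s)) = 2 * al / p"
proof -
 have e: "p*(N-2 * s) - 2*N = be * (4*(1-s))" "2*N - p*(N-2) = al * (4*(1-s))" using s1 by (simp_all add: al_def be_def)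
 have "1 - s \<noteq> 0" using s1 by simp
 then show "(p*(N-2 * s) - 2*N) / (2*N - p*(N-2)) = be / al" "(2*p*(1-s)) / (p*(N-2 * s) - 2*N) = p / (2 * be)"
  "(p*(N-2 * s) - 2*N) / (2*p*(1-s)) = 2 * be / p" "(2*N - p*(N-2)) / (2*p*(1-s)) = 2 * al / p"
  unfolding e using exponents(1,2,4) by (simp_all add: field_simps del: right_diff_distrib')
qed

end

theorem theorem1p1:
  fixes s p :: real
  assumes N3: "CARD('n::finite) \<ge> 3"
    and s: "0 < s" "s < 1"
    and p_lo: "2 * real CARD('n) / (real CARD('n) - 2 * s) < p"
    and p_hi: "p < 2 * real CARD('n) / (real CARD('n) - 2)"
  shows "\<exists>C>0.
     (\<forall>u\<in>E_space s. GN_ineq s p C (u :: real^'n \<Rightarrow> real)) \<and>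
     (\<forall>C'. (\<forall>u\<in>E_space s. GN_ineq s p C' (u :: real^'n \<Rightarrow> real)) \<longrightarrow> C \<le> C') \<and>
     (\<exists>u :: real^'n \<Rightarrow> real. radial u \<and> nonneg u \<and> GN_optimizer s p C u \<and>
        (let N = real CARD('n);
             lam1 = ((p*(N-2 * s) - 2*N) / (2*N - p*(N-2))) powr (1 / ((1-s)*(p-2)))
                  * ((2*p*(1-s)) / (p*(N-2 * s) - 2*N) * (1 / Lp_pow p u)) powr (1 / (p-2));
             lam2 = ((p*(N-2 * s) - 2*N) / (2*N - p*(N-2))) powr (1 / (2 - 2 * s));
             Q = (\<lambda>x. lam1 * u (lam2 *\<^sub>R x))
         in radial Q \<and> nonneg Q \<and> weak_solution s p Q \<and> GN_optimizer s p C Q \<and>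
            D12_sq Q = (p*(N-2 * s) - 2*N) / (2*N - p*(N-2)) * Ds2_sq s Q \<and>
            D12_sq Q = (p*(N-2 * s) - 2*N) / (2*p*(1-s)) * Lp_pow p Q \<and>
            (N-2)/2 * D12_sq Q + (N-2 * s)/2 * Ds2_sq s Q = N / p * Lp_pow p Q \<and>
            1 / C = ((2*N - p*(N-2)) / (2*p*(1-s))) powr ((2*N - p*(N-2)) / (4*(1-s)))
                  * ((p*(N-2 * s) - 2*N) / (2*p*(1-s))) powr ((p*(N-2 * s) - 2*N) / (4*(1-s)))
                  * Lp_norm p Q powr (p*(p-2)/2)))"
proof -
 interpret GN_setting s p "real CARD('n)" "TYPE('n)"
  by unfold_locales (use assms in auto)
 obtain u where u: "maximizer u" and rad: "radial u" using radial_maximizer by blast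
 note m = maximizerD[OF u]
 \<comment> \<open>By the normalisation the L^p integral inside the scaling factor is the best
   constant itself.\<close>
 have Lp: "Lp_pow p u = Cgn" using m(5) Cgn_pos by (simp add: Lp_pow_def)
 have opt: "GN_optimizer s p Cgn u"
  unfolding GN_optimizer_iff using m(1,3,4,5) Lp_zero[of u] Cgn_pos by auto
 have nn: "nonneg u" using m(2) by (simp add: nonneg_def)
 note R = rescaled_solution[OF u rad]
 show ?thesis
  unfolding Let_def exponent_ratios al_def[symmetric] be_def[symmetric]
  by (intro exI[of _ Cgn] exI[of _ u] conjI allI impI ballI Cgn_pos Cgn_best rad nn opt; (unfold Lp)?; (rule R | simp add: GN_ineq_iff GN_E))
qed

end
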